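(* Let $m\in\mathbb{N}^+$, $p>2$, and let $\Omega\subset\mathbb{R}^2$ be a bounded open set with $|S(\Omega^c)|=0$, where \[ S(\Omega^c)=\{x\in\Omega^c:\ x=\lim_{k\to\infty}x_k \text{ for some } \{x_k\}_k\subset\Omega^c \text{ such that } x \text{ and } x_k \text{ lie in different connected components of } \Omega^c \text{ for every } k\}. \] Let $u\in W^{m,p}(\mathbb{R}^2;\mathbb{R}^2)$ satisfy $\operatorname{div}u=0$ and $D^ju(x)=0$ for every $x\in\Omega^c$ and every multi-index $j$ with $0\le|j|\le m-1$. Then there exists a sequence $\{u_k\}_k\subset C^\infty_c(\mathbb{R}^2;\mathbb{R}^2)$ with $\operatorname{div}u_k=0$ and $\operatorname{supp}u_k\subset\Omega$ for all $k$, such that $u_k\to u$ in $W^{m,p}(\mathbb{R}^2;\mathbb{R}^2)$.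
   Context: $|A|$ denotes Lebesgue measure. Since $p>2$, by the Morrey–Sobolev embedding all derivatives $D^ju$ with $|j|\le m-1$ have continuous representatives, and the vanishing condition $D^ju=0$ on $\Omega^c$ refers to these continuous representatives (pointwise everywhere on $\Omega^c$). *)

theory Defs
  imports "HOL-Analysis.Analysis"
begin

definition pd1 :: "(real \<times> real \<Rightarrow> real) \<Rightarrow> real \<times> real \<Rightarrow> real" where
  "pd1 f x = deriv (\<lambda>t. f (t, snd x)) (fst x)"

definition pd2 :: "(real \<times> real \<Rightarrow> real) \<Rightarrow> real \<times> real \<Rightarrow> real" where
  "pd2 f x = deriv (\<lambda>t. f (fst x, t)) (snd x)"

definition Dm :: "nat \<times> nat \<Rightarrow> (real \<times> real \<Rightarrow> real) \<Rightarrow> real \<times> real \<Rightarrow> real" where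
  "Dm j f = (pd1 ^^ fst j) ((pd2 ^^ snd j) f)"

definition order :: "nat \<times> nat \<Rightarrow> nat" where
  "order j = fst j + snd j"

definition smooth2 :: "(real \<times> real \<Rightarrow> real) \<Rightarrow> bool" where
  "smooth2 f \<longleftrightarrow> (\<forall>j. continuous_on UNIV (Dm j f) \<and>
     (\<forall>x. (\<lambda>t. Dm j f (t, snd x)) differentiable (at (fst x)) \<and>
          (\<lambda>t. Dm j f (fst x, t)) differentiable (at (snd x))))"

definition csupp :: "('a::topological_space \<Rightarrow> 'b::zero) \<Rightarrow> 'a set" where
  "csupp f = closure {x. f x \<noteq> 0}"

definition test_fun :: "(real \<times> real \<Rightarrow> real) \<Rightarrow> bool" where
  "test_fun \<phi> \<longleftrightarrow> smooth2 \<phi> \<and> compact (csupp \<phi>)"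

definition loc_int :: "(real \<times> real \<Rightarrow> real) \<Rightarrow> bool" where
  "loc_int f \<longleftrightarrow> (\<forall>K. compact K \<longrightarrow> set_integrable lebesgue K f)"

definition weak_deriv :: "nat \<times> nat \<Rightarrow> (real \<times> real \<Rightarrow> real) \<Rightarrow> (real \<times> real \<Rightarrow> real) \<Rightarrow> bool" where
  "weak_deriv j f g \<longleftrightarrow> loc_int f \<and> loc_int g \<and>
     (\<forall>\<phi>. test_fun \<phi> \<longrightarrow>
        (\<integral>x. f x * Dm j \<phi> x \<partial>lebesgue) = (-1) ^ order j * (\<integral>x. g x * \<phi> x \<partial>lebesgue))"

definition Lp :: "real \<Rightarrow> (real \<times> real \<Rightarrow> real) \<Rightarrow> bool" where
  "Lp p f \<longleftrightarrow> f \<in> borel_measurable lebesgue \<and>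
     (\<integral>\<^sup>+ x. ennreal (\<bar>f x\<bar> powr p) \<partial>lebesgue) < \<infinity>"

definition sobolev :: "nat \<Rightarrow> real \<Rightarrow> (real \<times> real \<Rightarrow> real) \<Rightarrow> bool" where
  "sobolev m p f \<longleftrightarrow> Lp p f \<and> (\<forall>j. order j \<le> m \<longrightarrow> (\<exists>g. weak_deriv j f g \<and> Lp p g))"

definition weak_div_free :: "(real \<times> real \<Rightarrow> real \<times> real) \<Rightarrow> bool" where
  "weak_div_free u \<longleftrightarrow> (\<forall>\<phi>. test_fun \<phi> \<longrightarrow>
     (\<integral>x. fst (u x) * pd1 \<phi> x + snd (u x) * pd2 \<phi> x \<partial>lebesgue) = 0)"

definition S_set :: "(real \<times> real) set \<Rightarrow> (real \<times> real) set" where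
  "S_set \<Omega> = {x. x \<notin> \<Omega> \<and> (\<exists>xk::nat \<Rightarrow> real \<times> real.
      (\<forall>k. xk k \<notin> \<Omega>) \<and> xk \<longlonglongrightarrow> x \<and>
      (\<forall>k. xk k \<notin> connected_component_set (- \<Omega>) x))}"

text \<open>Convergence f_k -> f in W^{m,p} for smooth f_k: the p-th power of the distance of
  every derivative of order at most m tends to 0 (g ranges over the weak derivatives of f).\<close>
definition sobolev_conv :: "nat \<Rightarrow> real \<Rightarrow> (nat \<Rightarrow> real \<times> real \<Rightarrow> real) \<Rightarrow> (real \<times> real \<Rightarrow> real) \<Rightarrow> bool" where
  "sobolev_conv m p fk f \<longleftrightarrow> (\<forall>j g. order j \<le> m \<longrightarrow> weak_deriv j f g \<longrightarrow>
     ((\<lambda>k. \<integral>\<^sup>+ x. ennreal (\<bar>Dm j (fk k) x - g x\<bar> powr p) \<partial>lebesgue) \<longlonglongrightarrow> 0))"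

end

theory Submission
  imports Defs
begin

text \<open>
  The divergence-free field has a stream function \<open>Psi\<close>, of class \<open>C^m\<close> with derivatives of order
  \<open>m + 1\<close> in \<open>L^p\<close>, whose derivatives of order \<open>1, \<dots>, m\<close> vanish on the complement \<open>K\<close> of the open set.
  By a Morse--Sard argument \<open>Psi ` K\<close> is a null set. It is therefore covered by an open set \<open>N\<close> of
  measure at most \<open>\<epsilon>\<close>, and the 1-Lipschitz function \<open>h\<close> with \<open>h 0 = 0\<close> and derivative the indicator of \<open>N\<close> is bounded
  by \<open>\<epsilon>\<close>, while \<open>t - h t\<close> is locally constant near \<open>Psi ` K\<close>.

  The function \<open>H = h \<circ> Psi\<close> on \<open>K\<close> is extended to the plane by a multiscale partition of unity, stopped at
  the scale \<open>rr J\<close>. Since \<open>H\<close> oscillates at most as much as \<open>Psi\<close>, Morrey's inequality bounds all derivatives of the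
  extension of order up to \<open>m + 1\<close> by a maximal function of the derivatives of order \<open>m + 1\<close> of \<open>Psi\<close>. Since
  \<open>H\<close> is bounded by \<open>\<epsilon>\<close>, the same derivatives tend to zero with \<open>\<epsilon>\<close> off \<open>K\<close>, and dominated convergence makes
  the extension small in \<open>W^{m+1,p}\<close>. After the mollified stream function is corrected near \<open>K\<close> so
  that it takes the values of \<open>Psi\<close> there, subtracting the extension leaves a function which is locally constant
  near \<open>K\<close>; its rotated gradient is the approximating field.
\<close>


section \<open>Smooth functions of two variables\<close>

text \<open>The obstacle is that \<open>Psi\<close> cannot simply be cut off near \<open>K\<close>:
  its value may differ from one component of \<open>K\<close> to the next, components may
  accumulate, and a cut-off at distance d costs d^(-l) in the derivatives of order l, which only
  differences of \<open>Psi\<close> at scale d can pay for. Truncation in the range avoids any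
  description of the components. All estimates of the extension use differences of values on
  \<open>K\<close>, so a 1-Lipschitz \<open>h\<close> preserves them, and no further regularity of
  \<open>h\<close> is needed because \<open>H\<close> is merely sampled at points of
  \<open>K\<close>. Two exponents occur. Outside the stopping layer, Morrey's inequality with an
  exponent \<open>q\<close> strictly between 2 and \<open>p\<close> leaves room for the maximal
  theorem in L^(p/q). Inside the layer of width comparable to \<open>rr J\<close> no maximal
  function is used: Morrey with \<open>p\<close> itself and Fubini give the integral of D^p over a
  slightly wider layer, which is small because \<open>D\<close> vanishes almost everywhere on
  \<open>K\<close>. Derivatives are only ever taken of the mollified \<open>psi\<close>;
  \<open>Psi\<close> enters by its values.\<close>

primrec Ck :: "nat \<Rightarrow> (real \<times> real \<Rightarrow> real) \<Rightarrow> bool" where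
  "Ck 0 f \<longleftrightarrow> continuous_on UNIV f"
| "Ck (Suc n) f \<longleftrightarrow> continuous_on UNIV f \<and>
     (\<forall>x y. (\<lambda>t. f (t, y)) differentiable (at x) \<and> (\<lambda>t. f (x, t)) differentiable (at y)) \<and>
     Ck n (pd1 f) \<and> Ck n (pd2 f)"

text \<open>\<open>Ck\<close> asks for both partial derivatives at every stage, so smoothness covers
  iterated derivatives in every order of differentiation and is inherited by \<open>pd1 f\<close>
  and \<open>pd2 f\<close> at once. The target notion \<open>smooth2\<close> only speaks of
  \<open>Dm j\<close>, where \<open>pd2\<close> acts first; \<open>smooth_imp_smooth2\<close> is the
  direction that is used.\<close>

definition smooth :: "(real \<times> real \<Rightarrow> real) \<Rightarrow> bool" where
  "smooth f \<longleftrightarrow> (\<forall>n. Ck n f)"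

lemma pd1_unique:
  assumes "\<And>x y. ((\<lambda>t. f (t, y)) has_real_derivative f1 (x, y)) (at x)"
  shows "pd1 f = f1"
  using assms by (auto simp: pd1_def fun_eq_iff intro!: DERIV_imp_deriv)

lemma pd2_unique:
  assumes "\<And>x y. ((\<lambda>t. f (x, t)) has_real_derivative f2 (x, y)) (at y)"
  shows "pd2 f = f2"
  using assms by (auto simp: pd2_def fun_eq_iff intro!: DERIV_imp_deriv)

lemma Ck_SucI:
  assumes "continuous_on UNIV f"
    and "\<And>x y. ((\<lambda>t. f (t, y)) has_real_derivative f1 (x, y)) (at x)"
    and "\<And>x y. ((\<lambda>t. f (x, t)) has_real_derivative f2 (x, y)) (at y)"
    and "Ck n f1" "Ck n f2"
  shows "Ck (Suc n) f"
proof -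
  have "pd1 f = f1" "pd2 f = f2"
    using assms(2,3) by (auto intro: pd1_unique pd2_unique)
  then show ?thesis using assms
    unfolding Ck.simps real_differentiable_def by blast
qed

lemma Ck_cont: "Ck n f \<Longrightarrow> continuous_on UNIV f"
  by (cases n) auto

lemma Ck_Suc_has_derivative:
  assumes "Ck (Suc n) f"
  shows "((\<lambda>t. f (t, y)) has_real_derivative pd1 f (x, y)) (at x)"
    and "((\<lambda>t. f (x, t)) has_real_derivative pd2 f (x, y)) (at y)"
  using assms by (auto simp: pd1_def pd2_def DERIV_deriv_iff_real_differentiable)

lemma Ck_SucD: "Ck (Suc n) f \<Longrightarrow> Ck n f"
proof (induction n arbitrary: f)
  case (Suc n)
  have "Ck (Suc n) (pd1 f)" "Ck (Suc n) (pd2 f)"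
    using Suc.prems Ck.simps(2)[of "Suc n" f] by blast+
  then show ?case using Suc.IH Suc.prems unfolding Ck.simps(2)[of _ f] by blast
qed simp

lemma smooth_cont: "smooth f \<Longrightarrow> continuous_on UNIV f"
  by (metis Ck.simps(1) smooth_def)

lemma smooth_has_pd1: "smooth f \<Longrightarrow> ((\<lambda>t. f (t, y)) has_real_derivative pd1 f (x, y)) (at x)"
  and smooth_has_pd2: "smooth f \<Longrightarrow> ((\<lambda>t. f (x, t)) has_real_derivative pd2 f (x, y)) (at y)"
  by (auto simp: smooth_def intro: Ck_Suc_has_derivative)

lemma smooth_pd1: "smooth f \<Longrightarrow> smooth (pd1 f)" and smooth_pd2: "smooth f \<Longrightarrow> smooth (pd2 f)"
  unfolding smooth_def by (metis Ck.simps(2))+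

lemma smoothI:
  assumes "continuous_on UNIV f"
    and "\<And>x y. ((\<lambda>t. f (t, y)) has_real_derivative f1 (x, y)) (at x)"
    and "\<And>x y. ((\<lambda>t. f (x, t)) has_real_derivative f2 (x, y)) (at y)"
    and "smooth f1" "smooth f2"
  shows "smooth f"
  unfolding smooth_def
proof
  fix n show "Ck n f"
    using Ck_SucD[OF Ck_SucI[OF assms(1-3), of n]] assms(4,5) by (simp add: smooth_def)
qed

lemma smooth_Dm: "smooth f \<Longrightarrow> smooth (Dm j f)"
proof -
  have 1: "smooth f \<Longrightarrow> smooth ((pd1 ^^ n) f)" for n f
    by (induction n) (auto intro: smooth_pd1)
  have 2: "smooth f \<Longrightarrow> smooth ((pd2 ^^ n) f)" for n f
    by (induction n) (auto intro: smooth_pd2)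
  show "smooth f \<Longrightarrow> smooth (Dm j f)"
    by (auto simp: Dm_def intro: 1 2)
qed

lemma smooth_imp_smooth2: "smooth f \<Longrightarrow> smooth2 f"
  unfolding smooth2_def real_differentiable_def
  by (metis smooth_Dm smooth_cont smooth_has_pd1 smooth_has_pd2)

lemma Ck_const: "Ck n (\<lambda>x. c)"
proof (induction n arbitrary: c)
  case (Suc n)
  show ?case by (rule Ck_SucI[where ?f1.0="\<lambda>x. 0" and ?f2.0="\<lambda>x. 0"]) (use Suc in auto)
qed auto

lemma Ck_add: "Ck n f \<Longrightarrow> Ck n g \<Longrightarrow> Ck n (\<lambda>x. f x + g x)"
proof (induction n arbitrary: f g)
  case (Suc n)
  have "Ck n (pd1 f)" "Ck n (pd1 g)" "Ck n (pd2 f)" "Ck n (pd2 g)"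
    using Suc.prems by auto
  then show ?case
    by (intro Ck_SucI[where ?f1.0="\<lambda>x. pd1 f x + pd1 g x" and ?f2.0="\<lambda>x. pd2 f x + pd2 g x"]
        continuous_on_add DERIV_add Suc.IH Ck_cont[OF Suc.prems(1)] Ck_cont[OF Suc.prems(2)]
        Ck_Suc_has_derivative[OF Suc.prems(1)] Ck_Suc_has_derivative[OF Suc.prems(2)])
qed (auto intro: continuous_intros)

lemma Ck_mult: "Ck n f \<Longrightarrow> Ck n g \<Longrightarrow> Ck n (\<lambda>x. f x * g x)"
proof (induction n arbitrary: f g)
  case (Suc n)
  have "Ck n f" "Ck n g" "Ck n (pd1 f)" "Ck n (pd1 g)" "Ck n (pd2 f)" "Ck n (pd2 g)"
    using Suc.prems Suc.prems[THEN Ck_SucD] unfolding Ck.simps(2) by blast+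
  moreover have "((\<lambda>t. f (t, y) * g (t, y)) has_real_derivative pd1 f (x, y) * g (x, y) + f (x, y) * pd1 g (x, y)) (at x)"
    "((\<lambda>t. f (x, t) * g (x, t)) has_real_derivative pd2 f (x, y) * g (x, y) + f (x, y) * pd2 g (x, y)) (at y)" for x y
    using DERIV_mult'[OF Ck_Suc_has_derivative(1)[OF Suc.prems(1)] Ck_Suc_has_derivative(1)[OF Suc.prems(2)]]
      DERIV_mult'[OF Ck_Suc_has_derivative(2)[OF Suc.prems(1)] Ck_Suc_has_derivative(2)[OF Suc.prems(2)]]
    by (simp_all add: add.commute)
  ultimately show ?case
    by (intro Ck_SucI[where ?f1.0="\<lambda>x. pd1 f x * g x + f x * pd1 g x" and ?f2.0="\<lambda>x. pd2 f x * g x + f x * pd2 g x"]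
        continuous_on_mult Ck_cont[OF Suc.prems(1)] Ck_cont[OF Suc.prems(2)] Ck_add Suc.IH)
qed (auto intro: continuous_intros)

lemma has_pd1_affine:
  fixes f :: "real \<times> real \<Rightarrow> real"
  assumes "\<And>x y. ((\<lambda>t. f (t, y)) has_real_derivative f1 (x, y)) (at x)"
  shows "((\<lambda>t. f (k *\<^sub>R ((t, y) - c))) has_real_derivative k * f1 (k *\<^sub>R ((x, y) - c))) (at x)"
proof -
  have "((\<lambda>t. k * (t - fst c)) has_real_derivative k) (at x)"
    by (auto intro!: derivative_eq_intros)
  from DERIV_chain[OF assms[of "k * (y - snd c)" "k * (x - fst c)"] this] show ?thesis
    by (cases c) (auto simp: o_def mult.commute)
qed

lemma has_pd2_affine:
  fixes f :: "real \<times> real \<Rightarrow> real"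
  assumes "\<And>x y. ((\<lambda>t. f (x, t)) has_real_derivative f2 (x, y)) (at y)"
  shows "((\<lambda>t. f (k *\<^sub>R ((x, t) - c))) has_real_derivative k * f2 (k *\<^sub>R ((x, y) - c))) (at y)"
proof -
  have "((\<lambda>t. k * (t - snd c)) has_real_derivative k) (at y)"
    by (auto intro!: derivative_eq_intros)
  from DERIV_chain[OF assms[of "k * (x - fst c)" "k * (y - snd c)"] this] show ?thesis
    by (cases c) (auto simp: o_def mult.commute)
qed

lemma Ck_affine:
  assumes "Ck n f" shows "Ck n (\<lambda>x. f (k *\<^sub>R (x - c)))"
  using assms
proof (induction n arbitrary: f)
  case 0
  then have "continuous_on UNIV f" by simp
  then have "continuous_on UNIV (\<lambda>x. f (k *\<^sub>R (x - c)))"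
    by (rule continuous_on_compose2) (intro continuous_intros subset_UNIV)+
  then show ?case by simp
next
  case (Suc n)
  have 0: "continuous_on UNIV (\<lambda>x. f (k *\<^sub>R (x - c)))"
    by (rule continuous_on_compose2[OF Ck_cont[OF Suc.prems]]) (intro continuous_intros subset_UNIV)+
  have "Ck n (pd1 f)" "Ck n (pd2 f)" using Suc.prems by auto
  then show ?case
    by (intro Ck_SucI[where ?f1.0="\<lambda>x. k * pd1 f (k *\<^sub>R (x - c))" and ?f2.0="\<lambda>x. k * pd2 f (k *\<^sub>R (x - c))"]
      has_pd1_affine has_pd2_affine Ck_Suc_has_derivative[OF Suc.prems] 0 Ck_mult Ck_const Suc.IH)
qed

lemma smooth_const: "smooth (\<lambda>x. c)"
  and smooth_add: "smooth f \<Longrightarrow> smooth g \<Longrightarrow> smooth (\<lambda>x. f x + g x)"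
  and smooth_mult: "smooth f \<Longrightarrow> smooth g \<Longrightarrow> smooth (\<lambda>x. f x * g x)"
  and smooth_affine: "smooth f \<Longrightarrow> smooth (\<lambda>x. f (k *\<^sub>R (x - d)))"
  by (auto simp: smooth_def Ck_const Ck_add Ck_mult Ck_affine)

lemma smooth_uminus: "smooth f \<Longrightarrow> smooth (\<lambda>x. - f x)"
  using smooth_mult[OF smooth_const[of "-1"]] by simp

lemma smooth_diff: "smooth f \<Longrightarrow> smooth g \<Longrightarrow> smooth (\<lambda>x. f x - g x)"
  using smooth_add[OF _ smooth_uminus] by simp

lemma smooth_sum: "(\<And>i. i \<in> I \<Longrightarrow> smooth (f i)) \<Longrightarrow> smooth (\<lambda>x. \<Sum>i\<in>I. f i x)"
  by (induction I rule: infinite_finite_induct) (auto intro: smooth_const smooth_add)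

lemma pd_const: "pd1 (\<lambda>x. c) = (\<lambda>x. 0)" "pd2 (\<lambda>x. c) = (\<lambda>x. 0)"
  by (auto intro: pd1_unique pd2_unique)

lemma pd_add:
  assumes "smooth f" "smooth g"
  shows "pd1 (\<lambda>x. f x + g x) = (\<lambda>x. pd1 f x + pd1 g x)" "pd2 (\<lambda>x. f x + g x) = (\<lambda>x. pd2 f x + pd2 g x)"
  by (intro pd1_unique pd2_unique DERIV_add smooth_has_pd1 smooth_has_pd2 assms)+

lemma pd_mult:
  assumes "smooth f" "smooth g"
  shows "pd1 (\<lambda>x. f x * g x) = (\<lambda>x. pd1 f x * g x + f x * pd1 g x)"
    and "pd2 (\<lambda>x. f x * g x) = (\<lambda>x. pd2 f x * g x + f x * pd2 g x)"
  by (intro pd1_unique pd2_unique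
      DERIV_cong[OF DERIV_mult'[OF smooth_has_pd1[OF assms(1)] smooth_has_pd1[OF assms(2)]]]
      DERIV_cong[OF DERIV_mult'[OF smooth_has_pd2[OF assms(1)] smooth_has_pd2[OF assms(2)]]] | simp)+

lemma pd_uminus:
  assumes "smooth f"
  shows "pd1 (\<lambda>x. - f x) = (\<lambda>x. - pd1 f x)" "pd2 (\<lambda>x. - f x) = (\<lambda>x. - pd2 f x)"
  by (intro pd1_unique pd2_unique DERIV_minus smooth_has_pd1 smooth_has_pd2 assms)+

lemma pd_affine:
  assumes "smooth f"
  shows "pd1 (\<lambda>x. f (k *\<^sub>R (x - c))) = (\<lambda>x. k * pd1 f (k *\<^sub>R (x - c)))"
    and "pd2 (\<lambda>x. f (k *\<^sub>R (x - c))) = (\<lambda>x. k * pd2 f (k *\<^sub>R (x - c)))"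
  by (intro pd1_unique pd2_unique has_pd1_affine has_pd2_affine smooth_has_pd1 smooth_has_pd2 assms)+

lemma pd_cong_open:
  assumes "open S" "x \<in> S" "\<And>y. y \<in> S \<Longrightarrow> f y = g y"
  shows "pd1 f x = pd1 g x" "pd2 f x = pd2 g x"
proof -
  obtain e where e: "e > 0" "ball x e \<subseteq> S" using assms openE by blast
  have "(t, snd x) \<in> ball x e" if "dist t (fst x) < e" for t
    using that by (cases x) (simp add: dist_prod_def dist_commute)
  then have "\<forall>\<^sub>F t in nhds (fst x). f (t, snd x) = g (t, snd x)"
    unfolding eventually_nhds_metric using e assms(3) by blast
  then show "pd1 f x = pd1 g x"
    by (auto simp: pd1_def intro!: deriv_cong_ev)
  have "(fst x, t) \<in> ball x e" if "dist t (snd x) < e" for t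
    using that by (cases x) (simp add: dist_prod_def dist_commute)
  then have "\<forall>\<^sub>F t in nhds (snd x). f (fst x, t) = g (fst x, t)"
    unfolding eventually_nhds_metric using e assms(3) by blast
  then show "pd2 f x = pd2 g x"
    by (auto simp: pd2_def intro!: deriv_cong_ev)
qed

lemma continuous_on_slices:
  fixes f :: "real \<times> real \<Rightarrow> real"
  assumes "continuous_on UNIV f"
  shows "continuous_on S (\<lambda>t. f (t, y))" "continuous_on S (\<lambda>t. f (x, t))"
  by (auto intro!: continuous_on_compose2[OF assms] continuous_intros)

text \<open>\<open>f\<close> is written as the integral of \<open>pd1 f\<close> along a horizontal
  segment; differentiation under the integral sign in the second variable and then in the upper
  limit produces both mixed derivatives. Needed because \<open>Dm\<close> fixes one order of
  differentiation while \<open>dnorm\<close> runs through all of them.\<close>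

lemma pd_commute:
  assumes "smooth f"
  shows "pd1 (pd2 f) = pd2 (pd1 f)"
proof
  fix x :: "real \<times> real"
  \<comment> \<open>The segment starts one unit to the left of the point, which is therefore
    interior to the interval on which the fundamental theorem is applied.\<close>
  obtain a y0 where x: "x = (a + 1, y0)" by (cases x) (metis diff_add_cancel)
  let ?g = "pd2 (pd1 f)"
  have c1: "continuous_on UNIV (pd1 f)" and c2: "continuous_on UNIV ?g"
    using assms smooth_pd1 smooth_pd2 smooth_cont by blast+
  have f_eq: "f (s, y) = f (a, y) + integral {a..s} (\<lambda>t. pd1 f (t, y))" if "s \<ge> a" for s y
  proof -
    have "((\<lambda>t. pd1 f (t, y)) has_integral (f (s, y) - f (a, y))) {a..s}"
      using that
      by (intro fundamental_theorem_of_calculus)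
         (auto simp flip: has_real_derivative_iff_has_vector_derivative intro!: has_field_derivative_at_within smooth_has_pd1[OF assms])
    from integral_unique[OF this] show ?thesis by simp
  qed
  have p2: "pd2 f (s, y) = pd2 f (a, y) + integral {a..s} (\<lambda>t. ?g (t, y))" if "s \<ge> a" for s y
  proof -
    have "((\<lambda>y. integral (cbox a s) (\<lambda>t. pd1 f (t, y))) has_field_derivative integral (cbox a s) (\<lambda>t. ?g (t, y))) (at y within UNIV)"
    proof (rule leibniz_rule_field_derivative)
      show "(\<lambda>t. pd1 f (t, y)) integrable_on cbox a s" for y
        by (intro integrable_continuous continuous_on_slices c1)
      show "continuous_on (UNIV \<times> cbox a s) (\<lambda>(y, t). ?g (t, y))"
        unfolding split_beta by (auto intro!: continuous_on_compose2[OF c2] continuous_intros)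
    qed (auto intro!: smooth_has_pd2[OF smooth_pd1[OF assms]])
    then have "((\<lambda>y. f (a, y) + integral {a..s} (\<lambda>t. pd1 f (t, y))) has_field_derivative pd2 f (a, y) + integral {a..s} (\<lambda>t. ?g (t, y))) (at y)"
      using DERIV_add[OF smooth_has_pd2[OF assms]] by simp
    then show ?thesis
      unfolding f_eq[OF that, symmetric] by (rule DERIV_unique[OF smooth_has_pd2[OF assms]])
  qed
  have "((\<lambda>s. integral {a..s} (\<lambda>t. ?g (t, y0))) has_real_derivative ?g (a + 1, y0)) (at (a + 1) within {a..a+2})"
    by (rule integral_has_real_derivative) (auto intro: continuous_on_slices c2)
  then have "((\<lambda>s. integral {a..s} (\<lambda>t. ?g (t, y0))) has_real_derivative ?g (a + 1, y0)) (at (a + 1))"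
    by (simp add: at_within_Icc_at)
  from DERIV_add[OF DERIV_const[of "pd2 f (a, y0)"] this]
  have "((\<lambda>s. pd2 f (a, y0) + integral {a..s} (\<lambda>t. ?g (t, y0))) has_real_derivative ?g (a + 1, y0)) (at (a + 1))"
    by simp
  then have "((\<lambda>s. pd2 f (s, y0)) has_real_derivative ?g (a + 1, y0)) (at (a + 1))"
    by (rule has_field_derivative_transform_within_open[where S="{a<..}"]) (simp_all add: p2[symmetric])
  then show "pd1 (pd2 f) x = ?g x"
    unfolding x pd1_def by (simp add: DERIV_imp_deriv)
qed

section \<open>The sum of all derivatives of a given order\<close>

text \<open>The sum runs over all words of length \<open>l\<close> in the two partial derivatives,
  not over multi-indices. The bound of \<open>dnorm l (pd1 f)\<close> by
  \<open>dnorm (Suc l) f\<close> is then immediate, and inductions on the order need no commutation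
  of derivatives.\<close>

primrec dnorm :: "nat \<Rightarrow> (real \<times> real \<Rightarrow> real) \<Rightarrow> real \<times> real \<Rightarrow> real" where
  "dnorm 0 f x = \<bar>f x\<bar>"
| "dnorm (Suc l) f x = dnorm l (pd1 f) x + dnorm l (pd2 f) x"

lemma dnorm_nonneg: "dnorm l f x \<ge> 0"
  by (induction l arbitrary: f) auto

lemma dnorm_uminus: "smooth f \<Longrightarrow> dnorm l (\<lambda>x. - f x) x = dnorm l f x"
  by (induction l arbitrary: f) (auto simp: pd_uminus smooth_pd1 smooth_pd2)

lemma dnorm_add: "smooth f \<Longrightarrow> smooth g \<Longrightarrow> dnorm l (\<lambda>x. f x + g x) x \<le> dnorm l f x + dnorm l g x"
proof (induction l arbitrary: f g)
  case (Suc l)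
  from Suc.IH[of "pd1 f" "pd1 g"] Suc.IH[of "pd2 f" "pd2 g"] Suc.prems show ?case
    by (simp add: pd_add smooth_pd1 smooth_pd2)
qed auto

lemma dnorm_const: "dnorm (Suc l) (\<lambda>x. c) x = 0"
  by (induction l arbitrary: c) (auto simp: pd_const)

lemma dnorm_0: "dnorm l (\<lambda>x. 0) x = 0"
  by (cases l) (auto simp del: dnorm.simps(2) simp: dnorm_const)

lemma dnorm_sum:
  assumes "\<And>i. i \<in> I \<Longrightarrow> smooth (f i)"
  shows "dnorm l (\<lambda>x. \<Sum>i\<in>I. f i x) x \<le> (\<Sum>i\<in>I. dnorm l (f i) x)"
  using assms
proof (induction I rule: infinite_finite_induct)
  case (insert i I)
  then have "smooth (\<lambda>x. \<Sum>i\<in>I. f i x)" by (intro smooth_sum) auto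
  with insert show ?case using dnorm_add[of "f i" "\<lambda>x. \<Sum>i\<in>I. f i x" l x] by auto
qed (auto simp: dnorm_0)

text \<open>Leibniz rule in the form suited to functions living at length scale 1/s: a bound A s^i
  in each order i is stable under products. The factor 4 per order comes from two partial
  derivatives with two product terms each.\<close>

lemma dnorm_mult:
  assumes "smooth f" "smooth g" "A \<ge> 0" "B \<ge> 0" "s \<ge> 0"
    and "\<And>i. i \<le> l \<Longrightarrow> dnorm i f x \<le> A * s ^ i" and "\<And>i. i \<le> l \<Longrightarrow> dnorm i g x \<le> B * s ^ i"
  shows "dnorm l (\<lambda>x. f x * g x) x \<le> 4 ^ l * A * B * s ^ l"
  using assms
proof (induction l arbitrary: f g A B)
  case 0
  from 0(6)[of 0] 0(7)[of 0] 0(3,4) show ?case by (simp add: abs_mult mult_mono)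
next
  case (Suc l)
  have sm: "smooth (pd1 f)" "smooth (pd1 g)" "smooth (pd2 f)" "smooth (pd2 g)"
    using Suc.prems smooth_pd1 smooth_pd2 by auto
  have f: "dnorm i f x \<le> A * s ^ i" and g: "dnorm i g x \<le> B * s ^ i" if "i \<le> l" for i
    using Suc.prems(6,7)[of i] that by auto
  have pf: "dnorm i (pd1 f) x \<le> (A * s) * s ^ i" "dnorm i (pd2 f) x \<le> (A * s) * s ^ i" if "i \<le> l" for i
    using Suc.prems(6)[of "Suc i"] that dnorm_nonneg[of i "pd1 f" x] dnorm_nonneg[of i "pd2 f" x] by (auto simp: mult_ac)
  have pg: "dnorm i (pd1 g) x \<le> (B * s) * s ^ i" "dnorm i (pd2 g) x \<le> (B * s) * s ^ i" if "i \<le> l" for i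
    using Suc.prems(7)[of "Suc i"] that dnorm_nonneg[of i "pd1 g" x] dnorm_nonneg[of i "pd2 g" x] by (auto simp: mult_ac)
  have "dnorm l (\<lambda>x. pd1 f x * g x) x \<le> 4 ^ l * (A * s) * B * s ^ l"
    "dnorm l (\<lambda>x. pd2 f x * g x) x \<le> 4 ^ l * (A * s) * B * s ^ l"
    "dnorm l (\<lambda>x. f x * pd1 g x) x \<le> 4 ^ l * A * (B * s) * s ^ l"
    "dnorm l (\<lambda>x. f x * pd2 g x) x \<le> 4 ^ l * A * (B * s) * s ^ l"
    using Suc.prems(1-5) sm f g pf pg by (auto intro!: Suc.IH)
  moreover have "dnorm l (\<lambda>x. pd1 f x * g x + f x * pd1 g x) x \<le> dnorm l (\<lambda>x. pd1 f x * g x) x + dnorm l (\<lambda>x. f x * pd1 g x) x"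
    "dnorm l (\<lambda>x. pd2 f x * g x + f x * pd2 g x) x \<le> dnorm l (\<lambda>x. pd2 f x * g x) x + dnorm l (\<lambda>x. f x * pd2 g x) x"
    using Suc.prems(1,2) sm by (auto intro!: dnorm_add smooth_mult)
  ultimately show ?case
    using Suc.prems(1,2) by (simp add: pd_mult algebra_simps)
qed

lemma dnorm_cmult:
  assumes "smooth f" shows "dnorm l (\<lambda>x. c * f x) x = \<bar>c\<bar> * dnorm l f x"
  using assms
proof (induction l arbitrary: f)
  case (Suc l)
  have "pd1 (\<lambda>x. c * f x) = (\<lambda>x. c * pd1 f x)" "pd2 (\<lambda>x. c * f x) = (\<lambda>x. c * pd2 f x)"
    using pd_mult[OF smooth_const Suc.prems, of c] by (simp_all add: pd_const)
  then show ?case using Suc.IH[OF smooth_pd1[OF Suc.prems]] Suc.IH[OF smooth_pd2[OF Suc.prems]]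
    by (simp add: distrib_left)
qed (simp add: abs_mult)

lemma dnorm_affine:
  assumes "smooth f" shows "dnorm l (\<lambda>x. f (k *\<^sub>R (x - c))) x = \<bar>k\<bar> ^ l * dnorm l f (k *\<^sub>R (x - c))"
  using assms
proof (induction l arbitrary: f)
  case (Suc l)
  have sm: "smooth (pd1 f)" "smooth (pd2 f)" using Suc.prems smooth_pd1 smooth_pd2 by auto
  show ?case
    unfolding dnorm.simps pd_affine[OF Suc.prems] dnorm_cmult[OF smooth_affine[OF sm(1)]] dnorm_cmult[OF smooth_affine[OF sm(2)]]
      Suc.IH[OF sm(1)] Suc.IH[OF sm(2)] by (simp only: power_Suc distrib_left mult.assoc)
qed simp

lemma dnorm_cong_open:
  assumes "open S" "x \<in> S" "\<And>y. y \<in> S \<Longrightarrow> f y = g y"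
  shows "dnorm l f x = dnorm l g x"
  using assms(3)
proof (induction l arbitrary: f g)
  case (Suc l)
  have "pd1 f y = pd1 g y" "pd2 f y = pd2 g y" if "y \<in> S" for y
    using pd_cong_open[OF assms(1) that Suc.prems] by auto
  then have "dnorm l (pd1 f) x = dnorm l (pd1 g) x" "dnorm l (pd2 f) x = dnorm l (pd2 g) x"
    by (intro Suc.IH; simp)+
  then show ?case by simp
qed (use assms in auto)

lemma Dm_le_dnorm: "\<bar>Dm j f x\<bar> \<le> dnorm (order j) f x"
proof -
  have 1: "\<bar>(pd1 ^^ n) f x\<bar> \<le> dnorm n f x" for n and f :: "real \<times> real \<Rightarrow> real"
  proof (induction n arbitrary: f)
    case (Suc n)
    have "\<bar>(pd1 ^^ Suc n) f x\<bar> \<le> dnorm n (pd1 f) x"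
      using Suc.IH[of "pd1 f"] by (simp add: funpow_swap1)
    then show ?case using dnorm_nonneg[of n "pd2 f" x] by simp
  qed simp
  have 2: "dnorm a ((pd2 ^^ n) f) x \<le> dnorm (a + n) f x" for a n
  proof (induction n arbitrary: f)
    case (Suc n)
    have "dnorm a ((pd2 ^^ Suc n) f) x \<le> dnorm (a + n) (pd2 f) x"
      using Suc.IH[of "pd2 f"] by (simp add: funpow_swap1)
    then show ?case using dnorm_nonneg[of "a+n" "pd1 f" x] by simp
  qed simp
  show ?thesis unfolding Dm_def order_def by (rule order_trans[OF 1 2])
qed

lemma pd2_funpow_pd1: "smooth f \<Longrightarrow> (pd2 ^^ n) (pd1 f) = pd1 ((pd2 ^^ n) f)"
proof (induction n)
  case (Suc n)
  have "smooth ((pd2 ^^ n) f)" using smooth_Dm[OF Suc.prems, of "(0, n)"] by (simp add: Dm_def)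
  with Suc show ?case by (simp add: pd_commute)
qed simp

text \<open>Here \<open>pd_commute\<close> sorts each word of derivatives into the shape of
  \<open>Dm\<close>; the power of 2 bounds how often one multi-index occurs.\<close>

lemma dnorm_le_Dm:
  assumes "smooth f"
  shows "dnorm l f x \<le> 2 ^ l * (\<Sum>a\<le>l. \<bar>Dm (a, l - a) f x\<bar>)"
  using assms
proof (induction l arbitrary: f)
  case 0
  then show ?case by (simp add: Dm_def)
next
  case (Suc l)
  let ?S = "\<Sum>a\<le>Suc l. \<bar>Dm (a, Suc l - a) f x\<bar>"
  have d1: "Dm (a, l - a) (pd1 f) = Dm (Suc a, Suc l - Suc a) f" for a
    using Suc.prems by (simp add: Dm_def pd2_funpow_pd1 funpow_swap1)
  have d2: "Dm (a, l - a) (pd2 f) = Dm (a, Suc l - a) f" if "a \<le> l" for a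
    using that by (simp add: Dm_def Suc_diff_le funpow_swap1)
  have "(\<Sum>a\<le>l. \<bar>Dm (a, l - a) (pd1 f) x\<bar>) \<le> ?S"
    unfolding d1 sum.atMost_Suc_shift by simp
  moreover have "(\<Sum>a\<le>l. \<bar>Dm (a, l - a) (pd2 f) x\<bar>) = (\<Sum>a\<le>l. \<bar>Dm (a, Suc l - a) f x\<bar>)"
    using d2 by (intro sum.cong) auto
  then have "(\<Sum>a\<le>l. \<bar>Dm (a, l - a) (pd2 f) x\<bar>) \<le> ?S" by simp
  ultimately have "2 ^ l * (\<Sum>a\<le>l. \<bar>Dm (a, l - a) (pd1 f) x\<bar>) + 2 ^ l * (\<Sum>a\<le>l. \<bar>Dm (a, l - a) (pd2 f) x\<bar>) \<le> 2 ^ l * ?S + 2 ^ l * ?S"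
    by (intro add_mono mult_left_mono) auto
  with Suc.IH[of "pd1 f"] Suc.IH[of "pd2 f"] Suc.prems show ?case
    by (simp add: smooth_pd1 smooth_pd2 del: sum.atMost_Suc)
qed

lemma dnorm_continuous: "smooth f \<Longrightarrow> continuous_on UNIV (dnorm l f)"
proof (induction l arbitrary: f)
  case 0 then show ?case using smooth_cont by (auto intro!: continuous_intros)
next
  case (Suc l)
  then show ?case by (auto intro!: continuous_on_add simp: smooth_pd1 smooth_pd2)
qed

section \<open>A smooth partition of unity\<close>

text \<open>The powers of 1/x are carried along because differentiation of exp(-1/x) stays inside
  the span of this family; smoothness then follows by one induction for all \<open>k\<close>
  simultaneously.\<close>

definition flat :: "nat \<Rightarrow> real \<Rightarrow> real" where
  "flat k x = (if x > 0 then (1 / x) ^ k * exp (- (1 / x)) else 0)"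

lemma flat_tendsto_0: "(flat k \<longlongrightarrow> 0) (at 0)"
proof (rule filterlim_split_at)
  show "(flat k \<longlongrightarrow> 0) (at_left 0)"
    by (rule tendsto_eventually) (auto simp: flat_def eventually_at_filter)
  have "((\<lambda>x. inverse x ^ k / exp (inverse x)) \<longlongrightarrow> (0::real)) (at_right 0)"
    by (rule filterlim_compose[OF tendsto_power_div_exp_0 filterlim_inverse_at_top_right])
  then show "(flat k \<longlongrightarrow> 0) (at_right 0)"
    by (rule Lim_transform_eventually)
      (auto simp: flat_def eventually_at_filter exp_minus inverse_eq_divide divide_simps)
qed

lemma flat_has_derivative:
  "(flat k has_real_derivative flat (k + 2) x - k * flat (k + 1) x) (at x)"
proof -
  consider "x < 0" | "x > 0" | "x = 0" by linarith
  then show ?thesis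
  proof cases
    case 1
    have "((\<lambda>x. 0) has_real_derivative 0) (at x)" by simp
    then have "(flat k has_real_derivative 0) (at x)"
      by (rule has_field_derivative_transform_within_open[where S="{..<0}"]) (use 1 in \<open>auto simp: flat_def\<close>)
    with 1 show ?thesis by (simp add: flat_def)
  next
    case 2
    have pk: "real k * (1 / x) ^ (k - 1) = real k * ((1 / x) ^ k * x)"
      using 2 by (cases k) auto
    have "((\<lambda>x. (1 / x) ^ k * exp (- (1 / x))) has_real_derivative
        (real k * (1 / x) ^ (k - 1) * (- 1 / x ^ 2)) * exp (- (1 / x)) + (1 / x) ^ k * (exp (- (1 / x)) * (1 / x ^ 2))) (at x)"
    proof -
      have i: "((\<lambda>x. 1 / x) has_real_derivative - 1 / x ^ 2) (at x)"
        using 2 by (auto intro!: derivative_eq_intros simp: power2_eq_square)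
      have "((\<lambda>x. (1 / x) ^ k) has_real_derivative real k * (1 / x) ^ (k - 1) * (- 1 / x ^ 2)) (at x)"
        using DERIV_power[OF i, of k] by (simp add: mult_ac)
      moreover have "((\<lambda>x. exp (- (1 / x))) has_real_derivative exp (- (1 / x)) * (1 / x ^ 2)) (at x)"
        using DERIV_fun_exp[OF DERIV_minus[OF i]] by simp
      ultimately show ?thesis
        by (rule DERIV_cong[OF DERIV_mult]) (simp add: mult_ac)
    qed
    also have "(real k * (1 / x) ^ (k - 1) * (- 1 / x ^ 2)) * exp (- (1 / x)) + (1 / x) ^ k * (exp (- (1 / x)) * (1 / x ^ 2))
       = flat (k + 2) x - k * flat (k + 1) x"
      using 2 unfolding pk by (simp add: flat_def field_simps power2_eq_square)
    finally show ?thesis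
      by (rule has_field_derivative_transform_within_open[where S="{0<..}"]) (use 2 in \<open>auto simp: flat_def\<close>)
  next
    case 3
    \<comment> \<open>At 0 the difference quotient of \<open>flat k\<close> is
      \<open>flat (k + 1)\<close> itself, since division by y raises the exponent.\<close>
    have "(flat (k + 1) \<longlongrightarrow> 0) (at 0)" by (rule flat_tendsto_0)
    then have "((\<lambda>y. (flat k y - flat k 0) / (y - 0)) \<longlongrightarrow> 0) (at 0)"
      by (rule Lim_transform_eventually) (auto simp: flat_def eventually_at_filter)
    with 3 show ?thesis by (simp add: has_field_derivative_iff flat_def)
  qed
qed

lemma flat_continuous: "continuous_on UNIV (flat k)"
  by (rule DERIV_continuous_on) (rule has_field_derivative_at_within[OF flat_has_derivative])

lemma Ck_flat: "Ck n (\<lambda>x. flat k (fst x))" "Ck n (\<lambda>x. flat k (snd x))"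
proof (induction n arbitrary: k)
  case (Suc n)
  { case 1
    show ?case
    proof (rule Ck_SucI[where ?f1.0="\<lambda>x. flat (k + 2) (fst x) + (- real k) * flat (k + 1) (fst x)" and ?f2.0="\<lambda>x. 0"])
      show "continuous_on UNIV (\<lambda>x::real\<times>real. flat k (fst x))"
        by (rule continuous_on_compose2[OF flat_continuous]) (auto intro: continuous_intros)
      show "Ck n (\<lambda>x. flat (k + 2) (fst x) + (- real k) * flat (k + 1) (fst x))"
        by (intro Ck_add Ck_mult Ck_const Suc.IH)
    qed (use flat_has_derivative in \<open>auto simp: Ck_const\<close>) }
  { case 2
    show ?case
    proof (rule Ck_SucI[where ?f2.0="\<lambda>x. flat (k + 2) (snd x) + (- real k) * flat (k + 1) (snd x)" and ?f1.0="\<lambda>x. 0"])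
      show "continuous_on UNIV (\<lambda>x::real\<times>real. flat k (snd x))"
        by (rule continuous_on_compose2[OF flat_continuous]) (auto intro: continuous_intros)
      show "Ck n (\<lambda>x. flat (k + 2) (snd x) + (- real k) * flat (k + 1) (snd x))"
        by (intro Ck_add Ck_mult Ck_const Suc.IH)
    qed (use flat_has_derivative in \<open>auto simp: Ck_const\<close>) }
next
  case 0
  { case 1 show ?case by (auto intro!: continuous_on_compose2[OF flat_continuous[of k]] continuous_intros) }
  { case 2 show ?case by (auto intro!: continuous_on_compose2[OF flat_continuous[of k]] continuous_intros) }
qed

lemma Ck_inverse:
  assumes "\<And>x. f x \<noteq> 0"
  shows "Ck n f \<Longrightarrow> Ck n (\<lambda>x. inverse (f x))"
proof (induction n)
  case 0
  then show ?case using assms by (auto intro!: continuous_intros)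
next
  case (Suc n)
  have c: "Ck n f" "Ck n (pd1 f)" "Ck n (pd2 f)"
    using Suc.prems Ck_SucD[OF Suc.prems] unfolding Ck.simps(2) by blast+
  note i = Suc.IH[OF c(1)]
  have "continuous_on UNIV (\<lambda>x. inverse (f x))"
    using Ck_cont[OF Suc.prems] assms by (auto intro!: continuous_intros)
  moreover have "((\<lambda>t. inverse (f (t, y))) has_real_derivative - 1 * ((inverse (f (x, y)) * inverse (f (x, y))) * pd1 f (x, y))) (at x)"
    "((\<lambda>t. inverse (f (x, t))) has_real_derivative - 1 * ((inverse (f (x, y)) * inverse (f (x, y))) * pd2 f (x, y))) (at y)" for x y
    using DERIV_inverse_fun[OF Ck_Suc_has_derivative(1)[OF Suc.prems] assms]
      DERIV_inverse_fun[OF Ck_Suc_has_derivative(2)[OF Suc.prems] assms]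
    by (simp_all add: power2_eq_square mult_ac)
  moreover have "Ck n (\<lambda>x. - 1 * ((inverse (f x) * inverse (f x)) * pd1 f x))" "Ck n (\<lambda>x. - 1 * ((inverse (f x) * inverse (f x)) * pd2 f x))"
    by (intro Ck_mult Ck_const i c)+
  ultimately show ?case by (rule Ck_SucI)
qed

definition stp :: "real \<Rightarrow> real" where
  "stp x = flat 0 x * inverse (flat 0 x + flat 0 (1 - x))"

text \<open>Difference of two consecutive translates of a smooth step. Its integer translates
  telescope to 1 without normalisation, and its integral is 1 as well; thus the product
  \<open>eta\<close> serves both as partition of unity and as mollifier.\<close>

definition theta :: "real \<Rightarrow> real" where
  "theta x = stp x - stp (x - 1)"

definition eta :: "real \<times> real \<Rightarrow> real" where
  "eta x = theta (fst x) * theta (snd x)"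

lemma flat0: "x \<le> 0 \<Longrightarrow> flat 0 x = 0" "x > 0 \<Longrightarrow> flat 0 x > 0" "flat 0 x \<ge> 0"
  by (auto simp: flat_def)

lemma flat0_sum_pos: "flat 0 x + flat 0 (1 - x) > 0"
proof (cases "x > 0")
  case True then show ?thesis using flat0(2)[of x] flat0(3)[of "1 - x"] by linarith
next
  case False then show ?thesis using flat0(2)[of "1 - x"] flat0(3)[of "x"] by linarith
qed

lemma stp_0: "x \<le> 0 \<Longrightarrow> stp x = 0"
  by (simp add: stp_def flat0)

lemma stp_1: "x \<ge> 1 \<Longrightarrow> stp x = 1"
  using flat0(2)[of x] by (simp add: stp_def flat0(1)[of "1 - x"])

lemma stp_bounds: "0 \<le> stp x" "stp x \<le> 1"
  using flat0_sum_pos[of x] flat0(3)[of x] flat0(3)[of "1 - x"] by (auto simp: stp_def field_simps)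

lemma theta_nonneg: "theta x \<ge> 0"
  using stp_bounds[of x] stp_bounds[of "x - 1"] stp_0[of "x - 1"] stp_1[of x]
  by (cases "x \<ge> 1") (auto simp: theta_def)

lemma theta_eq_0: "x \<le> 0 \<or> x \<ge> 2 \<Longrightarrow> theta x = 0"
  using stp_0[of x] stp_0[of "x - 1"] stp_1[of x] stp_1[of "x - 1"] by (auto simp: theta_def)

lemma eta_nonneg: "eta x \<ge> 0"
  by (simp add: eta_def theta_nonneg)

lemma eta_support: "eta x \<noteq> 0 \<Longrightarrow> 0 < fst x \<and> fst x < 2 \<and> 0 < snd x \<and> snd x < 2"
  using theta_eq_0[of "fst x"] theta_eq_0[of "snd x"] by (fastforce simp: eta_def not_le)

lemma smooth_eta: "smooth eta"
proof -
  have 1: "Ck n (\<lambda>x. stp (fst x))" "Ck n (\<lambda>x. stp (snd x))" for n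
  proof -
    have "Ck n (\<lambda>x. flat 0 (fst ((- 1) *\<^sub>R (x - (1, 1)))))" "Ck n (\<lambda>x. flat 0 (snd ((- 1) *\<^sub>R (x - (1, 1)))))"
      by (rule Ck_affine, rule Ck_flat)+
    then have "Ck n (\<lambda>x. flat 0 (1 - fst x))" "Ck n (\<lambda>x. flat 0 (1 - snd x))"
      by (simp_all add: algebra_simps)
    then show "Ck n (\<lambda>x. stp (fst x))" "Ck n (\<lambda>x. stp (snd x))"
      unfolding stp_def using flat0_sum_pos
      by (auto intro!: Ck_mult Ck_inverse Ck_add Ck_flat simp: less_imp_neq[THEN not_sym])
  qed
  have 2: "Ck n (\<lambda>x. stp (fst x - 1))" "Ck n (\<lambda>x. stp (snd x - 1))" for n
    using Ck_affine[OF 1(1), of n 1 "(1, 1)"] Ck_affine[OF 1(2), of n 1 "(1, 1)"] by simp_all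
  have "smooth (\<lambda>x. (stp (fst x) + (- 1) * stp (fst x - 1)) * (stp (snd x) + (- 1) * stp (snd x - 1)))"
    unfolding smooth_def by (intro allI Ck_mult Ck_add Ck_const 1 2)
  then show ?thesis by (simp add: eta_def[abs_def] theta_def)
qed

definition lat :: "int \<times> int \<Rightarrow> real \<times> real" where
  "lat z = (real_of_int (fst z), real_of_int (snd z))"

text \<open>In each variable only the translates by the integer part and by its predecessor can be
  nonzero. Admitting any finite index set that contains the active translates allows index sets cut
  down to the neighbourhood of \<open>K\<close>.\<close>

lemma eta_partition:
  assumes "finite Z" "\<And>z. eta (x - lat z) \<noteq> 0 \<Longrightarrow> z \<in> Z"
  shows "(\<Sum>z\<in>Z. eta (x - lat z)) = 1"
proof -
  define a b where "a = \<lfloor>fst x\<rfloor>" and "b = \<lfloor>snd x\<rfloor>"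
  let ?A = "{a - 1, a}" and ?B = "{b - 1, b}"
  have th: "theta (t - of_int (\<lfloor>t\<rfloor> - 1)) + theta (t - of_int \<lfloor>t\<rfloor>) = 1" for t :: real
  proof -
    have "t - \<lfloor>t\<rfloor> \<ge> 0" "t - \<lfloor>t\<rfloor> < 1" by linarith+
    then show ?thesis
      using stp_1[of "t - \<lfloor>t\<rfloor> + 1"] stp_0[of "t - \<lfloor>t\<rfloor> - 1"] by (simp add: theta_def algebra_simps)
  qed
  have sup: "z \<in> ?A \<times> ?B" if "eta (x - lat z) \<noteq> 0" for z
  proof -
    have "0 < fst x - fst z" "fst x - fst z < 2" "0 < snd x - snd z" "snd x - snd z < 2"
      using eta_support[OF that] by (auto simp: lat_def)
    then have "fst z = a - 1 \<or> fst z = a" "snd z = b - 1 \<or> snd z = b"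
      unfolding a_def b_def by linarith+
    then show ?thesis by (cases z) auto
  qed
  have "(\<Sum>z\<in>Z. eta (x - lat z)) = (\<Sum>z\<in>?A \<times> ?B. eta (x - lat z))"
    by (intro sum.mono_neutral_cong) (use assms sup in auto)
  also have "\<dots> = (\<Sum>m\<in>?A. theta (fst x - m)) * (\<Sum>n\<in>?B. theta (snd x - n))"
    by (simp add: sum.cartesian_product[symmetric] eta_def lat_def sum_product algebra_simps)
  also have "\<dots> = 1" using th[of "fst x"] th[of "snd x"] by (simp add: a_def b_def)
  finally show ?thesis .
qed

lemma continuous_stp: "continuous_on UNIV stp"
  unfolding stp_def[abs_def]
  by (intro continuous_intros continuous_on_compose2[OF flat_continuous] subset_UNIV)
    (use flat0_sum_pos in \<open>auto simp: less_imp_neq[THEN not_sym]\<close>)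

lemma continuous_theta: "continuous_on UNIV theta"
  unfolding theta_def[abs_def]
  by (intro continuous_intros continuous_on_compose2[OF continuous_stp] subset_UNIV)

text \<open>On [0,1] the bump is the step and on [1,2] one minus its translate; the unknown integral
  of the step cancels.\<close>

lemma theta_has_integral: "(theta has_integral 1) UNIV"
proof -
  define I where "I = integral {0..1} stp"
  have I: "(stp has_integral I) (cbox 0 1)"
    unfolding I_def by (auto intro!: integrable_integral integrable_continuous_real continuous_on_subset[OF continuous_stp])
  have "(theta has_integral I) {0..1}"
    by (rule has_integral_eq[of _ stp]) (use I in \<open>auto simp: theta_def stp_0\<close>)
  moreover have "((\<lambda>x. stp (1 *\<^sub>R x + (- 1))) has_integral I /\<^sub>R 1 ^ DIM(real)) (cbox ((0 - (- 1)) /\<^sub>R 1) ((1 - (- 1)) /\<^sub>R 1))"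
    by (rule has_integral_affinity'[OF I]) simp
  then have "((\<lambda>x. stp (x - 1)) has_integral I) {1..2}" by simp
  then have "((\<lambda>x. 1 - stp (x - 1)) has_integral 1 - I) {1..2}"
    using has_integral_const_real[of "1::real" 1 2] by (intro has_integral_diff) auto
  then have "(theta has_integral 1 - I) {1..2}"
    by (rule has_integral_eq[rotated]) (auto simp: theta_def stp_1)
  ultimately have "(theta has_integral I + (1 - I)) {0..2}"
    by (intro has_integral_combine[of 0 1 2]) auto
  then have "(theta has_integral 1) {0..2}" by simp
  then show ?thesis
  proof (rule has_integral_on_superset)
    show "theta x = 0" if "x \<notin> {0..2}" for x using that by (intro theta_eq_0) auto
  qed simp
qed

lemma borel_measurable_theta [measurable]: "theta \<in> borel_measurable borel"
  by (rule borel_measurable_continuous_onI[OF continuous_theta])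

lemma borel_measurable_eta [measurable]: "eta \<in> borel_measurable borel"
  by (rule borel_measurable_continuous_onI[OF smooth_cont[OF smooth_eta]])

lemma nn_integral_eta: "(\<integral>\<^sup>+x. ennreal (eta x) \<partial>lborel) = 1"
proof -
  have t: "(\<integral>\<^sup>+x. ennreal (theta x) \<partial>lborel) = 1"
    using nn_integral_has_integral_lborel[OF borel_measurable_theta theta_nonneg theta_has_integral] by simp
  have "(\<integral>\<^sup>+x. ennreal (eta x) \<partial>lborel) = (\<integral>\<^sup>+x. ennreal (eta x) \<partial>(lborel \<Otimes>\<^sub>M lborel))"
    by (simp add: lborel_prod)
  also have "\<dots> = (\<integral>\<^sup>+x. \<integral>\<^sup>+y. ennreal (eta (x, y)) \<partial>lborel \<partial>lborel)"
    by (subst lborel.nn_integral_fst[symmetric]) (auto simp: lborel_prod)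
  also have "\<dots> = (\<integral>\<^sup>+x. \<integral>\<^sup>+y. ennreal (theta x) * ennreal (theta y) \<partial>lborel \<partial>lborel)"
    by (simp add: eta_def ennreal_mult theta_nonneg)
  also have "\<dots> = 1" by (simp add: nn_integral_cmult t)
  finally show ?thesis .
qed

lemma dnorm_eta_zero:
  assumes "x \<notin> cbox 0 (2, 2)" shows "dnorm l eta x = 0"
proof -
  have "dnorm l eta x = dnorm l (\<lambda>x. 0) x"
  proof (rule dnorm_cong_open)
    show "open (- cbox (0::real\<times>real) (2, 2))" by (simp add: open_Compl closed_cbox)
    show "eta y = 0" if "y \<in> - cbox 0 (2, 2)" for y
    proof (rule ccontr)
      assume "eta y \<noteq> 0"
      from eta_support[OF this] that show False
        by (cases y) (auto simp: zero_prod_def cbox_Pair_eq)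
    qed
  qed (use assms in auto)
  then show ?thesis by (simp add: dnorm_0)
qed

lemma dnorm_eta_bounded:
  obtains C where "C \<ge> 1" "\<And>i x. i \<le> l \<Longrightarrow> dnorm i eta x \<le> C"
proof -
  have "\<exists>B. \<forall>x. dnorm i eta x \<le> B" for i
  proof -
    have "compact (dnorm i eta ` cbox 0 (2, 2))"
      by (intro compact_continuous_image continuous_on_subset[OF dnorm_continuous[OF smooth_eta]]) auto
    then obtain B where "\<forall>y\<in>dnorm i eta ` cbox 0 (2, 2). y \<le> B"
      using bounded_imp_bdd_above[OF compact_imp_bounded] unfolding bdd_above_def by blast
    then have "dnorm i eta x \<le> max B 0" for x
      using dnorm_eta_zero[of x i] by (cases "x \<in> cbox 0 (2, 2)") auto
    then show ?thesis by blast
  qed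
  then obtain B where B: "\<And>i x. dnorm i eta x \<le> B i" by metis
  have B0: "B i \<ge> 0" for i using B[of i 0] dnorm_nonneg[of i eta 0] by linarith
  show ?thesis
  proof
    show "1 + (\<Sum>i\<le>l. B i) \<ge> 1" using B0 by (simp add: sum_nonneg)
    fix i x assume "i \<le> l"
    then have "B i \<le> (\<Sum>i\<le>l. B i)" using B0 by (intro member_le_sum) auto
    then show "dnorm i eta x \<le> 1 + (\<Sum>i\<le>l. B i)" using B[of i x] by linarith
  qed
qed

section \<open>Morrey's inequality on squares\<close>

text \<open>The closed ball of the maximum norm. Being a box, it carries the box integral, and its
  contraction towards one of its points is again a box, as the proof of Morrey's inequality
  requires.\<close>

definition sq :: "real \<times> real \<Rightarrow> real \<Rightarrow> (real \<times> real) set" where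
  "sq c r = cbox (c - (r, r)) (c + (r, r))"

lemma mem_sq: "x \<in> sq c r \<longleftrightarrow> \<bar>fst x - fst c\<bar> \<le> r \<and> \<bar>snd x - snd c\<bar> \<le> r"
  by (cases x; cases c) (auto simp: sq_def cbox_Pair_eq abs_le_iff)

lemma sq_borel [measurable, simp]: "sq c r \<in> sets borel"
  by (simp add: sq_def)

lemma measure_sq: "r \<ge> 0 \<Longrightarrow> measure lborel (sq c r) = 4 * r\<^sup>2"
  by (cases c) (auto simp: sq_def content_Pair power2_eq_square)

lemma smooth_has_derivative:
  assumes "smooth f"
  shows "(f has_derivative (\<lambda>h. pd1 f x * fst h + pd2 f x * snd h)) (at x)"
proof -
  have "((\<lambda>(x, y). f (x, y)) has_derivative (\<lambda>(tx, ty). pd1 f x * tx + blinfun_mult_right (pd2 f (fst x, snd x)) ty)) (at (fst x, snd x) within UNIV \<times> UNIV)"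
  proof (rule has_derivative_partialsI[where f="\<lambda>x y. f (x, y)" and fy="\<lambda>x y. blinfun_mult_right (pd2 f (x, y))"])
    show "((\<lambda>t. f (t, snd x)) has_derivative (\<lambda>h. pd1 f x * h)) (at (fst x))"
      using smooth_has_pd1[OF assms, of "snd x" "fst x"] by (simp add: has_field_derivative_def)
    show "((\<lambda>t. f (a, t)) has_derivative blinfun_apply (blinfun_mult_right (pd2 f (a, b)))) (at b)" for a b
      using smooth_has_pd2[OF assms, of a b] by (simp add: has_field_derivative_def blinfun_mult_right.rep_eq)
    have "isCont (pd2 f) (fst x, snd x)"
      using smooth_cont[OF smooth_pd2[OF assms]] continuous_on_eq_continuous_at[of UNIV "pd2 f"] by blast
    moreover have "(\<lambda>(x, y). blinfun_mult_right (pd2 f (x, y))) = (\<lambda>z. blinfun_mult_right (pd2 f z))" by auto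
    ultimately show "continuous (at (fst x, snd x) within UNIV \<times> UNIV) (\<lambda>(x, y). blinfun_mult_right (pd2 f (x, y)))"
      using bounded_linear.isCont[OF bounded_linear_blinfun_mult_right] by simp
  qed auto
  then have "(f has_derivative (\<lambda>(tx, ty). pd1 f x * tx + pd2 f x * ty)) (at x)"
    by (simp add: blinfun_mult_right.rep_eq)
  then show ?thesis by (rule has_derivative_eq_rhs) auto
qed

text \<open>Young's inequality with a free parameter \<open>A\<close>. After integration, inserting
  for \<open>A\<close> the expected mean of t yields the inequalities of Hoelder and Jensen; in the
  Morse--Sard argument the parameter balances two sums instead.\<close>

lemma young_tangent:
  fixes q :: real
  assumes "q > 1" "t \<ge> 0" "A > 0"
  shows "t \<le> t powr q * A powr (1 - q) / q + (1 - 1 / q) * A"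
proof -
  show ?thesis
  proof (cases "t = 0")
    case True
    then show ?thesis using assms by simp
  next
    case False
  have "((t powr q * A powr (1 - q)) powr (1 / q)) * (A powr (1 - 1 / q))
      \<le> (1 / q) * (t powr q * A powr (1 - q)) + (1 - 1 / q) * A"
    using assms False by (intro Youngs_inequality_0) auto
  moreover have "((t powr q * A powr (1 - q)) powr (1 / q)) * (A powr (1 - 1 / q)) = t"
  proof -
    have "(A powr (1 - q)) powr (1 / q) * A powr (1 - 1 / q) = A powr 0"
      using assms by (simp add: powr_powr diff_divide_distrib flip: powr_add)
    moreover have "(t powr q) powr (1 / q) = t" using assms False by (simp add: powr_powr)
    ultimately show ?thesis using assms by (simp add: powr_mult)
  qed
  ultimately show ?thesis by simp
  qed
qed

text \<open>The square is contracted to \<open>x\<close>: \<open>w s\<close> integrates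
  \<open>v\<close> over the copy shrunk by the factor \<open>s\<close>, in the coordinates of the
  full square, so \<open>w 1\<close> is the integral of \<open>v\<close> and \<open>w 0\<close> the
  area times \<open>v x\<close>. The derivative of \<open>w\<close> is of size s^(-2/q), which is
  integrable at 0 exactly because q > 2.\<close>

lemma morrey_mean_value:
  fixes v :: "real \<times> real \<Rightarrow> real"
  assumes v: "smooth v" and r: "r > 0" and q: "q > 2" and x: "x \<in> sq c r" and W: "W > 0"
    and J: "integral (sq c r) (\<lambda>z. dnorm 1 v z powr q) \<le> W powr q"
  shows "\<bar>integral (sq c r) v - 4 * r\<^sup>2 * v x\<bar> \<le> 4 * r\<^sup>2 * (2 / (1 - 2 / q) * r powr (1 - 2 / q) * W)"
proof -
  let ?Q = "sq c r"
  let ?N = "\<lambda>z. dnorm 1 v z"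
  have cv: "continuous_on UNIV v" and cN: "continuous_on UNIV ?N"
    and c1: "continuous_on UNIV (pd1 v)" and c2: "continuous_on UNIV (pd2 v)"
    using smooth_cont[OF v] dnorm_continuous[OF v] smooth_cont[OF smooth_pd1[OF v]] smooth_cont[OF smooth_pd2[OF v]] by blast+
  define w where "w s = integral ?Q (\<lambda>z. v (x + s *\<^sub>R (z - x)))" for s
  define d where "d s z = pd1 v (x + s *\<^sub>R (z - x)) * (fst z - fst x) + pd2 v (x + s *\<^sub>R (z - x)) * (snd z - snd x)" for s z
  have w': "(w has_field_derivative integral ?Q (d s)) (at s)" for s
    unfolding w_def sq_def
  proof (rule leibniz_rule_field_derivative)
    fix t z
    have "((\<lambda>t. x + t *\<^sub>R (z - x)) has_derivative (\<lambda>h. h *\<^sub>R (z - x))) (at t)"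
      by (auto intro!: derivative_eq_intros)
    from diff_chain_at[OF this smooth_has_derivative[OF v]]
    have "((\<lambda>t. v (x + t *\<^sub>R (z - x))) has_derivative (\<lambda>h. pd1 v (x + t *\<^sub>R (z - x)) * (h * (fst z - fst x)) + pd2 v (x + t *\<^sub>R (z - x)) * (h * (snd z - snd x)))) (at t)"
      by (simp add: o_def)
    then show "((\<lambda>t. v (x + t *\<^sub>R (z - x))) has_field_derivative d t z) (at t within UNIV)"
      unfolding has_field_derivative_def by (rule has_derivative_eq_rhs) (simp add: fun_eq_iff d_def algebra_simps)
  next
    fix t :: real
    have "continuous_on UNIV (\<lambda>z. v (x + t *\<^sub>R (z - x)))"
      by (rule continuous_on_compose2[OF cv]) (intro continuous_intros subset_UNIV)+
    then show "(\<lambda>z. v (x + t *\<^sub>R (z - x))) integrable_on cbox (c - (r, r)) (c + (r, r))"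
      by (intro integrable_continuous) (auto elim: continuous_on_subset)
  next
    show "continuous_on (UNIV \<times> cbox (c - (r, r)) (c + (r, r))) (\<lambda>(t, z). d t z)"
      unfolding d_def split_beta
      by (intro continuous_intros continuous_on_compose2[OF c1] continuous_on_compose2[OF c2] subset_UNIV)
  qed auto
  define J where "J = integral ?Q (\<lambda>z. ?N z powr q)"
  have cNq: "continuous_on UNIV (\<lambda>z. ?N z powr q)"
    using q by (intro continuous_on_powr' cN continuous_intros) (auto simp del: dnorm.simps One_nat_def simp: dnorm_nonneg)
  have bound: "norm (integral ?Q (d s)) \<le> 8 * r powr 3 * (4 * r\<^sup>2) powr (- (1 / q)) * W * s powr (- (2 / q))" if s: "0 < s" "s < 1" for s
  proof -
    \<comment> \<open>An upper bound for the L^q mean of the gradient over the shrunken square,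
      where the Jacobian contributes s^(-2/q). With this value the two terms of
      \<open>young_tangent\<close> combine to a multiple of \<open>A\<close>.\<close>
    define A where "A = W * s powr (- (2 / q)) * (4 * r\<^sup>2) powr (- (1 / q))"
    have A: "A > 0" using W s r by (simp add: A_def)
    have Aq: "A powr q = W powr q * s powr (- 2) * (4 * r\<^sup>2) powr (- 1)"
      using W s r q by (simp add: A_def powr_mult powr_powr)
    define y where "y z = x + s *\<^sub>R (z - x)" for z
    have cy: "continuous_on UNIV y" unfolding y_def by (intro continuous_intros)
    have cNy: "continuous_on UNIV (\<lambda>z. ?N (y z))" by (rule continuous_on_compose2[OF cN cy]) auto
    have cNqy: "continuous_on UNIV (\<lambda>z. ?N (y z) powr q)" by (rule continuous_on_compose2[OF cNq cy]) auto
    have int: "f integrable_on ?Q" if "continuous_on UNIV f" for f :: "real \<times> real \<Rightarrow> real"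
      unfolding sq_def by (intro integrable_continuous) (use that in \<open>auto elim: continuous_on_subset\<close>)
    have cd: "continuous_on UNIV (d s)"
      unfolding d_def
      by (intro continuous_intros continuous_on_compose2[OF c1] continuous_on_compose2[OF c2] subset_UNIV)
    have "norm (integral ?Q (d s)) \<le> integral ?Q (\<lambda>z. 2 * r * ?N (y z))"
    proof (rule integral_norm_bound_integral)
      fix z assume z: "z \<in> ?Q"
      have zx: "\<bar>fst z - fst x\<bar> \<le> 2 * r" "\<bar>snd z - snd x\<bar> \<le> 2 * r" using z x by (auto simp: mem_sq)
      have "norm (d s z) \<le> \<bar>pd1 v (y z)\<bar> * \<bar>fst z - fst x\<bar> + \<bar>pd2 v (y z)\<bar> * \<bar>snd z - snd x\<bar>"
        unfolding d_def y_def by (simp add: abs_triangle_ineq flip: abs_mult)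
      also have "\<dots> \<le> \<bar>pd1 v (y z)\<bar> * (2 * r) + \<bar>pd2 v (y z)\<bar> * (2 * r)"
        by (intro add_mono mult_left_mono zx) auto
      finally show "norm (d s z) \<le> 2 * r * ?N (y z)" by (simp add: algebra_simps)
    qed (auto intro!: int cd continuous_intros cNy simp del: dnorm.simps One_nat_def)
    also have "\<dots> \<le> integral ?Q (\<lambda>z. 2 * r * (A powr (1 - q) / q * ?N (y z) powr q + (1 - 1 / q) * A))"
    proof (rule integral_le)
      fix z assume "z \<in> ?Q"
      have "?N (y z) \<le> ?N (y z) powr q * A powr (1 - q) / q + (1 - 1 / q) * A"
        using q A dnorm_nonneg by (intro young_tangent) auto
      then show "2 * r * ?N (y z) \<le> 2 * r * (A powr (1 - q) / q * ?N (y z) powr q + (1 - 1 / q) * A)"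
        using r by (intro mult_left_mono) (auto simp: mult_ac simp del: dnorm.simps One_nat_def)
    qed (use q in \<open>auto intro!: int continuous_intros cNy cNqy simp del: dnorm.simps One_nat_def\<close>)
    also have "\<dots> = 2 * r * (A powr (1 - q) / q * integral ?Q (\<lambda>z. ?N (y z) powr q) + (1 - 1 / q) * A * (4 * r\<^sup>2))"
    proof -
      have "integral ?Q (\<lambda>z. A powr (1 - q) / q * ?N (y z) powr q + (1 - 1 / q) * A) =
        integral ?Q (\<lambda>z. A powr (1 - q) / q * ?N (y z) powr q) + integral ?Q (\<lambda>z. (1 - 1 / q) * A)"
        using q by (intro integral_add int continuous_intros cNqy) auto
      also have "integral ?Q (\<lambda>z. (1 - 1 / q) * A) = (1 - 1 / q) * A * (4 * r\<^sup>2)"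
        using measure_sq[of r c] r q by (simp add: sq_def)
      finally show ?thesis using q by (simp del: dnorm.simps One_nat_def)
    qed
    also have "\<dots> \<le> 2 * r * (A powr (1 - q) / q * (W powr q * s powr (- 2)) + (1 - 1 / q) * A * (4 * r\<^sup>2))"
    proof -
      \<comment> \<open>The image of the square under the contraction. The corners are written as
        offsets from those of the square, so that the inclusion becomes a question of signs.\<close>
      let ?S = "cbox (c - (r, r) - (1 - s) *\<^sub>R (c - (r, r) - x)) (c + (r, r) - (1 - s) *\<^sub>R (c + (r, r) - x))"
      have S: "?S \<subseteq> ?Q"
      proof
        fix z assume z: "z \<in> ?S"
        obtain c1 c2 x1 x2 z1 z2 where e: "c = (c1, c2)" "x = (x1, x2)" "z = (z1, z2)" by (metis surj_pair)
        have "(1 - s) * (c1 - r - x1) \<le> 0" "(1 - s) * (c2 - r - x2) \<le> 0"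
          "(1 - s) * (c1 + r - x1) \<ge> 0" "(1 - s) * (c2 + r - x2) \<ge> 0"
          using s x e by (auto simp: mem_sq abs_le_iff intro!: mult_nonneg_nonpos mult_nonneg_nonneg)
        then show "z \<in> ?Q" using z e by (auto simp: sq_def cbox_Pair_eq)
      qed
      have "((\<lambda>z. ?N z powr q) has_integral integral ?S (\<lambda>z. ?N z powr q)) ?S"
        by (intro integrable_integral integrable_continuous continuous_on_subset[OF cNq subset_UNIV])
      from has_integral_affinity'[OF this s(1), of "(1 - s) *\<^sub>R x"]
      have h: "((\<lambda>z. ?N (s *\<^sub>R z + (1 - s) *\<^sub>R x) powr q) has_integral integral ?S (\<lambda>z. ?N z powr q) / s ^ 2)
        (cbox ((c - (r, r) - (1 - s) *\<^sub>R (c - (r, r) - x) - (1 - s) *\<^sub>R x) /\<^sub>R s) ((c + (r, r) - (1 - s) *\<^sub>R (c + (r, r) - x) - (1 - s) *\<^sub>R x) /\<^sub>R s))"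
        by (simp add: divide_inverse mult.commute power2_eq_square)
      have e1: "(a - (1 - s) *\<^sub>R (a - x) - (1 - s) *\<^sub>R x) /\<^sub>R s = a" for a
      proof -
        have "a - (1 - s) *\<^sub>R (a - x) - (1 - s) *\<^sub>R x = s *\<^sub>R a" by (simp add: algebra_simps)
        then show ?thesis using s by simp
      qed
      have e2: "s *\<^sub>R z + (1 - s) *\<^sub>R x = y z" for z by (simp add: y_def algebra_simps)
      have "integral ?Q (\<lambda>z. ?N (y z) powr q) = integral ?S (\<lambda>z. ?N z powr q) / s ^ 2"
        using h unfolding e1 e2 sq_def by (rule integral_unique)
      also have "integral ?S (\<lambda>z. ?N z powr q) \<le> integral ?Q (\<lambda>z. ?N z powr q)"
        using S by (intro integral_subset_le int cNq integrable_continuous continuous_on_subset[OF cNq subset_UNIV]) auto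
      also have "\<dots> \<le> W powr q" by (rule assms)
      finally have "integral ?Q (\<lambda>z. ?N (y z) powr q) \<le> W powr q / s ^ 2"
        using s by (simp add: divide_right_mono)
      also have "W powr q / s ^ 2 = W powr q * s powr (- 2)"
        using s by (simp add: powr_minus divide_inverse)
      finally show ?thesis
        using r q by (intro mult_left_mono add_right_mono) auto
    qed
    also have "W powr q * s powr (- 2) = A powr q * (4 * r\<^sup>2)"
      unfolding Aq using r by (simp add: powr_minus)
    also have "A powr (1 - q) / q * (A powr q * (4 * r\<^sup>2)) = 1 / q * A * (4 * r\<^sup>2)"
    proof -
      have "A powr (1 - q) * A powr q = A" using A by (simp flip: powr_add)
      then show ?thesis by (simp flip: mult.assoc)
    qed
    also have "2 * r * (1 / q * A * (4 * r\<^sup>2) + (1 - 1 / q) * A * (4 * r\<^sup>2)) = 8 * r powr 3 * A"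
      using r by (simp add: algebra_simps power2_eq_square powr_numeral power3_eq_cube)
    finally show ?thesis by (simp add: A_def mult_ac)
  qed
  define B where "B = 8 * r powr 3 * (4 * r\<^sup>2) powr (- (1 / q)) * W"
  define k where "k = 1 - 2 / q"
  have k: "k > 0" using q by (simp add: k_def)
  \<comment> \<open>The comparison function is an antiderivative of the bound B s^(k-1). That bound
    blows up at 0, hence the mean value theorem that asks for derivatives in the open interval
    only.\<close>
  have "norm (w 1 - w 0) \<le> B / k * 1 powr k - B / k * 0 powr k"
  proof (rule differentiable_bound_general[where \<phi>="\<lambda>s. B / k * s powr k"])
    show "continuous_on {0..1} w"
      by (rule DERIV_continuous_on) (rule has_field_derivative_at_within[OF w'])
    have "continuous_on {0..1} (\<lambda>s::real. s powr k)"
      by (rule continuous_on_powr'[OF continuous_on_id continuous_on_const]) (use k in auto)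
    then show "continuous_on {0..1} (\<lambda>s. B / k * s powr k)"
      by (rule continuous_on_mult_left)
    fix s :: real assume s: "0 < s" "s < 1"
    show "(w has_vector_derivative integral ?Q (d s)) (at s)"
      using w' by (simp add: has_real_derivative_iff_has_vector_derivative)
    have "((\<lambda>s. B / k * s powr k) has_real_derivative B / k * (k * s powr (k - 1))) (at s)"
      using has_real_derivative_powr[OF s(1)] by (intro DERIV_cmult)
    also have "B / k * (k * s powr (k - 1)) = B * s powr (k - 1)"
      using k by simp
    finally show "((\<lambda>s. B / k * s powr k) has_vector_derivative B * s powr (k - 1)) (at s)"
      by (simp add: has_real_derivative_iff_has_vector_derivative)
    show "norm (integral ?Q (d s)) \<le> B * s powr (k - 1)" using bound[OF s] by (simp add: B_def k_def)
  qed simp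
  moreover have "w 1 = integral ?Q v" by (simp add: w_def)
  moreover have "w 0 = 4 * r\<^sup>2 * v x"
    using measure_sq[of r c] r by (simp add: w_def sq_def)
  ultimately have "\<bar>integral ?Q v - 4 * r\<^sup>2 * v x\<bar> \<le> B / (1 - 2 / q)" using q by (simp add: k_def)
  also have "B / (1 - 2 / q) \<le> 4 * r\<^sup>2 * (2 / (1 - 2 / q) * r powr (1 - 2 / q) * W)"
  proof -
    have "(4 * r\<^sup>2) powr (- (1 / q)) \<le> (r\<^sup>2) powr (- (1 / q))"
      using r q by (intro powr_mono2') auto
    also have "(r\<^sup>2) powr (- (1 / q)) = r powr (- (2 / q))"
      using r by (simp add: powr_powr flip: powr_numeral)
    finally have "r powr 3 * (4 * r\<^sup>2) powr (- (1 / q)) \<le> r powr 3 * r powr (- (2 / q))"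
      by (intro mult_left_mono) auto
    also have "\<dots> = r\<^sup>2 * r powr (1 - 2 / q)"
      using r by (simp flip: powr_add powr_numeral)
    finally have "r powr 3 * (4 * r\<^sup>2) powr (- (1 / q)) * (8 * W / (1 - 2 / q)) \<le> r\<^sup>2 * r powr (1 - 2 / q) * (8 * W / (1 - 2 / q))"
      using q W by (intro mult_right_mono) auto
    then show ?thesis by (simp add: B_def mult_ac)
  qed
  finally show ?thesis .
qed

lemma nn_integral_sq:
  assumes "continuous_on UNIV f" "\<And>z. f z \<ge> 0"
  shows "(\<integral>\<^sup>+z. ennreal (f z) * indicator (sq c r) z \<partial>lborel) = ennreal (integral (sq c r) f)"
proof -
  have "(f has_integral integral (sq c r) f) (sq c r)"
    unfolding sq_def by (intro integrable_integral integrable_continuous continuous_on_subset[OF assms(1) subset_UNIV])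
  then have "((\<lambda>z. f z * indicator (sq c r) z) has_integral integral (sq c r) f) UNIV"
    by (subst (asm) has_integral_restrict_UNIV[symmetric]) (simp add: indicator_def of_bool_def if_distrib cong: if_cong)
  moreover have "(\<lambda>z. f z * indicator (sq c r) z) \<in> borel_measurable borel"
    using borel_measurable_continuous_onI[OF assms(1)] by measurable
  ultimately have "integral\<^sup>N lborel (\<lambda>z. ennreal (f z * indicator (sq c r) z)) = ennreal (integral (sq c r) f)"
    using assms(2) by (intro nn_integral_has_integral_lborel) auto
  then show ?thesis using assms(2) by (simp add: ennreal_mult ennreal_indicator)
qed

text \<open>Twice the constant of \<open>morrey_mean_value\<close>, once for each of the two points
  compared with the mean.\<close>

definition morrey_const :: "real \<Rightarrow> real" where
  "morrey_const q = 4 / (1 - 2 / q)"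

lemma morrey:
  fixes v :: "real \<times> real \<Rightarrow> real"
  assumes v: "smooth v" and r: "r > 0" and q: "q > 2" and x: "x \<in> sq c r" and y: "y \<in> sq c r" and W: "W \<ge> 0"
    and J: "(\<integral>\<^sup>+z. ennreal (dnorm 1 v z powr q) * indicator (sq c r) z \<partial>lborel) \<le> ennreal (W powr q)"
  shows "\<bar>v x - v y\<bar> \<le> morrey_const q * r powr (1 - 2 / q) * W"
proof (rule field_le_epsilon)
  fix e :: real assume e: "e > 0"
  define K where "K = morrey_const q * r powr (1 - 2 / q)"
  have K: "K > 0" using q r by (simp add: K_def morrey_const_def)
  \<comment> \<open>\<open>W\<close> may be 0 whereas \<open>morrey_mean_value\<close> requires a
    positive bound; the enlargement costs exactly \<open>e\<close> in the result.\<close>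
  define V where "V = W + e / K"
  have V: "V > 0" "W \<le> V" using W e K by (auto simp: V_def add_nonneg_pos)
  have "continuous_on UNIV (\<lambda>z. dnorm 1 v z powr q)"
    using q by (intro continuous_on_powr' dnorm_continuous v continuous_intros) (auto simp del: dnorm.simps One_nat_def simp: dnorm_nonneg)
  from nn_integral_sq[OF this] J
  have "ennreal (integral (sq c r) (\<lambda>z. dnorm 1 v z powr q)) \<le> ennreal (W powr q)" by simp
  then have "integral (sq c r) (\<lambda>z. dnorm 1 v z powr q) \<le> W powr q" by (subst (asm) ennreal_le_iff) auto
  also have "\<dots> \<le> V powr q" using V W q by (intro powr_mono2) auto
  finally have i: "integral (sq c r) (\<lambda>z. dnorm 1 v z powr q) \<le> V powr q" .
  have "4 * r\<^sup>2 * \<bar>v x - v y\<bar> = \<bar>(integral (sq c r) v - 4 * r\<^sup>2 * v y) - (integral (sq c r) v - 4 * r\<^sup>2 * v x)\<bar>"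
  proof -
    have "(integral (sq c r) v - 4 * r\<^sup>2 * v y) - (integral (sq c r) v - 4 * r\<^sup>2 * v x) = 4 * r\<^sup>2 * (v x - v y)"
      by (simp add: algebra_simps)
    then show ?thesis using r by (simp only: abs_mult) simp
  qed
  also have "\<dots> \<le> 4 * r\<^sup>2 * (2 / (1 - 2 / q) * r powr (1 - 2 / q) * V) + 4 * r\<^sup>2 * (2 / (1 - 2 / q) * r powr (1 - 2 / q) * V)"
    by (rule order_trans[OF abs_triangle_ineq4 add_mono[OF morrey_mean_value[OF v r q y V(1) i] morrey_mean_value[OF v r q x V(1) i]]])
  also have "\<dots> = 4 * r\<^sup>2 * (K * V)" by (simp add: K_def morrey_const_def)
  finally have "\<bar>v x - v y\<bar> \<le> K * V" using r by simp
  also have "\<dots> = K * W + e"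
    using K by (simp add: V_def distrib_left)
  finally show "\<bar>v x - v y\<bar> \<le> morrey_const q * r powr (1 - 2 / q) * W + e" by (simp add: K_def)
qed

lemma dnorm_morrey:
  assumes "smooth f" and r: "r > 0" and q: "q > 2" and x: "x \<in> sq c r" and y: "y \<in> sq c r" and W: "W \<ge> 0"
    and "(\<integral>\<^sup>+z. ennreal (dnorm (Suc m) f z powr q) * indicator (sq c r) z \<partial>lborel) \<le> ennreal (W powr q)"
  shows "dnorm m f x \<le> dnorm m f y + 2 ^ m * (morrey_const q * r powr (1 - 2 / q) * W)"
  using assms(1,7)
proof (induction m arbitrary: f)
  case 0
  then show ?case using morrey[OF 0(1) r q x y W] by simp
next
  case (Suc m)
  have mono: "(\<integral>\<^sup>+z. ennreal (dnorm (Suc m) g z powr q) * indicator (sq c r) z \<partial>lborel) \<le> ennreal (W powr q)"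
    if "g = pd1 f \<or> g = pd2 f" for g
  proof -
    have "dnorm (Suc m) g z \<le> dnorm (Suc (Suc m)) f z" for z
      using that dnorm_nonneg[of "Suc m" "pd1 f" z] dnorm_nonneg[of "Suc m" "pd2 f" z]
      by (auto simp only: dnorm.simps(2)[of "Suc m"])
    then have "(\<integral>\<^sup>+z. ennreal (dnorm (Suc m) g z powr q) * indicator (sq c r) z \<partial>lborel)
      \<le> (\<integral>\<^sup>+z. ennreal (dnorm (Suc (Suc m)) f z powr q) * indicator (sq c r) z \<partial>lborel)"
      using q by (intro nn_integral_mono mult_right_mono ennreal_leI powr_mono2 dnorm_nonneg) auto
    then show ?thesis using Suc.prems(2) by order
  qed
  from Suc.IH[OF smooth_pd1[OF Suc.prems(1)] mono] Suc.IH[OF smooth_pd2[OF Suc.prems(1)] mono]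
  show ?case by simp
qed

lemma mean_value_sq:
  assumes f: "smooth f" and x: "x \<in> sq c r" and a: "a \<in> sq c r"
    and B: "\<And>y. y \<in> sq c r \<Longrightarrow> dnorm 1 f y \<le> B"
  shows "\<bar>f x - f a\<bar> \<le> 4 * r * B"
proof -
  obtain x1 x2 a1 a2 where e: "x = (x1, x2)" "a = (a1, a2)" by (metis surj_pair)
  have r: "r \<ge> 0" using x by (auto simp: mem_sq)
  have B0: "B \<ge> 0" using B[OF x] dnorm_nonneg[of 1 f x] by linarith
  have pd: "\<bar>pd1 f y\<bar> \<le> B" "\<bar>pd2 f y\<bar> \<le> B" if "y \<in> sq c r" for y using B[OF that] by auto
  have "norm (f (x1, x2) - f (a1, x2)) \<le> B * norm (x1 - a1)"
  proof (rule field_differentiable_bound[of "{fst c - r..fst c + r}" "\<lambda>t. f (t, x2)" "\<lambda>t. pd1 f (t, x2)"])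
    show "((\<lambda>t. f (t, x2)) has_field_derivative pd1 f (t, x2)) (at t within {fst c - r..fst c + r})" for t
      by (rule has_field_derivative_at_within[OF smooth_has_pd1[OF f]])
  qed (use x a e pd in \<open>auto simp: mem_sq abs_le_iff\<close>)
  moreover have "norm (f (a1, x2) - f (a1, a2)) \<le> B * norm (x2 - a2)"
  proof (rule field_differentiable_bound[of "{snd c - r..snd c + r}" "\<lambda>t. f (a1, t)" "\<lambda>t. pd2 f (a1, t)"])
    show "((\<lambda>t. f (a1, t)) has_field_derivative pd2 f (a1, t)) (at t within {snd c - r..snd c + r})" for t
      by (rule has_field_derivative_at_within[OF smooth_has_pd2[OF f]])
  qed (use x a e pd in \<open>auto simp: mem_sq abs_le_iff\<close>)
  moreover have "B * norm (x1 - a1) \<le> B * (2 * r)" "B * norm (x2 - a2) \<le> B * (2 * r)"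
    using x a e B0 by (auto simp: mem_sq intro!: mult_left_mono)
  moreover have "\<bar>f (x1, x2) - f (a1, a2)\<bar> \<le> \<bar>f (x1, x2) - f (a1, x2)\<bar> + \<bar>f (a1, x2) - f (a1, a2)\<bar>" by linarith
  ultimately have "\<bar>f (x1, x2) - f (a1, a2)\<bar> \<le> B * (2 * r) + B * (2 * r)" unfolding real_norm_def by linarith
  then show ?thesis using e by (simp add: algebra_simps)
qed

lemma dnorm_mean_value:
  assumes "smooth f" and x: "x \<in> sq c r" and a: "a \<in> sq c r"
    and "\<And>y. y \<in> sq c r \<Longrightarrow> dnorm (Suc i) f y \<le> B"
  shows "dnorm i f x \<le> dnorm i f a + 2 ^ i * (4 * r * B)"
  using assms(1,4)
proof (induction i arbitrary: f)
  case 0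
  then show ?case using mean_value_sq[OF 0(1) x a, of B] by simp
next
  case (Suc i)
  have "dnorm (Suc i) (pd1 f) y \<le> B" "dnorm (Suc i) (pd2 f) y \<le> B" if "y \<in> sq c r" for y
    using Suc.prems(2)[OF that] dnorm_nonneg[of "Suc i" "pd1 f" y] dnorm_nonneg[of "Suc i" "pd2 f" y]
    unfolding dnorm.simps(2)[of "Suc i"] by linarith+
  from Suc.IH[OF smooth_pd1[OF Suc.prems(1)] this(1)] Suc.IH[OF smooth_pd2[OF Suc.prems(1)] this(2)]
  show ?case by simp
qed

text \<open>The top order is controlled by Morrey's inequality; each descent by one order is a mean
  value estimate that gains a factor r for the Sobolev part and keeps the error \<open>e\<close>,
  which measures how far the derivatives at \<open>a\<close> are from vanishing. The cap
  \<open>R\<close> on the radius lets factors r in front of \<open>e\<close> be absorbed into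
  \<open>C\<close>.\<close>

lemma taylor_morrey:
  fixes m :: nat and q R :: real
  assumes q: "q > 2" and R: "R > 0" and m: "m \<ge> 1"
  obtains C where "C > 0" "\<And>f c r a e W x. \<lbrakk>smooth f; 0 < r; r \<le> R; a \<in> sq c r; x \<in> sq c r; e \<ge> 0; W \<ge> 0;
      \<And>i. 1 \<le> i \<Longrightarrow> i \<le> m \<Longrightarrow> dnorm i f a \<le> e;
      (\<integral>\<^sup>+z. ennreal (dnorm (Suc m) f z powr q) * indicator (sq c r) z \<partial>lborel) \<le> ennreal (W powr q)\<rbrakk>
     \<Longrightarrow> \<bar>f x - f a\<bar> \<le> C * (r ^ m * r powr (1 - 2 / q) * W + e)
       \<and> (\<forall>i. 1 \<le> i \<and> i \<le> m \<longrightarrow> dnorm i f x \<le> C * (r ^ (m - i) * r powr (1 - 2 / q) * W + e))"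
proof -
  define M where "M = 2 ^ m * morrey_const q"
  define L where "L = 2 ^ m * (4::real)"
  \<comment> \<open>One descent multiplies the Sobolev part by L r and turns a coefficient c of e
    into 1 + L r c; \<open>T\<close> is large enough to dominate the latter for all radii up to
    R.\<close>
  define T where "T = 2 + L * R"
  have M: "M > 0" using q by (simp add: M_def morrey_const_def)
  have L: "L \<ge> 1" unfolding L_def using one_le_power[of "2::real" m] by linarith
  have T: "T \<ge> 2" using L R by (simp add: T_def)
  define C where "C = (L ^ m * M + T ^ m) * (1 + 4 * R) + 4 * L ^ m * M"
  have C0: "C > 0" using M L T R by (auto simp: C_def intro!: add_pos_nonneg mult_pos_pos add_pos_pos)
  show ?thesis
  proof (rule that[OF C0])
    fix f c r a e W x
    assume f: "smooth f" and r: "0 < r" "r \<le> R" and a: "a \<in> sq c r" and x: "x \<in> sq c r" and e: "(e::real) \<ge> 0" and W: "(W::real) \<ge> 0"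
      and fa: "\<And>i. 1 \<le> i \<Longrightarrow> i \<le> m \<Longrightarrow> dnorm i f a \<le> e"
      and J: "(\<integral>\<^sup>+z. ennreal (dnorm (Suc m) f z powr q) * indicator (sq c r) z \<partial>lborel) \<le> ennreal (W powr q)"
    let ?w = "r powr (1 - 2 / q) * W"
    have w: "?w \<ge> 0" using W by simp
    have main: "dnorm (m - k) f y \<le> L ^ k * M * (r ^ k * ?w) + T ^ k * e" if "k < m" "y \<in> sq c r" for k y
      using that
    proof (induction k arbitrary: y)
      case 0
      then show ?case using dnorm_morrey[OF f r(1) q _ a W J, of y] fa[of m] m by (simp add: M_def mult_ac)
    next
      case (Suc k)
      have "dnorm (Suc (m - Suc k)) f z \<le> L ^ k * M * (r ^ k * ?w) + T ^ k * e" if "z \<in> sq c r" for z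
        using Suc.IH[OF _ that] Suc.prems(1) by (simp add: Suc_diff_Suc)
      from dnorm_mean_value[OF f Suc.prems(2) a this]
      have "dnorm (m - Suc k) f y \<le> dnorm (m - Suc k) f a + 2 ^ (m - Suc k) * (4 * r * (L ^ k * M * (r ^ k * ?w) + T ^ k * e))" .
      also have "dnorm (m - Suc k) f a \<le> e" using Suc.prems(1) by (intro fa) auto
      also have "2 ^ (m - Suc k) * (4 * r * (L ^ k * M * (r ^ k * ?w) + T ^ k * e)) \<le> 2 ^ m * (4 * r * (L ^ k * M * (r ^ k * ?w) + T ^ k * e))"
        using r L M T e w by (intro mult_right_mono power_increasing) auto
      also have "e + 2 ^ m * (4 * r * (L ^ k * M * (r ^ k * ?w) + T ^ k * e)) = L ^ Suc k * M * (r ^ Suc k * ?w) + (e + L * r * (T ^ k * e))"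
        by (simp add: L_def algebra_simps)
      also have "e + L * r * (T ^ k * e) \<le> T ^ k * e + L * R * (T ^ k * e)"
        using e r L T by (intro add_mono mult_right_mono mult_left_mono) (auto simp: mult_le_cancel_right1)
      also have "\<dots> \<le> T ^ Suc k * e"
        using e T by (simp add: T_def algebra_simps)
      finally show ?case by simp
    qed
    have CM: "L ^ k * M \<le> C" "T ^ k \<le> C" if "k \<le> m" for k
    proof -
      have "L ^ k \<le> L ^ m" "T ^ k \<le> T ^ m" using that L T by (auto intro!: power_increasing)
      then have "L ^ k * M \<le> L ^ m * M" "T ^ k \<le> T ^ m" using M by auto
      moreover have "L ^ m * M + T ^ m \<le> C" "0 \<le> L ^ m * M" "0 \<le> T ^ m"
        using M L T R by (auto simp: C_def algebra_simps)
      ultimately show "L ^ k * M \<le> C" "T ^ k \<le> C" by linarith+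
    qed
    have "dnorm i f x \<le> C * (r ^ (m - i) * r powr (1 - 2 / q) * W + e)" if i: "1 \<le> i" "i \<le> m" for i
    proof -
      have "dnorm i f x \<le> L ^ (m - i) * M * (r ^ (m - i) * ?w) + T ^ (m - i) * e"
        using main[of "m - i" x] i x by simp
      also have "\<dots> \<le> C * (r ^ (m - i) * ?w) + C * e"
        using CM[of "m - i"] w e r by (intro add_mono mult_right_mono) auto
      finally show ?thesis by (simp add: distrib_left mult_ac)
    qed
    moreover have "\<bar>f x - f a\<bar> \<le> C * (r ^ m * r powr (1 - 2 / q) * W + e)"
    proof -
      let ?B = "L ^ (m - 1) * M * (r ^ (m - 1) * ?w) + T ^ (m - 1) * e"
      have "dnorm 1 f y \<le> ?B" if "y \<in> sq c r" for y
        using main[of "m - 1" y] m that by simp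
      from mean_value_sq[OF f x a this] have "\<bar>f x - f a\<bar> \<le> 4 * r * ?B" .
      also have "\<dots> = (4 * L ^ (m - 1) * M) * (r ^ m * ?w) + 4 * r * T ^ (m - 1) * e"
        using m by (cases m) (auto simp: algebra_simps)
      also have "\<dots> \<le> C * (r ^ m * ?w) + C * e"
      proof (intro add_mono mult_right_mono)
        have l: "L ^ (m - 1) \<le> L ^ m" "T ^ (m - 1) \<le> T ^ m" using L T by (auto intro!: power_increasing)
        have p: "L ^ m * M > 0" "T ^ m > 0" using L T M by auto
        have "4 * L ^ (m - 1) * M \<le> 4 * L ^ m * M" using l M by auto
        also have "\<dots> \<le> C" using p R by (simp add: C_def)
        finally show "4 * L ^ (m - 1) * M \<le> C" .
        have "4 * r * T ^ (m - 1) \<le> 4 * R * T ^ m" using l r T by (intro mult_mono) auto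
        also have "\<dots> \<le> (L ^ m * M + T ^ m) * (1 + 4 * R)"
        proof -
          have "4 * R * T ^ m \<le> (L ^ m * M) * (1 + 4 * R) + T ^ m * (1 + 4 * R)"
            using p R by (simp add: distrib_left)
          then show ?thesis by (simp add: distrib_right)
        qed
        also have "\<dots> \<le> C" using p by (simp add: C_def mult.commute)
        finally show "4 * r * T ^ (m - 1) \<le> C" .
      qed (use e w r in auto)
      finally show ?thesis by (simp add: distrib_left mult_ac)
    qed
    ultimately show "\<bar>f x - f a\<bar> \<le> C * (r ^ m * r powr (1 - 2 / q) * W + e)
       \<and> (\<forall>i. 1 \<le> i \<and> i \<le> m \<longrightarrow> dnorm i f x \<le> C * (r ^ (m - i) * r powr (1 - 2 / q) * W + e))" by blast
  qed
qed

section \<open>The Hardy--Littlewood maximal inequality\<close>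

lemma emeasure_cball_le:
  fixes x :: "real \<times> real"
  assumes "r \<ge> 0" shows "emeasure lborel (cball x r) \<le> ennreal (4 * r\<^sup>2)"
proof -
  have "cball x r \<subseteq> cbox (x - (r, r)) (x + (r, r))"
  proof
    fix y assume "y \<in> cball x r"
    then have "dist (fst x) (fst y) \<le> r" "dist (snd x) (snd y) \<le> r"
      using dist_fst_le[of x y] dist_snd_le[of x y] by auto
    then show "y \<in> cbox (x - (r, r)) (x + (r, r))"
      by (cases x; cases y) (auto simp: cbox_Pair_eq dist_real_def abs_le_iff)
  qed
  then have "emeasure lborel (cball x r) \<le> emeasure lborel (cbox (x - (r, r)) (x + (r, r)))"
    by (intro emeasure_mono) auto
  also have "\<dots> = ennreal (measure lborel (cbox (x - (r, r)) (x + (r, r))))"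
    by (intro emeasure_eq_ennreal_measure) (metis emeasure_lborel_cbox_finite infinity_ennreal_def less_irrefl)
  also have "measure lborel (cbox (x - (r, r)) (x + (r, r))) = 4 * r\<^sup>2"
    using assms by (cases x) (auto simp: content_Pair power2_eq_square)
  finally show ?thesis .
qed

text \<open>Vitali's covering lemma extracts disjoint balls whose fivefold enlargements cover
  \<open>E\<close>. A ball of radius r has measure at most 4 r^2, hence 100 = 4 * 5^2.\<close>

lemma maximal_weak_type:
  fixes g :: "real \<times> real \<Rightarrow> ennreal" and lam :: ennreal
  assumes g [measurable]: "g \<in> borel_measurable borel"
    and rho: "\<And>x. x \<in> E \<Longrightarrow> 0 < \<rho> x \<and> \<rho> x \<le> B"
    and E: "\<And>x. x \<in> E \<Longrightarrow> lam * ennreal ((\<rho> x)\<^sup>2) \<le> (\<integral>\<^sup>+y. g y * indicator (cball x (\<rho> x)) y \<partial>lborel)"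
  shows "lam * emeasure lborel E \<le> 100 * (\<integral>\<^sup>+y. g y \<partial>lborel)"
proof -
  obtain C where C: "countable C" "C \<subseteq> E"
     "pairwise (\<lambda>i j. disjnt (cball i (\<rho> i)) (cball j (\<rho> j))) C"
     "\<And>i. i \<in> E \<Longrightarrow> \<exists>j. j \<in> C \<and> \<not> disjnt (cball i (\<rho> i)) (cball j (\<rho> j)) \<and> cball i (\<rho> i) \<subseteq> ball j (5 * \<rho> j)"
    by (rule Vitali_covering_lemma_cballs_balls[of E \<rho> B "\<lambda>x. x"]) (use rho in simp, blast)
  define I where "I = to_nat_on C ` C"
  define c where "c = from_nat_into C"
  have cC: "c n \<in> C" if "n \<in> I" for n
    using that C(1) by (auto simp: I_def c_def)
  have cinj: "c n \<noteq> c k" if "n \<in> I" "k \<in> I" "n \<noteq> k" for n k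
    using that C(1) by (auto simp: I_def c_def)
  have cex: "\<exists>n\<in>I. c n = j" if "j \<in> C" for j
    using that C(1) by (auto simp: I_def c_def)
  define A where "A n = (if n \<in> I then cball (c n) (\<rho> (c n)) else {})" for n
  define A5 where "A5 n = (if n \<in> I then cball (c n) (5 * \<rho> (c n)) else {})" for n
  have disj: "disjoint_family A"
    using C(3) cC cinj unfolding disjoint_family_on_def A_def pairwise_def disjnt_def by auto
  have "E \<subseteq> (\<Union>n. A5 n)"
  proof
    fix x assume x: "x \<in> E"
    then obtain j where j: "j \<in> C" "cball x (\<rho> x) \<subseteq> ball j (5 * \<rho> j)" using C(4) by blast
    then obtain n where n: "n \<in> I" "c n = j" using cex by blast
    have "x \<in> cball x (\<rho> x)" using rho[OF x] by simp
    with j(2) have "x \<in> ball j (5 * \<rho> j)" by blast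
    with n have "x \<in> A5 n" by (auto simp: A5_def)
    then show "x \<in> (\<Union>n. A5 n)" by blast
  qed
  then have "emeasure lborel E \<le> emeasure lborel (\<Union>n. A5 n)"
    by (intro emeasure_mono) (auto simp: A5_def)
  also have "\<dots> \<le> (\<Sum>n. emeasure lborel (A5 n))"
    by (intro emeasure_subadditive_countably) (auto simp: A5_def)
  finally have "lam * emeasure lborel E \<le> lam * (\<Sum>n. emeasure lborel (A5 n))"
    by (intro mult_left_mono) auto
  also have "\<dots> = (\<Sum>n. lam * emeasure lborel (A5 n))" by simp
  also have "\<dots> \<le> (\<Sum>n. 100 * (\<integral>\<^sup>+y. g y * indicator (A n) y \<partial>lborel))"
  proof (intro suminf_le summableI)
    fix n show "lam * emeasure lborel (A5 n) \<le> 100 * (\<integral>\<^sup>+y. g y * indicator (A n) y \<partial>lborel)"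
    proof (cases "n \<in> I")
      case True
      let ?r = "\<rho> (c n)"
      have cE: "c n \<in> E" using cC[OF True] C(2) by auto
      have r: "?r > 0" using rho[OF cE] by simp
      have "lam * emeasure lborel (A5 n) \<le> lam * ennreal (4 * (5 * ?r)\<^sup>2)"
        using True emeasure_cball_le[of "5 * ?r" "c n"] r unfolding A5_def by (intro mult_left_mono) simp_all
      also have "4 * (5 * ?r)\<^sup>2 = 100 * ?r\<^sup>2" by (simp add: power2_eq_square)
      also have "lam * ennreal (100 * ?r\<^sup>2) = 100 * (lam * ennreal (?r\<^sup>2))"
        by (simp add: ennreal_mult mult_ac)
      also have "\<dots> \<le> 100 * (\<integral>\<^sup>+y. g y * indicator (cball (c n) ?r) y \<partial>lborel)"
        by (intro mult_left_mono E cE) auto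
      finally show ?thesis using True by (simp add: A_def)
    qed (simp add: A5_def)
  qed
  also have "\<dots> = 100 * (\<Sum>n. emeasure (density lborel g) (A n))"
    by (subst ennreal_suminf_cmult[symmetric])
       (auto intro!: suminf_cong arg_cong[where f="\<lambda>x. 100 * x"] emeasure_density[symmetric] simp: A_def)
  also have "(\<Sum>n. emeasure (density lborel g) (A n)) = emeasure (density lborel g) (\<Union>n. A n)"
    by (intro suminf_emeasure disj) (auto simp: A_def)
  also have "\<dots> \<le> emeasure (density lborel g) (space (density lborel g))"
    by (intro emeasure_mono) (auto simp: A_def)
  also have "\<dots> = (\<integral>\<^sup>+y. g y \<partial>lborel)"
    by (simp add: emeasure_density)
  finally show ?thesis by (simp add: mult_left_mono)
qed

lemma ennreal_divide_mult_cancel: "b > 0 \<Longrightarrow> (a / ennreal b) * ennreal b = a"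
  by (simp add: ennreal_divide_times ennreal_divide_self)

lemma nn_integral_powr_from_0:
  assumes "a > -1" "c \<ge> 0"
  shows "(\<integral>\<^sup>+x. ennreal (x powr a) * indicator {0..c} x \<partial>lborel) = ennreal (c powr (a + 1) / (a + 1))"
proof -
  have "((\<lambda>x. x powr a * indicator {0..c} x) has_integral (c powr (a + 1) / (a + 1))) UNIV"
    using has_integral_powr_from_0[OF assms] by (subst (asm) has_integral_restrict_UNIV[symmetric])
      (auto simp: indicator_def if_distrib cong: if_cong elim!: has_integral_eq[rotated])
  then have "integral\<^sup>N lborel (\<lambda>x. ennreal (x powr a * indicator {0..c} x)) = ennreal (c powr (a + 1) / (a + 1))"
    by (intro nn_integral_has_integral_lborel) auto
  then show ?thesis by (simp add: ennreal_mult' ennreal_indicator)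
qed

text \<open>Radii are restricted to a sequence, so the maximal function is a countable supremum and
  Borel measurable. Means are normalised by the square of the radius instead of the area. The result
  speaks of a real-valued \<open>H\<close> that dominates almost everywhere, because the maximal
  function itself may be infinite on a null set.\<close>

lemma maximal_inequality:
  fixes f :: "real \<times> real \<Rightarrow> real"
  assumes f [measurable]: "f \<in> borel_measurable borel" and f0: "\<And>x. f x \<ge> 0"
    and s: "s > 1" and fin: "(\<integral>\<^sup>+x. ennreal (f x powr s) \<partial>lborel) < \<infinity>"
    and rho: "\<And>n::nat. 0 < \<rho> n \<and> \<rho> n \<le> B"
  obtains H :: "real \<times> real \<Rightarrow> real" where "H \<in> borel_measurable borel" "\<And>x. H x \<ge> 0"
    "(\<integral>\<^sup>+x. ennreal (H x powr s) \<partial>lborel) < \<infinity>"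
    "AE x in lborel. \<forall>n. (\<integral>\<^sup>+y. ennreal (f y) * indicator (cball x (\<rho> n)) y \<partial>lborel) \<le> ennreal (H x * (\<rho> n)\<^sup>2)"
proof -
  have [measurable]: "cball x r \<in> sets borel" for x :: "real \<times> real" and r by simp
  define A where "A n x = (\<integral>\<^sup>+y. ennreal (f y) * indicator (cball x (\<rho> n)) y \<partial>lborel) / ennreal ((\<rho> n)\<^sup>2)" for n x
  define M where "M x = (SUP n. A n x)" for x
  have meas [measurable]: "(\<lambda>x. \<integral>\<^sup>+y. ennreal (f y) * indicator (cball x r) y \<partial>lborel) \<in> borel_measurable borel" for r
  proof -
    have "(\<lambda>(x, y). ennreal (f y) * (if dist x y \<le> r then 1 else 0)) \<in> borel_measurable (borel \<Otimes>\<^sub>M lborel)"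
      by measurable
    from lborel.borel_measurable_nn_integral[OF this] show ?thesis by (simp add: indicator_def)
  qed
  have [measurable]: "A n \<in> borel_measurable borel" for n
    unfolding A_def by measurable
  have M [measurable]: "M \<in> borel_measurable borel"
    unfolding M_def by measurable
  \<comment> \<open>On a disc of radius r the part of \<open>f\<close> below lam/8 contributes at
    most (lam/8) * 4 r^2, half of lam r^2; so the weak type estimate applies at level lam/2 to the
    part where 8 f exceeds lam.\<close>
  have weak: "ennreal lam * emeasure lborel {x. ennreal lam < M x} \<le> 200 * (\<integral>\<^sup>+y. ennreal (f y) * indicator {y. lam < 8 * f y} y \<partial>lborel)"
    if "lam > 0" for lam :: real
  proof -
    have "\<exists>n. ennreal lam < A n x" if "ennreal lam < M x" for x
      using that by (auto simp: M_def less_SUP_iff)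
    then obtain N where N: "ennreal lam < A (N x) x" if "ennreal lam < M x" for x by metis
    have "ennreal (lam / 2) * emeasure lborel {x. ennreal lam < M x} \<le> 100 * (\<integral>\<^sup>+y. ennreal (f y) * indicator {y. lam < 8 * f y} y \<partial>lborel)"
    proof (rule maximal_weak_type[where \<rho>="\<lambda>x. \<rho> (N x)" and B=B])
      fix x assume x: "x \<in> {x. ennreal lam < M x}"
      show "0 < \<rho> (N x) \<and> \<rho> (N x) \<le> B" by (rule rho)
      let ?r = "\<rho> (N x)"
      have r: "?r > 0" using rho by blast
      let ?I = "\<integral>\<^sup>+y. ennreal (f y) * indicator {y. lam < 8 * f y} y * indicator (cball x ?r) y \<partial>lborel"
      have "ennreal (lam / 2) * ennreal (?r\<^sup>2) + ennreal (lam / 2) * ennreal (?r\<^sup>2) = ennreal lam * ennreal (?r\<^sup>2)"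
        using that by (simp flip: ennreal_mult ennreal_plus)
      also have "\<dots> \<le> A (N x) x * ennreal (?r\<^sup>2)"
        using N[of x] x by (intro mult_right_mono) auto
      also have "\<dots> = (\<integral>\<^sup>+y. ennreal (f y) * indicator (cball x ?r) y \<partial>lborel)"
        unfolding A_def using r by (intro ennreal_divide_mult_cancel) auto
      also have "\<dots> \<le> (\<integral>\<^sup>+y. ennreal (f y) * indicator {y. lam < 8 * f y} y * indicator (cball x ?r) y + ennreal (lam / 8) * indicator (cball x ?r) y \<partial>lborel)"
        by (intro nn_integral_mono) (auto simp: indicator_def intro!: ennreal_leI)
      also have "\<dots> = ?I + (\<integral>\<^sup>+y. ennreal (lam / 8) * indicator (cball x ?r) y \<partial>lborel)"
        by (rule nn_integral_add) measurable
      also have "(\<integral>\<^sup>+y. ennreal (lam / 8) * indicator (cball x ?r) y \<partial>lborel) = ennreal (lam / 8) * emeasure lborel (cball x ?r)"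
        by (rule nn_integral_cmult_indicator) simp
      also have "?I + ennreal (lam / 8) * emeasure lborel (cball x ?r) \<le> ?I + ennreal (lam / 8) * ennreal (4 * ?r\<^sup>2)"
        using r by (intro add_left_mono mult_left_mono emeasure_cball_le) auto
      also have "ennreal (lam / 8) * ennreal (4 * ?r\<^sup>2) = ennreal (lam / 2) * ennreal (?r\<^sup>2)"
        using that by (simp flip: ennreal_mult)
      finally show "ennreal (lam / 2) * ennreal (?r\<^sup>2) \<le> ?I"
        by (subst (asm) (2) add.commute, subst (asm) ennreal_add_left_cancel_le)
          (simp flip: ennreal_mult'')
    qed measurable
    then have "2 * (ennreal (lam / 2) * emeasure lborel {x. ennreal lam < M x}) \<le> 2 * (100 * (\<integral>\<^sup>+y. ennreal (f y) * indicator {y. lam < 8 * f y} y \<partial>lborel))"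
      by (intro mult_left_mono) auto
    moreover have "2 * ennreal (lam / 2) = ennreal lam"
      using that by (simp add: ennreal_mult'[symmetric] flip: ennreal_numeral)
    ultimately show ?thesis by (simp flip: mult.assoc)
  qed
  \<comment> \<open>Layer-cake form of the s-th power of the maximal function, up to the factor s;
    Fubini turns its integral into an integral of distribution functions.\<close>
  define I where "I x = (\<integral>\<^sup>+lam. ennreal (lam powr (s - 1)) * indicator {lam. 0 < lam \<and> ennreal lam < M x} lam \<partial>lborel)" for x
  have mI [measurable]: "(\<lambda>(x, lam). ennreal (lam powr (s - 1)) * indicator {lam. 0 < lam \<and> ennreal lam < M x} lam) \<in> borel_measurable (lborel \<Otimes>\<^sub>M lborel)"
    unfolding indicator_def by measurable
  have "(\<integral>\<^sup>+x. I x \<partial>lborel) = (\<integral>\<^sup>+lam. \<integral>\<^sup>+x. ennreal (lam powr (s - 1)) * indicator {lam. 0 < lam \<and> ennreal lam < M x} lam \<partial>lborel \<partial>lborel)"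
    unfolding I_def using mI by (rule lborel_pair.Fubini'[symmetric])
  also have "\<dots> = (\<integral>\<^sup>+lam. ennreal (lam powr (s - 1)) * indicator {0<..} lam * emeasure lborel {x. ennreal lam < M x} \<partial>lborel)"
  proof (rule nn_integral_cong)
    fix lam :: real
    have "(\<integral>\<^sup>+x. ennreal (lam powr (s - 1)) * indicator {lam. 0 < lam \<and> ennreal lam < M x} lam \<partial>lborel)
      = (\<integral>\<^sup>+x. ennreal (lam powr (s - 1)) * indicator {0<..} lam * indicator {x. ennreal lam < M x} x \<partial>lborel)"
      by (intro nn_integral_cong) (auto simp: indicator_def)
    also have "\<dots> = ennreal (lam powr (s - 1)) * indicator {0<..} lam * emeasure lborel {x. ennreal lam < M x}"
      by (subst nn_integral_cmult_indicator) auto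
    finally show "(\<integral>\<^sup>+x. ennreal (lam powr (s - 1)) * indicator {lam. 0 < lam \<and> ennreal lam < M x} lam \<partial>lborel)
      = ennreal (lam powr (s - 1)) * indicator {0<..} lam * emeasure lborel {x. ennreal lam < M x}" .
  qed
  also have "\<dots> \<le> (\<integral>\<^sup>+lam. 200 * (\<integral>\<^sup>+y. ennreal (lam powr (s - 2)) * indicator {0<..} lam * (ennreal (f y) * indicator {y. lam < 8 * f y} y) \<partial>lborel) \<partial>lborel)"
  proof (rule nn_integral_mono)
    fix lam :: real
    show "ennreal (lam powr (s - 1)) * indicator {0<..} lam * emeasure lborel {x. ennreal lam < M x}
      \<le> 200 * (\<integral>\<^sup>+y. ennreal (lam powr (s - 2)) * indicator {0<..} lam * (ennreal (f y) * indicator {y. lam < 8 * f y} y) \<partial>lborel)"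
    proof (cases "lam > 0")
      case True
      have "lam powr (s - 1) = lam powr (s - 2) * lam"
        using True powr_add[of lam "s - 2" 1] by simp
      then have "ennreal (lam powr (s - 1)) * emeasure lborel {x. ennreal lam < M x} = ennreal (lam powr (s - 2)) * (ennreal lam * emeasure lborel {x. ennreal lam < M x})"
        using True by (simp add: ennreal_mult mult.assoc)
      also have "\<dots> \<le> ennreal (lam powr (s - 2)) * (200 * (\<integral>\<^sup>+y. ennreal (f y) * indicator {y. lam < 8 * f y} y \<partial>lborel))"
        by (intro mult_left_mono weak True) auto
      also have "\<dots> = 200 * (\<integral>\<^sup>+y. ennreal (lam powr (s - 2)) * (ennreal (f y) * indicator {y. lam < 8 * f y} y) \<partial>lborel)"
        by (subst nn_integral_cmult) (auto simp: mult_ac)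
      finally show ?thesis using True by simp
    qed simp
  qed
  also have "\<dots> = 200 * (\<integral>\<^sup>+lam. \<integral>\<^sup>+y. ennreal (lam powr (s - 2)) * indicator {0<..} lam * (ennreal (f y) * indicator {y. lam < 8 * f y} y) \<partial>lborel \<partial>lborel)"
    unfolding indicator_def by (rule nn_integral_cmult) measurable
  also have "(\<integral>\<^sup>+lam. \<integral>\<^sup>+y. ennreal (lam powr (s - 2)) * indicator {0<..} lam * (ennreal (f y) * indicator {y. lam < 8 * f y} y) \<partial>lborel \<partial>lborel)
    = (\<integral>\<^sup>+y. \<integral>\<^sup>+lam. ennreal (lam powr (s - 2)) * indicator {0<..} lam * (ennreal (f y) * indicator {y. lam < 8 * f y} y) \<partial>lborel \<partial>lborel)"
    unfolding indicator_def by (rule lborel_pair.Fubini') measurable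
  also have "\<dots> \<le> (\<integral>\<^sup>+y. ennreal (8 powr (s - 1) / (s - 1)) * ennreal (f y powr s) \<partial>lborel)"
  proof (rule nn_integral_mono)
    fix y
    have "(\<integral>\<^sup>+lam. ennreal (lam powr (s - 2)) * indicator {0<..} lam * (ennreal (f y) * indicator {y. lam < 8 * f y} y) \<partial>lborel)
      \<le> (\<integral>\<^sup>+lam. ennreal (f y) * (ennreal (lam powr (s - 2)) * indicator {0..8 * f y} lam) \<partial>lborel)"
      by (intro nn_integral_mono) (auto simp: indicator_def mult_ac)
    also have "\<dots> = ennreal (f y) * ennreal ((8 * f y) powr (s - 2 + 1) / (s - 2 + 1))"
      using s f0[of y] by (subst nn_integral_cmult) (auto simp: nn_integral_powr_from_0)
    also have "\<dots> = ennreal (8 powr (s - 1) / (s - 1)) * ennreal (f y powr s)"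
    proof -
      have "f y * f y powr (s - 1) = f y powr s"
        using f0[of y] powr_add[of "f y" 1 "s - 1"] by (cases "f y = 0") auto
      then have "f y * ((8 * f y) powr (s - 2 + 1) / (s - 2 + 1)) = 8 powr (s - 1) / (s - 1) * f y powr s"
        using f0[of y] by (simp add: powr_mult)
      then show ?thesis using s f0[of y] by (simp flip: ennreal_mult)
    qed
    finally show "(\<integral>\<^sup>+lam. ennreal (lam powr (s - 2)) * indicator {0<..} lam * (ennreal (f y) * indicator {y. lam < 8 * f y} y) \<partial>lborel)
      \<le> ennreal (8 powr (s - 1) / (s - 1)) * ennreal (f y powr s)" .
  qed
  also have "\<dots> = ennreal (8 powr (s - 1) / (s - 1)) * (\<integral>\<^sup>+y. ennreal (f y powr s) \<partial>lborel)"
    by (rule nn_integral_cmult) measurable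
  finally have le: "(\<integral>\<^sup>+x. I x \<partial>lborel) \<le> 200 * (ennreal (8 powr (s - 1) / (s - 1)) * (\<integral>\<^sup>+y. ennreal (f y powr s) \<partial>lborel))"
    by (simp add: mult_left_mono)
  have "200 * (ennreal (8 powr (s - 1) / (s - 1)) * (\<integral>\<^sup>+y. ennreal (f y powr s) \<partial>lborel)) < \<infinity>"
    using fin by (simp add: ennreal_mult_less_top)
  with le have Ifin: "(\<integral>\<^sup>+x. I x \<partial>lborel) < \<infinity>" by order
  have Im [measurable]: "I \<in> borel_measurable borel"
    unfolding I_def using lborel.borel_measurable_nn_integral[OF mI] by simp
  have It: "ennreal (t powr s / s) \<le> I x" if "t \<ge> 0" "ennreal t < M x" for t x
  proof -
    have "ennreal (t powr (s - 1 + 1) / (s - 1 + 1)) = (\<integral>\<^sup>+lam. ennreal (lam powr (s - 1)) * indicator {0..t} lam \<partial>lborel)"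
      using s that by (intro nn_integral_powr_from_0[symmetric]) auto
    also have "\<dots> \<le> I x"
      unfolding I_def
    proof (intro nn_integral_mono)
      fix l :: real
      show "ennreal (l powr (s - 1)) * indicator {0..t} l \<le> ennreal (l powr (s - 1)) * indicator {l. 0 < l \<and> ennreal l < M x} l"
      proof (cases "0 < l \<and> l \<le> t")
        case True
        then have "ennreal l < M x" using that ennreal_leI[of l t] by (meson le_less_trans)
        with True show ?thesis by simp
      next
        case False
        then have "l = 0 \<or> l \<notin> {0..t}" by auto
        then show ?thesis by auto
      qed
    qed
    finally show ?thesis by simp
  qed
  \<comment> \<open>The value 0 at infinite points is harmless: there \<open>I\<close> is infinite
    as well, which happens only on a null set.\<close>
  define H where "H x = (if M x = \<infinity> then 0 else enn2real (M x))" for x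
  show ?thesis
  proof
    show "H \<in> borel_measurable borel" unfolding H_def by measurable
    show "H x \<ge> 0" for x by (simp add: H_def)
    have "ennreal (H x powr s) \<le> ennreal (2 powr s * s) * I x" for x
    proof (cases "H x > 0")
      case True
      then have Mx: "M x = ennreal (H x)" by (auto simp: H_def less_top split: if_splits)
      \<comment> \<open>\<open>It\<close> needs a level strictly below the maximal function; half of
        it is taken, which is the origin of 2 powr s.\<close>
      have "ennreal ((H x / 2) powr s / s) \<le> I x"
        using True by (intro It) (auto simp: Mx intro!: ennreal_lessI)
      then have "ennreal (2 powr s * s) * ennreal ((H x / 2) powr s / s) \<le> ennreal (2 powr s * s) * I x"
        by (intro mult_left_mono) auto
      moreover have "ennreal (2 powr s * s) * ennreal ((H x / 2) powr s / s) = ennreal (H x powr s)"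
        using s True by (simp flip: ennreal_mult add: powr_divide)
      ultimately show ?thesis by simp
    next
      case False
      moreover have "H x \<ge> 0" by (simp add: H_def)
      ultimately have "H x = 0" by simp
      then show ?thesis by simp
    qed
    then have "(\<integral>\<^sup>+x. ennreal (H x powr s) \<partial>lborel) \<le> (\<integral>\<^sup>+x. ennreal (2 powr s * s) * I x \<partial>lborel)"
      by (intro nn_integral_mono) auto
    also have "\<dots> = ennreal (2 powr s * s) * (\<integral>\<^sup>+x. I x \<partial>lborel)"
      by (rule nn_integral_cmult) simp
    also have "\<dots> < \<infinity>" using Ifin by (simp add: ennreal_mult_less_top)
    finally show "(\<integral>\<^sup>+x. ennreal (H x powr s) \<partial>lborel) < \<infinity>" .
    have "AE x in lborel. I x \<noteq> \<infinity>"
      using Ifin by (intro nn_integral_PInf_AE) auto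
    then show "AE x in lborel. \<forall>n. (\<integral>\<^sup>+y. ennreal (f y) * indicator (cball x (\<rho> n)) y \<partial>lborel) \<le> ennreal (H x * (\<rho> n)\<^sup>2)"
    proof eventually_elim
      case (elim x)
      have Mx: "M x \<noteq> \<infinity>"
      proof
        assume inf: "M x = \<infinity>"
        obtain c where c: "I x = ennreal c" "c \<ge> 0" using elim by (cases "I x") auto
        define t where "t = ((c + 1) * s) powr (1 / s)"
        have "ennreal (t powr s / s) \<le> I x"
          by (rule It) (auto simp: inf t_def)
        moreover have "t powr s / s = c + 1"
          using s c by (simp add: t_def powr_powr)
        ultimately show False using c by simp
      qed
      show ?case
      proof
        fix n
        have r: "\<rho> n > 0" using rho by blast
        have "A n x \<le> M x" unfolding M_def by (rule SUP_upper) simp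
        also have "\<dots> = ennreal (H x)" using Mx by (simp add: H_def less_top)
        finally have "A n x * ennreal ((\<rho> n)\<^sup>2) \<le> ennreal (H x) * ennreal ((\<rho> n)\<^sup>2)"
          by (intro mult_right_mono) auto
        also have "A n x * ennreal ((\<rho> n)\<^sup>2) = (\<integral>\<^sup>+y. ennreal (f y) * indicator (cball x (\<rho> n)) y \<partial>lborel)"
          unfolding A_def using r by (intro ennreal_divide_mult_cancel) auto
        also have "ennreal (H x) * ennreal ((\<rho> n)\<^sup>2) = ennreal (H x * (\<rho> n)\<^sup>2)"
          by (rule ennreal_mult[symmetric]) (auto simp: H_def)
        finally show "(\<integral>\<^sup>+y. ennreal (f y) * indicator (cball x (\<rho> n)) y \<partial>lborel) \<le> ennreal (H x * (\<rho> n)\<^sup>2)" .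
      qed
    qed
  qed
qed

section \<open>Mollification\<close>

text \<open>The kernel is not centred: \<open>y\<close> ranges over a square of side 2 \<delta> to
  the lower left of \<open>x\<close>. The estimates work with the enclosing square
  \<open>sq x (2 * \<delta>)\<close>.\<close>

definition ker :: "real \<Rightarrow> real \<times> real \<Rightarrow> real \<times> real \<Rightarrow> real" where
  "ker \<delta> x y = eta ((1 / \<delta>) *\<^sub>R (x - y)) / \<delta>\<^sup>2"

definition moll :: "real \<Rightarrow> (real \<times> real \<Rightarrow> real) \<Rightarrow> real \<times> real \<Rightarrow> real" where
  "moll \<delta> f x = (\<integral>y. f y * ker \<delta> x y \<partial>lborel)"

text \<open>Borel counterpart of \<open>loc_int\<close>: Borel measurability is what Fubini on
  products of \<open>lborel\<close> asks for, and every compact set lies in a square.\<close>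

definition locint :: "(real \<times> real \<Rightarrow> real) \<Rightarrow> bool" where
  "locint f \<longleftrightarrow> f \<in> borel_measurable borel \<and> (\<forall>c r. integrable lborel (\<lambda>x. f x * indicator (sq c r) x))"

lemma ker_nonneg: "ker \<delta> x y \<ge> 0"
  by (simp add: ker_def eta_nonneg)

lemma eta_le_1: "eta x \<le> 1"
proof -
  have "theta t \<le> 1" for t using stp_bounds[of t] stp_bounds[of "t - 1"] by (simp add: theta_def)
  then show ?thesis unfolding eta_def using theta_nonneg by (intro mult_le_one) auto
qed

lemma ker_le: "ker \<delta> x y \<le> 1 / \<delta>\<^sup>2"
  unfolding ker_def by (intro divide_right_mono eta_le_1) auto

lemma ker_support:
  assumes "\<delta> > 0" "ker \<delta> x y \<noteq> 0"
  shows "0 < fst x - fst y" "fst x - fst y < 2 * \<delta>" "0 < snd x - snd y" "snd x - snd y < 2 * \<delta>"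
  using eta_support[of "(1 / \<delta>) *\<^sub>R (x - y)"] assms by (auto simp: ker_def field_simps)

lemma ker_support_sq: "\<delta> > 0 \<Longrightarrow> ker \<delta> x y \<noteq> 0 \<Longrightarrow> y \<in> sq x (2 * \<delta>)"
  using ker_support[of \<delta> x y] by (auto simp: mem_sq)

lemma ker_measurable [measurable]: "(\<lambda>(x, y). ker \<delta> x y) \<in> borel_measurable (borel \<Otimes>\<^sub>M borel)"
  unfolding ker_def by measurable

lemma ker_measurable1 [measurable]: "(\<lambda>y. ker \<delta> x y) \<in> borel_measurable borel"
  and ker_measurable2 [measurable]: "(\<lambda>x. ker \<delta> x y) \<in> borel_measurable borel"
  unfolding ker_def by measurable

lemma nn_integral_affine_plane:
  fixes f :: "real \<times> real \<Rightarrow> ennreal"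
  assumes [measurable]: "f \<in> borel_measurable borel" and c: "c \<noteq> 0"
  shows "(\<integral>\<^sup>+x. f x \<partial>lborel) = ennreal (c\<^sup>2) * (\<integral>\<^sup>+x. f (t + c *\<^sub>R x) \<partial>lborel)"
proof -
  have "(\<integral>\<^sup>+x. f x \<partial>lborel) = (\<integral>\<^sup>+x. f x \<partial>density (distr lborel borel (\<lambda>x. t + c *\<^sub>R x)) (\<lambda>_. \<bar>c\<bar>^DIM(real \<times> real)))"
    by (subst lborel_affine[OF c, of t]) simp
  also have "\<dots> = (\<integral>\<^sup>+x. ennreal (\<bar>c\<bar>^DIM(real \<times> real)) * f x \<partial>distr lborel borel (\<lambda>x. t + c *\<^sub>R x))"
    by (subst nn_integral_density) auto
  also have "\<dots> = (\<integral>\<^sup>+x. ennreal (\<bar>c\<bar>^DIM(real \<times> real)) * f (t + c *\<^sub>R x) \<partial>lborel)"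
    by (subst nn_integral_distr) auto
  also have "\<dots> = ennreal (\<bar>c\<bar>^DIM(real \<times> real)) * (\<integral>\<^sup>+x. f (t + c *\<^sub>R x) \<partial>lborel)"
    by (rule nn_integral_cmult) measurable
  finally show ?thesis by (simp add: power2_eq_square)
qed

lemma nn_integral_ker:
  assumes "\<delta> > 0"
  shows "(\<integral>\<^sup>+y. ennreal (ker \<delta> x y) \<partial>lborel) = 1" "(\<integral>\<^sup>+x. ennreal (ker \<delta> x y) \<partial>lborel) = 1"
proof -
  have e: "ennreal (\<delta>\<^sup>2) * (\<integral>\<^sup>+z. ennreal (eta z / \<delta>\<^sup>2) \<partial>lborel) = 1"
  proof -
    have "ennreal (\<delta>\<^sup>2) * (\<integral>\<^sup>+z. ennreal (eta z / \<delta>\<^sup>2) \<partial>lborel) = (\<integral>\<^sup>+z. ennreal (\<delta>\<^sup>2) * ennreal (eta z / \<delta>\<^sup>2) \<partial>lborel)"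
      by (rule nn_integral_cmult[symmetric]) measurable
    also have "\<dots> = (\<integral>\<^sup>+z. ennreal (eta z) \<partial>lborel)"
      using assms by (simp add: eta_nonneg flip: ennreal_mult)
    finally show ?thesis by (simp add: nn_integral_eta)
  qed
  have "(\<integral>\<^sup>+y. ennreal (ker \<delta> x y) \<partial>lborel) = ennreal ((- \<delta>)\<^sup>2) * (\<integral>\<^sup>+z. ennreal (ker \<delta> x (x + (- \<delta>) *\<^sub>R z)) \<partial>lborel)"
    using assms by (intro nn_integral_affine_plane) auto
  also have "\<dots> = 1" using e assms by (simp add: ker_def)
  finally show "(\<integral>\<^sup>+y. ennreal (ker \<delta> x y) \<partial>lborel) = 1" .
  have "(\<integral>\<^sup>+x. ennreal (ker \<delta> x y) \<partial>lborel) = ennreal (\<delta>\<^sup>2) * (\<integral>\<^sup>+z. ennreal (ker \<delta> (y + \<delta> *\<^sub>R z) y) \<partial>lborel)"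
    using assms by (intro nn_integral_affine_plane) auto
  also have "\<dots> = 1" using e assms by (simp add: ker_def)
  finally show "(\<integral>\<^sup>+x. ennreal (ker \<delta> x y) \<partial>lborel) = 1" .
qed

lemma integrable_ker: "\<delta> > 0 \<Longrightarrow> integrable lborel (ker \<delta> x)"
  by (rule integrableI_bounded) (use nn_integral_ker[of \<delta> x] ker_nonneg in \<open>auto simp: ker_measurable1[unfolded]\<close>)

lemma integral_ker: "\<delta> > 0 \<Longrightarrow> (\<integral>y. ker \<delta> x y \<partial>lborel) = 1"
  using nn_integral_ker(1)[of \<delta> x] ker_nonneg by (subst integral_eq_nn_integral) auto

lemma locint_mult_bounded:
  assumes f: "locint f" and [measurable]: "k \<in> borel_measurable borel"
    and k: "\<And>y. \<bar>k y\<bar> \<le> B" "\<And>y. k y \<noteq> 0 \<Longrightarrow> y \<in> sq c r"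
  shows "integrable lborel (\<lambda>y. f y * k y)"
proof -
  have [measurable]: "f \<in> borel_measurable borel" using f by (simp add: locint_def)
  have "integrable lborel (\<lambda>y. B * (f y * indicator (sq c r) y))"
    using f unfolding locint_def by (intro integrable_mult_right) blast
  then show ?thesis
  proof (rule Bochner_Integration.integrable_bound)
    show "AE y in lborel. norm (f y * k y) \<le> norm (B * (f y * indicator (sq c r) y))"
    proof (rule AE_I2)
      fix y
      have "\<bar>f y\<bar> * \<bar>k y\<bar> \<le> \<bar>f y\<bar> * \<bar>B\<bar>" using k(1)[of y] by (intro mult_left_mono) auto
      then show "norm (f y * k y) \<le> norm (B * (f y * indicator (sq c r) y))"
        using k(2)[of y] by (cases "k y = 0") (auto simp: abs_mult mult.commute)
    qed
  qed measurable
qed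

lemma integrable_mult_ker: "locint f \<Longrightarrow> \<delta> > 0 \<Longrightarrow> integrable lborel (\<lambda>y. f y * ker \<delta> x y)"
  by (rule locint_mult_bounded[where B="1 / \<delta>\<^sup>2" and c=x and r="2 * \<delta>"])
     (auto simp: ker_nonneg ker_le abs_of_nonneg intro: ker_support_sq)

lemma moll_measurable [measurable]:
  assumes "f \<in> borel_measurable borel" shows "moll \<delta> f \<in> borel_measurable borel"
proof -
  have "(\<lambda>z. f (snd z)) \<in> borel_measurable (borel \<Otimes>\<^sub>M lborel)"
    using measurable_compose[OF measurable_snd, of f lborel borel borel] assms by simp
  moreover have "(\<lambda>z. ker \<delta> (fst z) (snd z)) \<in> borel_measurable (borel \<Otimes>\<^sub>M lborel)"
    unfolding ker_def by measurable
  ultimately have "(\<lambda>(x, y). f y * ker \<delta> x y) \<in> borel_measurable (borel \<Otimes>\<^sub>M lborel)"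
    unfolding split_beta by (rule borel_measurable_times)
  then show ?thesis unfolding moll_def by (rule lborel.borel_measurable_lebesgue_integral)
qed

lemma moll_diff: "locint f \<Longrightarrow> locint g \<Longrightarrow> \<delta> > 0 \<Longrightarrow> moll \<delta> (\<lambda>x. f x - g x) x = moll \<delta> f x - moll \<delta> g x"
  unfolding moll_def by (simp add: left_diff_distrib integrable_mult_ker)

lemma locint_diff: "locint f \<Longrightarrow> locint g \<Longrightarrow> locint (\<lambda>x. f x - g x)"
  by (auto simp: locint_def left_diff_distrib)

lemma locint_continuous:
  assumes "continuous_on UNIV f" shows "locint f"
  unfolding locint_def
proof (intro conjI allI)
  show "f \<in> borel_measurable borel" using assms by (rule borel_measurable_continuous_onI)
  fix c r
  have "integrable lborel (\<lambda>x. indicator (sq c r) x *\<^sub>R f x)"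
    unfolding sq_def by (rule borel_integrable_compact) (auto intro: continuous_on_subset[OF assms])
  then show "integrable lborel (\<lambda>x. f x * indicator (sq c r) x)" by (simp add: mult.commute)
qed

lemma moll_const: "\<delta> > 0 \<Longrightarrow> moll \<delta> (\<lambda>y. a) x = a"
  by (simp add: moll_def integral_ker)

text \<open>Jensen's inequality for the probability density \<open>ker \<delta> x\<close>, from
  \<open>young_tangent\<close> with \<open>A\<close> the absolute value of the mean itself. If the
  integrand is not integrable, the mean is 0 by the convention of the Bochner integral and the bound
  is trivial.\<close>

lemma moll_jensen:
  assumes [measurable]: "f \<in> borel_measurable borel" and s: "s \<ge> 1" and d: "\<delta> > 0"
  shows "ennreal (\<bar>moll \<delta> f x\<bar> powr s) \<le> (\<integral>\<^sup>+y. ennreal (\<bar>f y\<bar> powr s) * ennreal (ker \<delta> x y) \<partial>lborel)"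
proof (cases "moll \<delta> f x = 0")
  case False
  define a where "a = \<bar>moll \<delta> f x\<bar>"
  have a: "a > 0" using False by (simp add: a_def)
  have "integrable lborel (\<lambda>y. f y * ker \<delta> x y)"
    using False not_integrable_integral_eq by (auto simp: moll_def)
  then have "ennreal (norm (moll \<delta> f x)) \<le> (\<integral>\<^sup>+y. norm (f y * ker \<delta> x y) \<partial>lborel)"
    unfolding moll_def by (rule integral_norm_bound_ennreal)
  then have le: "ennreal a \<le> (\<integral>\<^sup>+y. ennreal \<bar>f y\<bar> * ennreal (ker \<delta> x y) \<partial>lborel)"
    by (simp add: a_def abs_mult ennreal_mult ker_nonneg)
  show ?thesis
  proof (cases "s = 1")
    case True
    then show ?thesis using le a by (simp add: a_def)
  next
    case False
    with s have s: "s > 1" by simp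
    let ?I = "\<integral>\<^sup>+y. ennreal (\<bar>f y\<bar> powr s) * ennreal (ker \<delta> x y) \<partial>lborel"
    show ?thesis
    proof (cases "?I = \<infinity>")
      case True then show ?thesis by simp
    next
      case False
      then obtain i where i: "?I = ennreal i" "i \<ge> 0" by (cases ?I) auto
      have "ennreal a \<le> (\<integral>\<^sup>+y. ennreal (\<bar>f y\<bar> powr s * a powr (1 - s) / s + (1 - 1 / s) * a) * ennreal (ker \<delta> x y) \<partial>lborel)"
        by (rule order_trans[OF le]) (intro nn_integral_mono mult_right_mono ennreal_leI young_tangent s a; simp)
      also have "\<dots> = (\<integral>\<^sup>+y. ennreal (a powr (1 - s) / s) * (ennreal (\<bar>f y\<bar> powr s) * ennreal (ker \<delta> x y)) + ennreal ((1 - 1 / s) * a) * ennreal (ker \<delta> x y) \<partial>lborel)"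
      proof (rule nn_integral_cong)
        fix y
        have "ennreal (\<bar>f y\<bar> powr s * a powr (1 - s) / s + (1 - 1 / s) * a) = ennreal (a powr (1 - s) / s) * ennreal (\<bar>f y\<bar> powr s) + ennreal ((1 - 1 / s) * a)"
          using s a by (subst ennreal_plus) (auto simp flip: ennreal_mult simp: mult_ac)
        then show "ennreal (\<bar>f y\<bar> powr s * a powr (1 - s) / s + (1 - 1 / s) * a) * ennreal (ker \<delta> x y) = ennreal (a powr (1 - s) / s) * (ennreal (\<bar>f y\<bar> powr s) * ennreal (ker \<delta> x y)) + ennreal ((1 - 1 / s) * a) * ennreal (ker \<delta> x y)"
          by (simp add: distrib_right mult.assoc)
      qed
      also have "\<dots> = (\<integral>\<^sup>+y. ennreal (a powr (1 - s) / s) * (ennreal (\<bar>f y\<bar> powr s) * ennreal (ker \<delta> x y)) \<partial>lborel) + (\<integral>\<^sup>+y. ennreal ((1 - 1 / s) * a) * ennreal (ker \<delta> x y) \<partial>lborel)"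
        by (rule nn_integral_add) measurable
      also have "\<dots> = ennreal (a powr (1 - s) / s) * ?I + ennreal ((1 - 1 / s) * a) * (\<integral>\<^sup>+y. ennreal (ker \<delta> x y) \<partial>lborel)"
        by (intro arg_cong2[where f="(+)"] nn_integral_cmult) measurable
      also have "\<dots> = ennreal (a powr (1 - s) / s * i + (1 - 1 / s) * a)"
        unfolding i nn_integral_ker[OF d] using i s a by (subst ennreal_plus) (auto simp flip: ennreal_mult)
      finally have "a \<le> a powr (1 - s) / s * i + (1 - 1 / s) * a"
        using i s a by (subst (asm) ennreal_le_iff) auto
      then have "a * s \<le> (a powr (1 - s) / s * i + (1 - 1 / s) * a) * s" using s by (intro mult_right_mono) auto
      also have "\<dots> = a powr (1 - s) * i + a * s - a" using s by (simp add: field_simps)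
      finally have "a \<le> a powr (1 - s) * i" by simp
      then have "a * a powr (s - 1) \<le> a powr (1 - s) * i * a powr (s - 1)" by (intro mult_right_mono) auto
      also have "\<dots> = i * (a powr (1 - s) * a powr (s - 1))" by (simp add: mult_ac)
      also have "a powr (1 - s) * a powr (s - 1) = 1" using a by (simp flip: powr_add)
      also have "a * a powr (s - 1) = a powr s" using a powr_add[of a 1 "s - 1"] by simp
      finally show ?thesis unfolding i using a i by (auto simp: a_def intro!: ennreal_leI)
    qed
  qed
qed simp

text \<open>Contraction in L^s by Jensen and Fubini. The pair of sets localises it: on
  \<open>A\<close> the mollification only sees \<open>f\<close> on \<open>A'\<close>. Integrals over
  squares and over layers around \<open>K\<close> are compared in this way.\<close>

lemma moll_powr_integral_le:
  assumes [measurable]: "f \<in> borel_measurable borel" and s: "s \<ge> 1" and d: "\<delta> > 0"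
    and [measurable]: "A \<in> sets borel" "A' \<in> sets borel" and AA: "\<And>x y. x \<in> A \<Longrightarrow> ker \<delta> x y \<noteq> 0 \<Longrightarrow> y \<in> A'"
  shows "(\<integral>\<^sup>+x. ennreal (\<bar>moll \<delta> f x\<bar> powr s) * indicator A x \<partial>lborel) \<le> (\<integral>\<^sup>+y. ennreal (\<bar>f y\<bar> powr s) * indicator A' y \<partial>lborel)"
proof -
  have "(\<integral>\<^sup>+x. ennreal (\<bar>moll \<delta> f x\<bar> powr s) * indicator A x \<partial>lborel)
    \<le> (\<integral>\<^sup>+x. (\<integral>\<^sup>+y. ennreal (\<bar>f y\<bar> powr s) * ennreal (ker \<delta> x y) \<partial>lborel) * indicator A x \<partial>lborel)"
    by (intro nn_integral_mono mult_right_mono moll_jensen s d) auto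
  also have "\<dots> = (\<integral>\<^sup>+x. \<integral>\<^sup>+y. ennreal (\<bar>f y\<bar> powr s) * ennreal (ker \<delta> x y) * indicator A x \<partial>lborel \<partial>lborel)"
    by (intro nn_integral_cong nn_integral_multc[symmetric]) measurable
  also have "\<dots> = (\<integral>\<^sup>+y. \<integral>\<^sup>+x. ennreal (\<bar>f y\<bar> powr s) * ennreal (ker \<delta> x y) * indicator A x \<partial>lborel \<partial>lborel)"
    by (rule lborel_pair.Fubini'[symmetric]) measurable
  also have "\<dots> \<le> (\<integral>\<^sup>+y. \<integral>\<^sup>+x. (ennreal (\<bar>f y\<bar> powr s) * indicator A' y) * ennreal (ker \<delta> x y) \<partial>lborel \<partial>lborel)"
  proof (intro nn_integral_mono)
    fix x y
    show "ennreal (\<bar>f y\<bar> powr s) * ennreal (ker \<delta> x y) * indicator A x \<le> (ennreal (\<bar>f y\<bar> powr s) * indicator A' y) * ennreal (ker \<delta> x y)"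
      using AA[of x y] by (cases "ker \<delta> x y = 0") (auto simp: indicator_def)
  qed
  also have "\<dots> = (\<integral>\<^sup>+y. (ennreal (\<bar>f y\<bar> powr s) * indicator A' y) * (\<integral>\<^sup>+x. ennreal (ker \<delta> x y) \<partial>lborel) \<partial>lborel)"
    by (intro nn_integral_cong nn_integral_cmult) measurable
  finally show ?thesis by (simp add: nn_integral_ker[OF d])
qed

lemma moll_close:
  assumes "continuous_on UNIV g" and d: "\<delta> > 0" and e: "\<And>y. y \<in> sq x (2 * \<delta>) \<Longrightarrow> \<bar>g y - g x\<bar> \<le> e"
  shows "\<bar>moll \<delta> g x - g x\<bar> \<le> e"
proof -
  have i: "integrable lborel (\<lambda>y. (g y - g x) * ker \<delta> x y)"
    by (rule integrable_mult_ker[OF locint_continuous d]) (intro continuous_intros assms)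
  have "moll \<delta> g x - g x = moll \<delta> g x - moll \<delta> (\<lambda>y. g x) x" using d by (simp add: moll_const)
  also have "\<dots> = moll \<delta> (\<lambda>y. g y - g x) x"
    by (rule moll_diff[symmetric]) (auto intro!: locint_continuous assms d)
  finally have "\<bar>moll \<delta> g x - g x\<bar> = norm (\<integral>y. (g y - g x) * ker \<delta> x y \<partial>lborel)" by (simp add: moll_def)
  also have "\<dots> \<le> (\<integral>y. norm ((g y - g x) * ker \<delta> x y) \<partial>lborel)" by (rule integral_norm_bound)
  also have "\<dots> \<le> (\<integral>y. e * ker \<delta> x y \<partial>lborel)"
  proof (rule integral_mono)
    show "integrable lborel (\<lambda>y. norm ((g y - g x) * ker \<delta> x y))" using i by (rule integrable_norm)
    show "integrable lborel (\<lambda>y. e * ker \<delta> x y)" using integrable_ker[OF d] by simp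
    fix y
    show "norm ((g y - g x) * ker \<delta> x y) \<le> e * ker \<delta> x y"
      using e[OF ker_support_sq[OF d, of x y]] ker_nonneg[of \<delta> x y]
      by (cases "ker \<delta> x y = 0") (auto simp: abs_mult)
  qed
  also have "\<dots> = e" using d by (simp add: integral_ker)
  finally show ?thesis .
qed

lemma moll_uniform_limit:
  assumes g: "continuous_on UNIV g" "\<And>y. y \<notin> sq 0 R \<Longrightarrow> g y = 0" and e: "e > 0"
  obtains \<delta>0 where "\<delta>0 > 0" "\<And>\<delta> x. 0 < \<delta> \<Longrightarrow> \<delta> < \<delta>0 \<Longrightarrow> \<bar>moll \<delta> g x - g x\<bar> \<le> e"
proof -
  have "uniformly_continuous_on (sq 0 (R + 2)) g"
    unfolding sq_def by (intro compact_uniformly_continuous continuous_on_subset[OF g(1)]) auto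
  then obtain d where d: "d > 0" "\<And>x y. x \<in> sq 0 (R + 2) \<Longrightarrow> y \<in> sq 0 (R + 2) \<Longrightarrow> dist x y < d \<Longrightarrow> dist (g x) (g y) < e"
    using e unfolding uniformly_continuous_on_def by metis
  show ?thesis
  proof (rule that[of "min 1 (d / 5)"])
    show "min 1 (d / 5) > 0" using d by simp
    fix \<delta> x assume dl: "0 < \<delta>" "\<delta> < min 1 (d / 5)"
    show "\<bar>moll \<delta> g x - g x\<bar> \<le> e"
    proof (rule moll_close[OF g(1) dl(1)])
      fix y assume y: "y \<in> sq x (2 * \<delta>)"
      have "dist x y \<le> dist (fst x) (fst y) + dist (snd x) (snd y)"
        by (cases x; cases y) (simp add: dist_Pair_Pair sqrt_add_le_add_sqrt order_trans[OF sqrt_add_le_add_sqrt])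
      also have "\<dots> \<le> 2 * \<delta> + 2 * \<delta>" using y by (auto simp: mem_sq dist_real_def)
      also have "\<dots> < d" using dl by simp
      finally have xy: "dist x y < d" .
      show "\<bar>g y - g x\<bar> \<le> e"
      proof (cases "x \<in> sq 0 (R + 2) \<and> y \<in> sq 0 (R + 2)")
        case True
        then show ?thesis using d(2)[of y x] xy by (auto simp: dist_real_def dist_commute)
      next
        case False
        then have "x \<notin> sq 0 R" "y \<notin> sq 0 R" using y dl by (auto simp: mem_sq)
        then show ?thesis using g(2) e by simp
      qed
    qed
  qed
qed

lemma locint_Lp:
  assumes [measurable]: "f \<in> borel_measurable borel" and s: "s \<ge> 1"
    and fin: "(\<integral>\<^sup>+x. ennreal (\<bar>f x\<bar> powr s) \<partial>lborel) < \<infinity>"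
  shows "locint f"
  unfolding locint_def
proof (intro conjI allI)
  fix c r
  show "integrable lborel (\<lambda>x. f x * indicator (sq c r) x)"
  proof (rule integrableI_bounded)
    have "(\<integral>\<^sup>+x. ennreal (norm (f x * indicator (sq c r) x)) \<partial>lborel) \<le> (\<integral>\<^sup>+x. indicator (sq c r) x + ennreal (\<bar>f x\<bar> powr s) \<partial>lborel)"
    proof (intro nn_integral_mono)
      fix x
      have "\<bar>f x\<bar> \<le> 1 + \<bar>f x\<bar> powr s"
      proof (cases "\<bar>f x\<bar> \<le> 1")
        case False
        then have "\<bar>f x\<bar> powr 1 \<le> \<bar>f x\<bar> powr s" using s by (intro powr_mono) auto
        then show ?thesis by simp
      qed (simp add: add_increasing2)
      then have "ennreal \<bar>f x\<bar> \<le> 1 + ennreal (\<bar>f x\<bar> powr s)" by (simp add: ennreal_leI flip: ennreal_1 ennreal_plus)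
      then show "ennreal (norm (f x * indicator (sq c r) x)) \<le> indicator (sq c r) x + ennreal (\<bar>f x\<bar> powr s)"
        by (auto simp: indicator_def)
    qed
    also have "\<dots> = emeasure lborel (sq c r) + (\<integral>\<^sup>+x. ennreal (\<bar>f x\<bar> powr s) \<partial>lborel)"
      by (subst nn_integral_add) auto
    also have "\<dots> < \<infinity>" using fin emeasure_lborel_cbox_finite[of "c - (r, r)" "c + (r, r)"] by (simp add: sq_def)
    finally show "(\<integral>\<^sup>+x. ennreal (norm (f x * indicator (sq c r) x)) \<partial>lborel) < \<infinity>" .
  qed measurable
qed simp

lemma powr_add3_le:
  fixes a b c s :: real
  assumes "s \<ge> 0" shows "\<bar>a + b + c\<bar> powr s \<le> 3 powr s * (\<bar>a\<bar> powr s + \<bar>b\<bar> powr s + \<bar>c\<bar> powr s)"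
proof -
  define M where "M = max \<bar>a\<bar> (max \<bar>b\<bar> \<bar>c\<bar>)"
  have "\<bar>a + b + c\<bar> powr s \<le> (3 * M) powr s" using assms by (intro powr_mono2) (auto simp: M_def)
  also have "\<dots> = 3 powr s * M powr s" by (simp add: powr_mult M_def)
  also have "M powr s \<le> \<bar>a\<bar> powr s + \<bar>b\<bar> powr s + \<bar>c\<bar> powr s"
    unfolding M_def max_def by auto
  finally show ?thesis by simp
qed

text \<open>\<open>f\<close> is first truncated in value and in space, to \<open>F n\<close>. A
  measurable function is an almost everywhere limit of continuous ones; clamping these to the bounds
  of \<open>F n\<close> and cutting them off leaves the limit unchanged and supplies a dominating
  function.\<close>

lemma Lp_continuous_dense:
  fixes f :: "real \<times> real \<Rightarrow> real"
  assumes [measurable]: "f \<in> borel_measurable borel" and s: "s \<ge> 1"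
    and fin: "(\<integral>\<^sup>+x. ennreal (\<bar>f x\<bar> powr s) \<partial>lborel) < \<infinity>" and e: "(e::ennreal) > 0"
  obtains g R where "continuous_on UNIV g" "\<And>x. x \<notin> sq 0 R \<Longrightarrow> g x = 0"
    "(\<integral>\<^sup>+x. ennreal (\<bar>f x - g x\<bar> powr s) \<partial>lborel) < e"
proof -
  define F where "F n x = (if \<bar>f x\<bar> \<le> real n \<and> x \<in> sq 0 (real n) then f x else 0)" for n :: nat and x
  have [measurable]: "F n \<in> borel_measurable borel" for n
    unfolding F_def by measurable
  have ev: "\<forall>\<^sub>F n in sequentially. F n x = f x" for x
  proof -
    obtain N :: nat where N: "real N \<ge> max \<bar>f x\<bar> (max \<bar>fst x\<bar> \<bar>snd x\<bar>)" using real_arch_simple by blast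
    show ?thesis
      by (rule eventually_sequentiallyI[of N]) (use N in \<open>auto simp: F_def mem_sq\<close>)
  qed
  have "(\<lambda>n. \<integral>\<^sup>+x. ennreal (\<bar>f x - F n x\<bar> powr s) \<partial>lborel) \<longlonglongrightarrow> (\<integral>\<^sup>+x. 0 \<partial>(lborel :: (real\<times>real) measure))"
  proof (rule nn_integral_dominated_convergence[where w="\<lambda>x. ennreal (\<bar>f x\<bar> powr s)"])
    show "AE x in lborel. ennreal (\<bar>f x - F j x\<bar> powr s) \<le> ennreal (\<bar>f x\<bar> powr s)" for j
      using s by (intro AE_I2 ennreal_leI powr_mono2) (auto simp: F_def)
    show "AE x in lborel. (\<lambda>i. ennreal (\<bar>f x - F i x\<bar> powr s)) \<longlonglongrightarrow> 0"
    proof (rule AE_I2)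
      fix x
      show "(\<lambda>i. ennreal (\<bar>f x - F i x\<bar> powr s)) \<longlonglongrightarrow> 0"
        by (rule tendsto_eventually) (use ev[of x] in \<open>auto elim: eventually_mono\<close>)
    qed
  qed (use fin in auto)
  moreover have e2: "e / (2 * ennreal (3 powr s)) > 0" using e by (auto simp: ennreal_zero_less_divide ennreal_mult_less_top)
  ultimately have "\<forall>\<^sub>F n in sequentially. (\<integral>\<^sup>+x. ennreal (\<bar>f x - F n x\<bar> powr s) \<partial>lborel) < e / (2 * ennreal (3 powr s))"
    by (auto simp: order_tendsto_iff)
  then obtain n where n: "(\<integral>\<^sup>+x. ennreal (\<bar>f x - F n x\<bar> powr s) \<partial>lborel) < e / (2 * ennreal (3 powr s))"
    by (auto simp: eventually_sequentially)
  have "F n \<in> borel_measurable lebesgue" by (simp add: measurable_completion)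
  then have "F n measurable_on UNIV" by (intro lebesgue_measurable_imp_measurable_on_real) auto
  then obtain N G where N: "negligible N" and G: "\<And>k. continuous_on UNIV (G k)"
    and lim: "\<And>x. x \<notin> N \<Longrightarrow> (\<lambda>k. G k x) \<longlonglongrightarrow> F n x"
    by (auto simp: measurable_on_def)
  define cut where "cut x = max 0 (min 1 (real n + 1 - max \<bar>fst x\<bar> \<bar>snd x\<bar>))" for x :: "real \<times> real"
  define h where "h k x = cut x * max (- real n) (min (real n) (G k x))" for k x
  have ch: "continuous_on UNIV (h k)" for k
    unfolding h_def cut_def by (intro continuous_intros G)
  then have [measurable]: "h k \<in> borel_measurable borel" for k by (rule borel_measurable_continuous_onI)
  have h0: "h k x = 0" if "x \<notin> sq 0 (real n + 1)" for k x
    using that by (auto simp: h_def cut_def mem_sq)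
  have cutb: "0 \<le> cut x" "cut x \<le> 1" for x by (auto simp: cut_def)
  have hb: "\<bar>h k x\<bar> \<le> real n" for k x
  proof -
    have "\<bar>h k x\<bar> = cut x * \<bar>max (- real n) (min (real n) (G k x))\<bar>" using cutb by (simp add: h_def abs_mult)
    also have "\<dots> \<le> 1 * real n" using cutb by (intro mult_mono) auto
    finally show ?thesis by simp
  qed
  have Fb: "\<bar>F n x\<bar> \<le> real n" "x \<notin> sq 0 (real n) \<Longrightarrow> F n x = 0" for x by (auto simp: F_def)
  have "(\<lambda>k. \<integral>\<^sup>+x. ennreal (\<bar>F n x - h k x\<bar> powr s) \<partial>lborel) \<longlonglongrightarrow> (\<integral>\<^sup>+x. 0 \<partial>(lborel :: (real\<times>real) measure))"
  proof (rule nn_integral_dominated_convergence[where w="\<lambda>x. ennreal ((2 * real n) powr s) * indicator (sq 0 (real n + 1)) x"])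
    show "AE x in lborel. ennreal (\<bar>F n x - h j x\<bar> powr s) \<le> ennreal ((2 * real n) powr s) * indicator (sq 0 (real n + 1)) x" for j
    proof (rule AE_I2)
      fix x
      show "ennreal (\<bar>F n x - h j x\<bar> powr s) \<le> ennreal ((2 * real n) powr s) * indicator (sq 0 (real n + 1)) x"
      proof (cases "x \<in> sq 0 (real n + 1)")
        case True
        have "\<bar>F n x - h j x\<bar> \<le> 2 * real n" using hb[of j x] Fb(1)[of x] by linarith
        then have "\<bar>F n x - h j x\<bar> powr s \<le> (2 * real n) powr s" using s by (intro powr_mono2) auto
        with True show ?thesis by (simp add: ennreal_leI)
      next
        case False
        then have "x \<notin> sq 0 (real n)" by (auto simp: mem_sq)
        with False show ?thesis using h0 Fb(2) by simp
      qed
    qed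
    have "emeasure lborel (sq 0 (real n + 1)) < \<infinity>" unfolding sq_def by (rule emeasure_lborel_cbox_finite)
    then show "(\<integral>\<^sup>+x. ennreal ((2 * real n) powr s) * indicator (sq 0 (real n + 1)) x \<partial>lborel) < \<infinity>"
      by (subst nn_integral_cmult_indicator) (auto simp: ennreal_mult_less_top)
    have "AE x in lebesgue. x \<notin> N" using N by (simp add: negligible_iff_null_sets AE_not_in)
    then have "AE x in lborel. x \<notin> N" by (simp add: AE_completion_iff)
    then show "AE x in lborel. (\<lambda>i. ennreal (\<bar>F n x - h i x\<bar> powr s)) \<longlonglongrightarrow> 0"
    proof eventually_elim
      case (elim x)
      have "(\<lambda>k. h k x) \<longlonglongrightarrow> cut x * max (- real n) (min (real n) (F n x))"
        unfolding h_def by (intro tendsto_intros lim elim)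
      moreover have "max (- real n) (min (real n) (F n x)) = F n x" using Fb(1)[of x] by auto
      moreover have "cut x * F n x = F n x"
        using Fb(2)[of x] by (cases "x \<in> sq 0 (real n)") (auto simp: cut_def mem_sq)
      ultimately have "(\<lambda>k. h k x) \<longlonglongrightarrow> F n x" by simp
      then have "(\<lambda>k. \<bar>F n x - h k x\<bar>) \<longlonglongrightarrow> \<bar>F n x - F n x\<bar>" by (intro tendsto_intros)
      then have "(\<lambda>k. \<bar>F n x - h k x\<bar> powr s) \<longlonglongrightarrow> 0 powr s"
        using s by (intro tendsto_powr2) auto
      then show ?case using tendsto_ennrealI[of _ "0 powr s"] by fastforce
    qed
  qed auto
  then have "\<forall>\<^sub>F k in sequentially. (\<integral>\<^sup>+x. ennreal (\<bar>F n x - h k x\<bar> powr s) \<partial>lborel) < e / (2 * ennreal (3 powr s))"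
    using e2 by (auto simp: order_tendsto_iff)
  then obtain k where k: "(\<integral>\<^sup>+x. ennreal (\<bar>F n x - h k x\<bar> powr s) \<partial>lborel) < e / (2 * ennreal (3 powr s))"
    by (auto simp: eventually_sequentially)
  show ?thesis
  proof (rule that[OF ch[of k] h0])
    let ?a = "\<integral>\<^sup>+x. ennreal (\<bar>f x - F n x\<bar> powr s) \<partial>lborel" and ?b = "\<integral>\<^sup>+x. ennreal (\<bar>F n x - h k x\<bar> powr s) \<partial>lborel"
    have "(\<integral>\<^sup>+x. ennreal (\<bar>f x - h k x\<bar> powr s) \<partial>lborel) \<le> (\<integral>\<^sup>+x. ennreal (3 powr s) * (ennreal (\<bar>f x - F n x\<bar> powr s) + ennreal (\<bar>F n x - h k x\<bar> powr s)) \<partial>lborel)"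
    proof (intro nn_integral_mono)
      fix x
      have "\<bar>f x - h k x\<bar> powr s \<le> 3 powr s * (\<bar>f x - F n x\<bar> powr s + \<bar>F n x - h k x\<bar> powr s)"
        using powr_add3_le[of s "f x - F n x" "F n x - h k x" 0] s by simp
      then show "ennreal (\<bar>f x - h k x\<bar> powr s) \<le> ennreal (3 powr s) * (ennreal (\<bar>f x - F n x\<bar> powr s) + ennreal (\<bar>F n x - h k x\<bar> powr s))"
        by (simp add: ennreal_leI flip: ennreal_plus ennreal_mult)
    qed
    also have "\<dots> = ennreal (3 powr s) * (?a + ?b)"
      by (subst nn_integral_cmult) (auto simp: nn_integral_add)
    also have "\<dots> < e"
    proof -
      have "?a + ?b < e / (2 * ennreal (3 powr s)) + e / (2 * ennreal (3 powr s))"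
        using n k by (rule add_strict_mono)
      also have "\<dots> = e / ennreal (3 powr s)"
      proof -
        have "e / (2 * ennreal (3 powr s)) + e / (2 * ennreal (3 powr s)) = e * 2 / (2 * ennreal (3 powr s))"
          by (simp add: mult_2_right flip: add_divide_distrib_ennreal)
        also have "\<dots> = e * 2 / (ennreal (3 powr s) * 2)" by (simp add: mult.commute)
        also have "\<dots> = e / ennreal (3 powr s)" by (rule divide_mult_eq) auto
        finally show ?thesis .
      qed
      finally have "ennreal (3 powr s) * (?a + ?b) < ennreal (3 powr s) * (e / ennreal (3 powr s))"
        by (intro ennreal_mult_strict_left_mono) auto
      also have "\<dots> = e" using ennreal_divide_mult_cancel[of "3 powr s" e] by (simp add: mult.commute)
      finally show ?thesis .
    qed
    finally show "(\<integral>\<^sup>+x. ennreal (\<bar>f x - h k x\<bar> powr s) \<partial>lborel) < e" .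
  qed auto
qed

lemma moll_Lp_tendsto:
  fixes f :: "real \<times> real \<Rightarrow> real"
  assumes f [measurable]: "f \<in> borel_measurable borel" and s: "s \<ge> 1"
    and fin: "(\<integral>\<^sup>+x. ennreal (\<bar>f x\<bar> powr s) \<partial>lborel) < \<infinity>"
    and d: "\<And>n. \<delta> n > 0" "\<delta> \<longlonglongrightarrow> 0"
  shows "(\<lambda>n. \<integral>\<^sup>+x. ennreal (\<bar>moll (\<delta> n) f x - f x\<bar> powr s) \<partial>lborel) \<longlonglongrightarrow> 0"
proof (rule order_tendstoI)
  fix e :: ennreal assume e: "0 < e"
  obtain r0 where r0: "r0 > 0" "ennreal r0 \<le> e"
    using e by (cases e) (auto intro: that[of 1])
  \<comment> \<open>Three errors, each at most \<open>r\<close> and magnified by 3 powr s, add up to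
    three quarters of \<open>r0\<close>.\<close>
  define r where "r = r0 / (3 powr s * 4)"
  have r: "r > 0" using r0 by (simp add: r_def)
  define e' where "e' = ennreal r"
  have e': "e' > 0" using r by (simp add: e'_def)
  obtain g R where g: "continuous_on UNIV g" "\<And>x. x \<notin> sq 0 R \<Longrightarrow> g x = 0"
    and fg: "(\<integral>\<^sup>+x. ennreal (\<bar>f x - g x\<bar> powr s) \<partial>lborel) < e'"
    using Lp_continuous_dense[OF f s fin e'] by blast
  have [measurable]: "g \<in> borel_measurable borel" using g(1) by (rule borel_measurable_continuous_onI)
  define m where "m = measure lborel (sq 0 (R + 2)) + 1"
  have em: "emeasure lborel (sq 0 (R + 2)) \<le> ennreal m"
    unfolding m_def sq_def using emeasure_lborel_cbox_finite[of "0 - (R+2, R+2)" "0 + (R+2,R+2)"]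
    by (subst emeasure_eq_ennreal_measure) (auto intro!: ennreal_leI)
  have m: "m > 0" unfolding m_def by (simp add: add_nonneg_pos)
  obtain t where t: "t > 0" "ennreal (t powr s) * ennreal m \<le> e'"
  proof (rule that[of "(r / m) powr (1 / s)"])
    show "(r / m) powr (1 / s) > 0" using r m by simp
    have "((r / m) powr (1 / s)) powr s * m = r" using r m s by (simp add: powr_powr)
    then show "ennreal (((r / m) powr (1 / s)) powr s) * ennreal m \<le> e'" using m by (simp add: e'_def flip: ennreal_mult)
  qed
  obtain \<delta>0 where d0: "\<delta>0 > 0" "\<And>\<delta> x. 0 < \<delta> \<Longrightarrow> \<delta> < \<delta>0 \<Longrightarrow> \<bar>moll \<delta> g x - g x\<bar> \<le> t"
    using moll_uniform_limit[OF g t(1)] by blast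
  have "\<forall>\<^sub>F n in sequentially. \<delta> n < min 1 \<delta>0" by (rule order_tendstoD(2)[OF d(2)]) (use d0 in auto)
  then show "\<forall>\<^sub>F n in sequentially. (\<integral>\<^sup>+x. ennreal (\<bar>moll (\<delta> n) f x - f x\<bar> powr s) \<partial>lborel) < e"
  proof eventually_elim
    case (elim n)
    let ?d = "\<delta> n"
    have lf: "locint f" using locint_Lp[OF f s fin] .
    have lg: "locint g" using locint_continuous[OF g(1)] .
    let ?a = "\<integral>\<^sup>+x. ennreal (\<bar>f x - g x\<bar> powr s) \<partial>lborel"
    have "(\<integral>\<^sup>+x. ennreal (\<bar>moll ?d f x - f x\<bar> powr s) \<partial>lborel) \<le> (\<integral>\<^sup>+x. ennreal (3 powr s) *
      (ennreal (\<bar>moll ?d (\<lambda>x. f x - g x) x\<bar> powr s) + ennreal (\<bar>moll ?d g x - g x\<bar> powr s) + ennreal (\<bar>f x - g x\<bar> powr s)) \<partial>lborel)"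
    proof (intro nn_integral_mono)
      fix x
      have "\<bar>moll ?d f x - f x\<bar> powr s \<le> 3 powr s * (\<bar>moll ?d (\<lambda>x. f x - g x) x\<bar> powr s + \<bar>moll ?d g x - g x\<bar> powr s + \<bar>f x - g x\<bar> powr s)"
        using powr_add3_le[of s "moll ?d (\<lambda>x. f x - g x) x" "moll ?d g x - g x" "g x - f x"] s
          moll_diff[OF lf lg d(1)[of n], of x] by (simp add: abs_minus_commute[of "g x"])
      then show "ennreal (\<bar>moll ?d f x - f x\<bar> powr s) \<le> ennreal (3 powr s) *
        (ennreal (\<bar>moll ?d (\<lambda>x. f x - g x) x\<bar> powr s) + ennreal (\<bar>moll ?d g x - g x\<bar> powr s) + ennreal (\<bar>f x - g x\<bar> powr s))"
        by (simp add: ennreal_leI flip: ennreal_plus ennreal_mult)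
    qed
    also have "\<dots> = ennreal (3 powr s) * ((\<integral>\<^sup>+x. ennreal (\<bar>moll ?d (\<lambda>x. f x - g x) x\<bar> powr s) \<partial>lborel)
      + (\<integral>\<^sup>+x. ennreal (\<bar>moll ?d g x - g x\<bar> powr s) \<partial>lborel) + ?a)"
      by (subst nn_integral_cmult) (auto simp: nn_integral_add)
    also have "\<dots> \<le> ennreal (3 powr s) * (?a + e' + ?a)"
    proof (intro mult_left_mono add_mono order_refl)
      show "(\<integral>\<^sup>+x. ennreal (\<bar>moll ?d (\<lambda>x. f x - g x) x\<bar> powr s) \<partial>lborel) \<le> ?a"
        using moll_powr_integral_le[of "\<lambda>x. f x - g x" s ?d UNIV UNIV] s d(1)[of n] by simp
      have "(\<integral>\<^sup>+x. ennreal (\<bar>moll ?d g x - g x\<bar> powr s) \<partial>lborel) \<le> (\<integral>\<^sup>+x. ennreal (t powr s) * indicator (sq 0 (R + 2)) x \<partial>lborel)"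
      proof (intro nn_integral_mono)
        fix x
        show "ennreal (\<bar>moll ?d g x - g x\<bar> powr s) \<le> ennreal (t powr s) * indicator (sq 0 (R + 2)) x"
        proof (cases "x \<in> sq 0 (R + 2)")
          case True
          have "\<bar>moll ?d g x - g x\<bar> powr s \<le> t powr s" using d0(2)[of ?d x] d(1)[of n] elim s by (intro powr_mono2) auto
          with True show ?thesis by (simp add: ennreal_leI)
        next
          case False
          have "\<bar>moll ?d g x - g x\<bar> \<le> 0"
          proof (rule moll_close[OF g(1) d(1)])
            fix y assume "y \<in> sq x (2 * ?d)"
            then have "y \<notin> sq 0 R" "x \<notin> sq 0 R" using False elim by (auto simp: mem_sq)
            then show "\<bar>g y - g x\<bar> \<le> 0" using g(2) by simp
          qed
          then show ?thesis using s by simp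
        qed
      qed
      also have "\<dots> = ennreal (t powr s) * emeasure lborel (sq 0 (R + 2))"
        by (rule nn_integral_cmult_indicator) simp
      also have "\<dots> \<le> ennreal (t powr s) * ennreal m" by (intro mult_left_mono em) auto
      also have "\<dots> \<le> e'" by (rule t)
      finally show "(\<integral>\<^sup>+x. ennreal (\<bar>moll ?d g x - g x\<bar> powr s) \<partial>lborel) \<le> e'" .
    qed auto
    also have "\<dots> < e"
    proof -
      have "ennreal (3 powr s) * (?a + e' + ?a) \<le> ennreal (3 powr s) * (e' + e' + e')"
        using fg by (intro mult_left_mono add_mono) auto
      also have "\<dots> = ennreal (3 powr s * (r + r + r))"
        unfolding e'_def using r by (simp flip: ennreal_plus ennreal_mult)
      also have "\<dots> < ennreal r0" using r0 by (intro ennreal_lessI) (auto simp: r_def)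
      finally show ?thesis using r0 by order
    qed
    finally show ?case .
  qed
qed simp

section \<open>Differentiation of mollified functions and weak derivatives\<close>

definition conv :: "real \<times> real \<Rightarrow> real \<times> real \<Rightarrow> real \<Rightarrow> (real \<times> real \<Rightarrow> real) \<Rightarrow> (real \<times> real \<Rightarrow> real) \<Rightarrow> real \<times> real \<Rightarrow> real" where
  "conv a b c g k x = integral (cbox a b) (\<lambda>y. g y * k (c *\<^sub>R (x - y)))"

context
  fixes g :: "real \<times> real \<Rightarrow> real"
  assumes g: "continuous_on UNIV g"
begin

lemma conv_continuous:
  assumes "continuous_on UNIV k" shows "continuous_on UNIV (conv a b c g k)"
  unfolding conv_def
  by (rule integral_continuous_on_param)
    (auto simp: split_beta intro!: continuous_intros continuous_on_compose2[OF g] continuous_on_compose2[OF assms])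

lemma conv_integrable:
  assumes "continuous_on UNIV k" shows "(\<lambda>y. g y * k (c *\<^sub>R (x - y))) integrable_on cbox a b"
  by (intro integrable_continuous continuous_intros continuous_on_compose2[OF g] continuous_on_compose2[OF assms] subset_UNIV)

lemma conv_has_pd1:
  assumes k: "smooth k"
  shows "((\<lambda>t. conv a b c g k (t, y)) has_real_derivative conv a b c g (\<lambda>z. c * pd1 k z) (x, y)) (at x)"
  unfolding conv_def
proof (rule leibniz_rule_field_derivative)
  fix t z
  have "((\<lambda>t. k (c *\<^sub>R ((t, y) - z))) has_real_derivative c * pd1 k (c *\<^sub>R ((t, y) - z))) (at t)"
    by (rule has_pd1_affine[OF smooth_has_pd1[OF k]])
  then show "((\<lambda>t. g z * k (c *\<^sub>R ((t, y) - z))) has_field_derivative g z * (c * pd1 k (c *\<^sub>R ((t, y) - z)))) (at t within UNIV)"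
    by (intro DERIV_cmult) simp
next
  show "continuous_on (UNIV \<times> cbox a b) (\<lambda>(t, z). g z * (c * pd1 k (c *\<^sub>R ((t, y) - z))))"
    unfolding split_beta
    by (intro continuous_intros continuous_on_compose2[OF g] continuous_on_compose2[OF smooth_cont[OF smooth_pd1[OF k]]] subset_UNIV)
qed (auto intro!: conv_integrable smooth_cont k)

lemma conv_has_pd2:
  assumes k: "smooth k"
  shows "((\<lambda>t. conv a b c g k (x, t)) has_real_derivative conv a b c g (\<lambda>z. c * pd2 k z) (x, y)) (at y)"
  unfolding conv_def
proof (rule leibniz_rule_field_derivative)
  fix t z
  have "((\<lambda>t. k (c *\<^sub>R ((x, t) - z))) has_real_derivative c * pd2 k (c *\<^sub>R ((x, t) - z))) (at t)"
    by (rule has_pd2_affine[OF smooth_has_pd2[OF k]])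
  then show "((\<lambda>t. g z * k (c *\<^sub>R ((x, t) - z))) has_field_derivative g z * (c * pd2 k (c *\<^sub>R ((x, t) - z)))) (at t within UNIV)"
    by (intro DERIV_cmult) simp
next
  show "continuous_on (UNIV \<times> cbox a b) (\<lambda>(t, z). g z * (c * pd2 k (c *\<^sub>R ((x, t) - z))))"
    unfolding split_beta
    by (intro continuous_intros continuous_on_compose2[OF g] continuous_on_compose2[OF smooth_cont[OF smooth_pd2[OF k]]] subset_UNIV)
qed (auto intro!: conv_integrable smooth_cont k)

lemma Ck_conv: "smooth k \<Longrightarrow> Ck n (conv a b c g k)"
proof (induction n arbitrary: k)
  case 0
  then show ?case using conv_continuous[OF smooth_cont] by simp
next
  case (Suc n)
  show ?case
    by (rule Ck_SucI[OF conv_continuous[OF smooth_cont[OF Suc.prems]] conv_has_pd1[OF Suc.prems] conv_has_pd2[OF Suc.prems]])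
       (intro Suc.IH smooth_mult smooth_const smooth_pd1 smooth_pd2 Suc.prems)+
qed

end

text \<open>An operator that commutes with both partial derivatives up to the factor
  \<open>c\<close> commutes with \<open>Dm j\<close> up to \<open>c ^ order j\<close>. The instances
  are convolution, affine substitution and multiplication by a constant, the last with c =
  1.\<close>

lemma Dm_induct_lemma:
  assumes "\<And>f. smooth f \<Longrightarrow> smooth (T f)"
    and "\<And>f. smooth f \<Longrightarrow> pd1 (T f) = T (\<lambda>x. c * pd1 f x)"
    and "\<And>f. smooth f \<Longrightarrow> pd2 (T f) = T (\<lambda>x. c * pd2 f x)"
    and "smooth f"
  shows "Dm j (T f) = T (\<lambda>x. c ^ order j * Dm j f x)"
proof -
  have s1: "smooth h \<Longrightarrow> smooth ((pd1 ^^ n) h)" for n h using smooth_Dm[of h "(n, 0)"] by (simp add: Dm_def)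
  have s2: "smooth h \<Longrightarrow> smooth ((pd2 ^^ n) h)" for n h using smooth_Dm[of h "(0, n)"] by (simp add: Dm_def)
  have pdc: "pd1 (\<lambda>x. d * h x) = (\<lambda>x. d * pd1 h x)" "pd2 (\<lambda>x. d * h x) = (\<lambda>x. d * pd2 h x)" if "smooth h" for d h
    using pd_mult[OF smooth_const that, of d] by (simp_all add: pd_const)
  have 1: "(pd1 ^^ n) (T h) = T (\<lambda>x. c ^ n * (pd1 ^^ n) h x)" if "smooth h" for n h
  proof (induction n)
    case (Suc n)
    have "(pd1 ^^ Suc n) (T h) = pd1 (T (\<lambda>x. c ^ n * (pd1 ^^ n) h x))" using Suc by simp
    also have "\<dots> = T (\<lambda>x. c * pd1 (\<lambda>x. c ^ n * (pd1 ^^ n) h x) x)"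
      by (intro assms(2) smooth_mult smooth_const s1 that)
    finally show ?case by (simp add: pdc[OF s1[OF that]] mult.assoc)
  qed simp
  have 2: "(pd2 ^^ n) (T h) = T (\<lambda>x. c ^ n * (pd2 ^^ n) h x)" if "smooth h" for n h
  proof (induction n)
    case (Suc n)
    have "(pd2 ^^ Suc n) (T h) = pd2 (T (\<lambda>x. c ^ n * (pd2 ^^ n) h x))" using Suc by simp
    also have "\<dots> = T (\<lambda>x. c * pd2 (\<lambda>x. c ^ n * (pd2 ^^ n) h x) x)"
      by (intro assms(3) smooth_mult smooth_const s2 that)
    finally show ?case by (simp add: pdc[OF s2[OF that]] mult.assoc)
  qed simp
  have 3: "(pd1 ^^ n) (\<lambda>x. d * h x) = (\<lambda>x. d * (pd1 ^^ n) h x)" if "smooth h" for n d h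
    by (induction n) (auto simp: pdc[OF s1[OF that]])
  have "Dm j (T f) = (pd1 ^^ fst j) (T (\<lambda>x. c ^ snd j * (pd2 ^^ snd j) f x))"
    by (simp add: Dm_def 2[OF assms(4)])
  also have "\<dots> = T (\<lambda>x. c ^ fst j * (pd1 ^^ fst j) (\<lambda>x. c ^ snd j * (pd2 ^^ snd j) f x) x)"
    by (intro 1 smooth_mult smooth_const s2 assms(4))
  finally show ?thesis by (simp add: 3[OF s2[OF assms(4)]] Dm_def order_def power_add mult_ac)
qed

lemma Dm_conv:
  assumes g: "continuous_on UNIV g" and k: "smooth k"
  shows "Dm j (conv a b c g k) = conv a b c g (\<lambda>z. c ^ order j * Dm j k z)"
proof (rule Dm_induct_lemma[OF _ _ _ k])
  fix f assume f: "smooth f"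
  show "smooth (conv a b c g f)" using Ck_conv[OF g f] by (simp add: smooth_def)
  show "pd1 (conv a b c g f) = conv a b c g (\<lambda>x. c * pd1 f x)" by (rule pd1_unique[OF conv_has_pd1[OF g f]])
  show "pd2 (conv a b c g f) = conv a b c g (\<lambda>x. c * pd2 f x)" by (rule pd2_unique[OF conv_has_pd2[OF g f]])
qed

lemma Dm_affine:
  assumes "smooth f"
  shows "Dm j (\<lambda>x. f (k *\<^sub>R (x - c))) = (\<lambda>x. k ^ order j * Dm j f (k *\<^sub>R (x - c)))"
  using Dm_induct_lemma[of "\<lambda>f x. f (k *\<^sub>R (x - c))" k f j] assms by (simp add: smooth_affine pd_affine)

lemma Dm_cmult:
  assumes "smooth f"
  shows "Dm j (\<lambda>x. d * f x) = (\<lambda>x. d * Dm j f x)"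
proof -
  have "pd1 (\<lambda>x. d * h x) = (\<lambda>x. d * (1 * pd1 h x))" "pd2 (\<lambda>x. d * h x) = (\<lambda>x. d * (1 * pd2 h x))" if "smooth h" for h
    using pd_mult[OF smooth_const that, of d] by (simp_all add: pd_const)
  then show ?thesis
    using Dm_induct_lemma[of "\<lambda>f x. d * f x" 1 f j] assms by (simp add: smooth_mult smooth_const)
qed

lemma integral_eq_integral_sq:
  fixes f :: "real \<times> real \<Rightarrow> real"
  assumes "continuous_on UNIV f" "\<And>y. y \<notin> sq c r \<Longrightarrow> f y = 0"
  shows "(\<integral>y. f y \<partial>lborel) = integral (sq c r) f" "integrable lborel f"
proof -
  have i: "integrable lborel (\<lambda>x. indicator (sq c r) x *\<^sub>R f x)"
    unfolding sq_def by (rule borel_integrable_compact) (auto intro: continuous_on_subset[OF assms(1)])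
  have e: "(\<lambda>x. indicator (sq c r) x *\<^sub>R f x) = f" using assms(2) by (auto simp: fun_eq_iff indicator_def)
  show "integrable lborel f" using i e by simp
  show "(\<integral>y. f y \<partial>lborel) = integral (sq c r) f"
    using set_borel_integral_eq_integral(2)[of "sq c r" f] i e by (simp add: set_integrable_def set_lebesgue_integral_def)
qed

text \<open>Since \<open>g\<close> vanishes off a fixed square, the plane can be replaced by a box
  that does not depend on \<open>x\<close>; this makes differentiation of parameter integrals over
  boxes, and hence the smoothness of \<open>conv\<close>, available.\<close>

lemma moll_eq_conv:
  assumes g: "continuous_on UNIV g" "\<And>y. y \<notin> sq 0 R \<Longrightarrow> g y = 0"
  shows "moll \<delta> g = conv (0 - (R, R)) (0 + (R, R)) (1 / \<delta>) g (\<lambda>z. (1 / \<delta>\<^sup>2) * eta z)"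
proof
  fix x
  have "moll \<delta> g x = integral (sq 0 R) (\<lambda>y. g y * ker \<delta> x y)"
    unfolding moll_def
  proof (rule integral_eq_integral_sq)
    have "continuous_on UNIV (\<lambda>y. ker \<delta> x y)"
      unfolding ker_def divide_inverse
      by (intro continuous_intros continuous_on_compose2[OF smooth_cont[OF smooth_eta]] subset_UNIV)
    then show "continuous_on UNIV (\<lambda>y. g y * ker \<delta> x y)" using g(1) by (intro continuous_on_mult)
  qed (use g(2) in simp)
  then show "moll \<delta> g x = conv (0 - (R, R)) (0 + (R, R)) (1 / \<delta>) g (\<lambda>z. (1 / \<delta>\<^sup>2) * eta z) x"
    by (simp add: conv_def ker_def sq_def)
qed

lemma smooth_moll:
  assumes g: "continuous_on UNIV g" "\<And>y. y \<notin> sq 0 R \<Longrightarrow> g y = 0"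
  shows "smooth (moll \<delta> g)"
proof -
  have "smooth (conv (0 - (R, R)) (0 + (R, R)) (1 / \<delta>) g (\<lambda>z. (1 / \<delta>\<^sup>2) * eta z))"
    using Ck_conv[OF g(1) smooth_mult[OF smooth_const smooth_eta]] unfolding smooth_def by blast
  moreover have "moll \<delta> g = conv (0 - (R, R)) (0 + (R, R)) (1 / \<delta>) g (\<lambda>z. (1 / \<delta>\<^sup>2) * eta z)"
    by (rule moll_eq_conv[OF g(1)]) (rule g(2))
  ultimately show ?thesis by (simp only:)
qed

text \<open>The integral identity of \<open>weak_deriv\<close>, transported to \<open>lborel\<close>
  and to the class \<open>smooth\<close>.\<close>

definition wderiv :: "nat \<times> nat \<Rightarrow> (real \<times> real \<Rightarrow> real) \<Rightarrow> (real \<times> real \<Rightarrow> real) \<Rightarrow> bool" where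
  "wderiv j g w \<longleftrightarrow> (\<forall>\<phi>. smooth \<phi> \<longrightarrow> compact (csupp \<phi>) \<longrightarrow>
     (\<integral>x. g x * Dm j \<phi> x \<partial>lborel) = (- 1) ^ order j * (\<integral>x. w x * \<phi> x \<partial>lborel))"

lemma compact_csupp_sq:
  fixes f :: "real \<times> real \<Rightarrow> real"
  assumes "\<And>y. f y \<noteq> 0 \<Longrightarrow> y \<in> sq c r" shows "compact (csupp f)"
proof -
  have "csupp f \<subseteq> sq c r" unfolding csupp_def by (rule closure_minimal) (use assms in \<open>auto simp: sq_def\<close>)
  then show ?thesis
    unfolding csupp_def sq_def by (metis bounded_cbox bounded_subset closed_closure compact_eq_bounded_closed)
qed

lemma ker_smooth:
  assumes d: "\<delta> > 0"
  shows "smooth (ker \<delta> x)" "compact (csupp (ker \<delta> x))"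
    "Dm j (ker \<delta> x) y = (- 1) ^ order j * ((1 / \<delta>) ^ order j * ((1 / \<delta>\<^sup>2) * Dm j eta ((1 / \<delta>) *\<^sub>R (x - y))))"
proof -
  have e: "ker \<delta> x = (\<lambda>y. (1 / \<delta>\<^sup>2) * eta ((- (1 / \<delta>)) *\<^sub>R (y - x)))"
    by (simp add: fun_eq_iff ker_def scaleR_diff_right)
  show "smooth (ker \<delta> x)" unfolding e by (intro smooth_mult smooth_const smooth_affine smooth_eta)
  show "compact (csupp (ker \<delta> x))" by (rule compact_csupp_sq) (rule ker_support_sq[OF d])
  have "Dm j (ker \<delta> x) y = (1 / \<delta>\<^sup>2) * ((- (1 / \<delta>)) ^ order j * Dm j eta ((- (1 / \<delta>)) *\<^sub>R (y - x)))"
    unfolding e Dm_cmult[OF smooth_affine[OF smooth_eta]] Dm_affine[OF smooth_eta] ..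
  also have "(- (1 / \<delta>)) *\<^sub>R (y - x) = (1 / \<delta>) *\<^sub>R (x - y)" by (simp add: scaleR_diff_right)
  also have "(- (1 / \<delta>)) ^ order j = (- 1) ^ order j * (1 / \<delta>) ^ order j" by (simp flip: power_mult_distrib)
  finally show "Dm j (ker \<delta> x) y = (- 1) ^ order j * ((1 / \<delta>) ^ order j * ((1 / \<delta>\<^sup>2) * Dm j eta ((1 / \<delta>) *\<^sub>R (x - y))))"
    by (simp add: mult_ac)
qed

text \<open>Derivatives in \<open>x\<close> fall on the kernel and equal, up to sign, derivatives in
  \<open>y\<close>; as a function of \<open>y\<close> the kernel is a test function, and the two
  signs cancel.\<close>

lemma Dm_moll_wderiv:
  assumes g: "continuous_on UNIV g" "\<And>y. y \<notin> sq 0 R \<Longrightarrow> g y = 0" and d: "\<delta> > 0" and w: "wderiv j g w"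
  shows "Dm j (moll \<delta> g) x = moll \<delta> w x"
proof -
  let ?k = "\<lambda>z. (1 / \<delta>\<^sup>2) * eta z"
  have sk: "smooth ?k" by (intro smooth_mult smooth_const smooth_eta)
  have "Dm j (moll \<delta> g) x = conv (0 - (R, R)) (0 + (R, R)) (1 / \<delta>) g (\<lambda>z. (1 / \<delta>) ^ order j * Dm j ?k z) x"
  proof -
    have "moll \<delta> g = conv (0 - (R, R)) (0 + (R, R)) (1 / \<delta>) g ?k"
      by (rule moll_eq_conv[OF g(1)]) (rule g(2))
    then show ?thesis by (simp only: Dm_conv[OF g(1) sk])
  qed
  also have "\<dots> = integral (sq 0 R) (\<lambda>y. g y * ((1 / \<delta>) ^ order j * Dm j ?k ((1 / \<delta>) *\<^sub>R (x - y))))"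
    by (simp add: conv_def sq_def)
  also have "\<dots> = (\<integral>y. g y * ((1 / \<delta>) ^ order j * Dm j ?k ((1 / \<delta>) *\<^sub>R (x - y))) \<partial>lborel)"
  proof (rule integral_eq_integral_sq(1)[symmetric])
    have "continuous_on UNIV (\<lambda>y. Dm j ?k ((1 / \<delta>) *\<^sub>R (x - y)))"
      by (rule continuous_on_compose2[OF smooth_cont[OF smooth_Dm[OF sk]]]) (intro continuous_intros subset_UNIV)+
    then show "continuous_on UNIV (\<lambda>y. g y * ((1 / \<delta>) ^ order j * Dm j ?k ((1 / \<delta>) *\<^sub>R (x - y))))"
      by (intro continuous_on_mult g(1) continuous_on_const)
  qed (use g(2) in simp)
  also have "\<dots> = (\<integral>y. (- 1) ^ order j * (g y * Dm j (ker \<delta> x) y) \<partial>lborel)"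
    unfolding ker_smooth(3)[OF d] Dm_cmult[OF smooth_eta]
    by (rule Bochner_Integration.integral_cong) (auto simp: mult_ac simp flip: power_mult_distrib)
  also have "\<dots> = (- 1) ^ order j * (\<integral>y. g y * Dm j (ker \<delta> x) y \<partial>lborel)" by simp
  also have "\<dots> = (- 1) ^ order j * ((- 1) ^ order j * (\<integral>y. w y * ker \<delta> x y \<partial>lborel))"
    using w ker_smooth(1,2)[OF d, of x] by (simp add: wderiv_def)
  finally show ?thesis by (simp add: moll_def flip: mult.assoc power_mult_distrib)
qed

lemma moll_cong_local:
  assumes "\<delta> > 0" "\<And>y. y \<in> sq x (2 * \<delta>) \<Longrightarrow> f y = g y"
  shows "moll \<delta> f x = moll \<delta> g x"
  unfolding moll_def
proof (rule Bochner_Integration.integral_cong)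
  fix y show "f y * ker \<delta> x y = g y * ker \<delta> x y"
    using assms ker_support_sq[of \<delta> x y] by (cases "ker \<delta> x y = 0") auto
qed simp

text \<open>For \<delta> below 1 the mollification on the square only sees \<open>w\<close> on the
  square enlarged by 2, where the cut-off \<open>v\<close> is integrable; so the L^1 theorem for
  \<open>v\<close> applies.\<close>

lemma moll_L1_local:
  assumes w: "locint w" and d: "\<And>n. \<delta> n > 0" "\<delta> \<longlonglongrightarrow> 0"
  shows "(\<lambda>n. \<integral>\<^sup>+x. ennreal \<bar>moll (\<delta> n) w x - w x\<bar> * indicator (sq c r) x \<partial>lborel) \<longlonglongrightarrow> 0"
proof -
  define v where "v x = w x * indicator (sq c (r + 2)) x" for x
  have i: "integrable lborel v" using w unfolding locint_def v_def by blast
  then have [measurable]: "v \<in> borel_measurable borel" by simp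
  have [measurable]: "w \<in> borel_measurable borel" using w by (simp add: locint_def)
  have "(\<integral>\<^sup>+x. ennreal (\<bar>v x\<bar> powr 1) \<partial>lborel) < \<infinity>"
    using i by (simp add: integrable_iff_bounded)
  from moll_Lp_tendsto[OF _ _ this d] have t: "(\<lambda>n. \<integral>\<^sup>+x. ennreal \<bar>moll (\<delta> n) v x - v x\<bar> \<partial>lborel) \<longlonglongrightarrow> 0" by simp
  have "\<forall>\<^sub>F n in sequentially. \<delta> n < 1" by (rule order_tendstoD(2)[OF d(2)]) simp
  then have "\<forall>\<^sub>F n in sequentially. (\<integral>\<^sup>+x. ennreal \<bar>moll (\<delta> n) w x - w x\<bar> * indicator (sq c r) x \<partial>lborel) \<le> (\<integral>\<^sup>+x. ennreal \<bar>moll (\<delta> n) v x - v x\<bar> \<partial>lborel)"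
  proof eventually_elim
    case (elim n)
    show ?case
    proof (rule nn_integral_mono)
      fix x
      show "ennreal \<bar>moll (\<delta> n) w x - w x\<bar> * indicator (sq c r) x \<le> ennreal \<bar>moll (\<delta> n) v x - v x\<bar>"
      proof (cases "x \<in> sq c r")
        case True
        have "moll (\<delta> n) w x = moll (\<delta> n) v x"
        proof (rule moll_cong_local[OF d(1)])
          fix y assume "y \<in> sq x (2 * \<delta> n)"
          then have "y \<in> sq c (r + 2)" using True elim by (auto simp: mem_sq)
          then show "w y = v y" by (simp add: v_def)
        qed
        moreover have "x \<in> sq c (r + 2)" using True by (auto simp: mem_sq)
        then have "w x = v x" by (simp add: v_def)
        ultimately show ?thesis by (simp add: indicator_def)
      qed simp
    qed
  qed
  then show ?thesis using t by (intro tendsto_sandwich[OF _ _ tendsto_const t]) auto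
qed

text \<open>The fundamental lemma of the calculus of variations, with the mollifying kernels as test
  functions.\<close>

lemma moll_zero_AE:
  assumes w: "locint w" and z: "\<And>\<delta> x. \<delta> > 0 \<Longrightarrow> moll \<delta> w x = 0"
  shows "AE x in lborel. w x = 0"
proof -
  have [measurable]: "w \<in> borel_measurable borel" using w by (simp add: locint_def)
  have "AE x in lborel. x \<in> sq 0 (real N) \<longrightarrow> w x = 0" for N :: nat
  proof -
    have "(\<lambda>n. \<integral>\<^sup>+x. ennreal \<bar>moll (inverse (real (Suc n))) w x - w x\<bar> * indicator (sq 0 (real N)) x \<partial>lborel) \<longlonglongrightarrow> 0"
      by (rule moll_L1_local[OF w]) (use LIMSEQ_inverse_real_of_nat in auto)
    then have "(\<lambda>n::nat. \<integral>\<^sup>+x. ennreal \<bar>w x\<bar> * indicator (sq 0 (real N)) x \<partial>lborel) \<longlonglongrightarrow> 0"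
      by (simp add: z)
    then have "(\<integral>\<^sup>+x. ennreal \<bar>w x\<bar> * indicator (sq 0 (real N)) x \<partial>lborel) = 0"
      by (simp add: tendsto_const_iff)
    then have "AE x in lborel. ennreal \<bar>w x\<bar> * indicator (sq 0 (real N)) x = 0"
      by (subst (asm) nn_integral_0_iff_AE) auto
    then show ?thesis by eventually_elim (auto simp: indicator_def)
  qed
  then have "AE x in lborel. \<forall>N::nat. x \<in> sq 0 (real N) \<longrightarrow> w x = 0"
    unfolding AE_all_countable by blast
  then show ?thesis
  proof eventually_elim
    case (elim x)
    obtain N :: nat where "real N \<ge> max \<bar>fst x\<bar> \<bar>snd x\<bar>" using real_arch_simple by blast
    then have "x \<in> sq 0 (real N)" by (auto simp: mem_sq)
    then show ?case using elim by blast
  qed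
qed

section \<open>The weak gradient vanishes almost everywhere on the zero set\<close>

lemma integral_pd_zero:
  fixes P :: "real \<times> real \<Rightarrow> real"
  assumes c: "continuous_on UNIV P1" and z: "\<And>x. x \<notin> sq 0 R \<Longrightarrow> P x = 0" "\<And>x. x \<notin> sq 0 R \<Longrightarrow> P1 x = 0"
  shows "(\<And>x y. ((\<lambda>t. P (t, y)) has_real_derivative P1 (x, y)) (at x)) \<Longrightarrow> (\<integral>x. P1 x \<partial>lborel) = 0"
    and "(\<And>x y. ((\<lambda>t. P (x, t)) has_real_derivative P1 (x, y)) (at y)) \<Longrightarrow> (\<integral>x. P1 x \<partial>lborel) = 0"
proof -
  have i: "integrable (lborel \<Otimes>\<^sub>M lborel) (\<lambda>(x, y). P1 (x, y))"
    using integral_eq_integral_sq(2)[OF c z(2)] by (simp add: lborel_prod)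
  define S where "S = \<bar>R\<bar> + 1"
  have line: "(\<integral>t. h' t \<partial>lborel) = 0"
    if ch: "continuous_on UNIV h'" and h: "\<And>t. (h has_real_derivative h' t) (at t)" and hz: "\<And>t. \<bar>t\<bar> \<ge> S \<Longrightarrow> h t = 0 \<and> h' t = 0"
    for h h' :: "real \<Rightarrow> real"
  proof -
    have S: "- S \<le> S" by (simp add: S_def)
    have "(h' has_integral (h S - h (- S))) {- S..S}"
      by (rule fundamental_theorem_of_calculus[OF S])
        (use h in \<open>auto simp: has_real_derivative_iff_has_vector_derivative intro: has_vector_derivative_at_within\<close>)
    then have "integral {- S..S} h' = 0" using hz[of S] hz[of "- S"] by (auto simp: S_def dest: integral_unique)
    moreover have ii: "integrable lborel (\<lambda>x. indicator {- S..S} x *\<^sub>R h' x)"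
      by (rule borel_integrable_compact) (auto intro: continuous_on_subset[OF ch])
    moreover have "(\<lambda>x. indicator {- S..S} x *\<^sub>R h' x) = h'"
    proof
      fix x show "indicator {- S..S} x *\<^sub>R h' x = h' x"
        using hz[of x] by (cases "x \<in> {- S..S}") auto
    qed
    ultimately show ?thesis
      using set_borel_integral_eq_integral(2)[of "{- S..S}" h'] by (simp add: set_integrable_def set_lebesgue_integral_def)
  qed
  have far: "P (x, y) = 0 \<and> P1 (x, y) = 0" if "\<bar>x\<bar> \<ge> S \<or> \<bar>y\<bar> \<ge> S" for x y
  proof -
    have "(x, y) \<notin> sq 0 R" using that by (auto simp: S_def mem_sq)
    then show ?thesis using z by blast
  qed
  show "(\<integral>x. P1 x \<partial>lborel) = 0" if "\<And>x y. ((\<lambda>t. P (t, y)) has_real_derivative P1 (x, y)) (at x)"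
  proof -
    have inner: "(\<integral>x. P1 (x, y) \<partial>lborel) = 0" for y
      by (rule line[of _ "\<lambda>t. P (t, y)"]) (use that far in \<open>auto intro!: continuous_on_slices c\<close>)
    have "(\<integral>x. P1 x \<partial>lborel) = (\<integral>x. P1 x \<partial>(lborel \<Otimes>\<^sub>M lborel))" by (simp add: lborel_prod)
    also have "\<dots> = (\<integral>y. (\<integral>x. P1 (x, y) \<partial>lborel) \<partial>lborel)"
      using lborel_pair.integral_snd[OF i] by simp
    also have "\<dots> = 0" by (simp add: inner)
    finally show ?thesis .
  qed
  show "(\<integral>x. P1 x \<partial>lborel) = 0" if "\<And>x y. ((\<lambda>t. P (x, t)) has_real_derivative P1 (x, y)) (at y)"
  proof -
    have inner: "(\<integral>y. P1 (x, y) \<partial>lborel) = 0" for x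
      by (rule line[of _ "\<lambda>t. P (x, t)"]) (use that far in \<open>auto intro!: continuous_on_slices c\<close>)
    have "(\<integral>x. P1 x \<partial>lborel) = (\<integral>x. P1 x \<partial>(lborel \<Otimes>\<^sub>M lborel))" by (simp add: lborel_prod)
    also have "\<dots> = (\<integral>x. (\<integral>y. P1 (x, y) \<partial>lborel) \<partial>lborel)"
      using lborel_pair.integral_fst[OF i] by simp
    also have "\<dots> = 0" by (simp add: inner)
    finally show ?thesis .
  qed
qed

lemma ennreal_tendsto_0_mono:
  fixes a b :: "nat \<Rightarrow> ennreal"
  assumes "b \<longlonglongrightarrow> 0" "\<And>n. a n \<le> b n" shows "a \<longlonglongrightarrow> 0"
  by (rule tendsto_sandwich[of "\<lambda>_. 0" a sequentially b]) (use assms in auto)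

text \<open>Derivative of e arctan(t/e). As e tends to 0 it approximates the indicator of {0}
  pointwise, while its antiderivative is bounded by 2 e.\<close>

definition bell :: "real \<Rightarrow> real \<Rightarrow> real" where
  "bell e t = 1 / (1 + (t / e)\<^sup>2)"

lemma bell_bounds: "0 < bell e t" "bell e t \<le> 1"
  using zero_le_power2[of "t / e"] by (auto simp: bell_def field_simps add_pos_nonneg intro!: divide_pos_pos)

lemma bell_continuous: "continuous_on UNIV (bell e)"
  unfolding bell_def divide_inverse
  by (intro continuous_intros) (metis add_pos_nonneg less_irrefl zero_le_power2 zero_less_one)

lemma arctan_scaled_derivative:
  assumes "e > 0" "(h has_real_derivative d) (at t)"
  shows "((\<lambda>t. e * arctan (h t / e)) has_real_derivative bell e (h t) * d) (at t)"
proof -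
  have "((\<lambda>t. h t / e) has_real_derivative d / e) (at t)"
    using assms(2) by (rule DERIV_cdivide)
  from DERIV_chain2[OF DERIV_arctan this]
  have "((\<lambda>t. arctan (h t / e)) has_real_derivative inverse (1 + (h t / e)\<^sup>2) * (d / e)) (at t)" .
  from DERIV_cmult[OF this, of e] show ?thesis
    using assms(1) by (simp add: bell_def divide_simps mult_ac)
qed

text \<open>One partial integration moves the derivative from e arctan(v/e) to the test function;
  arctan is bounded by 2 because pi < 4.\<close>

lemma bell_integration_by_parts:
  assumes v: "smooth v" and ph: "smooth \<phi>" and z: "\<And>x. x \<notin> sq 0 R \<Longrightarrow> \<phi> x = 0" and e: "e > 0"
  shows "\<bar>\<integral>x. \<phi> x * (bell e (v x) * pd1 v x) \<partial>lborel\<bar> \<le> 2 * e * (\<integral>x. \<bar>pd1 \<phi> x\<bar> \<partial>lborel)"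
    and "\<bar>\<integral>x. \<phi> x * (bell e (v x) * pd2 v x) \<partial>lborel\<bar> \<le> 2 * e * (\<integral>x. \<bar>pd2 \<phi> x\<bar> \<partial>lborel)"
proof -
  have cv: "continuous_on UNIV v" and cp: "continuous_on UNIV \<phi>" using v ph smooth_cont by auto
  have at: "\<bar>e * arctan (v x / e)\<bar> \<le> 2 * e" for x
  proof -
    have "\<bar>arctan (v x / e)\<bar> \<le> 2" using arctan_bounded[of "v x / e"] pi_less_4 by (auto simp: abs_le_iff)
    then show ?thesis using e by (simp add: abs_mult)
  qed
  have ca: "continuous_on UNIV (\<lambda>x. e * arctan (v x / e))"
    using e by (intro continuous_intros cv) auto
  have open_c: "open (- sq 0 R)" by (simp add: sq_def open_Compl closed_cbox)
  have cb: "continuous_on UNIV (\<lambda>x. bell e (v x))" by (rule continuous_on_compose2[OF bell_continuous cv]) auto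
  have main: "\<bar>\<integral>x. \<phi> x * (bell e (v x) * dv x) \<partial>lborel\<bar> \<le> 2 * e * (\<integral>x. \<bar>dp x\<bar> \<partial>lborel)"
    if cdv: "continuous_on UNIV dv" and cdp: "continuous_on UNIV dp" and dpz: "\<And>x. x \<notin> sq 0 R \<Longrightarrow> dp x = 0"
      and zero: "(\<integral>x. dp x * (e * arctan (v x / e)) + \<phi> x * (bell e (v x) * dv x) \<partial>lborel) = 0" for dv dp
  proof -
    have i1: "integrable lborel (\<lambda>x. dp x * (e * arctan (v x / e)))"
      by (rule integral_eq_integral_sq(2)[where c=0 and r=R]) (use dpz in \<open>auto intro!: continuous_on_mult cdp ca\<close>)
    have i2: "integrable lborel (\<lambda>x. \<phi> x * (bell e (v x) * dv x))"
      by (rule integral_eq_integral_sq(2)[where c=0 and r=R]) (use z in \<open>auto intro!: continuous_on_mult cdv cp cb\<close>)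
    have i3: "integrable lborel (\<lambda>x. \<bar>dp x\<bar>)"
      by (rule integral_eq_integral_sq(2)[where c=0 and r=R]) (use dpz in \<open>auto intro!: continuous_intros cdp\<close>)
    have "(\<integral>x. \<phi> x * (bell e (v x) * dv x) \<partial>lborel) = - (\<integral>x. dp x * (e * arctan (v x / e)) \<partial>lborel)"
      using zero Bochner_Integration.integral_add[OF i1 i2] by simp
    then have "\<bar>\<integral>x. \<phi> x * (bell e (v x) * dv x) \<partial>lborel\<bar> = norm (\<integral>x. dp x * (e * arctan (v x / e)) \<partial>lborel)" by simp
    also have "\<dots> \<le> (\<integral>x. norm (dp x * (e * arctan (v x / e))) \<partial>lborel)" by (rule integral_norm_bound)
    also have "\<dots> \<le> (\<integral>x. (2 * e) * \<bar>dp x\<bar> \<partial>lborel)"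
    proof (rule integral_mono)
      fix x
      have "\<bar>dp x\<bar> * \<bar>e * arctan (v x / e)\<bar> \<le> \<bar>dp x\<bar> * (2 * e)" by (intro mult_left_mono at) auto
      then show "norm (dp x * (e * arctan (v x / e))) \<le> (2 * e) * \<bar>dp x\<bar>" by (simp only: real_norm_def abs_mult mult.commute)
    qed (use i1 i3 in auto)
    finally show ?thesis by simp
  qed
  have pz: "pd1 \<phi> x = 0" "pd2 \<phi> x = 0" if "x \<notin> sq 0 R" for x
    using pd_cong_open[OF open_c, of x \<phi> "\<lambda>x. 0"] that z by (auto simp: pd_const)
  have c: "continuous_on UNIV (pd1 v)" "continuous_on UNIV (pd2 v)" "continuous_on UNIV (pd1 \<phi>)" "continuous_on UNIV (pd2 \<phi>)"
    using smooth_cont[OF smooth_pd1[OF v]] smooth_cont[OF smooth_pd2[OF v]] smooth_cont[OF smooth_pd1[OF ph]] smooth_cont[OF smooth_pd2[OF ph]] by auto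
  show "\<bar>\<integral>x. \<phi> x * (bell e (v x) * pd1 v x) \<partial>lborel\<bar> \<le> 2 * e * (\<integral>x. \<bar>pd1 \<phi> x\<bar> \<partial>lborel)"
  proof (rule main[OF c(1) c(3) pz(1)])
    show "(\<integral>x. pd1 \<phi> x * (e * arctan (v x / e)) + \<phi> x * (bell e (v x) * pd1 v x) \<partial>lborel) = 0"
    proof (rule integral_pd_zero(1)[where R=R and P="\<lambda>x. \<phi> x * (e * arctan (v x / e))"])
      show "((\<lambda>t. \<phi> (t, y) * (e * arctan (v (t, y) / e))) has_real_derivative
        pd1 \<phi> (x, y) * (e * arctan (v (x, y) / e)) + \<phi> (x, y) * (bell e (v (x, y)) * pd1 v (x, y))) (at x)" for x y
        using DERIV_mult'[OF smooth_has_pd1[OF ph] arctan_scaled_derivative[OF e smooth_has_pd1[OF v, of y x]], of y] by (simp add: add.commute)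
    qed (use z pz in \<open>auto intro!: continuous_on_add continuous_on_mult c ca cp cb\<close>)
  qed
  show "\<bar>\<integral>x. \<phi> x * (bell e (v x) * pd2 v x) \<partial>lborel\<bar> \<le> 2 * e * (\<integral>x. \<bar>pd2 \<phi> x\<bar> \<partial>lborel)"
  proof (rule main[OF c(2) c(4) pz(2)])
    show "(\<integral>x. pd2 \<phi> x * (e * arctan (v x / e)) + \<phi> x * (bell e (v x) * pd2 v x) \<partial>lborel) = 0"
    proof (rule integral_pd_zero(2)[where R=R and P="\<lambda>x. \<phi> x * (e * arctan (v x / e))"])
      show "((\<lambda>t. \<phi> (x, t) * (e * arctan (v (x, t) / e))) has_real_derivative
        pd2 \<phi> (x, y) * (e * arctan (v (x, y) / e)) + \<phi> (x, y) * (bell e (v (x, y)) * pd2 v (x, y))) (at y)" for x y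
        using DERIV_mult'[OF smooth_has_pd2[OF ph] arctan_scaled_derivative[OF e smooth_has_pd2[OF v, of x y]], of x] by (simp add: add.commute)
    qed (use z pz in \<open>auto intro!: continuous_on_add continuous_on_mult c ca cp cb\<close>)
  qed
qed

lemma bell_tendsto_indicator:
  "(\<lambda>k. bell (inverse (real (Suc k))) t) \<longlonglongrightarrow> indicator {0} t"
proof (cases "t = 0")
  case False
  have "filterlim (\<lambda>k. real (Suc k)) at_top sequentially"
    by (rule filterlim_compose[OF filterlim_real_sequentially filterlim_Suc])
  then have "filterlim (\<lambda>k. real (Suc k) ^ 2) at_top sequentially"
    by (intro filterlim_pow_at_top) auto
  then have "filterlim (\<lambda>k. t\<^sup>2 * real (Suc k) ^ 2) at_top sequentially"
    using False by (intro filterlim_tendsto_pos_mult_at_top[OF tendsto_const]) auto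
  then have "filterlim (\<lambda>k. 1 + t\<^sup>2 * real (Suc k) ^ 2) at_top sequentially"
    by (intro filterlim_tendsto_add_at_top[OF tendsto_const])
  then have "((\<lambda>k. inverse (1 + t\<^sup>2 * real (Suc k) ^ 2)) \<longlongrightarrow> 0) sequentially"
    by (rule tendsto_inverse_0_at_top)
  then show ?thesis using False by (simp add: bell_def power_mult_distrib inverse_eq_divide)
qed (simp add: bell_def)

text \<open>Integration by parts against \<open>bell e (v x)\<close> gives a bound of order e,
  uniform in the mollification. Removing the mollification and then letting e tend to 0 turns the
  bell into the indicator of the zero set, so all means of \<open>w\<close> restricted to that set
  vanish. The derivative relation is assumed for the mollifications, the form in which
  \<open>Dm_U\<close> supplies it.\<close>

lemma weak_gradient_zero_AE:
  assumes v: "continuous_on UNIV v" "\<And>x. x \<notin> sq 0 R \<Longrightarrow> v x = 0" and w: "locint w"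
    and pd: "(\<forall>\<delta>>0. pd1 (moll \<delta> v) = moll \<delta> w) \<or> (\<forall>\<delta>>0. pd2 (moll \<delta> v) = moll \<delta> w)"
  shows "AE x in lborel. v x = 0 \<longrightarrow> w x = 0"
proof -
  have [measurable]: "w \<in> borel_measurable borel" using w by (simp add: locint_def)
  have [measurable]: "v \<in> borel_measurable borel" using v(1) by (rule borel_measurable_continuous_onI)
  have [measurable]: "bell e \<in> borel_measurable borel" for e by (rule borel_measurable_continuous_onI[OF bell_continuous])
  define w1 where "w1 x = w x * indicator {0} (v x)" for x
  have [measurable]: "w1 \<in> borel_measurable borel" unfolding w1_def by measurable
  have l1: "locint w1"
    unfolding locint_def
  proof (intro conjI allI)
    fix c r
    have i: "integrable lborel (\<lambda>x. w x * indicator (sq c r) x)" using w unfolding locint_def by blast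
    show "integrable lborel (\<lambda>x. w1 x * indicator (sq c r) x)"
      by (rule Bochner_Integration.integrable_bound[OF i]) (auto simp: w1_def indicator_def)
  qed measurable
  define d where "d n = inverse (real (Suc n))" for n
  have d: "d n > 0" "d \<longlonglongrightarrow> 0" for n
    using LIMSEQ_inverse_real_of_nat by (auto simp: d_def[abs_def])
  have sm: "smooth (moll (d n) v)" for n by (rule smooth_moll[OF v(1)]) (rule v(2))
  have cm: "continuous_on UNIV (moll (d n) v)" for n by (rule smooth_cont[OF sm])
  have vlim: "(\<lambda>n. moll (d n) v x) \<longlonglongrightarrow> v x" for x
  proof (rule LIMSEQ_I)
    fix e :: real assume e: "e > 0"
    then have e2: "e / 2 > 0" by simp
    obtain \<delta>0 where d0: "\<delta>0 > 0" "\<And>\<delta> x. 0 < \<delta> \<Longrightarrow> \<delta> < \<delta>0 \<Longrightarrow> \<bar>moll \<delta> v x - v x\<bar> \<le> e / 2"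
      by (rule moll_uniform_limit[OF v(1) _ e2, of R]) (use v(2) in auto)
    have "\<forall>\<^sub>F n in sequentially. d n < \<delta>0" by (rule order_tendstoD(2)[OF d(2) d0(1)])
    then obtain N where N: "\<And>n. n \<ge> N \<Longrightarrow> d n < \<delta>0" by (auto simp: eventually_sequentially)
    have "norm (moll (d n) v x - v x) < e" if "n \<ge> N" for n
    proof -
      have "\<bar>moll (d n) v x - v x\<bar> \<le> e / 2" by (rule d0(2)[OF d(1) N[OF that]])
      then show ?thesis using e unfolding real_norm_def by linarith
    qed
    then show "\<exists>N. \<forall>n\<ge>N. norm (moll (d n) v x - v x) < e" by blast
  qed
  have "AE x in lborel. w1 x = 0"
  proof (rule moll_zero_AE[OF l1])
    fix \<delta>' :: real and x0 :: "real \<times> real" assume d': "\<delta>' > 0"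
    define f where "f = ker \<delta>' x0"
    define S where "S = \<bar>fst x0\<bar> + \<bar>snd x0\<bar> + 2 * \<delta>'"
    have fs: "smooth f" unfolding f_def by (rule ker_smooth[OF d'])
    have [measurable]: "f \<in> borel_measurable borel" by (rule borel_measurable_continuous_onI[OF smooth_cont[OF fs]])
    have fz: "f x = 0" if "x \<notin> sq 0 S" for x
    proof (rule ccontr)
      assume "f x \<noteq> 0"
      then have "x \<in> sq x0 (2 * \<delta>')" using ker_support_sq[OF d'] by (simp add: f_def)
      then show False using that by (auto simp: mem_sq S_def)
    qed
    define B where "B = 1 / \<delta>'\<^sup>2"
    have fb: "0 \<le> f x" "f x \<le> B" for x by (auto simp: f_def ker_nonneg ker_le B_def)
    have int: "integrable lborel (\<lambda>x. f x * (k x * h x))"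
      if "locint h" "k \<in> borel_measurable borel" "\<And>x. \<bar>k x\<bar> \<le> 2" for h k
    proof -
      have "integrable lborel (\<lambda>x. h x * (f x * k x))"
      proof (rule locint_mult_bounded[OF that(1), where B="B * 2" and c=0 and r=S])
        fix x show "\<bar>f x * k x\<bar> \<le> B * 2" unfolding abs_mult using fb[of x] that(3)[of x] by (intro mult_mono) auto
      qed (use fz that(2) in auto)
      then show ?thesis by (simp add: mult_ac)
    qed
    define c0 where "c0 = max (\<integral>x. \<bar>pd1 f x\<bar> \<partial>lborel) (\<integral>x. \<bar>pd2 f x\<bar> \<partial>lborel)"
    have wm: "locint (moll (d n) w)" for n
    proof -
      have "continuous_on UNIV (moll (d n) w)"
        using pd d(1)[of n] smooth_cont[OF smooth_pd1[OF sm[of n]]] smooth_cont[OF smooth_pd2[OF sm[of n]]] by metis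
      then show ?thesis by (rule locint_continuous)
    qed
    have bound: "\<bar>\<integral>x. f x * (bell e (moll (d n) v x) * moll (d n) w x) \<partial>lborel\<bar> \<le> 2 * e * c0" if e: "e > 0" for n e
    proof -
      have b1: "\<bar>\<integral>x. f x * (bell e (moll (d n) v x) * pd1 (moll (d n) v) x) \<partial>lborel\<bar> \<le> 2 * e * (\<integral>x. \<bar>pd1 f x\<bar> \<partial>lborel)"
        by (rule bell_integration_by_parts(1)[OF sm fs _ e]) (rule fz)
      have b2: "\<bar>\<integral>x. f x * (bell e (moll (d n) v x) * pd2 (moll (d n) v) x) \<partial>lborel\<bar> \<le> 2 * e * (\<integral>x. \<bar>pd2 f x\<bar> \<partial>lborel)"
        by (rule bell_integration_by_parts(2)[OF sm fs _ e]) (rule fz)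
      have "2 * e * (\<integral>x. \<bar>pd1 f x\<bar> \<partial>lborel) \<le> 2 * e * c0" "2 * e * (\<integral>x. \<bar>pd2 f x\<bar> \<partial>lborel) \<le> 2 * e * c0"
        using e by (auto simp: c0_def)
      moreover have "pd1 (moll (d n) v) = moll (d n) w \<or> pd2 (moll (d n) v) = moll (d n) w" using pd d(1)[of n] by blast
      ultimately show ?thesis using b1 b2 by auto
    qed
    \<comment> \<open>At fixed e the bound survives the removal of the mollification: the mollified
      \<open>w\<close> is replaced at an L^1 cost since the bell is at most 1, then the mollified
      \<open>v\<close> by dominated convergence.\<close>
    have L: "\<bar>\<integral>x. f x * (bell e (v x) * w x) \<partial>lborel\<bar> \<le> 2 * e * c0" if e: "e > 0" for e
    proof -
      have bm [measurable]: "(\<lambda>x. bell e (moll (d n) v x)) \<in> borel_measurable borel" "(\<lambda>x. bell e (v x)) \<in> borel_measurable borel" for n by measurable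
      have bb: "\<bar>bell e t\<bar> \<le> 2" "\<bar>bell e s - bell e t\<bar> \<le> 2" for s t
        using bell_bounds[of e t] bell_bounds[of e s] by auto
      have t1: "(\<lambda>n. \<integral>x. f x * (bell e (moll (d n) v x) * (moll (d n) w x - w x)) \<partial>lborel) \<longlonglongrightarrow> 0"
      proof -
        have "(\<lambda>n. ennreal B * (\<integral>\<^sup>+x. ennreal \<bar>moll (d n) w x - w x\<bar> * indicator (sq 0 S) x \<partial>lborel)) \<longlonglongrightarrow> ennreal B * 0"
          by (intro ennreal_tendsto_cmult moll_L1_local w d) auto
        then have lim: "(\<lambda>n. ennreal B * (\<integral>\<^sup>+x. ennreal \<bar>moll (d n) w x - w x\<bar> * indicator (sq 0 S) x \<partial>lborel)) \<longlonglongrightarrow> 0"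
          by simp
        have le: "ennreal (norm (\<integral>x. f x * (bell e (moll (d n) v x) * (moll (d n) w x - w x)) \<partial>lborel))
          \<le> ennreal B * (\<integral>\<^sup>+x. ennreal \<bar>moll (d n) w x - w x\<bar> * indicator (sq 0 S) x \<partial>lborel)" for n
        proof -
          have "ennreal (norm (\<integral>x. f x * (bell e (moll (d n) v x) * (moll (d n) w x - w x)) \<partial>lborel))
            \<le> (\<integral>\<^sup>+x. ennreal (norm (f x * (bell e (moll (d n) v x) * (moll (d n) w x - w x)))) \<partial>lborel)"
            by (intro integral_norm_bound_ennreal int locint_diff wm w bm bb)
          also have "\<dots> \<le> (\<integral>\<^sup>+x. ennreal B * (ennreal \<bar>moll (d n) w x - w x\<bar> * indicator (sq 0 S) x) \<partial>lborel)"
          proof (rule nn_integral_mono)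
            fix x
            show "ennreal (norm (f x * (bell e (moll (d n) v x) * (moll (d n) w x - w x)))) \<le> ennreal B * (ennreal \<bar>moll (d n) w x - w x\<bar> * indicator (sq 0 S) x)"
            proof (cases "x \<in> sq 0 S")
              case True
              have "norm (f x * (bell e (moll (d n) v x) * (moll (d n) w x - w x))) \<le> B * (1 * \<bar>moll (d n) w x - w x\<bar>)"
                unfolding real_norm_def abs_mult using fb[of x] bell_bounds[of e "moll (d n) v x"] by (intro mult_mono) auto
              then show ?thesis using True fb[of x] by (simp add: ennreal_leI flip: ennreal_mult)
            qed (simp add: fz)
          qed
          also have "\<dots> = ennreal B * (\<integral>\<^sup>+x. ennreal \<bar>moll (d n) w x - w x\<bar> * indicator (sq 0 S) x \<partial>lborel)"
            by (rule nn_integral_cmult) measurable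
          finally show ?thesis .
        qed
        have "(\<lambda>n. ennreal (norm (\<integral>x. f x * (bell e (moll (d n) v x) * (moll (d n) w x - w x)) \<partial>lborel))) \<longlonglongrightarrow> ennreal 0"
          using ennreal_tendsto_0_mono[OF lim le] by simp
        then have "(\<lambda>n. norm (\<integral>x. f x * (bell e (moll (d n) v x) * (moll (d n) w x - w x)) \<partial>lborel)) \<longlonglongrightarrow> 0"
          by (rule tendsto_ennrealD) auto
        then show ?thesis by (rule tendsto_norm_zero_cancel)
      qed
      have t2: "(\<lambda>n. \<integral>x. f x * ((bell e (moll (d n) v x) - bell e (v x)) * w x) \<partial>lborel) \<longlonglongrightarrow> (\<integral>x. 0 \<partial>(lborel :: (real \<times> real) measure))"
      proof (rule integral_dominated_convergence[where w="\<lambda>x. norm (f x * (2 * w x))"])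
        show "integrable lborel (\<lambda>x. norm (f x * (2 * w x)))" by (intro integrable_norm int w) auto
        show "AE x in lborel. (\<lambda>n. f x * ((bell e (moll (d n) v x) - bell e (v x)) * w x)) \<longlonglongrightarrow> 0"
        proof (rule AE_I2)
          fix x
          have "(\<lambda>n. bell e (moll (d n) v x)) \<longlonglongrightarrow> bell e (v x)"
            by (rule continuous_on_tendsto_compose[OF bell_continuous vlim]) auto
          then have "(\<lambda>n. f x * ((bell e (moll (d n) v x) - bell e (v x)) * w x)) \<longlonglongrightarrow> f x * ((bell e (v x) - bell e (v x)) * w x)"
            by (intro tendsto_intros)
          then show "(\<lambda>n. f x * ((bell e (moll (d n) v x) - bell e (v x)) * w x)) \<longlonglongrightarrow> 0" by simp
        qed
        show "AE x in lborel. norm (f x * ((bell e (moll (d n) v x) - bell e (v x)) * w x)) \<le> norm (f x * (2 * w x))" for n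
          unfolding norm_mult by (intro AE_I2 mult_left_mono mult_right_mono) (auto simp: bb)
      qed measurable
      have eq: "(\<integral>x. f x * (bell e (moll (d n) v x) * moll (d n) w x) \<partial>lborel) =
        (\<integral>x. f x * (bell e (moll (d n) v x) * (moll (d n) w x - w x)) \<partial>lborel) + (\<integral>x. f x * ((bell e (moll (d n) v x) - bell e (v x)) * w x) \<partial>lborel)
        + (\<integral>x. f x * (bell e (v x) * w x) \<partial>lborel)" for n
      proof -
        have i: "integrable lborel (\<lambda>x. f x * (bell e (moll (d n) v x) * (moll (d n) w x - w x)))"
          "integrable lborel (\<lambda>x. f x * ((bell e (moll (d n) v x) - bell e (v x)) * w x))"
          "integrable lborel (\<lambda>x. f x * (bell e (v x) * w x))"
          by (intro int locint_diff wm w borel_measurable_diff bm bb)+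
        show ?thesis
          unfolding Bochner_Integration.integral_add[OF i(1,2), symmetric] Bochner_Integration.integral_add[OF Bochner_Integration.integrable_add[OF i(1,2)] i(3), symmetric]
          by (rule Bochner_Integration.integral_cong) (auto simp: algebra_simps)
      qed
      have "(\<lambda>n. \<integral>x. f x * (bell e (moll (d n) v x) * moll (d n) w x) \<partial>lborel) \<longlonglongrightarrow> 0 + 0 + (\<integral>x. f x * (bell e (v x) * w x) \<partial>lborel)"
        unfolding eq using t2 by (intro tendsto_add t1 tendsto_const) simp
      then have "(\<lambda>n. \<bar>\<integral>x. f x * (bell e (moll (d n) v x) * moll (d n) w x) \<partial>lborel\<bar>) \<longlonglongrightarrow> \<bar>\<integral>x. f x * (bell e (v x) * w x) \<partial>lborel\<bar>"
        by (intro tendsto_rabs) simp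
      then show ?thesis by (rule LIMSEQ_le_const2) (use bound[OF e] in auto)
    qed
    have "(\<lambda>k. \<integral>x. f x * (bell (d k) (v x) * w x) \<partial>lborel) \<longlonglongrightarrow> (\<integral>x. f x * (indicator {0} (v x) * w x) \<partial>lborel)"
    proof (rule integral_dominated_convergence[where w="\<lambda>x. norm (f x * (1 * w x))"])
      show "integrable lborel (\<lambda>x. norm (f x * (1 * w x)))" by (intro integrable_norm int w) auto
      show "AE x in lborel. (\<lambda>k. f x * (bell (d k) (v x) * w x)) \<longlonglongrightarrow> f x * (indicator {0} (v x) * w x)"
        unfolding d_def by (intro AE_I2 tendsto_intros bell_tendsto_indicator)
      show "AE x in lborel. norm (f x * (bell (d n) (v x) * w x)) \<le> norm (f x * (1 * w x))" for n
        unfolding norm_mult using bell_bounds[of "d n"] by (intro AE_I2 mult_left_mono mult_right_mono) (auto simp: less_imp_le)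
    qed measurable
    then have "(\<lambda>k. \<bar>\<integral>x. f x * (bell (d k) (v x) * w x) \<partial>lborel\<bar>) \<longlonglongrightarrow> \<bar>\<integral>x. f x * (indicator {0} (v x) * w x) \<partial>lborel\<bar>"
      by (intro tendsto_rabs)
    moreover have "(\<lambda>k. 2 * d k * c0) \<longlonglongrightarrow> 2 * 0 * c0" by (intro tendsto_intros d)
    ultimately have "\<bar>\<integral>x. f x * (indicator {0} (v x) * w x) \<partial>lborel\<bar> \<le> 2 * 0 * c0"
      by (rule LIMSEQ_le) (use L d in auto)
    moreover have "moll \<delta>' w1 x0 = (\<integral>x. f x * (indicator {0} (v x) * w x) \<partial>lborel)"
      unfolding moll_def w1_def f_def by (rule Bochner_Integration.integral_cong) (auto simp: mult_ac)
    ultimately show "moll \<delta>' w1 x0 = 0" by simp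
  qed
  then show ?thesis by eventually_elim (auto simp: w1_def indicator_def)
qed

section \<open>The stream function\<close>

text \<open>\<open>g True j\<close> and \<open>g False j\<close> are the weak derivatives of the first and second component of the field.\<close>

locale divfree =
  fixes m :: nat and p R :: real and K :: "(real \<times> real) set" and g :: "bool \<Rightarrow> nat \<times> nat \<Rightarrow> real \<times> real \<Rightarrow> real"
  assumes m: "m \<ge> 1" and p: "p > 2" and R: "R > 0"
    and K: "closed K" "\<And>x. x \<notin> sq 0 R \<Longrightarrow> x \<in> K"
    and cont: "\<And>i j. order j < m \<Longrightarrow> continuous_on UNIV (g i j)"
    and zero: "\<And>i j x. order j < m \<Longrightarrow> x \<in> K \<Longrightarrow> g i j x = 0"
    and meas: "\<And>i j. order j \<le> m \<Longrightarrow> g i j \<in> borel_measurable borel"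
    and Lpg: "\<And>i j. order j \<le> m \<Longrightarrow> (\<integral>\<^sup>+x. ennreal (\<bar>g i j x\<bar> powr p) \<partial>lborel) < \<infinity>"
    and wd: "\<And>i j. order j \<le> m \<Longrightarrow> wderiv j (g i (0, 0)) (g i j)"
    and divf: "\<And>\<phi>. smooth \<phi> \<Longrightarrow> compact (csupp \<phi>) \<Longrightarrow>
      (\<integral>x. g True (0, 0) x * pd1 \<phi> x + g False (0, 0) x * pd2 \<phi> x \<partial>lborel) = 0"
begin

lemma order00: "order (0, 0) < m" "order (0, 0) \<le> m"
  using m by (auto simp: order_def)

lemma g_zero_off: "order j < m \<Longrightarrow> x \<notin> sq 0 R \<Longrightarrow> g i j x = 0"
  using zero K(2) by blast

definition U :: "bool \<Rightarrow> real \<Rightarrow> real \<times> real \<Rightarrow> real" where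
  "U i \<delta> = moll \<delta> (g i (0, 0))"

lemma smooth_U: "smooth (U i \<delta>)"
  unfolding U_def by (rule smooth_moll[OF cont[OF order00(1)]]) (rule g_zero_off[OF order00(1)])

lemma Dm_U: "\<delta> > 0 \<Longrightarrow> order j \<le> m \<Longrightarrow> Dm j (U i \<delta>) = moll \<delta> (g i j)"
  unfolding U_def
  by (rule ext, rule Dm_moll_wderiv[OF cont[OF order00(1)] _ _ wd, where R=R]) (auto intro: g_zero_off[OF order00(1)])

lemma U_zero_off:
  assumes "0 < \<delta>" "\<delta> \<le> 1" "x \<notin> sq 0 (R + 2)" shows "U i \<delta> x = 0"
proof -
  have "U i \<delta> x = moll \<delta> (\<lambda>y. 0) x"
    unfolding U_def
  proof (rule moll_cong_local[OF assms(1)])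
    fix y assume "y \<in> sq x (2 * \<delta>)"
    then have "y \<notin> sq 0 R" using assms by (auto simp: mem_sq)
    then show "g i (0, 0) y = 0" by (rule g_zero_off[OF order00(1)])
  qed
  then show ?thesis using assms by (simp add: moll_const)
qed

text \<open>The divergence at \<open>x\<close> is tested with the kernel as a function of
  \<open>y\<close>; passing from derivatives in \<open>x\<close> to derivatives in \<open>y\<close>
  only changes the sign.\<close>

lemma U_div_free:
  assumes d: "\<delta> > 0" shows "pd1 (U True \<delta>) x + pd2 (U False \<delta>) x = 0"
proof -
  have c: "continuous_on UNIV (g i (0, 0))" for i by (rule cont[OF order00(1)])
  have k: "smooth (ker \<delta> x)" by (rule ker_smooth[OF d])
  have conv_eq: "moll \<delta> (g i (0,0)) = conv (0 - (R, R)) (0 + (R, R)) (1 / \<delta>) (g i (0,0)) (\<lambda>z. (1 / \<delta>\<^sup>2) * eta z)" for i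
    by (rule moll_eq_conv[OF c]) (rule g_zero_off[OF order00(1)])
  have sk: "smooth (\<lambda>z. (1 / \<delta>\<^sup>2) * eta z)" by (intro smooth_mult smooth_const smooth_eta)
  have ck: "continuous_on UNIV (Dm j (ker \<delta> x))" for j by (rule smooth_cont[OF smooth_Dm[OF k]])
  have D: "Dm j (U i \<delta>) x = - (\<integral>y. g i (0, 0) y * Dm j (ker \<delta> x) y \<partial>lborel)" if j: "order j = 1" for i j
  proof -
    have "Dm j (U i \<delta>) x = integral (sq 0 R) (\<lambda>y. g i (0,0) y * ((1 / \<delta>) ^ order j * Dm j (\<lambda>z. (1 / \<delta>\<^sup>2) * eta z) ((1 / \<delta>) *\<^sub>R (x - y))))"
      unfolding U_def conv_eq Dm_conv[OF c sk] by (simp add: conv_def sq_def)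
    also have "\<dots> = integral (sq 0 R) (\<lambda>y. - (g i (0,0) y * Dm j (ker \<delta> x) y))"
      unfolding ker_smooth(3)[OF d] Dm_cmult[OF smooth_eta] j by simp
    also have "\<dots> = (\<integral>y. - (g i (0,0) y * Dm j (ker \<delta> x) y) \<partial>lborel)"
      by (rule integral_eq_integral_sq(1)[symmetric])
        (use g_zero_off[OF order00(1)] in \<open>auto intro!: continuous_on_minus continuous_on_mult c ck\<close>)
    finally show ?thesis by simp
  qed
  have i: "integrable lborel (\<lambda>y. g i (0,0) y * Dm j (ker \<delta> x) y)" for i j
    by (rule integral_eq_integral_sq(2)[where c=0 and r=R])
        (use g_zero_off[OF order00(1)] in \<open>auto intro!: continuous_on_mult c ck\<close>)
  have e: "Dm (1, 0) f = pd1 f" "Dm (0, 1) f = pd2 f" for f by (auto simp: Dm_def)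
  have "pd1 (U True \<delta>) x + pd2 (U False \<delta>) x =
    - ((\<integral>y. g True (0, 0) y * pd1 (ker \<delta> x) y \<partial>lborel) + (\<integral>y. g False (0, 0) y * pd2 (ker \<delta> x) y \<partial>lborel))"
    using D[of "(1, 0)" True] D[of "(0, 1)" False] by (simp add: e[unfolded One_nat_def] order_def)
  also have "\<dots> = - (\<integral>y. g True (0, 0) y * pd1 (ker \<delta> x) y + g False (0, 0) y * pd2 (ker \<delta> x) y \<partial>lborel)"
    using Bochner_Integration.integral_add[OF i[of True "(1, 0)"] i[of False "(0, 1)"]] by (simp add: e[unfolded One_nat_def])
  also have "\<dots> = 0" using divf[OF k ker_smooth(2)[OF d]] by simp
  finally show ?thesis .
qed

text \<open>The mollified fields with \<delta> at most 1 live in the square of radius R + 2, so the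
  ordinate -S lies strictly below their support.\<close>

definition S :: real where "S = R + 3"

definition psi :: "real \<Rightarrow> real \<times> real \<Rightarrow> real" where
  "psi \<delta> x = integral {- S..snd x} (\<lambda>t. U True \<delta> (fst x, t))"

text \<open>The limit object itself. It is never differentiated; what is needed about it is obtained
  from \<open>psi\<close> by uniform convergence.\<close>

definition Psi :: "real \<times> real \<Rightarrow> real" where
  "Psi x = integral {- S..snd x} (\<lambda>t. g True (0, 0) (fst x, t))"

context
  fixes \<delta> :: real
  assumes d: "0 < \<delta>" "\<delta> \<le> 1"
begin

lemma U_zero_edge: "\<bar>t\<bar> > R + 2 \<Longrightarrow> U i \<delta> (x, t) = 0" "\<bar>t\<bar> > R + 2 \<Longrightarrow> U i \<delta> (t, x) = 0"
  using U_zero_off[OF d, of "(x, t)"] U_zero_off[OF d, of "(t, x)"] by (auto simp: mem_sq)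

lemma psi_has_pd2: "((\<lambda>t. psi \<delta> (x, t)) has_real_derivative U True \<delta> (x, y)) (at y)"
proof (cases "y > - S")
  case True
  have "((\<lambda>t. integral {- S..t} (\<lambda>t. U True \<delta> (x, t))) has_real_derivative U True \<delta> (x, y)) (at y within {- S..y + 1})"
    by (rule integral_has_real_derivative) (use True in \<open>auto intro!: continuous_on_slices smooth_cont smooth_U\<close>)
  then show ?thesis using True by (simp add: psi_def at_within_Icc_at)
next
  case False
  \<comment> \<open>The stream function vanishes identically below the support. The half-line of
    ordinates is open and contains -S, where the integral formula changes its form.\<close>
  have z: "psi \<delta> (x, t) = 0" if "t \<in> {..< - R - 2}" for t
  proof -
    have "psi \<delta> (x, t) = integral {- S..t} (\<lambda>t. 0)"
      unfolding psi_def fst_conv snd_conv by (rule integral_cong) (use that in \<open>auto intro!: U_zero_edge(1)\<close>)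
    then show ?thesis by simp
  qed
  have "((\<lambda>t. 0) has_real_derivative U True \<delta> (x, y)) (at y)"
    using U_zero_edge(1)[of y True x] False R by (simp add: S_def)
  then show ?thesis
    by (rule has_field_derivative_transform_within_open[where S="{..< - R - 2}"])
      (use False in \<open>simp_all add: S_def z\<close>)
qed

lemma psi_has_pd1: "((\<lambda>t. psi \<delta> (t, y)) has_real_derivative - U False \<delta> (x, y)) (at x)"
proof (cases "y \<ge> - S")
  case True
  have c: "continuous_on UNIV (pd1 (U True \<delta>))" by (rule smooth_cont[OF smooth_pd1[OF smooth_U]])
  have "((\<lambda>t. integral (cbox (- S) y) (\<lambda>s. U True \<delta> (t, s))) has_field_derivative integral (cbox (- S) y) (\<lambda>s. pd1 (U True \<delta>) (x, s))) (at x within UNIV)"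
  proof (rule leibniz_rule_field_derivative)
    show "((\<lambda>t. U True \<delta> (t, s)) has_field_derivative pd1 (U True \<delta>) (t, s)) (at t within UNIV)" for t s
      by (rule smooth_has_pd1[OF smooth_U])
    show "(\<lambda>s. U True \<delta> (t, s)) integrable_on cbox (- S) y" for t
      by (intro integrable_continuous continuous_on_slices smooth_cont smooth_U)
    show "continuous_on (UNIV \<times> cbox (- S) y) (\<lambda>(t, s). pd1 (U True \<delta>) (t, s))"
      by (auto intro: continuous_on_subset[OF c])
  qed auto
  moreover have "integral (cbox (- S) y) (\<lambda>s. pd1 (U True \<delta>) (x, s)) = - U False \<delta> (x, y)"
  proof -
    have "((\<lambda>s. pd2 (U False \<delta>) (x, s)) has_integral (U False \<delta> (x, y) - U False \<delta> (x, - S))) {- S..y}"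
      by (rule fundamental_theorem_of_calculus[OF True])
        (auto simp flip: has_real_derivative_iff_has_vector_derivative intro!: has_field_derivative_at_within smooth_has_pd2[OF smooth_U])
    moreover have "U False \<delta> (x, - S) = 0" using R by (intro U_zero_edge) (simp add: S_def)
    ultimately have "((\<lambda>s. - pd2 (U False \<delta>) (x, s)) has_integral - U False \<delta> (x, y)) {- S..y}"
      by (intro has_integral_neg) simp
    moreover have eq: "pd1 (U True \<delta>) (x, s) = - pd2 (U False \<delta>) (x, s)" for s
      using U_div_free[OF d(1), of "(x, s)"] by linarith
    ultimately show ?thesis unfolding eq cbox_interval by (intro integral_unique)
  qed
  ultimately show ?thesis by (simp add: psi_def)
next
  case False
  then have "psi \<delta> (t, y) = 0" for t by (simp add: psi_def)
  moreover have "U False \<delta> (x, y) = 0" using False R by (intro U_zero_edge) (simp add: S_def)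
  ultimately show ?thesis by simp
qed

lemma pd_psi: "pd1 (psi \<delta>) = (\<lambda>x. - U False \<delta> x)" "pd2 (psi \<delta>) = U True \<delta>"
  by (rule pd1_unique[OF psi_has_pd1], rule pd2_unique[OF psi_has_pd2])

text \<open>Above the support \<open>psi\<close> is the total flux through a vertical line. It does
  not depend on the line, since the horizontal derivative is minus the second component of the field
  and thus 0 there, and it is 0 for lines that miss the support.\<close>

lemma psi_zero_left: "x \<notin> sq 0 (R + 2) \<Longrightarrow> psi \<delta> x = 0"
proof -
  have lr: "psi \<delta> (x, y) = 0" if "\<bar>x\<bar> > R + 2" for x y
    unfolding psi_def using U_zero_edge(2)[OF that] by simp
  have low: "psi \<delta> (x, y) = 0" if "y < - (R + 2)" for x y
  proof -
    have "psi \<delta> (x, y) = integral {- S..y} (\<lambda>t. 0)"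
      unfolding psi_def fst_conv snd_conv by (rule integral_cong) (use that in \<open>auto intro!: U_zero_edge(1)\<close>)
    then show ?thesis by simp
  qed
  have high: "psi \<delta> (x, y) = 0" if "y > R + 2" for x y
  proof -
    have c: "\<forall>t. ((\<lambda>t. psi \<delta> (t, y)) has_real_derivative 0) (at t)"
      using psi_has_pd1[of y] U_zero_edge(1)[of y False] that R by simp
    have "psi \<delta> (x, y) = psi \<delta> (R + 3, y)"
      by (rule DERIV_isconst_all[OF c])
    also have "\<dots> = 0" using R by (intro lr) simp
    finally show ?thesis .
  qed
  show "x \<notin> sq 0 (R + 2) \<Longrightarrow> psi \<delta> x = 0"
    by (cases x) (auto simp: mem_sq abs_le_iff not_le intro: lr low high)
qed

text \<open>Existence of partial derivatives does not give continuity; that comes from total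
  differentiability, which holds because the vertical partial derivative is known to be
  continuous.\<close>

lemma smooth_psi: "smooth (psi \<delta>)"
proof (rule smoothI[OF _ psi_has_pd1 psi_has_pd2])
  show "smooth (\<lambda>x. - U False \<delta> x)" "smooth (U True \<delta>)" using smooth_U smooth_uminus by auto
  have d1: "((\<lambda>(x, y). psi \<delta> (x, y)) has_derivative (\<lambda>(tx, ty). - U False \<delta> x * tx + blinfun_mult_right (U True \<delta> (fst x, snd x)) ty)) (at (fst x, snd x) within UNIV \<times> UNIV)" for x
  proof (rule has_derivative_partialsI[where f="\<lambda>x y. psi \<delta> (x, y)" and fy="\<lambda>x y. blinfun_mult_right (U True \<delta> (x, y))"])
    show "((\<lambda>t. psi \<delta> (t, snd x)) has_derivative (\<lambda>h. - U False \<delta> x * h)) (at (fst x))"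
      using psi_has_pd1[of "snd x" "fst x"] by (simp only: has_field_derivative_def prod.collapse)
    show "((\<lambda>t. psi \<delta> (a, t)) has_derivative blinfun_apply (blinfun_mult_right (U True \<delta> (a, b)))) (at b)" for a b
      using psi_has_pd2[of a b] by (simp add: has_field_derivative_def blinfun_mult_right.rep_eq)
    have "isCont (U True \<delta>) (fst x, snd x)"
      using smooth_cont[OF smooth_U] continuous_on_eq_continuous_at[of UNIV "U True \<delta>"] by blast
    moreover have "(\<lambda>(x, y). blinfun_mult_right (U True \<delta> (x, y))) = (\<lambda>z. blinfun_mult_right (U True \<delta> z))" by auto
    ultimately show "continuous (at (fst x, snd x) within UNIV \<times> UNIV) (\<lambda>(x, y). blinfun_mult_right (U True \<delta> (x, y)))"
      using bounded_linear.isCont[OF bounded_linear_blinfun_mult_right] by simp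
  qed auto
  have "isCont (psi \<delta>) x" for x
    using has_derivative_continuous[OF d1[of x]] by simp
  then show "continuous_on UNIV (psi \<delta>)" by (simp add: continuous_at_imp_continuous_on)
qed

lemma dnorm_psi_Suc: "dnorm (Suc l) (psi \<delta>) x = dnorm l (U False \<delta>) x + dnorm l (U True \<delta>) x"
  by (simp add: pd_psi dnorm_uminus[OF smooth_U])

lemma dnorm_U_le: "l \<le> m \<Longrightarrow> dnorm l (U i \<delta>) x \<le> 2 ^ l * (\<Sum>a\<le>l. \<bar>moll \<delta> (g i (a, l - a)) x\<bar>)"
  using dnorm_le_Dm[OF smooth_U, of l i \<delta> x] d by (simp add: Dm_U order_def)

end

text \<open>Majorant for the derivatives of order m + 1 of the stream function, which are available
  only as L^p functions. The weights 2^m are those of \<open>dnorm_le_Dm\<close>, so that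
  \<open>moll \<delta> D\<close> dominates \<open>dnorm (Suc m) (psi \<delta>)\<close>.\<close>

definition D :: "real \<times> real \<Rightarrow> real" where
  "D x = 2 ^ m * (\<Sum>a\<le>m. \<bar>g False (a, m - a) x\<bar>) + 2 ^ m * (\<Sum>a\<le>m. \<bar>g True (a, m - a) x\<bar>)"

lemma D_nonneg: "D x \<ge> 0"
  by (auto simp: D_def intro!: add_nonneg_nonneg sum_nonneg)

lemma g_top_measurable: "a \<le> m \<Longrightarrow> g i (a, m - a) \<in> borel_measurable borel"
  by (rule meas) (simp add: order_def)

lemma D_measurable [measurable]: "D \<in> borel_measurable borel"
proof -
  have "(\<lambda>x. \<Sum>a\<le>m. \<bar>g i (a, m - a) x\<bar>) \<in> borel_measurable borel" for i
    by (intro borel_measurable_sum borel_measurable_abs g_top_measurable) auto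
  then show ?thesis unfolding D_def[abs_def] by measurable
qed

lemma powr_sum_le:
  fixes f :: "'a \<Rightarrow> real"
  assumes "finite A" "\<And>a. a \<in> A \<Longrightarrow> f a \<ge> 0" "s \<ge> 0"
  shows "(\<Sum>a\<in>A. f a) powr s \<le> real (card A) powr s * (\<Sum>a\<in>A. f a powr s)"
proof (cases "A = {}")
  case False
  define M where "M = Max (f ` A)"
  have "M \<in> f ` A" unfolding M_def using assms False by (intro Max_in) auto
  then obtain b where b: "b \<in> A" "M = f b" by auto
  have "(\<Sum>a\<in>A. f a) \<le> real (card A) * M"
    unfolding M_def using assms by (intro sum_bounded_above) auto
  then have "(\<Sum>a\<in>A. f a) powr s \<le> (real (card A) * M) powr s"
    using assms by (intro powr_mono2 sum_nonneg) auto
  also have "\<dots> = real (card A) powr s * f b powr s" using b assms by (simp add: powr_mult)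
  also have "f b powr s \<le> (\<Sum>a\<in>A. f a powr s)" using b assms by (intro member_le_sum) auto
  finally show ?thesis by (simp add: mult_left_mono)
qed simp

lemma D_Lp: "(\<integral>\<^sup>+x. ennreal (D x powr p) \<partial>lborel) < \<infinity>"
proof -
  let ?A = "{..m} \<times> (UNIV :: bool set)"
  let ?f = "\<lambda>x (a, i). 2 ^ m * \<bar>g i (a, m - a) x\<bar>"
  let ?c = "real (card ?A) powr p * (2 ^ m) powr p"
  have D: "D x = (\<Sum>b\<in>?A. ?f x b)" for x
  proof -
    have "(\<Sum>b\<in>?A. ?f x b) = (\<Sum>a\<le>m. \<Sum>i\<in>UNIV. 2 ^ m * \<bar>g i (a, m - a) x\<bar>)"
      by (subst sum.cartesian_product) simp
    also have "\<dots> = D x" by (simp add: UNIV_bool D_def sum.distrib sum_distrib_left)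
    finally show ?thesis by simp
  qed
  have "(\<integral>\<^sup>+x. ennreal (D x powr p) \<partial>lborel) \<le> (\<integral>\<^sup>+x. ennreal ?c * (\<Sum>b\<in>?A. ennreal (\<bar>g (snd b) (fst b, m - fst b) x\<bar> powr p)) \<partial>lborel)"
  proof (rule nn_integral_mono)
    fix x
    have "D x powr p \<le> real (card ?A) powr p * (\<Sum>b\<in>?A. ?f x b powr p)"
      unfolding D using p by (intro powr_sum_le) auto
    also have "(\<Sum>b\<in>?A. ?f x b powr p) = (2 ^ m) powr p * (\<Sum>b\<in>?A. \<bar>g (snd b) (fst b, m - fst b) x\<bar> powr p)"
      by (simp add: sum_distrib_left split_beta powr_mult)
    finally have "ennreal (D x powr p) \<le> ennreal (?c * (\<Sum>b\<in>?A. \<bar>g (snd b) (fst b, m - fst b) x\<bar> powr p))"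
      by (intro ennreal_leI) (simp add: mult.assoc)
    also have "\<dots> = ennreal ?c * (\<Sum>b\<in>?A. ennreal (\<bar>g (snd b) (fst b, m - fst b) x\<bar> powr p))"
      by (subst ennreal_mult) (auto intro!: sum_nonneg simp: sum_ennreal)
    finally show "ennreal (D x powr p) \<le> ennreal ?c * (\<Sum>b\<in>?A. ennreal (\<bar>g (snd b) (fst b, m - fst b) x\<bar> powr p))" .
  qed
  also have "\<dots> = ennreal ?c * (\<Sum>b\<in>?A. \<integral>\<^sup>+x. ennreal (\<bar>g (snd b) (fst b, m - fst b) x\<bar> powr p) \<partial>lborel)"
  proof -
    have gm: "(\<lambda>x. ennreal (\<bar>g (snd b) (fst b, m - fst b) x\<bar> powr p)) \<in> borel_measurable lborel" if "b \<in> ?A" for b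
      using g_top_measurable[of "fst b" "snd b"] that by auto
    have "(\<integral>\<^sup>+x. ennreal ?c * (\<Sum>b\<in>?A. ennreal (\<bar>g (snd b) (fst b, m - fst b) x\<bar> powr p)) \<partial>lborel)
      = ennreal ?c * (\<integral>\<^sup>+x. (\<Sum>b\<in>?A. ennreal (\<bar>g (snd b) (fst b, m - fst b) x\<bar> powr p)) \<partial>lborel)"
      by (rule nn_integral_cmult) (rule borel_measurable_sum, rule gm)
    also have "(\<integral>\<^sup>+x. (\<Sum>b\<in>?A. ennreal (\<bar>g (snd b) (fst b, m - fst b) x\<bar> powr p)) \<partial>lborel)
      = (\<Sum>b\<in>?A. \<integral>\<^sup>+x. ennreal (\<bar>g (snd b) (fst b, m - fst b) x\<bar> powr p) \<partial>lborel)"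
      by (rule nn_integral_sum) (rule gm)
    finally show ?thesis .
  qed
  also have "\<dots> < \<infinity>"
  proof -
    have "(\<Sum>b\<in>?A. \<integral>\<^sup>+x. ennreal (\<bar>g (snd b) (fst b, m - fst b) x\<bar> powr p) \<partial>lborel) < \<infinity>"
      using Lpg unfolding infinity_ennreal_def by (subst ennreal_sum_less_top) (auto simp: order_def)
    then show ?thesis by (simp only: ennreal_mult_less_top infinity_ennreal_def) simp
  qed
  finally show ?thesis .
qed

lemma locint_g: "order j \<le> m \<Longrightarrow> locint (g i j)"
  using locint_Lp[OF meas, of j p i] Lpg[of j i] p by simp

lemma dnorm_psi_le_moll:
  assumes d: "0 < \<delta>" "\<delta> \<le> 1"
  shows "dnorm (Suc m) (psi \<delta>) x \<le> moll \<delta> D x"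
proof -
  have abs_le: "\<bar>moll \<delta> (g i (a, m - a)) x\<bar> \<le> (\<integral>y. \<bar>g i (a, m - a) y\<bar> * ker \<delta> x y \<partial>lborel)" for i a
    unfolding moll_def using integral_norm_bound[of lborel "\<lambda>y. g i (a, m - a) y * ker \<delta> x y"]
    by (simp add: abs_mult ker_nonneg)
  have i: "integrable lborel (\<lambda>y. \<bar>g i (a, m - a) y\<bar> * ker \<delta> x y)" if "a \<le> m" for i a
    using integrable_norm[OF integrable_mult_ker[OF locint_g d(1), of "(a, m - a)" i x]] that
    by (simp add: abs_mult ker_nonneg order_def)
  have "dnorm (Suc m) (psi \<delta>) x \<le> 2 ^ m * (\<Sum>a\<le>m. \<bar>moll \<delta> (g False (a, m - a)) x\<bar>) + 2 ^ m * (\<Sum>a\<le>m. \<bar>moll \<delta> (g True (a, m - a)) x\<bar>)"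
    unfolding dnorm_psi_Suc[OF d] by (intro add_mono dnorm_U_le[OF d]) auto
  also have "\<dots> \<le> 2 ^ m * (\<Sum>a\<le>m. \<integral>y. \<bar>g False (a, m - a) y\<bar> * ker \<delta> x y \<partial>lborel) + 2 ^ m * (\<Sum>a\<le>m. \<integral>y. \<bar>g True (a, m - a) y\<bar> * ker \<delta> x y \<partial>lborel)"
    by (intro add_mono mult_left_mono sum_mono abs_le) auto
  also have "\<dots> = moll \<delta> D x"
  proof -
    have "moll \<delta> D x = (\<integral>y. 2 ^ m * (\<Sum>a\<le>m. \<bar>g False (a, m - a) y\<bar> * ker \<delta> x y) + 2 ^ m * (\<Sum>a\<le>m. \<bar>g True (a, m - a) y\<bar> * ker \<delta> x y) \<partial>lborel)"
      unfolding moll_def D_def by (rule Bochner_Integration.integral_cong) (auto simp: sum_distrib_left sum_distrib_right distrib_left distrib_right mult_ac)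
    also have "\<dots> = 2 ^ m * (\<Sum>a\<le>m. \<integral>y. \<bar>g False (a, m - a) y\<bar> * ker \<delta> x y \<partial>lborel) + 2 ^ m * (\<Sum>a\<le>m. \<integral>y. \<bar>g True (a, m - a) y\<bar> * ker \<delta> x y \<partial>lborel)"
      by (subst Bochner_Integration.integral_add)
        (auto intro!: Bochner_Integration.integrable_sum i integrable_mult_right simp: i)
    finally show ?thesis by simp
  qed
  finally show ?thesis .
qed

end

section \<open>Passage to the limit in the stream functions and oscillation on the
  complement\<close>

context divfree
begin

lemma moll_g_uniform:
  assumes "order j < m" "e > 0"
  shows "\<forall>\<^sub>F \<delta> in at_right 0. \<forall>x. \<bar>moll \<delta> (g i j) x - g i j x\<bar> \<le> e"
proof -
  obtain \<delta>0 where d0: "\<delta>0 > 0" "\<And>\<delta> x. 0 < \<delta> \<Longrightarrow> \<delta> < \<delta>0 \<Longrightarrow> \<bar>moll \<delta> (g i j) x - g i j x\<bar> \<le> e"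
    by (rule moll_uniform_limit[OF cont[OF assms(1)] _ assms(2), of R i]) (auto intro: g_zero_off[OF assms(1)])
  then show ?thesis by (auto simp: eventually_at_right_field)
qed

lemma eventually_small: "c > 0 \<Longrightarrow> \<forall>\<^sub>F \<delta> in at_right (0::real). 0 < \<delta> \<and> \<delta> \<le> c"
  by (auto simp: eventually_at_right_field intro!: exI[of _ c])

text \<open>The derivatives of \<open>psi\<close> of order 1 to m are, up to sign, mollified
  \<open>g i j\<close> with order of j below m; these converge uniformly to functions that vanish on
  \<open>K\<close>. The factor 2 in \<open>e'\<close> accounts for the two components.\<close>

lemma psi_small_on_K:
  assumes e: "e > 0"
  shows "\<forall>\<^sub>F \<delta> in at_right 0. \<forall>x\<in>K. \<forall>i. 1 \<le> i \<and> i \<le> m \<longrightarrow> dnorm i (psi \<delta>) x \<le> e"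
proof -
  define k where "k = 2 ^ m * real (m + 1)"
  have k: "k > 0" by (simp add: k_def)
  define e' where "e' = e / (2 * k)"
  have e': "e' > 0" using e k by (simp add: e'_def)
  let ?J = "{j \<in> {..m} \<times> {..m}. order j < m} \<times> (UNIV :: bool set)"
  have "\<forall>\<^sub>F \<delta> in at_right 0. \<forall>b\<in>?J. \<forall>x. \<bar>moll \<delta> (g (snd b) (fst b)) x - g (snd b) (fst b) x\<bar> \<le> e'"
  proof (intro eventually_ball_finite ballI)
    show "\<forall>\<^sub>F \<delta> in at_right 0. \<forall>x. \<bar>moll \<delta> (g (snd b) (fst b)) x - g (snd b) (fst b) x\<bar> \<le> e'" if "b \<in> ?J" for b
      using that by (intro moll_g_uniform e') auto
  qed auto
  moreover have "\<forall>\<^sub>F \<delta> in at_right (0::real). 0 < \<delta> \<and> \<delta> \<le> 1" by (rule eventually_small) simp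
  ultimately show ?thesis
  proof eventually_elim
    case (elim \<delta>)
    have d: "0 < \<delta>" "\<delta> \<le> 1" using elim by auto
    show ?case
    proof (intro ballI allI impI)
      fix x i assume x: "x \<in> K" and i: "1 \<le> i \<and> i \<le> m"
      then obtain l where l: "i = Suc l" "l < m" by (cases i) auto
      have mo: "\<bar>moll \<delta> (g b (a, l - a)) x\<bar> \<le> e'" if "a \<le> l" for a b
      proof -
        have o: "order (a, l - a) < m" using that l by (simp add: order_def)
        have "((a, l - a), b) \<in> ?J" using that l o by auto
        from spec[OF bspec[OF elim(1) this], of x] have "\<bar>moll \<delta> (g b (a, l - a)) x - g b (a, l - a) x\<bar> \<le> e'" by simp
        then show ?thesis using zero[OF o x] by simp
      qed
      have U: "dnorm l (U b \<delta>) x \<le> 2 ^ m * (real (m + 1) * e')" for b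
      proof -
        have "dnorm l (U b \<delta>) x \<le> 2 ^ l * (\<Sum>a\<le>l. \<bar>moll \<delta> (g b (a, l - a)) x\<bar>)"
          using l by (intro dnorm_U_le[OF d]) auto
        also have "\<dots> \<le> 2 ^ l * (\<Sum>a\<le>l. e')" by (intro mult_left_mono sum_mono mo) auto
        also have "\<dots> \<le> 2 ^ m * (real (m + 1) * e')"
          using l e' by (intro mult_mono power_increasing) auto
        finally show ?thesis .
      qed
      have "dnorm i (psi \<delta>) x \<le> 2 ^ m * (real (m + 1) * e') + 2 ^ m * (real (m + 1) * e')"
        unfolding l dnorm_psi_Suc[OF d] by (intro add_mono U)
      also have "\<dots> = 2 * (k * e')" by (simp add: k_def)
      also have "\<dots> = e" using k by (simp add: e'_def)
      finally show "dnorm i (psi \<delta>) x \<le> e" .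
    qed
  qed
qed

lemma psi_pointwise:
  assumes d: "0 < \<delta>" "\<delta> \<le> 1" and e: "e \<ge> 0" and u: "\<And>x. \<bar>U True \<delta> x - g True (0, 0) x\<bar> \<le> e"
  shows "\<bar>psi \<delta> x - Psi x\<bar> \<le> e * max 0 (snd x + S)"
proof (cases "- S \<le> snd x")
  case True
  have c: "continuous_on {- S..snd x} (\<lambda>t. U True \<delta> (fst x, t))" "continuous_on {- S..snd x} (\<lambda>t. g True (0, 0) (fst x, t))"
    by (intro continuous_on_slices smooth_cont smooth_U cont order00)+
  have "psi \<delta> x - Psi x = integral {- S..snd x} (\<lambda>t. U True \<delta> (fst x, t) - g True (0, 0) (fst x, t))"
    unfolding psi_def Psi_def by (rule integral_diff[symmetric]) (intro integrable_continuous_real c)+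
  also have "norm \<dots> \<le> e * (snd x - (- S))"
    using u True by (intro integral_bound continuous_on_diff c) auto
  finally show ?thesis using True e by simp
qed (simp add: psi_def Psi_def)

text \<open>The bound in \<open>psi_pointwise\<close> grows with the height and gives no uniform
  convergence yet; at a fixed point it suffices to carry the vanishing of \<open>psi\<close> over to
  \<open>Psi\<close>. Uniformity in \<open>psi_uniform\<close> then follows from this lemma.\<close>

lemma Psi_zero_off: "x \<notin> sq 0 (R + 2) \<Longrightarrow> Psi x = 0"
proof (rule ccontr)
  assume x: "x \<notin> sq 0 (R + 2)" and ne: "Psi x \<noteq> 0"
  define M where "M = max 0 (snd x + S)"
  define e where "e = \<bar>Psi x\<bar> / (2 * (M + 1))"
  have M: "M \<ge> 0" by (simp add: M_def)
  then have e: "e > 0" unfolding e_def using ne by (intro divide_pos_pos) auto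
  have "\<forall>\<^sub>F \<delta> in at_right 0. (0 < \<delta> \<and> \<delta> \<le> 1) \<and> (\<forall>x. \<bar>U True \<delta> x - g True (0, 0) x\<bar> \<le> e)"
    unfolding U_def by (intro eventually_conj eventually_small moll_g_uniform order00 e) simp
  then obtain \<delta> where "0 < \<delta>" "\<delta> \<le> 1" "\<And>x. \<bar>U True \<delta> x - g True (0, 0) x\<bar> \<le> e"
    using eventually_happens'[OF trivial_limit_at_right_real] by blast
  from psi_pointwise[OF this(1,2) less_imp_le[OF e] this(3), of x] psi_zero_left[OF this(1,2) x]
  have "\<bar>Psi x\<bar> \<le> e * M" by (simp add: M_def)
  also have "\<dots> \<le> e * (M + 1)" using e by simp
  also have "\<dots> = \<bar>Psi x\<bar> / 2" using M by (simp add: e_def field_simps)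
  finally show False using ne by simp
qed

lemma psi_uniform:
  assumes e: "e > 0"
  shows "\<forall>\<^sub>F \<delta> in at_right 0. \<forall>x. \<bar>psi \<delta> x - Psi x\<bar> \<le> e"
proof -
  define e' where "e' = e / (2 * S)"
  have S: "S > 0" using R by (simp add: S_def)
  have e': "e' > 0" using e S by (simp add: e'_def)
  have "\<forall>\<^sub>F \<delta> in at_right 0. (0 < \<delta> \<and> \<delta> \<le> 1) \<and> (\<forall>x. \<bar>U True \<delta> x - g True (0, 0) x\<bar> \<le> e')"
    unfolding U_def by (intro eventually_conj eventually_small moll_g_uniform order00 e') simp
  then show ?thesis
  proof eventually_elim
    case (elim \<delta>)
    then have d: "0 < \<delta>" "\<delta> \<le> 1" by auto
    show ?case
    proof
      fix x show "\<bar>psi \<delta> x - Psi x\<bar> \<le> e"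
      proof (cases "x \<in> sq 0 (R + 2)")
        case True
        have "\<bar>psi \<delta> x - Psi x\<bar> \<le> e' * max 0 (snd x + S)"
          using elim e' by (intro psi_pointwise d) auto
        also have "\<dots> \<le> e' * (2 * S)" using True e' S by (intro mult_left_mono) (auto simp: mem_sq S_def)
        also have "\<dots> = e" using S by (simp add: e'_def)
        finally show ?thesis .
      next
        case False
        then show ?thesis using Psi_zero_off psi_zero_left[OF d] e by simp
      qed
    qed
  qed
qed

text \<open>The kernel reaches at most 2 \<delta>, hence at most 2 r, which triples the
  square.\<close>

lemma dnorm_psi_Lq:
  assumes d: "0 < \<delta>" "\<delta> \<le> 1" and r: "\<delta> \<le> r" and q: "q \<ge> 1"
  shows "(\<integral>\<^sup>+z. ennreal (dnorm (Suc m) (psi \<delta>) z powr q) * indicator (sq c r) z \<partial>lborel)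
     \<le> (\<integral>\<^sup>+z. ennreal (D z powr q) * indicator (sq c (3 * r)) z \<partial>lborel)"
proof -
  have "(\<integral>\<^sup>+z. ennreal (dnorm (Suc m) (psi \<delta>) z powr q) * indicator (sq c r) z \<partial>lborel)
    \<le> (\<integral>\<^sup>+z. ennreal (\<bar>moll \<delta> D z\<bar> powr q) * indicator (sq c r) z \<partial>lborel)"
    using q by (intro nn_integral_mono mult_right_mono ennreal_leI powr_mono2 dnorm_nonneg order_trans[OF dnorm_psi_le_moll[OF d]]) auto
  also have "\<dots> \<le> (\<integral>\<^sup>+z. ennreal (\<bar>D z\<bar> powr q) * indicator (sq c (3 * r)) z \<partial>lborel)"
  proof (rule moll_powr_integral_le[OF D_measurable q d(1)])
    fix x y assume "x \<in> sq c r" "ker \<delta> x y \<noteq> 0"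
    with ker_support_sq[OF d(1), of x y] r show "y \<in> sq c (3 * r)" by (auto simp: mem_sq)
  qed auto
  finally show ?thesis using D_nonneg by simp
qed

lemma psi_taylor:
  assumes q: "q > 2" and R0: "R0 > 0"
  obtains C where "C > 0" "\<And>\<delta> c r a x e W. \<lbrakk>0 < \<delta>; \<delta> \<le> 1; \<delta> \<le> r; r \<le> R0; a \<in> sq c r; x \<in> sq c r; e \<ge> 0; W \<ge> 0;
      \<And>i. 1 \<le> i \<Longrightarrow> i \<le> m \<Longrightarrow> dnorm i (psi \<delta>) a \<le> e;
      (\<integral>\<^sup>+z. ennreal (D z powr q) * indicator (sq c (3 * r)) z \<partial>lborel) \<le> ennreal (W powr q)\<rbrakk>
     \<Longrightarrow> \<bar>psi \<delta> x - psi \<delta> a\<bar> \<le> C * (r ^ m * r powr (1 - 2 / q) * W + e)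
       \<and> (\<forall>i. 1 \<le> i \<and> i \<le> m \<longrightarrow> dnorm i (psi \<delta>) x \<le> C * (r ^ (m - i) * r powr (1 - 2 / q) * W + e))"
proof -
  obtain C where C: "C > 0" "\<And>f c r a e W x. \<lbrakk>smooth f; 0 < r; r \<le> R0; a \<in> sq c r; x \<in> sq c r; e \<ge> 0; W \<ge> 0;
      \<And>i. 1 \<le> i \<Longrightarrow> i \<le> m \<Longrightarrow> dnorm i f a \<le> e;
      (\<integral>\<^sup>+z. ennreal (dnorm (Suc m) f z powr q) * indicator (sq c r) z \<partial>lborel) \<le> ennreal (W powr q)\<rbrakk>
     \<Longrightarrow> \<bar>f x - f a\<bar> \<le> C * (r ^ m * r powr (1 - 2 / q) * W + e)
       \<and> (\<forall>i. 1 \<le> i \<and> i \<le> m \<longrightarrow> dnorm i f x \<le> C * (r ^ (m - i) * r powr (1 - 2 / q) * W + e))"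
    using taylor_morrey[OF q R0 m] by blast
  show ?thesis
  proof (rule that[OF C(1)])
    fix \<delta> c r a x e W
    assume a: "0 < \<delta>" "\<delta> \<le> 1" "\<delta> \<le> r" "r \<le> R0" "a \<in> sq c r" "x \<in> sq c r" "(e::real) \<ge> 0" "(W::real) \<ge> 0"
      "\<And>i. 1 \<le> i \<Longrightarrow> i \<le> m \<Longrightarrow> dnorm i (psi \<delta>) a \<le> e"
      "(\<integral>\<^sup>+z. ennreal (D z powr q) * indicator (sq c (3 * r)) z \<partial>lborel) \<le> ennreal (W powr q)"
    show "\<bar>psi \<delta> x - psi \<delta> a\<bar> \<le> C * (r ^ m * r powr (1 - 2 / q) * W + e)
       \<and> (\<forall>i. 1 \<le> i \<and> i \<le> m \<longrightarrow> dnorm i (psi \<delta>) x \<le> C * (r ^ (m - i) * r powr (1 - 2 / q) * W + e))"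
    proof (rule C(2)[where c=c])
      show "smooth (psi \<delta>)" by (rule smooth_psi[OF a(1,2)])
      have "(\<integral>\<^sup>+z. ennreal (dnorm (Suc m) (psi \<delta>) z powr q) * indicator (sq c r) z \<partial>lborel)
        \<le> (\<integral>\<^sup>+z. ennreal (D z powr q) * indicator (sq c (3 * r)) z \<partial>lborel)"
        using a q by (intro dnorm_psi_Lq) auto
      then show "(\<integral>\<^sup>+z. ennreal (dnorm (Suc m) (psi \<delta>) z powr q) * indicator (sq c r) z \<partial>lborel) \<le> ennreal (W powr q)"
        using a(10) by order
    qed (use a in auto)
  qed
qed

text \<open>At points of \<open>K\<close> the derivatives of order 1 to m tend to 0 with the
  mollification, so the error term of \<open>psi_taylor\<close> disappears in the limit and only the
  Sobolev part remains. Both the Morse--Sard property and the estimates of the extension rest on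
  this.\<close>

lemma Psi_osc:
  assumes q: "q > 2" and R0: "R0 > 0"
  obtains C where "C > 0" "\<And>c r a b W. \<lbrakk>0 < r; r \<le> R0; a \<in> K; b \<in> K; a \<in> sq c r; b \<in> sq c r; W \<ge> 0;
      (\<integral>\<^sup>+z. ennreal (D z powr q) * indicator (sq c (3 * r)) z \<partial>lborel) \<le> ennreal (W powr q)\<rbrakk>
     \<Longrightarrow> \<bar>Psi a - Psi b\<bar> \<le> C * (r ^ m * r powr (1 - 2 / q) * W)"
proof -
  obtain C where C: "C > 0" "\<And>\<delta> c r a x e W. \<lbrakk>0 < \<delta>; \<delta> \<le> 1; \<delta> \<le> r; r \<le> R0; a \<in> sq c r; x \<in> sq c r; e \<ge> 0; W \<ge> 0;
      \<And>i. 1 \<le> i \<Longrightarrow> i \<le> m \<Longrightarrow> dnorm i (psi \<delta>) a \<le> e;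
      (\<integral>\<^sup>+z. ennreal (D z powr q) * indicator (sq c (3 * r)) z \<partial>lborel) \<le> ennreal (W powr q)\<rbrakk>
     \<Longrightarrow> \<bar>psi \<delta> x - psi \<delta> a\<bar> \<le> C * (r ^ m * r powr (1 - 2 / q) * W + e)
       \<and> (\<forall>i. 1 \<le> i \<and> i \<le> m \<longrightarrow> dnorm i (psi \<delta>) x \<le> C * (r ^ (m - i) * r powr (1 - 2 / q) * W + e))"
    using psi_taylor[OF q R0] by blast
  show ?thesis
  proof (rule that[OF C(1)])
    fix c r a b W
    assume a: "0 < r" "r \<le> R0" "a \<in> K" "b \<in> K" "a \<in> sq c r" "b \<in> sq c r" "(W::real) \<ge> 0"
      "(\<integral>\<^sup>+z. ennreal (D z powr q) * indicator (sq c (3 * r)) z \<partial>lborel) \<le> ennreal (W powr q)"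
    show "\<bar>Psi a - Psi b\<bar> \<le> C * (r ^ m * r powr (1 - 2 / q) * W)"
    proof (rule field_le_epsilon)
      fix e :: real assume e: "e > 0"
      \<comment> \<open>The share \<open>C\<close> comes from the Taylor estimate, the share 2 from
        replacing \<open>psi\<close> by \<open>Psi\<close> at the two points.\<close>
      define e' where "e' = e / (2 + C)"
      have e': "e' > 0" using e C(1) by (simp add: e'_def)
      have "\<forall>\<^sub>F \<delta> in at_right 0. (0 < \<delta> \<and> \<delta> \<le> min 1 r) \<and> (\<forall>x. \<bar>psi \<delta> x - Psi x\<bar> \<le> e')
        \<and> (\<forall>x\<in>K. \<forall>i. 1 \<le> i \<and> i \<le> m \<longrightarrow> dnorm i (psi \<delta>) x \<le> e')"
        using a by (intro eventually_conj eventually_small psi_uniform psi_small_on_K e') auto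
      from eventually_happens'[OF trivial_limit_at_right_real this]
      obtain \<delta> where dd: "(0 < \<delta> \<and> \<delta> \<le> min 1 r) \<and> (\<forall>x. \<bar>psi \<delta> x - Psi x\<bar> \<le> e')
        \<and> (\<forall>x\<in>K. \<forall>i. 1 \<le> i \<and> i \<le> m \<longrightarrow> dnorm i (psi \<delta>) x \<le> e')" by (elim exE)
      then have d: "0 < \<delta>" "\<delta> \<le> 1" "\<delta> \<le> r" "\<And>x. \<bar>psi \<delta> x - Psi x\<bar> \<le> e'"
        "\<And>x i. x \<in> K \<Longrightarrow> 1 \<le> i \<Longrightarrow> i \<le> m \<Longrightarrow> dnorm i (psi \<delta>) x \<le> e'"
        unfolding min.bounded_iff by blast+
      have "\<bar>psi \<delta> a - psi \<delta> b\<bar> \<le> C * (r ^ m * r powr (1 - 2 / q) * W + e')"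
        by (rule C(2)[THEN conjunct1, of \<delta> r b c a e' W]) (use a d e' in \<open>simp_all\<close>)
      then have "\<bar>Psi a - Psi b\<bar> \<le> C * (r ^ m * r powr (1 - 2 / q) * W + e') + e' + e'"
        using d(4)[of a] d(4)[of b] by linarith
      also have "\<dots> = C * (r ^ m * r powr (1 - 2 / q) * W) + e' * (2 + C)" by (simp add: algebra_simps)
      also have "e' * (2 + C) = e" using C(1) by (simp add: e'_def)
      finally show "\<bar>Psi a - Psi b\<bar> \<le> C * (r ^ m * r powr (1 - 2 / q) * W) + e" .
    qed
  qed
qed

text \<open>A derivative of order m is a first derivative of some \<open>g i j'\<close> of order m -
  1, which is continuous and vanishes on \<open>K\<close>; by \<open>weak_gradient_zero_AE\<close>
  it is zero almost everywhere there. That m is at least 1 guarantees the predecessor.\<close>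

lemma g_top_zero_AE:
  assumes "order j = m"
  shows "AE x in lborel. x \<in> K \<longrightarrow> g i j x = 0"
proof -
  obtain j' where j': "order j' < m" "(\<forall>\<delta>>0. pd1 (moll \<delta> (g i j')) = moll \<delta> (g i j)) \<or> (\<forall>\<delta>>0. pd2 (moll \<delta> (g i j')) = moll \<delta> (g i j))"
  proof (cases j)
    case (Pair a b)
    show ?thesis
    proof (cases a)
      case (Suc a')
      have "pd1 (moll \<delta> (g i (a', b))) = moll \<delta> (g i j)" if "\<delta> > 0" for \<delta>
        using Dm_U[OF that, of "(a', b)" i] Dm_U[OF that, of j i] assms Pair Suc by (simp add: order_def Dm_def)
      then show ?thesis using that[of "(a', b)"] assms Pair Suc by (auto simp: order_def)
    next
      case 0
      then obtain b' where b': "b = Suc b'" using assms m Pair by (cases b) (auto simp: order_def)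
      have "pd2 (moll \<delta> (g i (0, b'))) = moll \<delta> (g i j)" if "\<delta> > 0" for \<delta>
        using Dm_U[OF that, of "(0, b')" i] Dm_U[OF that, of j i] assms Pair 0 b' by (simp add: order_def Dm_def)
      then show ?thesis using that[of "(0, b')"] assms Pair 0 b' by (auto simp: order_def)
    qed
  qed
  have "AE x in lborel. g i j' x = 0 \<longrightarrow> g i j x = 0"
    by (rule weak_gradient_zero_AE[OF cont[OF j'(1)] _ locint_g j'(2), of R]) (use assms in \<open>auto intro: g_zero_off[OF j'(1)]\<close>)
  then show ?thesis by eventually_elim (use zero[OF j'(1)] in auto)
qed

lemma D_zero_AE: "AE x in lborel. x \<in> K \<longrightarrow> D x = 0"
proof -
  have "AE x in lborel. \<forall>b\<in>{..m} \<times> (UNIV::bool set). x \<in> K \<longrightarrow> g (snd b) (fst b, m - fst b) x = 0"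
    by (intro AE_ball_countable[THEN iffD2] ballI g_top_zero_AE) (auto simp: order_def)
  then show ?thesis by eventually_elim (auto simp: D_def)
qed

definition layer :: "real \<Rightarrow> (real \<times> real) set" where
  "layer r = {y. infdist y K \<le> r}"

lemma layer_borel [measurable, simp]: "layer r \<in> sets borel"
  unfolding layer_def by (intro borel_closed closed_Collect_le continuous_intros)

lemma K_nonempty: "K \<noteq> {}"
  using K(2)[of "(R + 1, 0)"] R by (auto simp: mem_sq)

text \<open>\<open>D\<close> vanishes almost everywhere on \<open>K\<close>, and the layers shrink
  to \<open>K\<close>; dominated convergence does the rest. This smallness drives both the
  Morse--Sard property and the estimates at the stopping scale.\<close>

lemma layer_small:
  assumes e: "(e::ennreal) > 0"
  obtains r0 where "r0 > 0" "\<And>r. r \<le> r0 \<Longrightarrow> (\<integral>\<^sup>+z. ennreal (D z powr p) * indicator (layer r) z \<partial>lborel) < e"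
proof -
  have "(\<lambda>n. \<integral>\<^sup>+z. ennreal (D z powr p) * indicator (layer (inverse (real (Suc n)))) z \<partial>lborel) \<longlonglongrightarrow> (\<integral>\<^sup>+z. 0 \<partial>(lborel :: (real \<times> real) measure))"
  proof (rule nn_integral_dominated_convergence[where w="\<lambda>z. ennreal (D z powr p)"])
    show "AE z in lborel. (\<lambda>n. ennreal (D z powr p) * indicator (layer (inverse (real (Suc n)))) z) \<longlonglongrightarrow> 0"
      using D_zero_AE
    proof eventually_elim
      case (elim z)
      show ?case
      proof (cases "z \<in> K")
        case True then show ?thesis using elim p by simp
      next
        case False
        then have "infdist z K > 0" using K(1) K_nonempty by (metis in_closed_iff_infdist_zero infdist_nonneg less_eq_real_def)
        then have "\<forall>\<^sub>F n in sequentially. inverse (real (Suc n)) < infdist z K"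
          by (intro order_tendstoD(2)[OF LIMSEQ_inverse_real_of_nat])
        then have "\<forall>\<^sub>F n in sequentially. ennreal (D z powr p) * indicator (layer (inverse (real (Suc n)))) z = 0"
          by eventually_elim (auto simp: layer_def)
        then show ?thesis by (rule tendsto_eventually)
      qed
    qed
    show "AE z in lborel. ennreal (D z powr p) * indicator (layer (inverse (real (Suc n)))) z \<le> ennreal (D z powr p)" for n
      by (auto simp: indicator_def)
  qed (use D_Lp in auto)
  then have "\<forall>\<^sub>F n in sequentially. (\<integral>\<^sup>+z. ennreal (D z powr p) * indicator (layer (inverse (real (Suc n)))) z \<partial>lborel) < e"
    using e by (intro order_tendstoD(2)) auto
  then obtain n where n: "(\<integral>\<^sup>+z. ennreal (D z powr p) * indicator (layer (inverse (real (Suc n)))) z \<partial>lborel) < e"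
    by (auto simp: eventually_sequentially)
  show ?thesis
  proof (rule that[of "inverse (real (Suc n))"])
    fix r assume r: "r \<le> inverse (real (Suc n))"
    have "(\<integral>\<^sup>+z. ennreal (D z powr p) * indicator (layer r) z \<partial>lborel) \<le> (\<integral>\<^sup>+z. ennreal (D z powr p) * indicator (layer (inverse (real (Suc n)))) z \<partial>lborel)"
      using r by (intro nn_integral_mono mult_left_mono) (auto simp: layer_def indicator_def)
    then show "(\<integral>\<^sup>+z. ennreal (D z powr p) * indicator (layer r) z \<partial>lborel) < e" using n by order
  qed simp
qed

end

text \<open>\<open>h\<close> is the measure of the part of \<open>N\<close> below t, normalised at
  0. Its increments are measures of pieces of \<open>N\<close>, so they are bounded both by the
  length of the interval and by the total measure.\<close>

lemma truncation_function:
  fixes N :: "real set"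
  assumes N: "open N" "emeasure lborel N < ennreal \<epsilon>"
  obtains h :: "real \<Rightarrow> real" where "h 0 = 0" "\<And>t. \<bar>h t\<bar> \<le> \<epsilon>" "\<And>s t. \<bar>h s - h t\<bar> \<le> \<bar>s - t\<bar>"
    "\<And>s t. s \<le> t \<Longrightarrow> {s..t} \<subseteq> N \<Longrightarrow> h t - h s = t - s"
proof -
  define F where "F t = measure lborel (N \<inter> {..t})" for t
  have [measurable]: "N \<in> sets borel" using N(1) by (rule borel_open)
  have fin: "emeasure lborel (N \<inter> A) \<noteq> \<infinity>" if "A \<in> sets borel" for A
  proof -
    have "emeasure lborel (N \<inter> A) \<le> emeasure lborel N" using that by (intro emeasure_mono) auto
    moreover have "emeasure lborel N < \<infinity>" using less_trans[OF N(2), of \<infinity>] by simp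
    ultimately show ?thesis by (auto simp: top_unique)
  qed
  have diff: "F t - F s = measure lborel (N \<inter> {s<..t})" if "s \<le> t" for s t
  proof -
    have "N \<inter> {..t} = (N \<inter> {..s}) \<union> (N \<inter> {s<..t})" using that by auto
    then have "F t = measure lborel ((N \<inter> {..s}) \<union> (N \<inter> {s<..t}))" by (simp add: F_def)
    also have "\<dots> = F s + measure lborel (N \<inter> {s<..t})"
      unfolding F_def by (intro measure_Union) (use fin in auto)
    finally show ?thesis by simp
  qed
  have le: "0 \<le> F t - F s" "F t - F s \<le> t - s" if "s \<le> t" for s t
  proof -
    show "0 \<le> F t - F s" using diff[OF that] by simp
    have "measure lborel (N \<inter> {s<..t}) \<le> measure lborel {s<..t}"
      using that by (intro measure_mono_fmeasurable) (auto simp: fmeasurable_def)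
    then show "F t - F s \<le> t - s" using diff[OF that] that by simp
  qed
  have bd: "F t - F s \<le> \<epsilon>" if "s \<le> t" for s t
  proof -
    have "emeasure lborel (N \<inter> {s<..t}) \<le> emeasure lborel N" by (intro emeasure_mono) auto
    also have "\<dots> \<le> ennreal \<epsilon>" using N(2) by simp
    finally have "ennreal (measure lborel (N \<inter> {s<..t})) \<le> ennreal \<epsilon>"
      using fin[of "{s<..t}"] by (simp add: emeasure_eq_ennreal_measure)
    moreover have "\<epsilon> > 0" using N(2) by (metis ennreal_neg not_less not_less_zero)
    ultimately show ?thesis using diff[OF that] by simp
  qed
  show ?thesis
  proof (rule that[of "\<lambda>t. F t - F 0"])
    show "\<bar>F t - F 0\<bar> \<le> \<epsilon>" for t
      using le(1)[of t 0] le(1)[of 0 t] bd[of t 0] bd[of 0 t] by (cases "t \<ge> 0") auto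
    show "\<bar>(F s - F 0) - (F t - F 0)\<bar> \<le> \<bar>s - t\<bar>" for s t
      using le[of s t] le[of t s] by (cases "s \<le> t") auto
    show "(F t - F 0) - (F s - F 0) = t - s" if "s \<le> t" "{s..t} \<subseteq> N" for s t
    proof -
      have "N \<inter> {s<..t} = {s<..t}" using that by auto
      then show ?thesis using diff[OF that(1)] that(1) by simp
    qed
  qed simp
qed

section \<open>A Morse--Sard property\<close>

lemma card_int_interval_le:
  fixes s t :: real
  assumes "t - s \<le> real n"
  shows "finite {k::int. s \<le> k \<and> k \<le> t}" "card {k::int. s \<le> k \<and> k \<le> t} \<le> n + 1"
proof -
  have e: "{k::int. s \<le> k \<and> k \<le> t} = {\<lceil>s\<rceil>..\<lfloor>t\<rfloor>}" by (auto simp: ceiling_le_iff le_floor_iff)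
  show "finite {k::int. s \<le> k \<and> k \<le> t}" unfolding e by simp
  have "\<lfloor>t\<rfloor> - \<lceil>s\<rceil> \<le> int n" using assms by linarith
  then show "card {k::int. s \<le> k \<and> k \<le> t} \<le> n + 1" unfolding e by simp
qed

lemma lattice_count:
  fixes y :: "real \<times> real"
  assumes t: "t > 0" and b: "b - a \<le> real n"
  shows "finite {z. a * t \<le> fst y - t * fst (lat z) \<and> fst y - t * fst (lat z) \<le> b * t \<and> a * t \<le> snd y - t * snd (lat z) \<and> snd y - t * snd (lat z) \<le> b * t}" (is "finite ?A")
    and "card {z. a * t \<le> fst y - t * fst (lat z) \<and> fst y - t * fst (lat z) \<le> b * t \<and> a * t \<le> snd y - t * snd (lat z) \<and> snd y - t * snd (lat z) \<le> b * t} \<le> (n + 1) * (n + 1)"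
proof -
  let ?I = "\<lambda>u. {k::int. u / t - b \<le> k \<and> k \<le> u / t - a}"
  have fc: "finite (?I u)" "card (?I u) \<le> n + 1" for u
    using card_int_interval_le[of "u / t - a" "u / t - b" n] b by auto
  have eq: "(a * t \<le> u - t * real_of_int k \<and> u - t * real_of_int k \<le> b * t) \<longleftrightarrow> k \<in> ?I u" for u k
    using t by (auto simp: field_simps)
  have sub: "?A \<subseteq> ?I (fst y) \<times> ?I (snd y)"
  proof
    fix z assume "z \<in> ?A"
    then have "a * t \<le> fst y - t * real_of_int (fst z) \<and> fst y - t * real_of_int (fst z) \<le> b * t"
      "a * t \<le> snd y - t * real_of_int (snd z) \<and> snd y - t * real_of_int (snd z) \<le> b * t" by (auto simp: lat_def)
    then show "z \<in> ?I (fst y) \<times> ?I (snd y)" unfolding eq by (cases z) auto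
  qed
  show "finite ?A" by (rule finite_subset[OF sub]) (use fc in auto)
  have "card ?A \<le> card (?I (fst y) \<times> ?I (snd y))" by (rule card_mono[OF _ sub]) (use fc in auto)
  also have "\<dots> \<le> (n + 1) * (n + 1)" unfolding card_cartesian_product by (intro mult_mono fc) auto
  finally show "card ?A \<le> (n + 1) * (n + 1)" .
qed

context divfree
begin

lemma dist_le_sq: "x \<in> sq c r \<Longrightarrow> dist x c \<le> 2 * r"
proof -
  assume x: "x \<in> sq c r"
  have "dist x c \<le> dist (fst x) (fst c) + dist (snd x) (snd c)"
    by (cases x; cases c) (simp add: dist_Pair_Pair order_trans[OF sqrt_add_le_add_sqrt])
  also have "\<dots> \<le> 2 * r" using x by (auto simp: mem_sq dist_real_def)
  finally show "dist x c \<le> 2 * r" .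
qed

lemma D_integral_finite: "A \<in> sets borel \<Longrightarrow> (\<integral>\<^sup>+z. ennreal (D z powr p) * indicator A z \<partial>lborel) < \<infinity>"
  by (rule le_less_trans[OF _ D_Lp]) (intro nn_integral_mono, auto simp: indicator_def)

text \<open>With r^m at most r, the image of the part of \<open>K\<close> in a square of radius r
  has diameter at most a multiple of r^(2 - 2/p) times the local L^p norm of \<open>D\<close>.
  Young's inequality splits this into \<kappa> r^2 and a multiple of the local integral of D^p: the
  first part sums to \<kappa> times an area, the second to an integral over a thin layer. The
  uniform margin \<tau> around the image is produced for the later truncation.\<close>

lemma Psi_K_small_cover:
  assumes \<eta>: "\<eta> > 0"
  obtains N \<tau> where "open N" "emeasure lborel N < ennreal \<eta>" "\<tau> > 0" "\<And>s. s \<in> Psi ` K \<Longrightarrow> ball s \<tau> \<subseteq> N"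
proof -
  have p1: "p > 1" using p by simp
  obtain C where C: "C > 0" "\<And>c r a b W. \<lbrakk>0 < r; r \<le> 1; a \<in> K; b \<in> K; a \<in> sq c r; b \<in> sq c r; W \<ge> 0;
      (\<integral>\<^sup>+z. ennreal (D z powr p) * indicator (sq c (3 * r)) z \<partial>lborel) \<le> ennreal (W powr p)\<rbrakk>
     \<Longrightarrow> \<bar>Psi a - Psi b\<bar> \<le> C * (r ^ m * r powr (1 - 2 / p) * W)"
    using Psi_osc[OF p, of 1] by auto
  \<comment> \<open>Upper bound for r^2 times the number of squares of radius r that cover the
    square of radius R + 2.\<close>
  define A0 where "A0 = (2 * R + 14)\<^sup>2"
  have A0: "A0 > 0" using R by (auto simp: A0_def)
  define T where "T = C * A0 + A0 + 1"
  have T: "T > 0" unfolding T_def using C(1) A0 by (intro add_pos_pos mult_pos_pos) auto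
  \<comment> \<open>\<kappa> and \<open>t\<close> are tuned so that the areas, together with the
    ball around 0, contribute \<eta> / 2 and the layer integrals \<eta> / 4.\<close>
  define \<kappa> where "\<kappa> = \<eta> / (4 * T)"
  have k: "\<kappa> > 0" using \<eta> T by (simp add: \<kappa>_def)
  define t where "t = \<eta> / (128 * C * \<kappa> powr (1 - p))"
  have t: "t > 0" using \<eta> C(1) k by (simp add: t_def)
  obtain r0 where r0: "r0 > 0" "\<And>r. r \<le> r0 \<Longrightarrow> (\<integral>\<^sup>+z. ennreal (D z powr p) * indicator (layer r) z \<partial>lborel) < ennreal t"
    using layer_small[of "ennreal t"] t by auto
  \<comment> \<open>A point of an enlarged square has distance at most 6 r + 2 r from the chosen
    point of \<open>K\<close>, so the enlarged squares lie in the layer of width 8 r.\<close>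
  define r where "r = min 1 (r0 / 8)"
  have r: "0 < r" "r \<le> 1" "8 * r \<le> r0" using r0 by (auto simp: r_def)
  define Q where "Q = (R + 2) / (2 * r)"
  define n where "n = \<lceil>Q\<rceil> + 1"
  define Z where "Z = {- n..n} \<times> {- n..n}"
  define c where "c z = (2 * r) *\<^sub>R lat z" for z
  have "Q \<ge> 0" using R r by (simp add: Q_def)
  then have n0: "n \<ge> 1" unfolding n_def by linarith
  have cardZ: "r\<^sup>2 * real (card Z) \<le> A0"
  proof -
    have "real (card Z) = (2 * real_of_int n + 1)\<^sup>2"
      using n0 by (simp add: Z_def card_cartesian_product power2_eq_square)
    then have "r\<^sup>2 * real (card Z) = (r * (2 * real_of_int n + 1))\<^sup>2" by (simp add: power_mult_distrib)
    also have "\<dots> \<le> (2 * R + 14)\<^sup>2"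
    proof (rule power_mono)
      have "real_of_int n \<le> Q + 2" unfolding n_def by linarith
      then have "2 * real_of_int n + 1 \<le> 2 * (Q + 2) + 1" by (intro add_mono mult_left_mono) simp_all
      then have "r * (2 * real_of_int n + 1) \<le> r * (2 * (Q + 2) + 1)" by (rule mult_left_mono) (use r in simp)
      also have "\<dots> = R + 2 + 5 * r" using r by (simp add: Q_def field_simps)
      finally show "r * (2 * real_of_int n + 1) \<le> 2 * R + 14" using r R by linarith
      show "0 \<le> r * (2 * real_of_int n + 1)" using r n0 by auto
    qed
    finally show ?thesis by (simp add: A0_def)
  qed
  have cover: "\<exists>z\<in>Z. x \<in> sq (c z) r" if x: "x \<in> sq 0 (R + 2)" for x
  proof
    have rd: "\<bar>u - 2 * r * real_of_int (round (u / (2 * r)))\<bar> \<le> r \<and> round (u / (2 * r)) \<in> {- n..n}" if u: "\<bar>u\<bar> \<le> R + 2" for u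
    proof -
      have a: "\<bar>real_of_int (round (u / (2 * r))) - u / (2 * r)\<bar> \<le> 1 / 2" by (rule of_int_round_abs_le)
      then have "(2 * r) * \<bar>real_of_int (round (u / (2 * r))) - u / (2 * r)\<bar> \<le> (2 * r) * (1 / 2)" using r by (intro mult_left_mono) auto
      moreover have "(2 * r) * \<bar>real_of_int (round (u / (2 * r))) - u / (2 * r)\<bar> = \<bar>u - 2 * r * real_of_int (round (u / (2 * r)))\<bar>"
      proof -
        have "(2 * r) * \<bar>real_of_int (round (u / (2 * r))) - u / (2 * r)\<bar> = \<bar>(2 * r) * (real_of_int (round (u / (2 * r))) - u / (2 * r))\<bar>"
          using r by (simp add: abs_mult)
        also have "(2 * r) * (real_of_int (round (u / (2 * r))) - u / (2 * r)) = 2 * r * real_of_int (round (u / (2 * r))) - u"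
          using r by (simp add: right_diff_distrib)
        finally show ?thesis by (simp add: abs_minus_commute)
      qed
      moreover have "\<bar>u / (2 * r)\<bar> \<le> Q" using u r by (simp add: Q_def divide_right_mono)
      then have "\<bar>real_of_int (round (u / (2 * r)))\<bar> \<le> Q + 1" using a by linarith
      then have "\<bar>round (u / (2 * r))\<bar> \<le> n" unfolding n_def by linarith
      ultimately show ?thesis by auto
    qed
    show "(round (fst x / (2 * r)), round (snd x / (2 * r))) \<in> Z"
      using rd[of "fst x"] rd[of "snd x"] x by (simp add: Z_def mem_sq)
    show "x \<in> sq (c (round (fst x / (2 * r)), round (snd x / (2 * r)))) r"
      using rd[of "fst x"] rd[of "snd x"] x by (simp add: mem_sq c_def lat_def)
  qed
  define Z' where "Z' = {z \<in> Z. sq (c z) r \<inter> K \<noteq> {}}"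
  have fin: "finite Z'" by (simp add: Z'_def Z_def)
  have "\<exists>a. a \<in> sq (c z) r \<inter> K" if "z \<in> Z'" for z using that by (auto simp: Z'_def)
  then obtain a where a: "\<And>z. z \<in> Z' \<Longrightarrow> a z \<in> sq (c z) r \<and> a z \<in> K" by (metis IntD1 IntD2)
  define J where "J z = (\<integral>\<^sup>+y. ennreal (D y powr p) * indicator (sq (c z) (3 * r)) y \<partial>lborel)" for z
  have Jfin: "J z = ennreal (enn2real (J z))" for z
    using D_integral_finite[of "sq (c z) (3 * r)"] by (simp add: J_def less_top)
  define W where "W z = enn2real (J z) powr (1 / p)" for z
  have Wp: "W z powr p = enn2real (J z)" for z using p by (simp add: W_def powr_powr)
  define \<rho> where "\<rho> z = C * (r ^ m * r powr (1 - 2 / p) * W z)" for z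
  have osc: "\<bar>Psi b - Psi (a z)\<bar> \<le> \<rho> z" if "z \<in> Z'" "b \<in> K" "b \<in> sq (c z) r" for z b
    unfolding \<rho>_def
  proof (rule C(2)[where c="c z"])
    show "(\<integral>\<^sup>+y. ennreal (D y powr p) * indicator (sq (c z) (3 * r)) y \<partial>lborel) \<le> ennreal (W z powr p)"
      unfolding Wp using Jfin[of z] by (simp add: J_def)
  qed (use that a r in \<open>auto simp: W_def\<close>)
  have rho: "\<rho> z \<le> C * (\<kappa> powr (1 - p) * enn2real (J z) + \<kappa> * r\<^sup>2)" "\<rho> z \<ge> 0" for z
  proof -
    have "r ^ m \<le> r ^ 1" using r m by (intro power_decreasing) auto
    then have "r ^ m * r powr (1 - 2 / p) * W z \<le> r * r powr (1 - 2 / p) * W z"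
      by (intro mult_right_mono) (auto simp: W_def)
    also have "r * r powr (1 - 2 / p) = r powr (2 - 2 / p)" using r powr_add[of r 1 "1 - 2 / p"] by simp
    \<comment> \<open>The parameter \<kappa> r^(2/p) makes all powers of r cancel in front of the
      integral and leaves r^2 in the other term.\<close>
    also have "r powr (2 - 2 / p) * W z \<le> r powr (2 - 2 / p) * (W z powr p * (\<kappa> * r powr (2 / p)) powr (1 - p) / p + (1 - 1 / p) * (\<kappa> * r powr (2 / p)))"
      using p1 k r by (intro mult_left_mono young_tangent) (auto simp: W_def)
    also have "\<dots> = \<kappa> powr (1 - p) * (W z powr p) * (r powr (2 - 2 / p) * (r powr (2 / p)) powr (1 - p)) / p + (1 - 1 / p) * \<kappa> * (r powr (2 - 2 / p) * r powr (2 / p))"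
      using k r by (simp add: powr_mult algebra_simps)
    also have "r powr (2 - 2 / p) * (r powr (2 / p)) powr (1 - p) = 1"
    proof -
      have "2 - 2 / p + 2 / p * (1 - p) = 0" using p by (simp add: field_simps)
      then show ?thesis using r by (simp add: powr_powr flip: powr_add)
    qed
    also have "r powr (2 - 2 / p) * r powr (2 / p) = r\<^sup>2" using r by (simp flip: powr_add)
    also have "\<kappa> powr (1 - p) * W z powr p * 1 / p \<le> \<kappa> powr (1 - p) * enn2real (J z)"
      unfolding Wp using divide_left_mono[of 1 p "\<kappa> powr (1 - p) * enn2real (J z)"] p1 by simp
    also have "(1 - 1 / p) * \<kappa> * r\<^sup>2 \<le> \<kappa> * r\<^sup>2"
    proof -
      have "(1 - 1 / p) * (\<kappa> * r\<^sup>2) \<le> 1 * (\<kappa> * r\<^sup>2)" using p1 k by (intro mult_right_mono) auto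
      then show ?thesis by (simp add: mult.assoc)
    qed
    finally have "r ^ m * r powr (1 - 2 / p) * W z \<le> \<kappa> powr (1 - p) * enn2real (J z) + \<kappa> * r\<^sup>2" by simp
    then show "\<rho> z \<le> C * (\<kappa> powr (1 - p) * enn2real (J z) + \<kappa> * r\<^sup>2)" unfolding \<rho>_def using C(1) by (intro mult_left_mono) auto
    show "\<rho> z \<ge> 0" unfolding \<rho>_def using C(1) r by (auto simp: W_def)
  qed
  have sumJ: "(\<Sum>z\<in>Z'. enn2real (J z)) \<le> 16 * t"
  proof -
    have "ennreal (\<Sum>z\<in>Z'. enn2real (J z)) = (\<Sum>z\<in>Z'. J z)"
      using Jfin by (simp add: sum_ennreal[symmetric] del: sum_ennreal)
    also have "\<dots> = (\<integral>\<^sup>+y. (\<Sum>z\<in>Z'. ennreal (D y powr p) * indicator (sq (c z) (3 * r)) y) \<partial>lborel)"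
      unfolding J_def by (rule nn_integral_sum[symmetric]) measurable
    also have "\<dots> \<le> (\<integral>\<^sup>+y. 16 * (ennreal (D y powr p) * indicator (layer (8 * r)) y) \<partial>lborel)"
    proof (rule nn_integral_mono)
      fix y
      let ?A = "{z \<in> Z'. y \<in> sq (c z) (3 * r)}"
      let ?B = "{z. - (3/2) * (2 * r) \<le> fst y - (2 * r) * fst (lat z) \<and> fst y - (2 * r) * fst (lat z) \<le> 3/2 * (2 * r) \<and> - (3/2) * (2 * r) \<le> snd y - (2 * r) * snd (lat z) \<and> snd y - (2 * r) * snd (lat z) \<le> 3/2 * (2 * r)}"
      \<comment> \<open>The enlarged squares have radius 3/2 in units of the grid spacing 2 r, so a
        point lies in at most 4 of them in each direction, 16 in all.\<close>
      have AB: "?A \<subseteq> ?B" by (auto simp: mem_sq c_def abs_le_iff)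
      have "card ?A \<le> card ?B" using lattice_count(1)[of "2 * r" "3/2" "-(3/2)" 3 y] r by (intro card_mono[OF _ AB]) auto
      also have "\<dots> \<le> (3 + 1) * (3 + 1)" using lattice_count(2)[of "2 * r" "3/2" "-(3/2)" 3 y] r by auto
      finally have cA: "card ?A \<le> 16" by simp
      have lay: "y \<in> layer (8 * r)" if "z \<in> ?A" for z
      proof -
        have "infdist y K \<le> dist y (a z)" using a[of z] that by (intro infdist_le) auto
        also have "\<dots> \<le> dist y (c z) + dist (a z) (c z)" by (metis dist_commute dist_triangle)
        also have "\<dots> \<le> 2 * (3 * r) + 2 * r" using that a[of z] by (intro add_mono dist_le_sq) auto
        finally show ?thesis by (simp add: layer_def)
      qed
      have "(\<Sum>z\<in>Z'. ennreal (D y powr p) * indicator (sq (c z) (3 * r)) y) = (\<Sum>z\<in>?A. ennreal (D y powr p))"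
        using fin by (intro sum.mono_neutral_cong_right) (auto simp: indicator_def)
      also have "\<dots> = of_nat (card ?A) * ennreal (D y powr p)" by simp
      also have "\<dots> \<le> 16 * (ennreal (D y powr p) * indicator (layer (8 * r)) y)"
      proof (cases "?A = {}")
        case False
        then have "y \<in> layer (8 * r)" using lay by blast
        moreover have "(of_nat (card ?A) :: ennreal) \<le> of_nat 16" using cA by (simp only: of_nat_le_iff)
        ultimately show ?thesis by (simp add: mult_right_mono)
      next
        case True
        show ?thesis unfolding True by simp
      qed
      finally show "(\<Sum>z\<in>Z'. ennreal (D y powr p) * indicator (sq (c z) (3 * r)) y) \<le> 16 * (ennreal (D y powr p) * indicator (layer (8 * r)) y)" .
    qed
    also have "\<dots> = 16 * (\<integral>\<^sup>+y. ennreal (D y powr p) * indicator (layer (8 * r)) y \<partial>lborel)"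
      by (rule nn_integral_cmult) measurable
    also have "\<dots> \<le> 16 * ennreal t" using r0(2)[of "8 * r"] r by (intro mult_left_mono) auto
    also have "\<dots> = ennreal (16 * t)" using t by (simp add: ennreal_mult)
    finally show ?thesis using t by (subst (asm) ennreal_le_iff) auto
  qed
  \<comment> \<open>The radii are increased by \<kappa> r^2, which becomes the margin; the ball
    around 0 takes care of the value of \<open>Psi\<close> off the square.\<close>
  define N where "N = (\<Union>z\<in>Z'. ball (Psi (a z)) (\<rho> z + \<kappa> * r\<^sup>2)) \<union> ball 0 \<kappa>"
  have bm: "emeasure lborel (ball x e) = ennreal (2 * e)" if "e \<ge> 0" for x e :: real
    using that by (simp add: ball_eq_greaterThanLessThan)
  have kr: "\<kappa> * r\<^sup>2 > 0" using k r by simp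
  have nn1: "0 \<le> \<rho> z + \<kappa> * r\<^sup>2" for z using rho(2)[of z] kr by (intro add_nonneg_nonneg) auto
  have nn: "0 \<le> 2 * (\<rho> z + \<kappa> * r\<^sup>2)" for z using rho(2)[of z] kr by simp
  show ?thesis
  proof (rule that[of N "\<kappa> * r\<^sup>2"])
    show "open N" unfolding N_def by auto
    show "\<kappa> * r\<^sup>2 > 0" by (rule kr)
    have "emeasure lborel N \<le> emeasure lborel (\<Union>z\<in>Z'. ball (Psi (a z)) (\<rho> z + \<kappa> * r\<^sup>2)) + emeasure lborel (ball (0::real) \<kappa>)"
      unfolding N_def by (rule emeasure_subadditive) (auto intro!: borel_open)
    also have "emeasure lborel (\<Union>z\<in>Z'. ball (Psi (a z)) (\<rho> z + \<kappa> * r\<^sup>2)) \<le> (\<Sum>z\<in>Z'. emeasure lborel (ball (Psi (a z)) (\<rho> z + \<kappa> * r\<^sup>2)))"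
      using fin by (intro emeasure_subadditive_finite) auto
    also have "\<dots> = ennreal (\<Sum>z\<in>Z'. 2 * (\<rho> z + \<kappa> * r\<^sup>2))"
    proof -
      have "(\<Sum>z\<in>Z'. emeasure lborel (ball (Psi (a z)) (\<rho> z + \<kappa> * r\<^sup>2))) = (\<Sum>z\<in>Z'. ennreal (2 * (\<rho> z + \<kappa> * r\<^sup>2)))"
        by (intro sum.cong refl bm nn1)
      also have "\<dots> = ennreal (\<Sum>z\<in>Z'. 2 * (\<rho> z + \<kappa> * r\<^sup>2))" by (rule sum_ennreal) (rule nn)
      finally show ?thesis .
    qed
    also have "emeasure lborel (ball (0::real) \<kappa>) = ennreal (2 * \<kappa>)" using k by (intro bm) auto
    also have "ennreal (\<Sum>z\<in>Z'. 2 * (\<rho> z + \<kappa> * r\<^sup>2)) + ennreal (2 * \<kappa>) = ennreal ((\<Sum>z\<in>Z'. 2 * (\<rho> z + \<kappa> * r\<^sup>2)) + 2 * \<kappa>)"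
      using nn k by (intro ennreal_plus[symmetric] sum_nonneg) auto
    also have "\<dots> < ennreal \<eta>"
    proof (rule ennreal_lessI[OF \<eta>])
      have "(\<Sum>z\<in>Z'. 2 * (\<rho> z + \<kappa> * r\<^sup>2)) \<le> (\<Sum>z\<in>Z'. 2 * C * \<kappa> powr (1 - p) * enn2real (J z) + 2 * (C + 1) * \<kappa> * r\<^sup>2)"
      proof (rule sum_mono)
        fix z
        have "2 * (\<rho> z + \<kappa> * r\<^sup>2) \<le> 2 * (C * (\<kappa> powr (1 - p) * enn2real (J z) + \<kappa> * r\<^sup>2) + \<kappa> * r\<^sup>2)"
          by (intro mult_left_mono add_right_mono rho(1)) simp
        also have "\<dots> = 2 * C * \<kappa> powr (1 - p) * enn2real (J z) + 2 * (C + 1) * \<kappa> * r\<^sup>2" by (simp add: algebra_simps)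
        finally show "2 * (\<rho> z + \<kappa> * r\<^sup>2) \<le> 2 * C * \<kappa> powr (1 - p) * enn2real (J z) + 2 * (C + 1) * \<kappa> * r\<^sup>2" .
      qed
      also have "\<dots> = 2 * C * \<kappa> powr (1 - p) * (\<Sum>z\<in>Z'. enn2real (J z)) + 2 * (C + 1) * \<kappa> * (r\<^sup>2 * real (card Z'))"
        by (simp add: sum.distrib sum_distrib_left)
      also have "\<dots> \<le> 2 * C * \<kappa> powr (1 - p) * (16 * t) + 2 * (C + 1) * \<kappa> * A0"
      proof (intro add_mono mult_left_mono sumJ)
        have "card Z' \<le> card Z" by (intro card_mono) (auto simp: Z'_def Z_def)
        then have "r\<^sup>2 * real (card Z') \<le> r\<^sup>2 * real (card Z)" by (intro mult_left_mono) auto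
        then show "r\<^sup>2 * real (card Z') \<le> A0" using cardZ by linarith
      qed (use C(1) k in auto)
      also have "2 * C * \<kappa> powr (1 - p) * (16 * t) = \<eta> / 4" using C(1) k by (simp add: t_def)
      finally have "(\<Sum>z\<in>Z'. 2 * (\<rho> z + \<kappa> * r\<^sup>2)) + 2 * \<kappa> \<le> \<eta> / 4 + 2 * (\<kappa> * T)" by (simp add: T_def algebra_simps)
      also have "\<kappa> * T = \<eta> / 4" using T by (simp add: \<kappa>_def)
      finally show "(\<Sum>z\<in>Z'. 2 * (\<rho> z + \<kappa> * r\<^sup>2)) + 2 * \<kappa> < \<eta>" using \<eta> by simp
    qed
    finally show "emeasure lborel N < ennreal \<eta>" by (simp add: add_right_mono)
    fix s assume "s \<in> Psi ` K"
    then obtain b where b: "b \<in> K" "s = Psi b" by auto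
    show "ball s (\<kappa> * r\<^sup>2) \<subseteq> N"
    proof (cases "b \<in> sq 0 (R + 2)")
      case True
      then obtain z where z: "z \<in> Z" "b \<in> sq (c z) r" using cover by blast
      then have zz: "z \<in> Z'" using b by (auto simp: Z'_def)
      have "ball s (\<kappa> * r\<^sup>2) \<subseteq> ball (Psi (a z)) (\<rho> z + \<kappa> * r\<^sup>2)"
      proof
        fix v assume v: "v \<in> ball s (\<kappa> * r\<^sup>2)"
        have "dist (Psi (a z)) v \<le> dist s (Psi (a z)) + dist s v" by (metis dist_commute dist_triangle)
        also have "\<dots> < \<rho> z + \<kappa> * r\<^sup>2" using v osc[OF zz b(1) z(2)] b(2) by (simp add: dist_real_def)
        finally show "v \<in> ball (Psi (a z)) (\<rho> z + \<kappa> * r\<^sup>2)" by simp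
      qed
      then show ?thesis using zz by (auto simp: N_def)
    next
      case False
      then have "s = 0" using b Psi_zero_off by simp
      moreover have "\<kappa> * r\<^sup>2 \<le> \<kappa> * 1" using k r by (intro mult_left_mono) (auto simp: power_le_one)
      ultimately have "ball s (\<kappa> * r\<^sup>2) \<subseteq> ball 0 \<kappa>" by auto
      then show ?thesis by (auto simp: N_def)
    qed
  qed
qed

end

section \<open>A multiscale extension of functions from the complement\<close>

context divfree
begin

text \<open>The ratio 16 exceeds the factor 9 in \<open>comb_zero\<close>: where the distance to
  \<open>K\<close> lies between \<open>rr (Suc j)\<close> and \<open>rr j\<close>, scales beyond
  \<open>Suc j\<close> are not seen, so only two scales meet there. The largest scale
  \<open>rr 0\<close> exceeds every distance to \<open>K\<close>.\<close>

definition rr :: "nat \<Rightarrow> real" where "rr j = (2 * R + 2) / 16 ^ j"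

lemma rr_pos: "rr j > 0" using R by (simp add: rr_def)

lemma rr_Suc: "rr (Suc j) = rr j / 16" by (simp add: rr_def)

lemma rr_mono: "i \<le> j \<Longrightarrow> rr j \<le> rr i"
  unfolding rr_def using R by (intro divide_left_mono power_increasing) auto

lemma infdist_lt_rr0: "infdist x K < rr 0"
proof (cases "x \<in> K")
  case False
  then have x: "x \<in> sq 0 R" using K(2) by blast
  have "(R + 1, snd x) \<in> K" using R by (intro K(2)) (simp add: mem_sq)
  then have "infdist x K \<le> dist x (R + 1, snd x)" by (rule infdist_le)
  also have "\<dots> = \<bar>fst x - (R + 1)\<bar>" by (cases x) (simp add: dist_Pair_Pair dist_real_def)
  also have "\<dots> < rr 0" using x R by (auto simp: mem_sq rr_def abs_le_iff)
  finally show ?thesis .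
qed (simp add: rr_pos)

definition ctr :: "real \<Rightarrow> int \<times> int \<Rightarrow> real \<times> real" where "ctr r z = r *\<^sub>R lat z"

text \<open>A point closer than r to \<open>K\<close> that touches the cell is within 4 r of its
  corner, whence 5 r.\<close>

definition near :: "real \<Rightarrow> int \<times> int \<Rightarrow> bool" where "near r z \<longleftrightarrow> (\<exists>a\<in>K. dist a (ctr r z) < 5 * r)"

definition apt :: "real \<Rightarrow> int \<times> int \<Rightarrow> real \<times> real" where "apt r z = (SOME a. a \<in> K \<and> dist a (ctr r z) < 5 * r)"

lemma apt: "near r z \<Longrightarrow> apt r z \<in> K" "near r z \<Longrightarrow> dist (apt r z) (ctr r z) < 5 * r"
proof -
  have "near r z \<Longrightarrow> apt r z \<in> K \<and> dist (apt r z) (ctr r z) < 5 * r"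
    unfolding near_def apt_def by (rule someI_ex) blast
  then show "near r z \<Longrightarrow> apt r z \<in> K" "near r z \<Longrightarrow> dist (apt r z) (ctr r z) < 5 * r" by auto
qed

text \<open>The points of \<open>K\<close> chosen for cells around \<open>x\<close> lie within 9 r
  of it. For \<open>x\<close> off this square they fall outside \<open>sq 0 (R + 2)\<close>, where
  \<open>H\<close> and \<open>Psi\<close> are 0 on \<open>K\<close>, so all sums of their values
  vanish.\<close>

definition B0 :: real where "B0 = R + 2 + 20 * rr 0"

text \<open>\<open>K\<close> is unbounded; the window retains every cell near \<open>K\<close> that
  touches \<open>sq 0 (B0 + 1)\<close> and makes the sums finite.\<close>

definition Zs :: "real \<Rightarrow> (int \<times> int) set" where
  "Zs r = {z. near r z \<and> ctr r z \<in> sq 0 (B0 + 1 + 2 * r)}"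

lemma finite_Zs: "r > 0 \<Longrightarrow> finite (Zs r)"
proof -
  assume r: "r > 0"
  define X where "X = B0 + 1 + 2 * r"
  obtain n :: nat where n: "2 * X / r \<le> real n" using real_arch_simple by blast
  have "finite {z. (- X / r) * r \<le> fst (0::real\<times>real) - r * fst (lat z) \<and> fst (0::real\<times>real) - r * fst (lat z) \<le> (X / r) * r
    \<and> (- X / r) * r \<le> snd (0::real\<times>real) - r * snd (lat z) \<and> snd (0::real\<times>real) - r * snd (lat z) \<le> (X / r) * r}"
  proof (rule lattice_count(1)[OF r, of _ _ n])
    have "X / r - - X / r = 2 * X / r" by simp
    then show "X / r - - X / r \<le> real n" using n by simp
  qed
  then show "finite (Zs r)"
    by (rule rev_finite_subset) (use r in \<open>auto simp: X_def Zs_def ctr_def mem_sq abs_le_iff\<close>)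
qed

definition pu :: "real \<Rightarrow> int \<times> int \<Rightarrow> real \<times> real \<Rightarrow> real" where
  "pu r z x = eta ((1 / r) *\<^sub>R (x - ctr r z))"

lemma smooth_pu: "smooth (pu r z)"
  unfolding pu_def[abs_def] by (rule smooth_affine[OF smooth_eta])

definition touch :: "real \<Rightarrow> real \<times> real \<Rightarrow> (int \<times> int) set" where
  "touch r x = {z. x \<in> sq (ctr r z) (2 * r)}"

text \<open>On the grid of spacing r a square of radius 2 r contains at most 5 nodes in each
  direction.\<close>

lemma card_touch: "r > 0 \<Longrightarrow> finite (touch r x)" "r > 0 \<Longrightarrow> card (touch r x) \<le> 25"
proof -
  have e: "touch r x = {z. (- 2) * r \<le> fst x - r * fst (lat z) \<and> fst x - r * fst (lat z) \<le> 2 * r \<and> (- 2) * r \<le> snd x - r * snd (lat z) \<and> snd x - r * snd (lat z) \<le> 2 * r}"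
    by (auto simp: touch_def mem_sq ctr_def abs_le_iff)
  show "r > 0 \<Longrightarrow> finite (touch r x)" unfolding e by (rule lattice_count(1)[of _ _ _ 4]) auto
  show "r > 0 \<Longrightarrow> card (touch r x) \<le> 25" unfolding e using lattice_count(2)[of r 2 "-2" 4 x] by simp
qed

lemma dnorm_pu_not_touch:
  assumes "r > 0" "z \<notin> touch r x" shows "dnorm l (pu r z) x = 0"
proof -
  have "(1 / r) *\<^sub>R (x - ctr r z) \<notin> cbox 0 (2, 2)"
  proof
    assume a: "(1 / r) *\<^sub>R (x - ctr r z) \<in> cbox 0 (2, 2)"
    obtain u v where uv: "x - ctr r z = (u, v)" by (metis surj_pair)
    have "(u / r, v / r) \<in> cbox (0, 0) (2, 2)" using a uv by (simp add: zero_prod_def)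
    then have "0 \<le> u" "u \<le> 2 * r" "0 \<le> v" "v \<le> 2 * r" using assms(1) by (auto simp: cbox_Pair_eq field_simps zero_le_divide_iff)
    moreover have "fst x - fst (ctr r z) = u" "snd x - snd (ctr r z) = v" using uv by (metis fst_conv fst_diff, metis snd_conv snd_diff)
    ultimately have "x \<in> sq (ctr r z) (2 * r)" by (auto simp: mem_sq)
    then show False using assms(2) by (simp add: touch_def)
  qed
  then have "dnorm l eta ((1 / r) *\<^sub>R (x - ctr r z)) = 0" by (rule dnorm_eta_zero)
  then show ?thesis unfolding pu_def[abs_def] dnorm_affine[OF smooth_eta] by (simp only: mult_zero_right)
qed

lemma pu_touch: "r > 0 \<Longrightarrow> pu r z x \<noteq> 0 \<Longrightarrow> z \<in> touch r x"
  using dnorm_pu_not_touch[of r z x 0] by auto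

lemma apt_touch:
  assumes r: "r > 0" and z: "z \<in> Zs r" "z \<in> touch r x"
  shows "dist x (apt r z) < 9 * r" "apt r z \<in> K" "apt r z \<in> sq x (9 * r)"
proof -
  have n: "near r z" using z by (simp add: Zs_def)
  have "dist x (apt r z) \<le> dist x (ctr r z) + dist (apt r z) (ctr r z)" by (metis dist_commute dist_triangle)
  also have "dist x (ctr r z) \<le> 2 * (2 * r)" using z by (intro dist_le_sq) (simp add: touch_def)
  also have "2 * (2 * r) + dist (apt r z) (ctr r z) < 9 * r" using apt(2)[OF n] by simp
  finally show d: "dist x (apt r z) < 9 * r" by simp
  show "apt r z \<in> K" by (rule apt(1)[OF n])
  show "apt r z \<in> sq x (9 * r)"
    using d dist_fst_le[of x "apt r z"] dist_snd_le[of x "apt r z"] by (auto simp: mem_sq dist_real_def abs_minus_commute)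
qed

definition Ce :: real where "Ce = (SOME C. C \<ge> 1 \<and> (\<forall>i x. i \<le> Suc m \<longrightarrow> dnorm i eta x \<le> C))"

lemma Ce: "Ce \<ge> 1" "i \<le> Suc m \<Longrightarrow> dnorm i eta x \<le> Ce"
proof -
  have "\<exists>C. C \<ge> 1 \<and> (\<forall>i x. i \<le> Suc m \<longrightarrow> dnorm i eta x \<le> C)"
  proof (rule dnorm_eta_bounded[of "Suc m"])
    fix C :: real assume "C \<ge> 1" "\<And>i x. i \<le> Suc m \<Longrightarrow> dnorm i eta x \<le> C"
    then show "\<exists>C. C \<ge> 1 \<and> (\<forall>i x. i \<le> Suc m \<longrightarrow> dnorm i eta x \<le> C)" by (intro exI[of _ C]) simp
  qed
  then have "Ce \<ge> 1 \<and> (\<forall>i x. i \<le> Suc m \<longrightarrow> dnorm i eta x \<le> Ce)" unfolding Ce_def by (rule someI_ex)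
  then show "Ce \<ge> 1" "i \<le> Suc m \<Longrightarrow> dnorm i eta x \<le> Ce" by blast+
qed

lemma dnorm_pu: "r > 0 \<Longrightarrow> i \<le> Suc m \<Longrightarrow> dnorm i (pu r z) x \<le> Ce * (1 / r) ^ i"
  unfolding pu_def[abs_def] dnorm_affine[OF smooth_eta]
  using mult_left_mono[OF Ce(2)[of i "(1 / r) *\<^sub>R (x - ctr r z)"], of "\<bar>1 / r\<bar> ^ i"] by (simp add: mult.commute)

lemma sum_touch_le:
  assumes "r > 0" "finite Z" "\<And>z. z \<in> Z \<Longrightarrow> z \<notin> touch r x \<Longrightarrow> f z \<le> (0::real)"
    and "\<And>z. z \<in> Z \<Longrightarrow> z \<in> touch r x \<Longrightarrow> f z \<le> B" and "B \<ge> 0"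
  shows "(\<Sum>z\<in>Z. f z) \<le> 25 * B"
proof -
  have "(\<Sum>z\<in>Z. f z) \<le> (\<Sum>z\<in>Z. if z \<in> touch r x then B else 0)" by (rule sum_mono) (use assms in auto)
  also have "\<dots> = (\<Sum>z\<in>Z \<inter> touch r x. B)" by (rule sum.inter_restrict[OF assms(2), symmetric])
  also have "\<dots> = real (card (Z \<inter> touch r x)) * B" by simp
  also have "\<dots> \<le> 25 * B"
  proof (rule mult_right_mono)
    have "card (Z \<inter> touch r x) \<le> card (touch r x)" by (rule card_mono) (use card_touch[OF assms(1)] in auto)
    then show "real (card (Z \<inter> touch r x)) \<le> 25" using card_touch(2)[OF assms(1), of x] by linarith
  qed (rule assms)
  finally show ?thesis .
qed

text \<open>The cells near \<open>K\<close> form a partition of unity only close to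
  \<open>K\<close>: inside the window their total \<open>chi\<close> equals 1 at distance below r,
  and it is 0 at distance 9 r or more. The same device therefore yields the extension and the
  cut-off.\<close>

definition comb :: "real \<Rightarrow> (int \<times> int \<Rightarrow> real) \<Rightarrow> real \<times> real \<Rightarrow> real" where
  "comb r b x = (\<Sum>z\<in>Zs r. b z * pu r z x)"

lemma smooth_comb: "smooth (comb r b)"
  unfolding comb_def[abs_def] by (intro smooth_sum smooth_mult smooth_const smooth_pu)

lemma dnorm_comb:
  assumes r: "r > 0" and i: "i \<le> Suc m" and B: "B \<ge> 0" "\<And>z. z \<in> Zs r \<Longrightarrow> z \<in> touch r x \<Longrightarrow> \<bar>b z\<bar> \<le> B"
  shows "dnorm i (comb r b) x \<le> 25 * Ce * B * (1 / r) ^ i"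
proof -
  have "dnorm i (comb r b) x \<le> (\<Sum>z\<in>Zs r. dnorm i (\<lambda>x. b z * pu r z x) x)"
    unfolding comb_def[abs_def] by (rule dnorm_sum) (intro smooth_mult smooth_const smooth_pu)
  also have "\<dots> = (\<Sum>z\<in>Zs r. \<bar>b z\<bar> * dnorm i (pu r z) x)" by (simp add: dnorm_cmult[OF smooth_pu])
  also have "\<dots> \<le> 25 * (B * (Ce * (1 / r) ^ i))"
  proof (rule sum_touch_le[OF r finite_Zs[OF r]])
    show "\<bar>b z\<bar> * dnorm i (pu r z) x \<le> 0" if "z \<notin> touch r x" for z by (simp add: dnorm_pu_not_touch[OF r that])
    show "\<bar>b z\<bar> * dnorm i (pu r z) x \<le> B * (Ce * (1 / r) ^ i)" if "z \<in> Zs r" "z \<in> touch r x" for z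
      by (rule mult_mono[OF B(2)[OF that] dnorm_pu[OF r i] B(1) dnorm_nonneg])
    show "0 \<le> B * (Ce * (1 / r) ^ i)" using B Ce(1) r by simp
  qed
  finally show ?thesis by (simp add: mult_ac)
qed

abbreviation chi :: "real \<Rightarrow> real \<times> real \<Rightarrow> real" where "chi r \<equiv> comb r (\<lambda>z. 1)"

text \<open>One-scale extension of Whitney type: each cell carries the value of \<open>H\<close> at
  a chosen nearby point of \<open>K\<close>.\<close>

abbreviation TT :: "real \<Rightarrow> (real \<times> real \<Rightarrow> real) \<Rightarrow> real \<times> real \<Rightarrow> real" where
  "TT r H \<equiv> comb r (\<lambda>z. H (apt r z))"

lemma comb_cong:
  assumes "r > 0" "\<And>z. z \<in> Zs r \<Longrightarrow> z \<in> touch r x \<Longrightarrow> b z = b' z"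
  shows "comb r b x = comb r b' x"
  unfolding comb_def
proof (rule sum.cong)
  fix z assume z: "z \<in> Zs r"
  show "b z * pu r z x = b' z * pu r z x"
    using assms(2)[OF z] pu_touch[OF assms(1), of z x] by (cases "pu r z x = 0") auto
qed simp

lemma comb_const: "comb r (\<lambda>z. c) x = c * chi r x"
  by (simp add: comb_def sum_distrib_left)

lemma comb_diff: "comb r (\<lambda>z. b z - b' z) x = comb r b x - comb r b' x"
  by (simp add: comb_def left_diff_distrib sum_subtractf)

lemma comb_zero: "r > 0 \<Longrightarrow> infdist x K \<ge> 9 * r \<Longrightarrow> comb r b x = 0"
proof -
  assume r: "r > 0" and d: "infdist x K \<ge> 9 * r"
  have "comb r b x = comb r (\<lambda>z. 0) x"
  proof (rule comb_cong[OF r])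
    fix z assume z: "z \<in> Zs r" "z \<in> touch r x"
    have "infdist x K \<le> dist x (apt r z)" by (rule infdist_le[OF apt_touch(2)[OF r z]])
    then show "b z = 0" using apt_touch(1)[OF r z] d by simp
  qed
  then show ?thesis by (simp add: comb_def)
qed

lemma infdist_lt_obtain:
  assumes "infdist x K < r" obtains a where "a \<in> K" "dist x a < r"
  using assms K_nonempty unfolding infdist_def by (auto simp: cInf_less_iff)

lemma chi_one:
  assumes r: "r > 0" and x: "x \<in> sq 0 (B0 + 1)" and d: "infdist x K < r"
  shows "chi r x = 1"
proof -
  have e: "pu r z y = eta ((1 / r) *\<^sub>R y - lat z)" for z y
    using r by (simp add: pu_def ctr_def scaleR_diff_right)
  obtain a where a: "a \<in> K" "dist x a < r" by (rule infdist_lt_obtain[OF d])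
  have "(\<Sum>z\<in>Zs r. eta ((1 / r) *\<^sub>R x - lat z)) = 1"
  proof (rule eta_partition[OF finite_Zs[OF r]])
    fix z assume "eta ((1 / r) *\<^sub>R x - lat z) \<noteq> 0"
    then have "z \<in> touch r x" using pu_touch[OF r, of z x] by (simp add: e)
    then have t: "x \<in> sq (ctr r z) (2 * r)" by (simp add: touch_def)
    have "dist a (ctr r z) \<le> dist x a + dist x (ctr r z)" by (metis dist_commute dist_triangle)
    also have "\<dots> < r + 2 * (2 * r)" using a dist_le_sq[OF t] by linarith
    finally have "near r z" using a by (auto simp: near_def)
    moreover have "ctr r z \<in> sq 0 (B0 + 1 + 2 * r)" using t x by (auto simp: mem_sq)
    ultimately show "z \<in> Zs r" by (simp add: Zs_def)
  qed
  then show ?thesis by (simp add: comb_def e)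
qed

lemma apt_out:
  assumes r: "r > 0" "r \<le> rr 0" and x: "x \<notin> sq 0 B0" and z: "z \<in> Zs r" "z \<in> touch r x"
  shows "apt r z \<notin> sq 0 (R + 2)"
  using apt_touch(3)[OF r(1) z] x r rr_pos[of 0] by (auto simp: mem_sq B0_def)

context
  fixes H :: "real \<times> real \<Rightarrow> real"
  assumes H0: "\<And>a. a \<in> K \<Longrightarrow> a \<notin> sq 0 (R + 2) \<Longrightarrow> H a = 0"
begin

lemma TT_out: "r > 0 \<Longrightarrow> r \<le> rr 0 \<Longrightarrow> x \<notin> sq 0 B0 \<Longrightarrow> TT r H x = 0"
proof -
  assume a: "r > 0" "r \<le> rr 0" "x \<notin> sq 0 B0"
  have "TT r H x = comb r (\<lambda>z. 0) x"
    by (rule comb_cong[OF a(1)]) (use H0 apt_out[OF a] apt_touch(2)[OF a(1)] in blast)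
  then show ?thesis by (simp add: comb_def)
qed

text \<open>Each step overwrites the coarse extension near \<open>K\<close> by the next scale, with
  \<open>chi\<close> as the transition. Since \<open>TT\<close> is already weighted by the cells
  that make up \<open>chi\<close>, the new term enters without a further factor.\<close>

primrec EE :: "nat \<Rightarrow> real \<times> real \<Rightarrow> real" where
  "EE 0 = TT (rr 0) H"
| "EE (Suc j) = (\<lambda>x. (1 - chi (rr (Suc j)) x) * EE j x + TT (rr (Suc j)) H x)"

lemma smooth_EE: "smooth (EE j)"
  by (induction j) (auto intro!: smooth_comb smooth_add smooth_mult smooth_diff smooth_const)

lemma EE_inner: "x \<in> sq 0 (B0 + 1) \<Longrightarrow> infdist x K < rr j \<Longrightarrow> EE j x = TT (rr j) H x"
  by (cases j) (auto simp: chi_one[OF rr_pos])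

lemma EE_stable: "infdist x K \<ge> 9 * rr (Suc j) \<Longrightarrow> EE (j + n) x = EE j x"
proof (induction n)
  case (Suc n)
  have "9 * rr (Suc (j + n)) \<le> infdist x K" using Suc.prems rr_mono[of "Suc j" "Suc (j + n)"] by linarith
  then show ?case using Suc by (simp add: comb_zero[OF rr_pos])
qed simp

lemma EE_out: "x \<notin> sq 0 B0 \<Longrightarrow> EE j x = 0"
  by (induction j) (auto simp: TT_out rr_pos rr_mono)

definition CE :: real where "CE = 4 ^ Suc m * (1 + 25 * Ce) * (25 * Ce) + 25 * Ce"

lemma CE_pos: "CE > 0" using Ce(1) by (auto simp: CE_def intro!: add_pos_pos mult_pos_pos)

lemma interior_box: "open {x::real\<times>real. \<bar>fst x\<bar> < b \<and> \<bar>snd x\<bar> < b}"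
  by (intro open_Collect_conj open_Collect_less continuous_intros)

lemma dnorm_EE_out: "x \<notin> sq 0 B0 \<Longrightarrow> dnorm l (EE j) x = 0"
proof -
  assume x: "x \<notin> sq 0 B0"
  have "dnorm l (EE j) x = dnorm l (\<lambda>x. 0) x"
    by (rule dnorm_cong_open[of "- sq 0 B0"]) (use x EE_out in \<open>auto simp: sq_def open_Compl closed_cbox\<close>)
  then show ?thesis by (simp add: dnorm_0)
qed

text \<open>Around \<open>x\<close> only the scales j and j + 1 are active, and the extension is a
  fixed value \<open>H a\<close> plus combinations of differences of values of \<open>H\<close>.
  Derivatives of order at least 1 do not see \<open>H a\<close>, so they are bounded by the local
  oscillation of \<open>H\<close>.\<close>

lemma dnorm_EE_strip:
  assumes x: "x \<in> sq 0 B0" and d: "rr (Suc j) \<le> infdist x K" "infdist x K < rr j" and J: "j < J"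
    and l: "1 \<le> l" "l \<le> Suc m" and B: "B \<ge> 0"
    and HB: "\<And>a b. a \<in> K \<Longrightarrow> b \<in> K \<Longrightarrow> a \<in> sq x (9 * rr j) \<Longrightarrow> b \<in> sq x (9 * rr j) \<Longrightarrow> \<bar>H a - H b\<bar> \<le> B"
  shows "dnorm l (EE J) x \<le> CE * B * (1 / rr (Suc j)) ^ l"
proof -
  let ?r = "rr (Suc j)" and ?R = "rr j"
  have r: "?r > 0" "?R > 0" "?r \<le> ?R" using rr_pos rr_mono by auto
  obtain a where a: "a \<in> K" "dist x a < ?R" by (rule infdist_lt_obtain[OF d(2)])
  have ax: "a \<in> sq x (9 * ?R)"
    using a(2) r dist_fst_le[of x a] dist_snd_le[of x a] by (auto simp: mem_sq dist_real_def abs_minus_commute)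
  define P where "P = comb ?R (\<lambda>z. H (apt ?R z) - H a)"
  define Q where "Q = comb ?r (\<lambda>z. H (apt ?r z) - H a)"
  \<comment> \<open>An open set on which the reduced formula holds identically, as is required to
    differentiate it; the extra unit in \<open>B0 + 1\<close> keeps points on the edge of
    \<open>sq 0 B0\<close> inside.\<close>
  let ?O = "{y. 9 * rr (Suc (Suc j)) < infdist y K} \<inter> {y. infdist y K < ?R} \<inter> {y. \<bar>fst y\<bar> < B0 + 1 \<and> \<bar>snd y\<bar> < B0 + 1}"
  have "open ?O" by (intro open_Int interior_box open_Collect_less continuous_intros)
  moreover have "x \<in> ?O" using x d r by (auto simp: mem_sq rr_Suc[of "Suc j"])
  moreover have "EE J y = H a + ((1 - chi ?r y) * P y + Q y)" if y: "y \<in> ?O" for y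
  proof -
    have yb: "y \<in> sq 0 (B0 + 1)" using y by (auto simp: mem_sq)
    obtain n where n: "J = Suc j + n" using le_Suc_ex[OF Suc_leI[OF J]] by (elim exE)
    have "EE J y = EE (Suc j) y" unfolding n using y by (intro EE_stable) auto
    also have "\<dots> = (1 - chi ?r y) * EE j y + TT ?r H y" by simp
    also have "EE j y = TT ?R H y" using y yb by (intro EE_inner) auto
    also have "TT ?R H y = H a + P y"
      using chi_one[OF r(2) yb] y by (simp add: P_def comb_diff comb_const[where c="H a"])
    also have "TT ?r H y = H a * chi ?r y + Q y" by (simp add: Q_def comb_diff comb_const[where c="H a"])
    finally show ?thesis by (simp add: algebra_simps)
  qed
  ultimately have "dnorm l (EE J) x = dnorm l (\<lambda>y. H a + ((1 - chi ?r y) * P y + Q y)) x"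
    by (rule dnorm_cong_open)
  also have "\<dots> \<le> dnorm l (\<lambda>y. H a) x + dnorm l (\<lambda>y. (1 - chi ?r y) * P y + Q y) x"
    unfolding P_def Q_def by (intro dnorm_add smooth_const smooth_add smooth_mult smooth_diff smooth_comb)
  also have "dnorm l (\<lambda>y. H a) x = 0" using l dnorm_const[of "l - 1"] by simp
  also have "dnorm l (\<lambda>y. (1 - chi ?r y) * P y + Q y) x \<le> dnorm l (\<lambda>y. (1 - chi ?r y) * P y) x + dnorm l Q x"
    unfolding P_def Q_def by (intro dnorm_add smooth_const smooth_add smooth_mult smooth_diff smooth_comb)
  also have "dnorm l Q x \<le> 25 * Ce * B * (1 / ?r) ^ l"
    unfolding Q_def
  proof (rule dnorm_comb[OF r(1) l(2) B])
    fix z assume z: "z \<in> Zs ?r" "z \<in> touch ?r x"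
    have "apt ?r z \<in> sq x (9 * ?R)" using apt_touch(3)[OF r(1) z] r by (auto simp: mem_sq)
    then show "\<bar>H (apt ?r z) - H a\<bar> \<le> B" by (intro HB apt_touch(2)[OF r(1) z] a ax)
  qed
  also have "dnorm l (\<lambda>y. (1 - chi ?r y) * P y) x \<le> 4 ^ l * (1 + 25 * Ce) * (25 * Ce * B) * (1 / ?r) ^ l"
  proof (rule dnorm_mult)
    show "smooth (\<lambda>y. 1 - chi ?r y)" "smooth P" unfolding P_def by (intro smooth_const smooth_diff smooth_comb)+
    show "0 \<le> 1 + 25 * Ce" "0 \<le> 25 * Ce * B" "0 \<le> 1 / ?r" using Ce(1) B r by auto
    fix i assume i: "i \<le> l"
    have c: "dnorm i (chi ?r) x \<le> 25 * Ce * 1 * (1 / ?r) ^ i" using i l by (intro dnorm_comb r) auto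
    have "dnorm i (\<lambda>y. 1 - chi ?r y) x \<le> dnorm i (\<lambda>y. 1) x + dnorm i (\<lambda>y. - chi ?r y) x"
      using dnorm_add[of "\<lambda>y. 1" "\<lambda>y. - chi ?r y" i x] by (simp add: smooth_const smooth_uminus smooth_comb)
    also have "dnorm i (\<lambda>y. - chi ?r y) x = dnorm i (chi ?r) x" by (rule dnorm_uminus[OF smooth_comb])
    also have "dnorm i (\<lambda>y. 1) x \<le> (1 / ?r) ^ i"
      using r dnorm_const[of "i - 1" 1 x] by (cases i) auto
    finally show "dnorm i (\<lambda>y. 1 - chi ?r y) x \<le> (1 + 25 * Ce) * (1 / ?r) ^ i" using c by (simp add: distrib_right)
    have "dnorm i P x \<le> 25 * Ce * B * (1 / ?R) ^ i"
      unfolding P_def using i l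
      by (intro dnorm_comb r B HB apt_touch[OF r(2)] a ax) auto
    also have "\<dots> \<le> 25 * Ce * B * (1 / ?r) ^ i"
      using Ce(1) B r by (intro mult_left_mono power_mono divide_left_mono) auto
    finally show "dnorm i P x \<le> 25 * Ce * B * (1 / ?r) ^ i" .
  qed
  also have "4 ^ l * (1 + 25 * Ce) * (25 * Ce * B) * (1 / ?r) ^ l \<le> 4 ^ Suc m * (1 + 25 * Ce) * (25 * Ce * B) * (1 / ?r) ^ l"
    using Ce(1) B r l by (intro mult_right_mono power_increasing) auto
  finally show ?thesis by (simp add: CE_def algebra_simps)
qed

text \<open>At the stopping scale there is no finer term: one combination of differences remains,
  and its derivatives cost powers of 1 / rr J only.\<close>

lemma dnorm_EE_inner:
  assumes x: "x \<in> sq 0 B0" and d: "infdist x K < rr J"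
    and l: "1 \<le> l" "l \<le> Suc m" and B: "B \<ge> 0"
    and HB: "\<And>a b. a \<in> K \<Longrightarrow> b \<in> K \<Longrightarrow> a \<in> sq x (9 * rr J) \<Longrightarrow> b \<in> sq x (9 * rr J) \<Longrightarrow> \<bar>H a - H b\<bar> \<le> B"
  shows "dnorm l (EE J) x \<le> CE * B * (1 / rr J) ^ l"
proof -
  let ?r = "rr J"
  have r: "?r > 0" using rr_pos by auto
  obtain a where a: "a \<in> K" "dist x a < ?r" by (rule infdist_lt_obtain[OF d])
  have ax: "a \<in> sq x (9 * ?r)"
    using a(2) r dist_fst_le[of x a] dist_snd_le[of x a] by (auto simp: mem_sq dist_real_def abs_minus_commute)
  define Q where "Q = comb ?r (\<lambda>z. H (apt ?r z) - H a)"
  let ?O = "{y. infdist y K < ?r} \<inter> {y. \<bar>fst y\<bar> < B0 + 1 \<and> \<bar>snd y\<bar> < B0 + 1}"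
  have "open ?O" by (intro open_Int interior_box open_Collect_less continuous_intros)
  moreover have "x \<in> ?O" using x d by (auto simp: mem_sq)
  moreover have "EE J y = H a + Q y" if y: "y \<in> ?O" for y
  proof -
    have yb: "y \<in> sq 0 (B0 + 1)" using y by (auto simp: mem_sq)
    have "EE J y = TT ?r H y" using y yb by (intro EE_inner) auto
    then show ?thesis using chi_one[OF r yb] y by (simp add: Q_def comb_diff comb_const[where c="H a"])
  qed
  ultimately have "dnorm l (EE J) x = dnorm l (\<lambda>y. H a + Q y) x"
    by (rule dnorm_cong_open)
  also have "\<dots> \<le> dnorm l (\<lambda>y. H a) x + dnorm l Q x"
    unfolding Q_def by (intro dnorm_add smooth_const smooth_comb)
  also have "dnorm l (\<lambda>y. H a) x = 0" using l dnorm_const[of "l - 1"] by simp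
  also have "dnorm l Q x \<le> 25 * Ce * B * (1 / ?r) ^ l"
    unfolding Q_def by (intro dnorm_comb[OF r l(2) B] HB apt_touch[OF r] a ax)
  also have "25 * Ce * B * (1 / ?r) ^ l \<le> CE * B * (1 / ?r) ^ l"
    using Ce(1) B r by (intro mult_right_mono) (auto simp: CE_def)
  finally show ?thesis by simp
qed

section \<open>Correction of the mollified stream function near the complement\<close>

definition XX :: "real \<Rightarrow> nat \<Rightarrow> real \<times> real \<Rightarrow> real" where
  "XX \<delta> J x = (\<Sum>z\<in>Zs (rr J). pu (rr J) z x * (psi \<delta> x - Psi (apt (rr J) z)))"

text \<open>Near \<open>K\<close>, where \<open>chi\<close> is 1, the mollified \<open>psi\<close>
  cancels against its correction and what remains is \<open>TT (rr J)\<close> applied to Psi - H, a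
  combination of values on \<open>K\<close> only.\<close>

definition FF :: "real \<Rightarrow> nat \<Rightarrow> real \<times> real \<Rightarrow> real" where
  "FF \<delta> J x = psi \<delta> x - (EE J x + XX \<delta> J x)"

text \<open>This form serves for supports and values. The defining sum is the one to differentiate,
  because each factor \<open>psi \<delta> x - Psi (apt (rr J) z)\<close> is small on its
  cell.\<close>

lemma XX_eq: "XX \<delta> J x = chi (rr J) x * psi \<delta> x - TT (rr J) Psi x"
  by (simp add: XX_def comb_def right_diff_distrib sum_subtractf sum_distrib_left sum_distrib_right mult_ac)

context
  fixes \<delta> :: real
  assumes \<delta>: "0 < \<delta>" "\<delta> \<le> 1"
begin

lemma smooth_XX: "smooth (XX \<delta> J)"
  unfolding XX_def[abs_def] by (intro smooth_sum smooth_mult smooth_diff smooth_const smooth_pu smooth_psi \<delta>)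

lemma smooth_FF: "smooth (FF \<delta> J)"
  unfolding FF_def[abs_def] by (intro smooth_add smooth_diff smooth_psi \<delta> smooth_EE smooth_XX)

lemma XX_out: "x \<notin> sq 0 B0 \<Longrightarrow> XX \<delta> J x = 0"
proof -
  assume x: "x \<notin> sq 0 B0"
  have "x \<notin> sq 0 (R + 2)" using x rr_pos[of 0] by (auto simp: mem_sq B0_def)
  then have "psi \<delta> x = 0" by (rule psi_zero_left[OF \<delta>])
  moreover have "TT (rr J) Psi x = comb (rr J) (\<lambda>z. 0) x"
    by (rule comb_cong[OF rr_pos]) (use apt_out[OF rr_pos rr_mono x] Psi_zero_off in auto)
  ultimately show ?thesis by (simp add: XX_eq comb_def)
qed

lemma FF_out: "x \<notin> sq 0 B0 \<Longrightarrow> FF \<delta> J x = 0"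
proof -
  assume x: "x \<notin> sq 0 B0"
  have "x \<notin> sq 0 (R + 2)" using x rr_pos[of 0] by (auto simp: mem_sq B0_def)
  then show ?thesis using psi_zero_left[OF \<delta>] EE_out[OF x] XX_out[OF x] by (simp add: FF_def)
qed

text \<open>Psi - H takes one value at all points of \<open>K\<close> near \<open>x\<close>, so
  around \<open>x\<close> the sum over cells is this constant times \<open>chi\<close>, which is 1.
  The radius 10 allows for 9 r around a point y at distance less than r from
  \<open>x\<close>.\<close>

lemma FF_gradient_zero:
  assumes G: "\<And>x a b. infdist x K < rr J \<Longrightarrow> a \<in> K \<Longrightarrow> b \<in> K \<Longrightarrow> a \<in> sq x (10 * rr J) \<Longrightarrow> b \<in> sq x (10 * rr J) \<Longrightarrow> Psi a - H a = Psi b - H b"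
    and x: "infdist x K < rr J"
  shows "pd1 (FF \<delta> J) x = 0" "pd2 (FF \<delta> J) x = 0"
proof -
  let ?r = "rr J"
  have r: "?r > 0" by (rule rr_pos)
  obtain a where a: "a \<in> K" "dist x a < ?r" by (rule infdist_lt_obtain[OF x])
  have ax: "a \<in> sq x (10 * ?r)"
    using a(2) r dist_fst_le[of x a] dist_snd_le[of x a] by (auto simp: mem_sq dist_real_def abs_minus_commute)
  have "\<exists>c V. open V \<and> x \<in> V \<and> (\<forall>y\<in>V. FF \<delta> J y = c)"
  proof (cases "x \<in> sq 0 B0")
    case False
    show ?thesis
      by (rule exI[of _ 0], rule exI[of _ "- sq 0 B0"]) (use False FF_out in \<open>auto simp: sq_def open_Compl closed_cbox\<close>)
  next
    case True
    let ?V = "{y. infdist y K < ?r} \<inter> {y. \<bar>fst y\<bar> < B0 + 1 \<and> \<bar>snd y\<bar> < B0 + 1} \<inter> ball x ?r"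
    have "open ?V" by (intro open_Int interior_box open_Collect_less continuous_intros open_ball)
    moreover have "x \<in> ?V" using True x r by (auto simp: mem_sq)
    moreover have "FF \<delta> J y = Psi a - H a" if y: "y \<in> ?V" for y
    proof -
      have yb: "y \<in> sq 0 (B0 + 1)" using y by (auto simp: mem_sq)
      have ch: "chi ?r y = 1" using chi_one[OF r yb] y by simp
      have "FF \<delta> J y = TT ?r Psi y - TT ?r H y"
        using ch EE_inner[OF yb, of J] y by (simp add: FF_def XX_eq)
      also have "\<dots> = comb ?r (\<lambda>z. Psi (apt ?r z) - H (apt ?r z)) y" by (simp add: comb_diff)
      also have "\<dots> = comb ?r (\<lambda>z. Psi a - H a) y"
      proof (rule comb_cong[OF r])
        fix z assume z: "z \<in> Zs ?r" "z \<in> touch ?r y"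
        have "dist x y < ?r" using y by simp
        then have "apt ?r z \<in> sq x (10 * ?r)"
          using apt_touch(3)[OF r z] dist_fst_le[of x y] dist_snd_le[of x y] by (auto simp: mem_sq dist_real_def)
        then show "Psi (apt ?r z) - H (apt ?r z) = Psi a - H a" by (intro G[OF x] apt_touch(2)[OF r z] a ax)
      qed
      also have "\<dots> = Psi a - H a" by (simp add: comb_const[where c="Psi a - H a"] ch)
      finally show ?thesis .
    qed
    ultimately show ?thesis by blast
  qed
  then obtain c V where V: "open V" "x \<in> V" "\<And>y. y \<in> V \<Longrightarrow> FF \<delta> J y = c" by blast
  show "pd1 (FF \<delta> J) x = 0" "pd2 (FF \<delta> J) x = 0"
    using pd_cong_open[OF V(1,2), of "FF \<delta> J" "\<lambda>y. c"] V(3) by (simp_all add: pd_const)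
qed

lemma dnorm_XX_far: "infdist x K > 9 * rr J \<or> x \<notin> sq 0 B0 \<Longrightarrow> dnorm l (XX \<delta> J) x = 0"
proof -
  assume x: "infdist x K > 9 * rr J \<or> x \<notin> sq 0 B0"
  let ?O = "{y. 9 * rr J < infdist y K} \<union> - sq 0 B0"
  have "open ?O" by (intro open_Un open_Collect_less continuous_intros) (simp add: sq_def open_Compl closed_cbox)
  moreover have "x \<in> ?O" using x by auto
  moreover have "XX \<delta> J y = 0" if "y \<in> ?O" for y
    using that XX_out[of y J] by (auto simp: XX_eq comb_zero[OF rr_pos])
  ultimately have "dnorm l (XX \<delta> J) x = dnorm l (\<lambda>x. 0) x" by (rule dnorm_cong_open)
  then show ?thesis by (simp add: dnorm_0)
qed

lemma dnorm_XX:
  assumes l: "l \<le> Suc m" and B: "B \<ge> 0"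
    and ps: "\<And>z i. z \<in> Zs (rr J) \<Longrightarrow> z \<in> touch (rr J) x \<Longrightarrow> i \<le> l \<Longrightarrow> dnorm i (\<lambda>y. psi \<delta> y - Psi (apt (rr J) z)) x \<le> B * (1 / rr J) ^ i"
  shows "dnorm l (XX \<delta> J) x \<le> 25 * (4 ^ l * Ce * B * (1 / rr J) ^ l)"
proof -
  let ?r = "rr J"
  have r: "?r > 0" by (rule rr_pos)
  have sm: "smooth (\<lambda>y. psi \<delta> y - c)" for c by (intro smooth_diff smooth_psi \<delta> smooth_const)
  have "dnorm l (XX \<delta> J) x \<le> (\<Sum>z\<in>Zs ?r. dnorm l (\<lambda>x. pu ?r z x * (psi \<delta> x - Psi (apt ?r z))) x)"
    unfolding XX_def[abs_def] by (rule dnorm_sum) (intro smooth_mult smooth_pu sm)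
  also have "\<dots> \<le> 25 * (4 ^ l * Ce * B * (1 / ?r) ^ l)"
  proof (rule sum_touch_le[OF r finite_Zs[OF r]])
    show "0 \<le> 4 ^ l * Ce * B * (1 / ?r) ^ l" using Ce(1) B r by auto
    show "dnorm l (\<lambda>x. pu ?r z x * (psi \<delta> x - Psi (apt ?r z))) x \<le> 4 ^ l * Ce * B * (1 / ?r) ^ l" if z: "z \<in> Zs ?r" "z \<in> touch ?r x" for z
      by (rule dnorm_mult[OF smooth_pu sm]) (use Ce(1) B r l z in \<open>auto intro!: dnorm_pu ps\<close>)
    show "dnorm l (\<lambda>x. pu ?r z x * (psi \<delta> x - Psi (apt ?r z))) x \<le> 0" if z: "z \<in> Zs ?r" "z \<notin> touch ?r x" for z
    proof -
      have "x \<in> - sq (ctr ?r z) (2 * ?r)" using z by (simp add: touch_def)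
      moreover have "open (- sq (ctr ?r z) (2 * ?r))" by (simp add: sq_def open_Compl closed_cbox)
      moreover have "pu ?r z y * (psi \<delta> y - Psi (apt ?r z)) = 0" if "y \<in> - sq (ctr ?r z) (2 * ?r)" for y
        using pu_touch[OF r, of z y] that by (auto simp: touch_def)
      ultimately have "dnorm l (\<lambda>x. pu ?r z x * (psi \<delta> x - Psi (apt ?r z))) x = dnorm l (\<lambda>x. 0) x"
        by (intro dnorm_cong_open[of "- sq (ctr ?r z) (2 * ?r)"]) auto
      then show ?thesis by (simp add: dnorm_0)
    qed
  qed
  finally show ?thesis .
qed

end

end

end

section \<open>Convergence in the Sobolev norm\<close>

context divfree
begin

text \<open>The midpoint of 2 and \<open>p\<close>; any exponent strictly between them would do.
  Morrey's inequality is used with \<open>q\<close>, the maximal theorem with p / q.\<close>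

definition q :: real where "q = (p + 2) / 2"

lemma q: "q > 2" "q < p" "q > 0" using p by (auto simp: q_def)

lemma sq_subset_cball: "sq x r \<subseteq> cball x (2 * r)"
  using dist_le_sq[of _ x r] by (auto simp: dist_commute)

text \<open>27 = 3 * 9: the oscillation over points within 9 rr j involves \<open>D\<close> on the
  tripled square, and that square lies in the disc of radius 54 rr j.\<close>

lemma maximal_D:
  obtains Hm :: "real \<times> real \<Rightarrow> real" where "Hm \<in> borel_measurable borel" "\<And>x. Hm x \<ge> 0"
    "(\<integral>\<^sup>+x. ennreal (Hm x powr (p / q)) \<partial>lborel) < \<infinity>"
    "AE x in lborel. \<forall>j. (\<integral>\<^sup>+y. ennreal (D y powr q) * indicator (sq x (27 * rr j)) y \<partial>lborel) \<le> ennreal (Hm x * (54 * rr j)\<^sup>2)"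
proof -
  have e: "(D y powr q) powr (p / q) = D y powr p" for y using q by (simp add: powr_powr)
  have fm: "(\<lambda>y. D y powr q) \<in> borel_measurable borel" by measurable
  have f0: "D x powr q \<ge> 0" for x by simp
  have s1: "p / q > 1" using q by simp
  have fin: "(\<integral>\<^sup>+x. ennreal ((D x powr q) powr (p / q)) \<partial>lborel) < \<infinity>" unfolding e by (rule D_Lp)
  have rho: "0 < 54 * rr n \<and> 54 * rr n \<le> 54 * rr 0" for n using rr_pos[of n] rr_mono[of 0 n] by simp
  show thesis
  proof (rule maximal_inequality[OF fm f0 s1 fin rho])
  fix Hm :: "real \<times> real \<Rightarrow> real"
  assume H: "Hm \<in> borel_measurable borel" "\<And>x. Hm x \<ge> 0" "(\<integral>\<^sup>+x. ennreal (Hm x powr (p / q)) \<partial>lborel) < \<infinity>"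
    and ae: "AE x in lborel. \<forall>j. (\<integral>\<^sup>+y. ennreal (D y powr q) * indicator (cball x (54 * rr j)) y \<partial>lborel) \<le> ennreal (Hm x * (54 * rr j)\<^sup>2)"
  from ae have "AE x in lborel. \<forall>j. (\<integral>\<^sup>+y. ennreal (D y powr q) * indicator (sq x (27 * rr j)) y \<partial>lborel) \<le> ennreal (Hm x * (54 * rr j)\<^sup>2)"
  proof eventually_elim
    case (elim x)
    show ?case
    proof
      fix j
      have "sq x (27 * rr j) \<subseteq> cball x (54 * rr j)" using sq_subset_cball[of x "27 * rr j"] by simp
      then have "(\<integral>\<^sup>+y. ennreal (D y powr q) * indicator (sq x (27 * rr j)) y \<partial>lborel) \<le> (\<integral>\<^sup>+y. ennreal (D y powr q) * indicator (cball x (54 * rr j)) y \<partial>lborel)"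
        by (intro nn_integral_mono mult_left_mono) (auto simp: indicator_def)
      also have "\<dots> \<le> ennreal (Hm x * (54 * rr j)\<^sup>2)" using elim by blast
      finally show "(\<integral>\<^sup>+y. ennreal (D y powr q) * indicator (sq x (27 * rr j)) y \<partial>lborel) \<le> ennreal (Hm x * (54 * rr j)\<^sup>2)" .
    qed
  qed
  from H this show thesis by (rule that)
  qed
qed

text \<open>What the estimates use of H = h o Psi. With the truncation hidden behind a predicate,
  constants and exceptional null sets are fixed before \<epsilon> and \<open>H\<close> are
  chosen.\<close>

definition admissible :: "real \<Rightarrow> (real \<times> real \<Rightarrow> real) \<Rightarrow> bool" where
  "admissible \<epsilon> H \<longleftrightarrow> (\<forall>a\<in>K. a \<notin> sq 0 (R + 2) \<longrightarrow> H a = 0) \<and> (\<forall>a\<in>K. \<bar>H a\<bar> \<le> \<epsilon>)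
     \<and> (\<forall>a\<in>K. \<forall>b\<in>K. \<bar>H a - H b\<bar> \<le> \<bar>Psi a - Psi b\<bar>)"

lemma admissibleD:
  assumes "admissible \<epsilon> H"
  shows "\<And>a. a \<in> K \<Longrightarrow> a \<notin> sq 0 (R + 2) \<Longrightarrow> H a = 0" "\<And>a. a \<in> K \<Longrightarrow> \<bar>H a\<bar> \<le> \<epsilon>"
    "\<And>a b. a \<in> K \<Longrightarrow> b \<in> K \<Longrightarrow> \<bar>H a - H b\<bar> \<le> \<bar>Psi a - Psi b\<bar>"
  using assms unfolding admissible_def by blast+

definition Rm :: real where "Rm = (1 + rr 0) ^ Suc m"

lemma rr_power_le: "i \<le> Suc m \<Longrightarrow> rr j ^ i \<le> Rm"
proof -
  assume i: "i \<le> Suc m"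
  have "rr j ^ i \<le> (1 + rr 0) ^ i" using rr_pos[of j] rr_mono[of 0 j] by (intro power_mono) auto
  also have "\<dots> \<le> Rm" unfolding Rm_def using i rr_pos[of 0] by (intro power_increasing) auto
  finally show ?thesis .
qed

lemma Rm_ge_1: "Rm \<ge> 1" using rr_power_le[of 0 0] by simp

text \<open>On the strip at scale r the first bound combines the oscillation of \<open>Psi\<close>
  with the maximal function: r^m r^(1-2/q) (Hm r^2)^(1/q) = r^(m+1) Hm^(1/q), and division by r^l
  leaves a bounded factor. The second uses only that \<open>H\<close> is at most \<epsilon>. The
  quantifiers over \<epsilon>, \<open>H\<close>, J and l stand inside the almost everywhere
  statement, so the null set depends on none of them.\<close>

lemma outer_bound:
  obtains C1 C2 Hm where "C1 > 0" "C2 > 0" "Hm \<in> borel_measurable borel" "\<And>x::real\<times>real. Hm x \<ge> (0::real)"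
    "(\<integral>\<^sup>+x. ennreal (Hm x powr (p / q)) \<partial>lborel) < \<infinity>"
    "AE x in lborel. \<forall>\<epsilon> H J l. admissible \<epsilon> H \<longrightarrow> 1 \<le> l \<longrightarrow> l \<le> Suc m \<longrightarrow> x \<in> sq 0 B0 \<longrightarrow> rr J \<le> infdist x K \<longrightarrow>
       dnorm l (EE H J) x \<le> min (C1 * Hm x powr (1 / q)) (C2 * \<epsilon> * (1 / infdist x K) ^ l)"
proof -
  obtain Hm :: "real \<times> real \<Rightarrow> real" where Hm: "Hm \<in> borel_measurable borel" "\<And>x. Hm x \<ge> 0"
    "(\<integral>\<^sup>+x. ennreal (Hm x powr (p / q)) \<partial>lborel) < \<infinity>"
    and ae: "AE x in lborel. \<forall>j. (\<integral>\<^sup>+y. ennreal (D y powr q) * indicator (sq x (27 * rr j)) y \<partial>lborel) \<le> ennreal (Hm x * (54 * rr j)\<^sup>2)"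
    by (rule maximal_D) blast
  have R0: "9 * rr 0 > 0" using rr_pos[of 0] by simp
  obtain C0 where C0: "C0 > 0" "\<And>c r a b W. \<lbrakk>0 < r; r \<le> 9 * rr 0; a \<in> K; b \<in> K; a \<in> sq c r; b \<in> sq c r; W \<ge> 0;
      (\<integral>\<^sup>+z. ennreal (D z powr q) * indicator (sq c (3 * r)) z \<partial>lborel) \<le> ennreal (W powr q)\<rbrakk>
     \<Longrightarrow> \<bar>Psi a - Psi b\<bar> \<le> C0 * (r ^ m * r powr (1 - 2 / q) * W)"
    using Psi_osc[OF q(1) R0] by blast
  have CE: "CE > 0" by (rule CE_pos[of "\<lambda>x. 0"]) simp
  define C1 where "C1 = CE * (C0 * 54 ^ Suc m) * 16 ^ Suc m * Rm"
  define C2 where "C2 = CE * 2 * 16 ^ Suc m"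
  have C1: "C1 > 0" using CE C0 Rm_ge_1 by (simp add: C1_def)
  have C2: "C2 > 0" using CE by (simp add: C2_def)
  from ae have "AE x in lborel. \<forall>\<epsilon> H J l. admissible \<epsilon> H \<longrightarrow> 1 \<le> l \<longrightarrow> l \<le> Suc m \<longrightarrow> x \<in> sq 0 B0 \<longrightarrow> rr J \<le> infdist x K \<longrightarrow>
       dnorm l (EE H J) x \<le> min (C1 * Hm x powr (1 / q)) (C2 * \<epsilon> * (1 / infdist x K) ^ l)"
  proof eventually_elim
    case (elim x)
    show ?case
    proof (intro allI impI)
      fix \<epsilon> H J l
      assume ad: "admissible \<epsilon> H" and l: "1 \<le> l" "l \<le> Suc m" and x: "x \<in> sq 0 B0" and d: "rr J \<le> infdist x K"
      \<comment> \<open>The strip that contains \<open>x\<close>: the distance is below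
        \<open>rr 0\<close> and at least \<open>rr J\<close>, so it falls between two consecutive
        scales before the stopping index.\<close>
      have "\<exists>j<J. rr (Suc j) \<le> infdist x K \<and> infdist x K < rr j"
        using d
      proof (induction J)
        case 0 then show ?case using infdist_lt_rr0[of x] by simp
      next
        case (Suc J)
        show ?case
        proof (cases "rr J \<le> infdist x K")
          case True then show ?thesis using Suc.IH less_Suc_eq by blast
        next
          case False then show ?thesis using Suc.prems by (intro exI[of _ J]) auto
        qed
      qed
      then obtain j where j: "j < J" "rr (Suc j) \<le> infdist x K" "infdist x K < rr j" by blast
      let ?r = "rr j"
      have r: "?r > 0" by (rule rr_pos)
      have dp: "infdist x K > 0" using j(2) rr_pos[of "Suc j"] by linarith
      have inv: "1 / rr (Suc j) = 16 / ?r" by (simp add: rr_Suc)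
      have p16: "(16::real) ^ l \<le> 16 ^ Suc m" using l by (intro power_increasing) auto
      have "dnorm l (EE H J) x \<le> C1 * Hm x powr (1 / q)"
      proof -
        define W where "W = (Hm x * (54 * ?r)\<^sup>2) powr (1 / q)"
        define B where "B = C0 * ((9 * ?r) ^ m * (9 * ?r) powr (1 - 2 / q) * W)"
        have Wq: "W powr q = Hm x * (54 * ?r)\<^sup>2" using q Hm(2)[of x] by (simp add: W_def powr_powr)
        have B0': "B \<ge> 0" using C0 r by (auto simp: B_def W_def)
        have "dnorm l (EE H J) x \<le> CE * B * (1 / rr (Suc j)) ^ l"
        proof (rule dnorm_EE_strip[OF admissibleD(1)[OF ad] x j(2,3,1) l B0'])
          fix a b assume ab: "a \<in> K" "b \<in> K" "a \<in> sq x (9 * ?r)" "b \<in> sq x (9 * ?r)"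
          have "\<bar>H a - H b\<bar> \<le> \<bar>Psi a - Psi b\<bar>" by (rule admissibleD(3)[OF ad ab(1,2)])
          also have "\<dots> \<le> B" unfolding B_def
          proof (rule C0(2)[where c=x])
            show "(\<integral>\<^sup>+z. ennreal (D z powr q) * indicator (sq x (3 * (9 * ?r))) z \<partial>lborel) \<le> ennreal (W powr q)"
              unfolding Wq using elim by simp
            show "9 * ?r \<le> 9 * rr 0" using rr_mono[of 0 j] by simp
          qed (use ab r in \<open>auto simp: W_def\<close>)
          finally show "\<bar>H a - H b\<bar> \<le> B" .
        qed
        also have "B \<le> C0 * (54 ^ Suc m * ?r ^ Suc m * Hm x powr (1 / q))"
        proof -
          have "W = Hm x powr (1 / q) * (54 * ?r) powr (2 / q)"
          proof -
            define c where "c = 54 * ?r"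
            have "c > 0" using r by (simp add: c_def)
            then have "c\<^sup>2 = c powr 2" by simp
            then have "W = (Hm x * c powr 2) powr (1 / q)" unfolding W_def c_def[symmetric] by (simp only:)
            also have "\<dots> = Hm x powr (1 / q) * c powr (2 / q)" using Hm(2)[of x] by (simp add: powr_mult powr_powr)
            finally show ?thesis by (simp add: c_def)
          qed
          then have "(9 * ?r) powr (1 - 2 / q) * W = (9 * ?r) powr (1 - 2 / q) * (54 * ?r) powr (2 / q) * Hm x powr (1 / q)" by simp
          also have "\<dots> \<le> (54 * ?r) powr (1 - 2 / q) * (54 * ?r) powr (2 / q) * Hm x powr (1 / q)"
            using r q by (intro mult_right_mono powr_mono2) auto
          also have "(54 * ?r) powr (1 - 2 / q) * (54 * ?r) powr (2 / q) = 54 * ?r" using r by (simp flip: powr_add)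
          finally have X1: "(9 * ?r) powr (1 - 2 / q) * W \<le> 54 * ?r * Hm x powr (1 / q)" .
          have X2: "(9 * ?r) ^ m \<le> (54 * ?r) ^ m" using r by (intro power_mono) auto
          have "(9 * ?r) ^ m * ((9 * ?r) powr (1 - 2 / q) * W) \<le> (54 * ?r) ^ m * (54 * ?r * Hm x powr (1 / q))"
            by (rule mult_mono[OF X2 X1]) (use r in \<open>auto simp: W_def\<close>)
          also have "\<dots> = 54 ^ Suc m * ?r ^ Suc m * Hm x powr (1 / q)" by (simp add: power_mult_distrib)
          finally show ?thesis unfolding B_def mult.assoc using C0 by (intro mult_left_mono) (auto simp: mult.assoc)
        qed
        then have "CE * B * (1 / rr (Suc j)) ^ l \<le> CE * (C0 * (54 ^ Suc m * ?r ^ Suc m * Hm x powr (1 / q))) * (1 / rr (Suc j)) ^ l"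
          using CE rr_pos[of "Suc j"] by (intro mult_right_mono mult_left_mono) auto
        also have "\<dots> = CE * (C0 * 54 ^ Suc m) * 16 ^ l * ?r ^ (Suc m - l) * Hm x powr (1 / q)"
        proof -
          have "?r ^ Suc m = ?r ^ (Suc m - l) * ?r ^ l" using l by (simp flip: power_add)
          then have "?r ^ Suc m * (1 / rr (Suc j)) ^ l = 16 ^ l * ?r ^ (Suc m - l)"
            unfolding inv using r by (simp add: power_divide)
          then show ?thesis by (simp add: mult_ac)
        qed
        also have "\<dots> \<le> CE * (C0 * 54 ^ Suc m) * 16 ^ Suc m * Rm * Hm x powr (1 / q)"
          using CE C0 p16 r by (intro mult_right_mono mult_mono rr_power_le) auto
        finally show ?thesis by (simp add: C1_def)
      qed
      moreover have "dnorm l (EE H J) x \<le> C2 * \<epsilon> * (1 / infdist x K) ^ l"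
      proof -
        obtain a0 where "a0 \<in> K" using K_nonempty by blast
        then have e0: "\<epsilon> \<ge> 0" using admissibleD(2)[OF ad, of a0] by linarith
        have "dnorm l (EE H J) x \<le> CE * (2 * \<epsilon>) * (1 / rr (Suc j)) ^ l"
        proof (rule dnorm_EE_strip[OF admissibleD(1)[OF ad] x j(2,3,1) l])
          show "\<bar>H a - H b\<bar> \<le> 2 * \<epsilon>" if "a \<in> K" "b \<in> K" for a b
            using admissibleD(2)[OF ad that(1)] admissibleD(2)[OF ad that(2)] by linarith
        qed (use e0 in auto)
        also have "(1 / rr (Suc j)) ^ l \<le> 16 ^ Suc m * (1 / infdist x K) ^ l"
        proof -
          have "(1 / rr (Suc j)) ^ l = 16 ^ l * (1 / ?r) ^ l" unfolding inv by (simp add: power_divide)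
          also have "\<dots> \<le> 16 ^ Suc m * (1 / infdist x K) ^ l"
            using j(3) dp r by (intro mult_mono p16 power_mono divide_left_mono) auto
          finally show ?thesis .
        qed
        then have "CE * (2 * \<epsilon>) * (1 / rr (Suc j)) ^ l \<le> CE * (2 * \<epsilon>) * (16 ^ Suc m * (1 / infdist x K) ^ l)"
          using CE e0 by (intro mult_left_mono) auto
        also have "\<dots> = C2 * \<epsilon> * (1 / infdist x K) ^ l" by (simp add: C2_def)
        finally show ?thesis .
      qed
      ultimately show "dnorm l (EE H J) x \<le> min (C1 * Hm x powr (1 / q)) (C2 * \<epsilon> * (1 / infdist x K) ^ l)" by simp
    qed
  qed
  with C1 C2 Hm show ?thesis by (rule that)
qed

text \<open>The dominating function is the p-th power of the first bound, a multiple of Hm^(p/q).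
  Only finitely many orders l occur, so one \<epsilon> serves them all.\<close>

lemma outer_integral_small:
  assumes C: "C1 > 0" "C2 > 0" and Hm [measurable]: "Hm \<in> borel_measurable borel" and Hm0: "\<And>x::real\<times>real. Hm x \<ge> (0::real)"
    and fin: "(\<integral>\<^sup>+x. ennreal (Hm x powr (p / q)) \<partial>lborel) < \<infinity>" and t: "(t::ennreal) > 0"
  obtains \<epsilon> where "\<epsilon> > 0" "\<And>l. l \<le> Suc m \<Longrightarrow>
    (\<integral>\<^sup>+x. ennreal (min (C1 * Hm x powr (1 / q)) (C2 * \<epsilon> * (1 / infdist x K) ^ l) powr p) * indicator (- K) x \<partial>lborel) < t"
proof -
  have [measurable]: "K \<in> sets borel" using K(1) by (rule borel_closed)
  have [measurable]: "(\<lambda>x::real\<times>real. infdist x K) \<in> borel_measurable borel"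
    by (intro borel_measurable_continuous_onI continuous_intros)
  let ?V = "\<lambda>l n x. ennreal (min (C1 * Hm x powr (1 / q)) (C2 * inverse (real (Suc n)) * (1 / infdist x K) ^ l) powr p) * indicator (- K) x"
  have "(\<lambda>n. \<integral>\<^sup>+x. ?V l n x \<partial>lborel) \<longlonglongrightarrow> (\<integral>\<^sup>+x. 0 \<partial>(lborel :: (real \<times> real) measure))" for l
  proof (rule nn_integral_dominated_convergence[where w="\<lambda>x. ennreal (C1 powr p) * ennreal (Hm x powr (p / q))"])
    show "AE x in lborel. ?V l n x \<le> ennreal (C1 powr p) * ennreal (Hm x powr (p / q))" for n
    proof (rule AE_I2)
      fix x
      have nn: "0 \<le> min (C1 * Hm x powr (1 / q)) (C2 * inverse (real (Suc n)) * (1 / infdist x K) ^ l)"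
        using C by (auto simp: infdist_nonneg)
      have "min (C1 * Hm x powr (1 / q)) (C2 * inverse (real (Suc n)) * (1 / infdist x K) ^ l) powr p \<le> (C1 * Hm x powr (1 / q)) powr p"
        using p nn by (intro powr_mono2) auto
      also have "\<dots> = C1 powr p * Hm x powr (p / q)" using C Hm0[of x] by (simp add: powr_mult powr_powr)
      finally have "ennreal (min (C1 * Hm x powr (1 / q)) (C2 * inverse (real (Suc n)) * (1 / infdist x K) ^ l) powr p) \<le> ennreal (C1 powr p * Hm x powr (p / q))"
        by (rule ennreal_leI)
      then show "?V l n x \<le> ennreal (C1 powr p) * ennreal (Hm x powr (p / q))"
        by (cases "x \<in> K") (auto simp: ennreal_mult)
    qed
    have "(\<integral>\<^sup>+x. ennreal (C1 powr p) * ennreal (Hm x powr (p / q)) \<partial>lborel) = ennreal (C1 powr p) * (\<integral>\<^sup>+x. ennreal (Hm x powr (p / q)) \<partial>lborel)"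
      by (rule nn_integral_cmult) measurable
    then show "(\<integral>\<^sup>+x. ennreal (C1 powr p) * ennreal (Hm x powr (p / q)) \<partial>lborel) < \<infinity>"
      using fin by (simp add: ennreal_mult_less_top)
    show "AE x in lborel. (\<lambda>n. ?V l n x) \<longlonglongrightarrow> 0"
    proof (rule AE_I2)
      fix x
      show "(\<lambda>n. ?V l n x) \<longlonglongrightarrow> 0"
      proof (cases "x \<in> K")
        case False
        have "(\<lambda>n. min (C1 * Hm x powr (1 / q)) (C2 * inverse (real (Suc n)) * (1 / infdist x K) ^ l)) \<longlonglongrightarrow> min (C1 * Hm x powr (1 / q)) (C2 * 0 * (1 / infdist x K) ^ l)"
          by (intro tendsto_intros LIMSEQ_inverse_real_of_nat)
        then have "(\<lambda>n. min (C1 * Hm x powr (1 / q)) (C2 * inverse (real (Suc n)) * (1 / infdist x K) ^ l)) \<longlonglongrightarrow> 0"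
          using C by (simp add: min_absorb2)
        then have "(\<lambda>n. min (C1 * Hm x powr (1 / q)) (C2 * inverse (real (Suc n)) * (1 / infdist x K) ^ l) powr p) \<longlonglongrightarrow> 0 powr p"
          using p C by (intro tendsto_powr2) (auto simp: infdist_nonneg intro!: always_eventually)
        then have "(\<lambda>n. ennreal (min (C1 * Hm x powr (1 / q)) (C2 * inverse (real (Suc n)) * (1 / infdist x K) ^ l) powr p)) \<longlonglongrightarrow> ennreal (0 powr p)"
          by (rule tendsto_ennrealI)
        with False show ?thesis by simp
      qed simp
    qed
  qed measurable
  then have "\<forall>\<^sub>F n in sequentially. (\<integral>\<^sup>+x. ?V l n x \<partial>lborel) < t" for l
    using t by (intro order_tendstoD(2)) auto
  then have "\<forall>\<^sub>F n in sequentially. \<forall>l\<in>{..Suc m}. (\<integral>\<^sup>+x. ?V l n x \<partial>lborel) < t"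
    by (intro eventually_ball_finite) auto
  then obtain n where n: "\<forall>l\<in>{..Suc m}. (\<integral>\<^sup>+x. ?V l n x \<partial>lborel) < t"
    unfolding eventually_sequentially by blast
  show ?thesis by (rule that[of "inverse (real (Suc n))"]) (use n in auto)
qed

text \<open>After Fubini each y is counted with at most the area (54 r)^2 = 2916 r^2 of a square
  around it, and y lies within 9 r + 54 r of \<open>K\<close>. The factor r^(-2/p) in
  \<open>layer_bound\<close>, raised to the power p, cancels this area.\<close>

lemma window_integral:
  assumes r: "r > 0"
  shows "(\<integral>\<^sup>+x. (\<integral>\<^sup>+y. ennreal (D y powr p) * indicator (sq x (27 * r)) y \<partial>lborel) * indicator (layer (9 * r)) x \<partial>lborel)
    \<le> ennreal (2916 * r\<^sup>2) * (\<integral>\<^sup>+y. ennreal (D y powr p) * indicator (layer (63 * r)) y \<partial>lborel)"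
proof -
  have sw: "indicator (sq x (27 * r)) y = (indicator (sq y (27 * r)) x :: ennreal)" for x y
    by (auto simp: indicator_def mem_sq abs_minus_commute)
  have ms: "emeasure lborel (sq y (27 * r)) = ennreal (2916 * r\<^sup>2)" for y
  proof -
    have "emeasure lborel (sq y (27 * r)) = ennreal (measure lborel (sq y (27 * r)))"
      unfolding sq_def by (intro emeasure_eq_ennreal_measure) (metis emeasure_lborel_cbox_finite infinity_ennreal_def less_irrefl)
    then show ?thesis using r by (simp add: measure_sq power_mult_distrib)
  qed
  have msw: "(\<lambda>(x, y). indicator (sq y (27 * r)) x :: ennreal) \<in> borel_measurable (lborel \<Otimes>\<^sub>M lborel)"
  proof -
    have "(\<lambda>z. fst z - snd z :: real \<times> real) \<in> borel_measurable (lborel \<Otimes>\<^sub>M lborel)" by measurable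
    then have "(\<lambda>z. indicator (sq 0 (27 * r)) (fst z - snd z) :: ennreal) \<in> borel_measurable (lborel \<Otimes>\<^sub>M lborel)"
      by (rule measurable_compose) simp
    moreover have "(\<lambda>z. indicator (sq 0 (27 * r)) (fst z - snd z) :: ennreal) = (\<lambda>(x, y). indicator (sq y (27 * r)) x)"
      by (auto simp: fun_eq_iff indicator_def mem_sq)
    ultimately show ?thesis by simp
  qed
  have m1: "(\<lambda>z. ennreal (D (snd z) powr p)) \<in> borel_measurable (lborel \<Otimes>\<^sub>M lborel :: ((real \<times> real) \<times> (real \<times> real)) measure)"
    by (rule measurable_compose[OF measurable_snd]) measurable
  have m3: "(\<lambda>z. indicator (layer (9 * r)) (fst z) :: ennreal) \<in> borel_measurable (lborel \<Otimes>\<^sub>M lborel :: ((real \<times> real) \<times> (real \<times> real)) measure)"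
    by (rule measurable_compose[OF measurable_fst]) simp
  have mF: "(\<lambda>(x, y). ennreal (D y powr p) * indicator (sq y (27 * r)) x * indicator (layer (9 * r)) x) \<in> borel_measurable (lborel \<Otimes>\<^sub>M lborel)"
    unfolding split_beta by (intro borel_measurable_times_ennreal m1 m3 msw[unfolded split_beta])
  have "(\<integral>\<^sup>+x. (\<integral>\<^sup>+y. ennreal (D y powr p) * indicator (sq x (27 * r)) y \<partial>lborel) * indicator (layer (9 * r)) x \<partial>lborel)
    = (\<integral>\<^sup>+x. \<integral>\<^sup>+y. ennreal (D y powr p) * indicator (sq y (27 * r)) x * indicator (layer (9 * r)) x \<partial>lborel \<partial>lborel)"
  proof (rule nn_integral_cong)
    fix x :: "real \<times> real"
    have "(\<lambda>y. ennreal (D y powr p) * indicator (sq x (27 * r)) y) \<in> borel_measurable lborel" by measurable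
    from nn_integral_multc[OF this, of "indicator (layer (9 * r)) x"]
    have "(\<integral>\<^sup>+y. ennreal (D y powr p) * indicator (sq x (27 * r)) y \<partial>lborel) * indicator (layer (9 * r)) x
      = (\<integral>\<^sup>+y. ennreal (D y powr p) * indicator (sq x (27 * r)) y * indicator (layer (9 * r)) x \<partial>lborel)" by (rule sym)
    also have "\<dots> = (\<integral>\<^sup>+y. ennreal (D y powr p) * indicator (sq y (27 * r)) x * indicator (layer (9 * r)) x \<partial>lborel)"
      by (rule nn_integral_cong) (rule arg_cong[OF sw, of "\<lambda>t. ennreal (D _ powr p) * t * indicator (layer (9 * r)) x"])
    finally show "(\<integral>\<^sup>+y. ennreal (D y powr p) * indicator (sq x (27 * r)) y \<partial>lborel) * indicator (layer (9 * r)) x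
      = (\<integral>\<^sup>+y. ennreal (D y powr p) * indicator (sq y (27 * r)) x * indicator (layer (9 * r)) x \<partial>lborel)" .
  qed
  also have "\<dots> = (\<integral>\<^sup>+y. \<integral>\<^sup>+x. ennreal (D y powr p) * indicator (sq y (27 * r)) x * indicator (layer (9 * r)) x \<partial>lborel \<partial>lborel)"
    using mF by (rule lborel_pair.Fubini'[symmetric])
  also have "\<dots> \<le> (\<integral>\<^sup>+y. \<integral>\<^sup>+x. (ennreal (D y powr p) * indicator (layer (63 * r)) y) * indicator (sq y (27 * r)) x \<partial>lborel \<partial>lborel)"
  proof (intro nn_integral_mono)
    fix x y :: "real \<times> real"
    have "y \<in> layer (63 * r)" if "x \<in> layer (9 * r)" "x \<in> sq y (27 * r)"
    proof -
      have "infdist y K \<le> infdist x K + dist y x" by (rule infdist_triangle)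
      also have "dist y x \<le> 2 * (27 * r)" using dist_le_sq[OF that(2)] by (simp add: dist_commute)
      finally show ?thesis using that(1) by (simp add: layer_def)
    qed
    then show "ennreal (D y powr p) * indicator (sq y (27 * r)) x * indicator (layer (9 * r)) x \<le> (ennreal (D y powr p) * indicator (layer (63 * r)) y) * indicator (sq y (27 * r)) x"
      by (auto simp: indicator_def)
  qed
  also have "\<dots> = (\<integral>\<^sup>+y. (ennreal (D y powr p) * indicator (layer (63 * r)) y) * ennreal (2916 * r\<^sup>2) \<partial>lborel)"
    by (rule nn_integral_cong) (simp add: nn_integral_cmult_indicator ms)
  also have "\<dots> = (\<integral>\<^sup>+y. ennreal (D y powr p) * indicator (layer (63 * r)) y \<partial>lborel) * ennreal (2916 * r\<^sup>2)"
    by (rule nn_integral_multc) measurable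
  finally show ?thesis by (simp add: mult.commute)
qed

text \<open>Local L^p norm of \<open>D\<close> on the window that Morrey's inequality sees from
  \<open>x\<close> at the stopping scale.\<close>

definition W :: "nat \<Rightarrow> real \<times> real \<Rightarrow> real" where
  "W J x = enn2real (\<integral>\<^sup>+y. ennreal (D y powr p) * indicator (sq x (27 * rr J)) y \<partial>lborel) powr (1 / p)"

lemma W: "W J x \<ge> 0" "ennreal (W J x powr p) = (\<integral>\<^sup>+y. ennreal (D y powr p) * indicator (sq x (27 * rr J)) y \<partial>lborel)"
proof -
  show "W J x \<ge> 0" by (simp add: W_def)
  have "W J x powr p = enn2real (\<integral>\<^sup>+y. ennreal (D y powr p) * indicator (sq x (27 * rr J)) y \<partial>lborel)"
    using p by (simp add: W_def powr_powr)
  then show "ennreal (W J x powr p) = (\<integral>\<^sup>+y. ennreal (D y powr p) * indicator (sq x (27 * rr J)) y \<partial>lborel)"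
    using D_integral_finite[of "sq x (27 * rr J)"] by (simp add: less_top)
qed

text \<open>The constant does not depend on the scale. The oscillation at scale r is r^(m + 1 - 2/p)
  times the window norm, so l derivatives leave r^(-2/p) \<open>W J x\<close> up to a bounded power
  of r. For the correction, Taylor's estimate handles the orders up to m and the mollified majorant
  the order m + 1; \<open>e\<close> collects the deviation of \<open>psi\<close> from its limiting
  data on \<open>K\<close> and is charged with the full r^(-l).\<close>

lemma layer_bound:
  obtains C where "C > 0" "\<And>\<epsilon> H J l x. admissible \<epsilon> H \<Longrightarrow> 1 \<le> l \<Longrightarrow> l \<le> Suc m \<Longrightarrow> x \<in> sq 0 B0 \<Longrightarrow> infdist x K < rr J \<Longrightarrow>
      dnorm l (EE H J) x \<le> C * (rr J powr (- (2 / p)) * W J x)"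
    "\<And>\<delta> J l x e. 0 < \<delta> \<Longrightarrow> \<delta> \<le> 1 \<Longrightarrow> \<delta> \<le> rr J \<Longrightarrow> e \<ge> 0 \<Longrightarrow> l \<le> Suc m \<Longrightarrow>
      (\<And>a. a \<in> K \<Longrightarrow> \<bar>psi \<delta> a - Psi a\<bar> \<le> e) \<Longrightarrow> (\<And>a i. a \<in> K \<Longrightarrow> 1 \<le> i \<Longrightarrow> i \<le> m \<Longrightarrow> dnorm i (psi \<delta>) a \<le> e) \<Longrightarrow>
      dnorm l (XX \<delta> J) x \<le> C * (rr J powr (- (2 / p)) * W J x + moll \<delta> D x + e * (1 / rr J) ^ l)"
proof -
  have R0: "9 * rr 0 > 0" using rr_pos[of 0] by simp
  have CE: "CE > 0" by (rule CE_pos[of "\<lambda>x. 0"]) simp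
  obtain C0 where C0: "C0 > 0" "\<And>c r a b W. \<lbrakk>0 < r; r \<le> 9 * rr 0; a \<in> K; b \<in> K; a \<in> sq c r; b \<in> sq c r; W \<ge> 0;
      (\<integral>\<^sup>+z. ennreal (D z powr p) * indicator (sq c (3 * r)) z \<partial>lborel) \<le> ennreal (W powr p)\<rbrakk>
     \<Longrightarrow> \<bar>Psi a - Psi b\<bar> \<le> C0 * (r ^ m * r powr (1 - 2 / p) * W)"
    using Psi_osc[OF p R0] by blast
  obtain CT where CT: "CT > 0" "\<And>\<delta> c r a x e W. \<lbrakk>0 < \<delta>; \<delta> \<le> 1; \<delta> \<le> r; r \<le> 9 * rr 0; a \<in> sq c r; x \<in> sq c r; e \<ge> 0; W \<ge> 0;
      \<And>i. 1 \<le> i \<Longrightarrow> i \<le> m \<Longrightarrow> dnorm i (psi \<delta>) a \<le> e;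
      (\<integral>\<^sup>+z. ennreal (D z powr p) * indicator (sq c (3 * r)) z \<partial>lborel) \<le> ennreal (W powr p)\<rbrakk>
     \<Longrightarrow> \<bar>psi \<delta> x - psi \<delta> a\<bar> \<le> CT * (r ^ m * r powr (1 - 2 / p) * W + e)
       \<and> (\<forall>i. 1 \<le> i \<and> i \<le> m \<longrightarrow> dnorm i (psi \<delta>) x \<le> CT * (r ^ (m - i) * r powr (1 - 2 / p) * W + e))"
    using psi_taylor[OF p R0] by blast
  \<comment> \<open>Takes the factor 9 out of the radius: 9^k * 9^(1-2/p) is at most
    9^(m+1).\<close>
  have nine: "(9 * r) ^ k * (9 * r) powr (1 - 2 / p) \<le> 9 ^ Suc m * (r ^ Suc k * r powr (- (2 / p)))" if "r > 0" "k \<le> m" for r k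
  proof -
    have "(9::real) powr (1 - 2 / p) \<le> 9 powr 1" using p by (intro powr_mono) auto
    moreover have "(9::real) ^ k \<le> 9 ^ m" using that by (intro power_increasing) auto
    ultimately have "(9::real) ^ k * 9 powr (1 - 2 / p) \<le> 9 ^ m * 9" by (intro mult_mono) auto
    then have "(9 ^ k * 9 powr (1 - 2 / p)) * (r ^ k * r powr (1 - 2 / p)) \<le> (9 ^ m * 9) * (r ^ k * r powr (1 - 2 / p))"
      using that by (intro mult_right_mono) auto
    moreover have "r powr (1 - 2 / p) = r * r powr (- (2 / p))" using that powr_add[of r 1 "- (2 / p)"] by simp
    ultimately show ?thesis using that by (simp add: power_mult_distrib powr_mult mult_ac)
  qed
  define CA where "CA = CE * C0 * 9 ^ Suc m * Rm"
  define CB where "CB = 25 * (4 ^ Suc m * Ce * ((CT + 1) * 9 ^ Suc m * Rm))"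
  have CA: "CA > 0" using CE C0 Rm_ge_1 by (simp add: CA_def)
  have CB: "CB > 0" using Ce(1) CT Rm_ge_1 by (simp add: CB_def)
  show ?thesis
  proof (rule that[of "CA + CB"])
    show "CA + CB > 0" using CA CB by simp
    fix \<epsilon> H J l x
    assume ad: "admissible \<epsilon> H" and l: "1 \<le> l" "l \<le> Suc m" and x: "x \<in> sq 0 B0" and d: "infdist x K < rr J"
    let ?r = "rr J"
    have r: "?r > 0" by (rule rr_pos)
    define B where "B = C0 * ((9 * ?r) ^ m * (9 * ?r) powr (1 - 2 / p) * W J x)"
    have B: "B \<ge> 0" using C0 r W(1)[of J x] by (simp add: B_def)
    have "dnorm l (EE H J) x \<le> CE * B * (1 / ?r) ^ l"
    proof (rule dnorm_EE_inner[OF admissibleD(1)[OF ad] x d l B])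
      fix a b assume ab: "a \<in> K" "b \<in> K" "a \<in> sq x (9 * ?r)" "b \<in> sq x (9 * ?r)"
      have "\<bar>H a - H b\<bar> \<le> \<bar>Psi a - Psi b\<bar>" by (rule admissibleD(3)[OF ad ab(1,2)])
      also have "\<dots> \<le> B" unfolding B_def
        by (rule C0(2)[where c=x]) (use ab r W[of J x] rr_mono[of 0 J] in auto)
      finally show "\<bar>H a - H b\<bar> \<le> B" .
    qed
    also have "\<dots> \<le> CE * (C0 * (9 ^ Suc m * (?r ^ Suc m * ?r powr (- (2 / p))) * W J x)) * (1 / ?r) ^ l"
      unfolding B_def using CE C0 r W(1)[of J x] by (intro mult_right_mono mult_left_mono nine) auto
    also have "\<dots> = CE * C0 * 9 ^ Suc m * ?r ^ (Suc m - l) * (?r powr (- (2 / p)) * W J x)"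
    proof -
      have "?r ^ Suc m = ?r ^ (Suc m - l) * ?r ^ l" using l by (simp flip: power_add)
      then have "?r ^ Suc m * (1 / ?r) ^ l = ?r ^ (Suc m - l)" using r by (simp add: power_divide)
      then show ?thesis by (simp add: mult_ac)
    qed
    also have "\<dots> \<le> CA * (?r powr (- (2 / p)) * W J x)"
      unfolding CA_def using CE C0 r W(1)[of J x] by (intro mult_right_mono mult_left_mono rr_power_le) auto
    also have "\<dots> \<le> (CA + CB) * (?r powr (- (2 / p)) * W J x)"
      using CB r W(1)[of J x] by (intro mult_right_mono) auto
    finally show "dnorm l (EE H J) x \<le> (CA + CB) * (?r powr (- (2 / p)) * W J x)" .
  next
    fix \<delta> J l x e
    assume d: "0 < \<delta>" "\<delta> \<le> 1" "\<delta> \<le> rr J" and e: "(e::real) \<ge> 0" and l: "l \<le> Suc m"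
      and pe: "\<And>a. a \<in> K \<Longrightarrow> \<bar>psi \<delta> a - Psi a\<bar> \<le> e" and pk: "\<And>a i. a \<in> K \<Longrightarrow> 1 \<le> i \<Longrightarrow> i \<le> m \<Longrightarrow> dnorm i (psi \<delta>) a \<le> e"
    let ?r = "rr J"
    have r: "?r > 0" by (rule rr_pos)
    have mo: "moll \<delta> D x \<ge> 0" unfolding moll_def by (intro integral_nonneg_AE) (auto simp: D_nonneg ker_nonneg)
    define G where "G = 9 ^ Suc m * (?r ^ Suc m * ?r powr (- (2 / p))) * W J x"
    have G: "G \<ge> 0" using r W(1)[of J x] by (simp add: G_def)
    \<comment> \<open>Sum of the contributions of the cases below, normalised so that order i is
      bounded by B r^(-i): Taylor part, deviation on \<open>K\<close>, top order.\<close>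
    define B where "B = CT * G + (CT + 1) * Rm * e + ?r ^ Suc m * moll \<delta> D x"
    have B: "B \<ge> 0" using CT G Rm_ge_1 e r mo by (simp add: B_def)
    \<comment> \<open>Taylor's estimate leaves \<open>e\<close> without a power of r; this inserts
      the missing r^(-i).\<close>
    have Rr: "1 \<le> Rm * (1 / ?r) ^ i" if "i \<le> Suc m" for i
      using rr_power_le[OF that, of J] r by (simp add: power_divide field_simps)
    have "dnorm l (XX \<delta> J) x \<le> 25 * (4 ^ l * Ce * B * (1 / ?r) ^ l)"
    proof (rule dnorm_XX[of "\<lambda>x. 0", OF _ d(1,2) l B])
      fix z i assume z: "z \<in> Zs ?r" "z \<in> touch ?r x" and i: "i \<le> l"
      let ?a = "apt ?r z"
      note az = apt_touch[OF r z]
      have T: "\<bar>psi \<delta> x - psi \<delta> ?a\<bar> \<le> CT * ((9 * ?r) ^ m * (9 * ?r) powr (1 - 2 / p) * W J x + e)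
       \<and> (\<forall>i. 1 \<le> i \<and> i \<le> m \<longrightarrow> dnorm i (psi \<delta>) x \<le> CT * ((9 * ?r) ^ (m - i) * (9 * ?r) powr (1 - 2 / p) * W J x + e))"
        by (rule CT(2)[where c=x]) (use d e az r W[of J x] rr_mono[of 0 J] pk in \<open>auto simp: mem_sq\<close>)
      have gi: "(9 * ?r) ^ (m - k) * (9 * ?r) powr (1 - 2 / p) * W J x \<le> G * (1 / ?r) ^ k" if "k \<le> m" for k
      proof -
        have "(9 * ?r) ^ (m - k) * (9 * ?r) powr (1 - 2 / p) * W J x \<le> 9 ^ Suc m * (?r ^ Suc (m - k) * ?r powr (- (2 / p))) * W J x"
          using r W(1)[of J x] by (intro mult_right_mono nine) auto
        also have "?r ^ Suc (m - k) = ?r ^ Suc m * (1 / ?r) ^ k"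
        proof -
          have "?r ^ Suc m = ?r ^ Suc (m - k) * ?r ^ k" using that by (simp flip: power_add)
          then show ?thesis using r by (simp add: power_divide)
        qed
        also have "9 ^ Suc m * (?r ^ Suc m * (1 / ?r) ^ k * ?r powr (- (2 / p))) * W J x = G * (1 / ?r) ^ k"
          unfolding G_def by (simp only: mult_ac)
        finally show ?thesis .
      qed
      have iSm: "i \<le> Suc m" using i l by simp
      consider "i = 0" | k where "i = Suc k" "i \<le> m" | "i = Suc m"
      proof (cases i)
        case 0 then show ?thesis by (rule that(1))
      next
        case (Suc k)
        show ?thesis
        proof (cases "i \<le> m")
          case True show ?thesis by (rule that(2)[OF Suc True])
        next
          case False
          then have "i = Suc m" using iSm by simp
          then show ?thesis by (rule that(3))
        qed
      qed
      then show "dnorm i (\<lambda>y. psi \<delta> y - Psi ?a) x \<le> B * (1 / ?r) ^ i"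
      proof cases
        case 1
        have "\<bar>psi \<delta> x - Psi ?a\<bar> \<le> CT * (G * (1 / ?r) ^ 0 + e) + e"
        proof -
          have "CT * ((9 * ?r) ^ m * (9 * ?r) powr (1 - 2 / p) * W J x + e) \<le> CT * (G * (1 / ?r) ^ 0 + e)"
            using CT gi[of 0] by (intro mult_left_mono add_right_mono) auto
          then show ?thesis using T pe[OF az(2)] by linarith
        qed
        also have "\<dots> = CT * G + (CT + 1) * e" by (simp add: algebra_simps)
        also have "\<dots> \<le> CT * G + (CT + 1) * Rm * e"
          using Rm_ge_1 e CT mult_right_mono[of 1 Rm e] by (simp add: mult.assoc mult_left_mono)
        also have "\<dots> \<le> B" using r mo by (simp add: B_def)
        finally show ?thesis using 1 by simp
      next
        case (2 k)
        have "dnorm i (\<lambda>y. psi \<delta> y - Psi ?a) x = dnorm i (\<lambda>y. psi \<delta> y + (- Psi ?a)) x" by simp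
        also have "\<dots> \<le> dnorm i (psi \<delta>) x + dnorm i (\<lambda>y. - Psi ?a) x"
          by (rule dnorm_add[OF smooth_psi[OF d(1,2)] smooth_const])
        also have "dnorm i (\<lambda>y. - Psi ?a) x = 0" unfolding 2(1) by (rule dnorm_const)
        also have "dnorm i (psi \<delta>) x \<le> CT * (G * (1 / ?r) ^ i + e)"
        proof -
          have i1: "1 \<le> i \<and> i \<le> m" using 2 by simp
          have "dnorm i (psi \<delta>) x \<le> CT * ((9 * ?r) ^ (m - i) * (9 * ?r) powr (1 - 2 / p) * W J x + e)"
            by (rule T[THEN conjunct2, rule_format, OF i1])
          also have "\<dots> \<le> CT * (G * (1 / ?r) ^ i + e)" using CT gi[of i] 2 by (intro mult_left_mono add_right_mono) auto
          finally show ?thesis .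
        qed
        also have "CT * (G * (1 / ?r) ^ i + e) \<le> CT * (G * (1 / ?r) ^ i) + (CT + 1) * (Rm * (1 / ?r) ^ i) * e"
        proof -
          have "CT * e \<le> (CT + 1) * (Rm * (1 / ?r) ^ i) * e"
          proof (rule mult_right_mono[OF _ e])
            have "CT * 1 \<le> (CT + 1) * (Rm * (1 / ?r) ^ i)" using CT Rr[of i] i l by (intro mult_mono) auto
            then show "CT \<le> (CT + 1) * (Rm * (1 / ?r) ^ i)" by simp
          qed
          then show ?thesis by (simp add: distrib_left)
        qed
        also have "\<dots> = (CT * G + (CT + 1) * Rm * e) * (1 / ?r) ^ i" by (simp add: algebra_simps)
        also have "\<dots> \<le> B * (1 / ?r) ^ i" using r mo by (intro mult_right_mono) (auto simp: B_def)
        finally show ?thesis by simp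
      next
        case 3
        have "dnorm i (\<lambda>y. psi \<delta> y - Psi ?a) x = dnorm i (\<lambda>y. psi \<delta> y + (- Psi ?a)) x" by simp
        also have "\<dots> \<le> dnorm i (psi \<delta>) x + dnorm i (\<lambda>y. - Psi ?a) x"
          by (rule dnorm_add[OF smooth_psi[OF d(1,2)] smooth_const])
        also have "dnorm i (\<lambda>y. - Psi ?a) x = 0" unfolding 3 by (rule dnorm_const)
        also have "dnorm i (psi \<delta>) x \<le> moll \<delta> D x" unfolding 3 by (rule dnorm_psi_le_moll[OF d(1,2)])
        also have "moll \<delta> D x = ?r ^ Suc m * moll \<delta> D x * (1 / ?r) ^ i" unfolding 3 using r by (simp add: power_divide)
        also have "\<dots> \<le> B * (1 / ?r) ^ i" using r CT G Rm_ge_1 e by (intro mult_right_mono) (auto simp: B_def)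
        finally show ?thesis by simp
      qed
    qed simp
    also have "\<dots> \<le> 25 * (4 ^ Suc m * Ce * B * (1 / ?r) ^ l)"
      using Ce(1) B r l by (intro mult_left_mono mult_right_mono power_increasing) auto
    also have "\<dots> = 25 * (4 ^ Suc m * Ce * (B * (1 / ?r) ^ l))" by (simp add: mult.assoc)
    also have "\<dots> \<le> 25 * (4 ^ Suc m * Ce * ((CT + 1) * 9 ^ Suc m * Rm * (?r powr (- (2 / p)) * W J x + moll \<delta> D x + e * (1 / ?r) ^ l)))"
    proof -
      let ?w = "?r powr (- (2 / p)) * W J x"
      have w: "?w \<ge> 0" using W(1)[of J x] by simp
      have rl: "?r ^ Suc m * (1 / ?r) ^ l = ?r ^ (Suc m - l)"
      proof -
        have "?r ^ Suc m = ?r ^ (Suc m - l) * ?r ^ l" using l by (simp flip: power_add)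
        then show ?thesis using r by (simp add: power_divide)
      qed
      have rle: "?r ^ (Suc m - l) \<le> Rm" by (rule rr_power_le) simp
      define Q where "Q = (CT + 1) * 9 ^ Suc m * Rm"
      have nine1: "(1::real) \<le> 9 ^ Suc m" by (rule one_le_power) simp
      have "B * (1 / ?r) ^ l = CT * 9 ^ Suc m * (?r ^ Suc m * (1 / ?r) ^ l) * ?w + (CT + 1) * Rm * (e * (1 / ?r) ^ l) + (?r ^ Suc m * (1 / ?r) ^ l) * moll \<delta> D x"
        by (simp add: B_def G_def algebra_simps)
      also have "\<dots> = CT * 9 ^ Suc m * ?r ^ (Suc m - l) * ?w + (CT + 1) * Rm * (e * (1 / ?r) ^ l) + ?r ^ (Suc m - l) * moll \<delta> D x"
        unfolding rl ..
      also have "\<dots> \<le> Q * ?w + Q * (e * (1 / ?r) ^ l) + Q * moll \<delta> D x"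
      proof (intro add_mono mult_right_mono w mo)
        show "CT * 9 ^ Suc m * ?r ^ (Suc m - l) \<le> Q" unfolding Q_def using CT rle r by (intro mult_mono) auto
        have "(CT + 1) * 1 * Rm \<le> (CT + 1) * 9 ^ Suc m * Rm"
          using CT nine1 Rm_ge_1 by (intro mult_right_mono mult_left_mono) auto
        then show "(CT + 1) * Rm \<le> Q" by (simp add: Q_def)
        have "1 * 1 * ?r ^ (Suc m - l) \<le> (CT + 1) * 9 ^ Suc m * Rm"
          using CT nine1 rle r by (intro mult_mono) auto
        then show "?r ^ (Suc m - l) \<le> Q" by (simp add: Q_def)
        show "0 \<le> e * (1 / ?r) ^ l" using e r by simp
      qed
      also have "\<dots> = Q * (?w + moll \<delta> D x + e * (1 / ?r) ^ l)" by (simp add: algebra_simps)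
      finally show ?thesis unfolding Q_def using Ce(1) by (intro mult_left_mono) auto
    qed
    also have "\<dots> = CB * (?r powr (- (2 / p)) * W J x + moll \<delta> D x + e * (1 / ?r) ^ l)" by (simp add: CB_def mult.assoc)
    also have "\<dots> \<le> (CA + CB) * (?r powr (- (2 / p)) * W J x + moll \<delta> D x + e * (1 / ?r) ^ l)"
      using CA r W(1)[of J x] mo e by (intro mult_right_mono) auto
    finally show "dnorm l (XX \<delta> J) x \<le> (CA + CB) * (?r powr (- (2 / p)) * W J x + moll \<delta> D x + e * (1 / ?r) ^ l)" .
  qed
qed

end

lemma powr_add4_le:
  fixes a b c d s :: real
  assumes s: "s \<ge> 0" and n: "a \<ge> 0" "b \<ge> 0" "c \<ge> 0" "d \<ge> 0"
  shows "(a + b + c + d) powr s \<le> 4 powr s * (a powr s + b powr s + c powr s + d powr s)"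
proof -
  define M where "M = max (max a b) (max c d)"
  have M0: "M \<ge> 0" using n by (simp add: M_def)
  have "(a + b + c + d) powr s \<le> (4 * M) powr s"
    using n s by (intro powr_mono2) (auto simp: M_def)
  also have "\<dots> = 4 powr s * M powr s" using M0 by (simp add: powr_mult)
  also have "\<dots> \<le> 4 powr s * (a powr s + b powr s + c powr s + d powr s)"
  proof (rule mult_left_mono)
    have "M = a \<or> M = b \<or> M = c \<or> M = d" by (auto simp: M_def max_def)
    then show "M powr s \<le> a powr s + b powr s + c powr s + d powr s"
      using powr_ge_zero[of a s] powr_ge_zero[of b s] powr_ge_zero[of c s] powr_ge_zero[of d s]
      by auto
  qed simp
  finally show ?thesis .
qed

section \<open>Choice of the parameters and the approximating stream function\<close>

context divfree
begin

text \<open>If two values of \<open>Psi\<close> on \<open>K\<close> differ by less than \<tau>, the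
  whole interval between them lies in the covering set \<open>N\<close>, where \<open>h\<close> has
  slope 1; hence Psi - h o Psi agrees at the two points. The uniform margin makes one \<tau> work
  for all of \<open>K\<close>.\<close>

lemma truncated_stream:
  assumes e: "\<epsilon> > 0"
  obtains H \<tau> where "admissible \<epsilon> H" "\<tau> > 0"
    "\<And>a b. a \<in> K \<Longrightarrow> b \<in> K \<Longrightarrow> \<bar>Psi a - Psi b\<bar> < \<tau> \<Longrightarrow> Psi a - H a = Psi b - H b"
proof -
  obtain N \<tau> where N: "open N" "emeasure lborel N < ennreal \<epsilon>" "\<tau> > 0" "\<And>s. s \<in> Psi ` K \<Longrightarrow> ball s \<tau> \<subseteq> N"
    using Psi_K_small_cover[OF e] by blast
  obtain h where h: "h 0 = 0" "\<And>t. \<bar>h t\<bar> \<le> \<epsilon>" "\<And>s t. \<bar>h s - h t\<bar> \<le> \<bar>s - t\<bar>"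
    "\<And>s t. s \<le> t \<Longrightarrow> {s..t} \<subseteq> N \<Longrightarrow> h t - h s = t - s"
    using truncation_function[OF N(1,2)] by blast
  have inc: "h (Psi b) - h (Psi a) = Psi b - Psi a" if "a \<in> K" "\<bar>Psi a - Psi b\<bar> < \<tau>" "Psi a \<le> Psi b" for a b
  proof (rule h(4)[OF that(3)])
    have "{Psi a..Psi b} \<subseteq> ball (Psi a) \<tau>" using that by (auto simp: dist_real_def)
    also have "\<dots> \<subseteq> N" using N(4) that(1) by blast
    finally show "{Psi a..Psi b} \<subseteq> N" .
  qed
  show thesis
  proof (rule that[of "\<lambda>a. h (Psi a)" \<tau>])
    show "admissible \<epsilon> (\<lambda>a. h (Psi a))"
      unfolding admissible_def using h(1,2,3) Psi_zero_off by simp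
    show "Psi a - h (Psi a) = Psi b - h (Psi b)" if "a \<in> K" "b \<in> K" "\<bar>Psi a - Psi b\<bar> < \<tau>" for a b
      using inc[of a b] inc[of b a] that by (cases "Psi a \<le> Psi b") (auto simp: abs_minus_commute)
  qed (rule N(3))
qed

lemma rr_small:
  assumes "c > 0" obtains J0 where "\<And>J. J0 \<le> J \<Longrightarrow> rr J \<le> c"
proof -
  obtain n where n: "(1 / 16) ^ n < c / (2 * R + 2)"
    using real_arch_pow_inv[of "c / (2 * R + 2)" "1 / 16"] assms R by auto
  have "rr n = (2 * R + 2) * (1 / 16) ^ n" by (simp add: rr_def power_divide)
  also have "\<dots> \<le> (2 * R + 2) * (c / (2 * R + 2))" using n R by (intro mult_left_mono) auto
  also have "\<dots> = c" using R by simp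
  finally have "rr n \<le> c" .
  then show thesis using that[of n] rr_mono order_trans by blast
qed

text \<open>Morrey's estimate with the L^p norm of \<open>D\<close> over the whole plane is uniform
  in the position, so fine scales bring the values within the margin \<tau>. The radius 10 rr J is
  the one occurring in \<open>FF_gradient_zero\<close>.\<close>

lemma Psi_osc_small:
  assumes t: "\<tau> > 0"
  obtains J0 where "\<And>J x a b. J0 \<le> J \<Longrightarrow> a \<in> K \<Longrightarrow> b \<in> K \<Longrightarrow> a \<in> sq x (10 * rr J) \<Longrightarrow> b \<in> sq x (10 * rr J) \<Longrightarrow> \<bar>Psi a - Psi b\<bar> < \<tau>"
proof -
  have R0: "10 * rr 0 > 0" using rr_pos by simp
  obtain C where C: "C > 0" "\<And>c r a b W. \<lbrakk>0 < r; r \<le> 10 * rr 0; a \<in> K; b \<in> K; a \<in> sq c r; b \<in> sq c r; W \<ge> 0;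
      (\<integral>\<^sup>+z. ennreal (D z powr p) * indicator (sq c (3 * r)) z \<partial>lborel) \<le> ennreal (W powr p)\<rbrakk>
     \<Longrightarrow> \<bar>Psi a - Psi b\<bar> \<le> C * (r ^ m * r powr (1 - 2 / p) * W)"
    using Psi_osc[OF p R0] by blast
  define I where "I = (\<integral>\<^sup>+z. ennreal (D z powr p) \<partial>lborel)"
  define V where "V = enn2real I powr (1 / p)"
  have V: "V \<ge> 0" "ennreal (V powr p) = I"
    using p D_Lp by (auto simp: V_def powr_powr I_def[symmetric])
  have VI: "(\<integral>\<^sup>+z. ennreal (D z powr p) * indicator A z \<partial>lborel) \<le> ennreal (V powr p)" for A
    unfolding V(2) I_def by (intro nn_integral_mono) (auto simp: indicator_def)
  \<comment> \<open>The first entry gives 10 rr J at most 1, so its m-th power is at most itself;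
    the second makes the resulting bound at most \<tau> / 2.\<close>
  define c where "c = min (1 / 10) (\<tau> / (20 * C * (V + 1)))"
  have c: "c > 0" using t C V by (simp add: c_def)
  obtain J0 where J0: "\<And>J. J0 \<le> J \<Longrightarrow> rr J \<le> c" using rr_small[OF c] by blast
  show thesis
  proof (rule that[of J0])
    fix J x a b
    assume J: "J0 \<le> J" and ab: "a \<in> K" "b \<in> K" "a \<in> sq x (10 * rr J)" "b \<in> sq x (10 * rr J)"
    define s where "s = 10 * rr J"
    have s0: "0 < s" using rr_pos by (simp add: s_def)
    have s1: "s \<le> 10 * rr 0" unfolding s_def by (intro mult_left_mono rr_mono) auto
    have sc: "s \<le> 10 * c" using J0[OF J] by (simp add: s_def)
    have s3: "s \<le> 10 * (\<tau> / (20 * C * (V + 1)))" using sc unfolding c_def by linarith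
    have s2: "s \<le> 1" using sc by (simp add: c_def min_def split: if_splits)
    have "\<bar>Psi a - Psi b\<bar> \<le> C * (s ^ m * s powr (1 - 2 / p) * V)"
      by (rule C(2)[OF s0 s1 ab(1,2) _ _ V(1) VI]) (use ab(3,4) in \<open>simp_all add: s_def\<close>)
    also have "\<dots> \<le> C * (s * 1 * V)"
    proof (intro mult_left_mono mult_right_mono mult_mono)
      show "s ^ m \<le> s" using power_decreasing[of 1 m s] m s0 s2 by simp
      show "s powr (1 - 2 / p) \<le> 1" using p s0 s2 by (intro powr_le1) auto
    qed (use s0 C V in auto)
    also have "\<dots> \<le> C * (10 * (\<tau> / (20 * C * (V + 1))) * V)"
      unfolding mult_1_right using C V s3 by (intro mult_left_mono mult_right_mono) auto
    also have "\<dots> = \<tau> / 2 * (V / (V + 1))" 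
    proof -
      have "C \<noteq> 0" "V + 1 \<noteq> 0" using C(1) V(1) by auto
      then show ?thesis by (simp add: divide_simps)
    qed
    also have "\<dots> \<le> \<tau> / 2 * 1" using t V(1) by (intro mult_left_mono) auto
    also have "\<dots> < \<tau>" using t by simp
    finally show "\<bar>Psi a - Psi b\<bar> < \<tau>" .
  qed
qed

lemma W_measurable: "(\<lambda>x. ennreal (W J x powr p)) \<in> borel_measurable lborel"
proof -
  have "(\<lambda>z. fst z - snd z :: real \<times> real) \<in> borel_measurable (lborel \<Otimes>\<^sub>M lborel)" by measurable
  then have 1: "(\<lambda>z. indicator (sq 0 (27 * rr J)) (fst z - snd z) :: ennreal) \<in> borel_measurable (lborel \<Otimes>\<^sub>M lborel)"
    by (rule measurable_compose) simp
  have 2: "(\<lambda>z. ennreal (D (snd z) powr p)) \<in> borel_measurable (lborel \<Otimes>\<^sub>M lborel :: ((real \<times> real) \<times> (real \<times> real)) measure)"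
    by (rule measurable_compose[OF measurable_snd]) measurable
  have 3: "(\<lambda>x. \<integral>\<^sup>+y. ennreal (D (snd (x, y)) powr p) * indicator (sq 0 (27 * rr J)) (fst (x, y) - snd (x, y)) \<partial>lborel) \<in> borel_measurable lborel"
    by (rule lborel.borel_measurable_nn_integral_fst) (intro borel_measurable_times_ennreal 1 2)
  have 4: "indicator (sq 0 (27 * rr J)) (x - y) = (indicator (sq x (27 * rr J)) y :: ennreal)" for x y
    by (auto simp: indicator_def mem_sq abs_minus_commute)
  show ?thesis using 3 by (simp add: W(2) 4)
qed

text \<open>The plane splits by the distance from \<open>K\<close>: beyond 9 rr J only the extension
  is present and is bounded by \<open>V\<close>; closer to \<open>K\<close> the window norm, the
  mollified majorant and the constant error enter as well; off \<open>sq 0 B0\<close> everything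
  vanishes. The p-th powers integrate separately, the window term by
  \<open>window_integral\<close>.\<close>

lemma error_integral:
  assumes adm: "admissible \<epsilon> H" and C: "C > 0" and e: "e \<ge> 0" and d: "0 < \<delta>" "\<delta> \<le> 1" "\<delta> \<le> rr J"
    and V [measurable]: "V \<in> borel_measurable borel" and V0: "\<And>x. V x \<ge> 0"
    and EE1: "\<And>x. x \<in> sq 0 B0 \<Longrightarrow> infdist x K < rr J \<Longrightarrow> dnorm l (EE H J) x \<le> C * (rr J powr (- (2 / p)) * W J x)"
    and EE2: "AE x in lborel. x \<in> sq 0 B0 \<longrightarrow> rr J \<le> infdist x K \<longrightarrow> dnorm l (EE H J) x \<le> V x"
    and XX: "\<And>x. dnorm l (XX \<delta> J) x \<le> C * (rr J powr (- (2 / p)) * W J x + moll \<delta> D x + e * (1 / rr J) ^ l)"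
  shows "(\<integral>\<^sup>+x. ennreal (dnorm l (\<lambda>x. psi \<delta> x - FF H \<delta> J x) x powr p) \<partial>lborel)
    \<le> ennreal (4 powr p) * ((\<integral>\<^sup>+x. ennreal (V x powr p) * indicator (- K) x \<partial>lborel)
      + ennreal (2916 * (2 * C) powr p) * (\<integral>\<^sup>+y. ennreal (D y powr p) * indicator (layer (63 * rr J)) y \<partial>lborel)
      + ennreal ((2 * C) powr p) * (\<integral>\<^sup>+y. ennreal (D y powr p) * indicator (layer (63 * rr J)) y \<partial>lborel)
      + ennreal ((2 * C * e * (1 / rr J) ^ l) powr p) * emeasure lborel (sq 0 B0))"
proof -
  note H0 = admissibleD(1)[OF adm]
  define r where "r = rr J"
  have r: "r > 0" using rr_pos by (simp add: r_def)
  define Wr where "Wr x = r powr (- (2 / p)) * W J x" for x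
  have Wr0: "Wr x \<ge> 0" for x using W(1) by (simp add: Wr_def)
  have Mo0: "moll \<delta> D x \<ge> 0" for x
    unfolding moll_def by (rule Bochner_Integration.integral_nonneg) (simp add: D_nonneg ker_nonneg)
  define E where "E = e * (1 / r) ^ l"
  have E0: "E \<ge> 0" using e r by (simp add: E_def)
  define L where "L = layer (9 * r)"
  have Lm [measurable]: "L \<in> sets borel" by (simp add: L_def)
  have Km [measurable]: "- K \<in> sets borel" using K(1) by (simp add: borel_open open_Compl)
  have iK: "infdist x K = 0" if "x \<in> K" for x using that by simp
  define w1 where "w1 x = ennreal (V x powr p) * indicator (- K) x" for x
  define w2 where "w2 x = ennreal ((2 * C) powr p / r\<^sup>2) * (ennreal (W J x powr p) * indicator L x)" for x
  define w3 where "w3 x = ennreal ((2 * C) powr p) * (ennreal (\<bar>moll \<delta> D x\<bar> powr p) * indicator L x)" for x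
  define w4 :: "real \<times> real \<Rightarrow> ennreal" where "w4 x = ennreal ((2 * C * E) powr p) * indicator (sq 0 B0) x" for x
  have Wm [measurable]: "(\<lambda>x. ennreal (W J x powr p)) \<in> borel_measurable borel"
    using W_measurable[of J] by simp
  have wm [measurable]: "w1 \<in> borel_measurable borel" "w2 \<in> borel_measurable borel" "w3 \<in> borel_measurable borel" "w4 \<in> borel_measurable borel"
    unfolding w1_def w2_def w3_def w4_def by measurable
  have eq: "(\<lambda>x. psi \<delta> x - FF H \<delta> J x) = (\<lambda>x. EE H J x + XX \<delta> J x)" by (simp add: FF_def[OF H0])
  have sm: "smooth (EE H J)" "smooth (XX \<delta> J)" by (rule smooth_EE[OF H0], assumption+) (rule smooth_XX[OF H0 d(1,2)], assumption+)
  have bd: "AE x in lborel. ennreal (dnorm l (\<lambda>x. psi \<delta> x - FF H \<delta> J x) x powr p) \<le> ennreal (4 powr p) * (w1 x + w2 x + w3 x + w4 x)"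
    using EE2
  proof eventually_elim
    fix x assume EV: "x \<in> sq 0 B0 \<longrightarrow> rr J \<le> infdist x K \<longrightarrow> dnorm l (EE H J) x \<le> V x"
    define n where "n = dnorm l (\<lambda>x. psi \<delta> x - FF H \<delta> J x) x"
    define nE where "nE = dnorm l (EE H J) x"
    define nX where "nX = dnorm l (XX \<delta> J) x"
    have n: "0 \<le> n" "n \<le> nE + nX"
      unfolding n_def nE_def nX_def eq by (rule dnorm_nonneg, rule dnorm_add[OF sm])
    \<comment> \<open>Four majorants, each cut off to the region where it is needed. The factor 2
      covers the points closer than \<open>rr J\<close>, where extension and correction both
      contribute a window term.\<close>
    define a where "a = (if x \<in> K then 0 else V x)"
    define b where "b = (if x \<in> L then 2 * C * Wr x else 0)"
    define c where "c = (if x \<in> L then 2 * C * moll \<delta> D x else 0)"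
    define f where "f = (if x \<in> sq 0 B0 then 2 * C * E else 0)"
    have pos: "a \<ge> 0" "b \<ge> 0" "c \<ge> 0" "f \<ge> 0" using V0 C Wr0 Mo0 E0 by (auto simp: a_def b_def c_def f_def)
    have nXb: "nX \<le> C * (Wr x + moll \<delta> D x + E)" using XX[of x] by (simp add: nX_def Wr_def E_def r_def)
    have "n \<le> a + b + c + f"
    proof (cases "x \<in> sq 0 B0")
      case False
      have "nE = 0" unfolding nE_def by (rule dnorm_EE_out[OF H0 False])
      moreover have "nX = 0" unfolding nX_def by (rule dnorm_XX_far[OF H0 d(1,2)]) (use False in auto)
      ultimately show ?thesis using n pos by linarith
    next
      case B: True
      have f: "f = 2 * C * E" using B by (simp add: f_def)
      have CE: "C * E \<ge> 0" "C * Wr x \<ge> 0" "C * moll \<delta> D x \<ge> 0" using C E0 Wr0 Mo0 by auto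
      have nXb': "nX \<le> C * Wr x + C * moll \<delta> D x + C * E" using nXb by (simp add: distrib_left)
      show ?thesis
      proof (cases "infdist x K < r")
        case True
        have L: "x \<in> L" using True r by (simp add: L_def layer_def)
        have "nE \<le> C * Wr x" unfolding nE_def Wr_def r_def by (rule EE1[OF B]) (use True in \<open>simp add: r_def\<close>)
        then show ?thesis using n nXb' CE pos L f by (simp add: b_def c_def)
      next
        case False
        have "x \<notin> K" using False r by (metis iK)
        then have nE: "nE \<le> a" using EV B False by (simp add: nE_def a_def r_def)
        show ?thesis
        proof (cases "x \<in> L")
          case True
          then show ?thesis using n nE nXb' CE f by (simp add: b_def c_def)
        next
          case False
          have "nX = 0" unfolding nX_def by (rule dnorm_XX_far[OF H0 d(1,2)]) (use False in \<open>auto simp: L_def layer_def r_def\<close>)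
          then show ?thesis using n nE pos by linarith
        qed
      qed
    qed
    then have "n powr p \<le> (a + b + c + f) powr p" using n p by (intro powr_mono2) auto
    also have "\<dots> \<le> 4 powr p * (a powr p + b powr p + c powr p + f powr p)"
      using p pos by (intro powr_add4_le) auto
    finally have "ennreal (n powr p) \<le> ennreal (4 powr p * (a powr p + b powr p + c powr p + f powr p))" by (rule ennreal_leI)
    also have "\<dots> = ennreal (4 powr p) * (ennreal (a powr p) + ennreal (b powr p) + ennreal (c powr p) + ennreal (f powr p))"
      by (simp add: ennreal_mult ennreal_plus[symmetric] del: ennreal_plus)
    also have "ennreal (a powr p) = w1 x" using p by (simp add: a_def w1_def)
    also have "ennreal (b powr p) = w2 x"
    proof (cases "x \<in> L")
      case True
      have rp: "(r powr (- (2 / p))) powr p = 1 / r\<^sup>2"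
      proof -
        have "(r powr (- (2 / p))) powr p = r powr (- 2)" using p by (simp add: powr_powr)
        also have "\<dots> = 1 / r\<^sup>2" using r by (simp only: powr_minus powr_numeral inverse_eq_divide)
        finally show ?thesis .
      qed
      have "(2 * C * Wr x) powr p = (2 * C) powr p / r\<^sup>2 * W J x powr p"
        unfolding Wr_def using C W(1)[of J x] by (simp add: powr_mult rp)
      then have "b powr p = (2 * C) powr p / r\<^sup>2 * W J x powr p" using True by (simp only: b_def if_True)
      then show ?thesis unfolding w2_def using True by (simp only: indicator_simps mult_1_right) (subst ennreal_mult, auto)
    qed (use p in \<open>simp add: b_def w2_def\<close>)
    also have "ennreal (c powr p) = w3 x"
      using p C Mo0[of x] by (simp add: c_def w3_def powr_mult ennreal_mult)
    also have "ennreal (f powr p) = w4 x" using p by (simp add: f_def w4_def)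
    finally show "ennreal (dnorm l (\<lambda>x. psi \<delta> x - FF H \<delta> J x) x powr p) \<le> ennreal (4 powr p) * (w1 x + w2 x + w3 x + w4 x)"
      unfolding n_def .
  qed
  define LD where "LD = (\<integral>\<^sup>+y. ennreal (D y powr p) * indicator (layer (63 * r)) y \<partial>lborel)"
  have i2: "(\<integral>\<^sup>+x. w2 x \<partial>lborel) \<le> ennreal (2916 * (2 * C) powr p) * LD"
  proof -
    have "(\<integral>\<^sup>+x. w2 x \<partial>lborel) = ennreal ((2 * C) powr p / r\<^sup>2) * (\<integral>\<^sup>+x. ennreal (W J x powr p) * indicator L x \<partial>lborel)"
      unfolding w2_def by (rule nn_integral_cmult) measurable
    also have "\<dots> \<le> ennreal ((2 * C) powr p / r\<^sup>2) * (ennreal (2916 * r\<^sup>2) * LD)"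
      using window_integral[OF r] unfolding LD_def L_def W(2) r_def[symmetric] by (rule mult_left_mono) simp
    also have "\<dots> = ennreal ((2 * C) powr p / r\<^sup>2 * (2916 * r\<^sup>2)) * LD"
    proof -
      have "ennreal ((2 * C) powr p / r\<^sup>2 * (2916 * r\<^sup>2)) = ennreal ((2 * C) powr p / r\<^sup>2) * ennreal (2916 * r\<^sup>2)"
        by (rule ennreal_mult) auto
      then show ?thesis by (simp only: mult.assoc)
    qed
    also have "(2 * C) powr p / r\<^sup>2 * (2916 * r\<^sup>2) = 2916 * (2 * C) powr p" using r by simp
    finally show ?thesis .
  qed
  have i3: "(\<integral>\<^sup>+x. w3 x \<partial>lborel) \<le> ennreal ((2 * C) powr p) * LD"
  proof -
    have "(\<integral>\<^sup>+x. w3 x \<partial>lborel) = ennreal ((2 * C) powr p) * (\<integral>\<^sup>+x. ennreal (\<bar>moll \<delta> D x\<bar> powr p) * indicator L x \<partial>lborel)"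
      unfolding w3_def by (rule nn_integral_cmult) measurable
    also have "\<dots> \<le> ennreal ((2 * C) powr p) * (\<integral>\<^sup>+y. ennreal (\<bar>D y\<bar> powr p) * indicator (layer (63 * r)) y \<partial>lborel)"
    proof (intro mult_left_mono moll_powr_integral_le d(1))
      fix x y assume x: "x \<in> L" and k: "ker \<delta> x y \<noteq> 0"
      have "dist y x \<le> 2 * (2 * \<delta>)" by (rule dist_le_sq[OF ker_support_sq[OF d(1) k]])
      then show "y \<in> layer (63 * r)"
        using infdist_triangle[of y K x] x d(3) r by (simp add: L_def layer_def r_def)
    qed (use p in auto)
    finally show ?thesis by (simp add: LD_def D_nonneg)
  qed
  have i4: "(\<integral>\<^sup>+x. w4 x \<partial>lborel) = ennreal ((2 * C * e * (1 / r) ^ l) powr p) * emeasure lborel (sq 0 B0)"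
    unfolding w4_def by (subst nn_integral_cmult_indicator) (simp_all add: E_def mult.assoc)
  have "(\<integral>\<^sup>+x. ennreal (dnorm l (\<lambda>x. psi \<delta> x - FF H \<delta> J x) x powr p) \<partial>lborel)
    \<le> (\<integral>\<^sup>+x. ennreal (4 powr p) * (w1 x + w2 x + w3 x + w4 x) \<partial>lborel)"
    using bd by (rule nn_integral_mono_AE)
  also have "\<dots> = ennreal (4 powr p) * ((\<integral>\<^sup>+x. w1 x \<partial>lborel) + (\<integral>\<^sup>+x. w2 x \<partial>lborel) + (\<integral>\<^sup>+x. w3 x \<partial>lborel) + (\<integral>\<^sup>+x. w4 x \<partial>lborel))"
    by (simp add: nn_integral_cmult nn_integral_add)
  also have "\<dots> \<le> ennreal (4 powr p) * ((\<integral>\<^sup>+x. w1 x \<partial>lborel) + ennreal (2916 * (2 * C) powr p) * LD + ennreal ((2 * C) powr p) * LD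
      + ennreal ((2 * C * e * (1 / r) ^ l) powr p) * emeasure lborel (sq 0 B0))"
    by (intro mult_left_mono add_mono i2 i3 eq_refl[OF i4]) auto
  finally show ?thesis by (simp only: w1_def LD_def r_def)
qed

text \<open>The order of choices matters. \<epsilon> comes from dominated convergence with constants
  already fixed; the margin \<tau> depends on \<epsilon>; J must be large for \<tau> and for the
  smallness of the layer integral; the error \<open>e\<close> allowed on \<open>K\<close> depends on
  J because it is multiplied by powers of 1 / rr J; \<delta> comes last.\<close>

lemma stream_approximation:
  assumes t: "t > 0"
  obtains F \<delta> r where "0 < \<delta>" "\<delta> \<le> 1" "\<delta> \<le> t" "r > 0" "smooth F" "\<And>x. x \<notin> sq 0 B0 \<Longrightarrow> F x = 0"
    "\<And>x. infdist x K < r \<Longrightarrow> pd1 F x = 0" "\<And>x. infdist x K < r \<Longrightarrow> pd2 F x = 0"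
    "\<And>l. 1 \<le> l \<Longrightarrow> l \<le> Suc m \<Longrightarrow> (\<integral>\<^sup>+x. ennreal (dnorm l (\<lambda>x. psi \<delta> x - F x) x powr p) \<partial>lborel) \<le> ennreal t"
proof -
  obtain C where C: "C > 0" and EE1: "\<And>\<epsilon> H J l x. admissible \<epsilon> H \<Longrightarrow> 1 \<le> l \<Longrightarrow> l \<le> Suc m \<Longrightarrow> x \<in> sq 0 B0 \<Longrightarrow> infdist x K < rr J \<Longrightarrow>
      dnorm l (EE H J) x \<le> C * (rr J powr (- (2 / p)) * W J x)"
    and XX1: "\<And>\<delta> J l x e. 0 < \<delta> \<Longrightarrow> \<delta> \<le> 1 \<Longrightarrow> \<delta> \<le> rr J \<Longrightarrow> e \<ge> 0 \<Longrightarrow> l \<le> Suc m \<Longrightarrow>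
      (\<And>a. a \<in> K \<Longrightarrow> \<bar>psi \<delta> a - Psi a\<bar> \<le> e) \<Longrightarrow> (\<And>a i. a \<in> K \<Longrightarrow> 1 \<le> i \<Longrightarrow> i \<le> m \<Longrightarrow> dnorm i (psi \<delta>) a \<le> e) \<Longrightarrow>
      dnorm l (XX \<delta> J) x \<le> C * (rr J powr (- (2 / p)) * W J x + moll \<delta> D x + e * (1 / rr J) ^ l)"
    by (rule layer_bound) (assumption | blast)+
  obtain C1 C2 Hm where C12: "C1 > 0" "C2 > 0" and Hm [measurable]: "Hm \<in> borel_measurable borel"
    and Hm0: "\<And>x::real\<times>real. Hm x \<ge> (0::real)" and Hmp: "(\<integral>\<^sup>+x. ennreal (Hm x powr (p / q)) \<partial>lborel) < \<infinity>"
    and EE2: "AE x in lborel. \<forall>\<epsilon> H J l. admissible \<epsilon> H \<longrightarrow> 1 \<le> l \<longrightarrow> l \<le> Suc m \<longrightarrow> x \<in> sq 0 B0 \<longrightarrow> rr J \<le> infdist x K \<longrightarrow>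
       dnorm l (EE H J) x \<le> min (C1 * Hm x powr (1 / q)) (C2 * \<epsilon> * (1 / infdist x K) ^ l)"
    using outer_bound by blast
  \<comment> \<open>A quarter of \<open>t\<close> for each of the four terms in
    \<open>error_integral\<close>, after division by its factor 4 powr p.\<close>
  define s where "s = t / (4 * 4 powr p)"
  have s: "s > 0" using t by (simp add: s_def)
  have s': "ennreal s > 0" using s by simp
  obtain \<epsilon> where \<epsilon>: "\<epsilon> > 0" and I1: "\<And>l. l \<le> Suc m \<Longrightarrow>
    (\<integral>\<^sup>+x. ennreal (min (C1 * Hm x powr (1 / q)) (C2 * \<epsilon> * (1 / infdist x K) ^ l) powr p) * indicator (- K) x \<partial>lborel) < ennreal s"
    using outer_integral_small[OF C12 Hm Hm0 Hmp s'] by blast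
  obtain H \<tau> where adm: "admissible \<epsilon> H" and \<tau>: "\<tau> > 0"
    and G: "\<And>a b. a \<in> K \<Longrightarrow> b \<in> K \<Longrightarrow> \<bar>Psi a - Psi b\<bar> < \<tau> \<Longrightarrow> Psi a - H a = Psi b - H b"
    using truncated_stream[OF \<epsilon>] by blast
  note H0 = admissibleD(1)[OF adm]
  obtain J0 where J0: "\<And>J x a b. J0 \<le> J \<Longrightarrow> a \<in> K \<Longrightarrow> b \<in> K \<Longrightarrow> a \<in> sq x (10 * rr J) \<Longrightarrow> b \<in> sq x (10 * rr J) \<Longrightarrow> \<bar>Psi a - Psi b\<bar> < \<tau>"
    using Psi_osc_small[OF \<tau>] by blast
  \<comment> \<open>The larger of the two constants in front of the layer integral, so one smallness
    condition serves both terms.\<close>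
  define A where "A = 2916 * (2 * C) powr p"
  have A: "A > 0" using C by (simp add: A_def)
  have sA: "ennreal (s / A) > 0" using s A by simp
  obtain r0 where r0: "r0 > 0" "\<And>r. r \<le> r0 \<Longrightarrow> (\<integral>\<^sup>+z. ennreal (D z powr p) * indicator (layer r) z \<partial>lborel) < ennreal (s / A)"
    using layer_small[OF sA] by blast
  obtain J1 where J1: "\<And>J. J1 \<le> J \<Longrightarrow> rr J \<le> r0 / 63" using rr_small[of "r0 / 63"] r0(1) by auto
  define J where "J = max J0 J1"
  define r where "r = rr J"
  have r: "r > 0" using rr_pos by (simp add: r_def)
  have "63 * r \<le> r0" using J1[of J] by (simp add: J_def r_def)
  then have L: "(\<integral>\<^sup>+z. ennreal (D z powr p) * indicator (layer (63 * r)) z \<partial>lborel) < ennreal (s / A)" by (rule r0(2))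
  define M where "M = measure lborel (sq 0 B0)"
  have M: "emeasure lborel (sq 0 B0) = ennreal M" "M \<ge> 0"
  proof -
    show "emeasure lborel (sq 0 B0) = ennreal M" unfolding M_def sq_def
      by (intro emeasure_eq_ennreal_measure) (metis emeasure_lborel_cbox_finite infinity_ennreal_def less_irrefl)
  qed (simp add: M_def)
  define Q where "Q = 2 * C * (1 + 1 / r) ^ Suc m"
  have Q: "Q > 0" using C r by (simp add: Q_def add_pos_pos)
  \<comment> \<open>Solves (Q e)^p (M + 1) = s, where \<open>Q\<close> dominates 2 C r^(-l) for all
    l up to m + 1; adding 1 to the area keeps the denominator positive.\<close>
  define e where "e = (s / (M + 1)) powr (1 / p) / Q"
  have e: "e > 0" using s M(2) Q by (simp add: e_def)
  have eQ: "(Q * e) powr p = s / (M + 1)"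
    using s M(2) Q p by (simp add: e_def powr_powr)
  have I4: "ennreal ((2 * C * e * (1 / r) ^ l) powr p) * emeasure lborel (sq 0 B0) \<le> ennreal s" if l: "l \<le> Suc m" for l
  proof -
    have "(1 / r) ^ l \<le> (1 + 1 / r) ^ l" using r by (intro power_mono) auto
    also have "\<dots> \<le> (1 + 1 / r) ^ Suc m" using r l by (intro power_increasing) auto
    finally have pw: "(1 / r) ^ l \<le> (1 + 1 / r) ^ Suc m" .
    have "2 * C * e * (1 / r) ^ l \<le> 2 * C * e * (1 + 1 / r) ^ Suc m"
      using pw C e by (intro mult_left_mono) auto
    also have "\<dots> = Q * e" by (simp add: Q_def)
    finally have "(2 * C * e * (1 / r) ^ l) powr p \<le> (Q * e) powr p"
      using C e r p by (intro powr_mono2) auto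
    then have "(2 * C * e * (1 / r) ^ l) powr p * M \<le> s / (M + 1) * M" using M(2) by (intro mult_right_mono) (simp_all only: eQ)
    also have "\<dots> = s * (M / (M + 1))" by simp
    also have "\<dots> \<le> s * 1" using s M(2) by (intro mult_left_mono) auto
    finally have "(2 * C * e * (1 / r) ^ l) powr p * M \<le> s" by simp
    then show ?thesis unfolding M(1) using M(2) by (simp add: ennreal_mult[symmetric] ennreal_leI)
  qed
  have d0: "min (min 1 t) r > 0" using t r by simp
  have "\<forall>\<^sub>F \<delta> in at_right (0::real). (0 < \<delta> \<and> \<delta> \<le> min (min 1 t) r) \<and> (\<forall>x. \<bar>psi \<delta> x - Psi x\<bar> \<le> e)
      \<and> (\<forall>x\<in>K. \<forall>i. 1 \<le> i \<and> i \<le> m \<longrightarrow> dnorm i (psi \<delta>) x \<le> e)"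
    by (intro eventually_conj eventually_small[OF d0] psi_uniform[OF e] psi_small_on_K[OF e])
  then obtain \<delta> where \<delta>: "0 < \<delta>" "\<delta> \<le> min (min 1 t) r" "\<forall>x. \<bar>psi \<delta> x - Psi x\<bar> \<le> e"
      "\<forall>x\<in>K. \<forall>i. 1 \<le> i \<and> i \<le> m \<longrightarrow> dnorm i (psi \<delta>) x \<le> e"
    by (blast dest: eventually_happens'[OF trivial_limit_at_right_real])
  have d: "0 < \<delta>" "\<delta> \<le> 1" "\<delta> \<le> t" "\<delta> \<le> rr J" using \<delta>(1,2) by (auto simp: r_def)
  have GG: "Psi a - H a = Psi b - H b" if "infdist x K < rr J" "a \<in> K" "b \<in> K" "a \<in> sq x (10 * rr J)" "b \<in> sq x (10 * rr J)" for x a b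
    using G[OF that(2,3)] J0[OF _ that(2-5)] by (simp add: J_def)
  show thesis
  proof (rule that[of \<delta> "rr J" "FF H \<delta> J"])
    show "smooth (FF H \<delta> J)" by (rule smooth_FF[OF H0 d(1,2)])
    show "FF H \<delta> J x = 0" if "x \<notin> sq 0 B0" for x by (rule FF_out[OF H0 d(1,2) that])
    show "pd1 (FF H \<delta> J) x = 0" "pd2 (FF H \<delta> J) x = 0" if "infdist x K < rr J" for x
      by (rule FF_gradient_zero(1)[OF H0 d(1,2) GG that], assumption+) (rule FF_gradient_zero(2)[OF H0 d(1,2) GG that], assumption+)
    fix l :: nat assume l: "1 \<le> l" "l \<le> Suc m"
    define V where "V x = min (C1 * Hm x powr (1 / q)) (C2 * \<epsilon> * (1 / infdist x K) ^ l)" for x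
    have Vm: "V \<in> borel_measurable borel"
    proof -
      have "(\<lambda>x. infdist x K) \<in> borel_measurable borel"
        by (intro borel_measurable_continuous_onI continuous_on_infdist continuous_on_id)
      then show ?thesis unfolding V_def by measurable
    qed
    have V0: "V x \<ge> 0" for x
      unfolding V_def using C12 \<epsilon> infdist_nonneg[of x K] by (intro min.boundedI mult_nonneg_nonneg zero_le_power) auto
    have EV: "AE x in lborel. x \<in> sq 0 B0 \<longrightarrow> rr J \<le> infdist x K \<longrightarrow> dnorm l (EE H J) x \<le> V x"
      using EE2
    proof eventually_elim
      case (elim x)
      show ?case unfolding V_def using elim adm l by blast
    qed
    define N where "N = (\<integral>\<^sup>+y. ennreal (D y powr p) * indicator (layer (63 * rr J)) y \<partial>lborel)"
    have XXb: "dnorm l (XX \<delta> J) x \<le> C * (rr J powr (- (2 / p)) * W J x + moll \<delta> D x + e * (1 / rr J) ^ l)" for x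
      using \<delta>(3,4) e l by (intro XX1[OF d(1,2,4)]) auto
    have "(\<integral>\<^sup>+x. ennreal (dnorm l (\<lambda>x. psi \<delta> x - FF H \<delta> J x) x powr p) \<partial>lborel)
      \<le> ennreal (4 powr p) * ((\<integral>\<^sup>+x. ennreal (V x powr p) * indicator (- K) x \<partial>lborel)
      + ennreal (2916 * (2 * C) powr p) * N + ennreal ((2 * C) powr p) * N
      + ennreal ((2 * C * e * (1 / rr J) ^ l) powr p) * emeasure lborel (sq 0 B0))"
      unfolding N_def
      by (rule error_integral[OF adm C less_imp_le[OF e] d(1,2,4) Vm V0 EE1[OF adm l] EV XXb]) assumption+
    also have "\<dots> \<le> ennreal (4 powr p) * (ennreal s + ennreal s + ennreal s + ennreal s)"
    proof (intro mult_left_mono add_mono)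
      show "(\<integral>\<^sup>+x. ennreal (V x powr p) * indicator (- K) x \<partial>lborel) \<le> ennreal s"
        unfolding V_def using I1[OF l(2)] by (rule less_imp_le)
      have N: "N \<le> ennreal (s / A)" using L by (simp add: N_def r_def)
      have AN: "ennreal A * N \<le> ennreal s"
      proof -
        have "ennreal A * N \<le> ennreal A * ennreal (s / A)" using N by (rule mult_left_mono) simp
        also have "\<dots> = ennreal s" using A s by (simp add: ennreal_mult[symmetric])
        finally show ?thesis .
      qed
      then show "ennreal (2916 * (2 * C) powr p) * N \<le> ennreal s" unfolding A_def .
      have "ennreal ((2 * C) powr p) * N \<le> ennreal A * N"
        unfolding A_def by (intro mult_right_mono ennreal_leI) auto
      then show "ennreal ((2 * C) powr p) * N \<le> ennreal s" using AN by (rule order_trans)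
      show "ennreal ((2 * C * e * (1 / rr J) ^ l) powr p) * emeasure lborel (sq 0 B0) \<le> ennreal s"
        using I4[OF l(2)] by (simp only: r_def)
    qed simp
    also have "\<dots> = ennreal (4 powr p * (s + s + s + s))"
    proof -
      have n: "0 \<le> s" "0 \<le> s + s" "0 \<le> s + s + s" "0 \<le> s + s + s + s" "0 \<le> 4 powr p" using s by auto
      show ?thesis by (simp only: ennreal_mult[OF n(5,4)] ennreal_plus n)
    qed
    also have "4 powr p * (s + s + s + s) = t" by (simp add: s_def)
    finally show "(\<integral>\<^sup>+x. ennreal (dnorm l (\<lambda>x. psi \<delta> x - FF H \<delta> J x) x powr p) \<partial>lborel) \<le> ennreal t" .
  qed (use d rr_pos in auto)
qed

end

section \<open>Weak derivatives and Borel representatives\<close>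

lemma Dm_Suc: "Dm (Suc a, b) f = pd1 (Dm (a, b) f)" "Dm (0, Suc b) f = pd2 (Dm (0, b) f)" "Dm (0, 0) f = f"
  by (simp_all add: Dm_def)

lemma Dm_add:
  assumes f: "smooth f" and g: "smooth g"
  shows "Dm j (\<lambda>x. f x + g x) = (\<lambda>x. Dm j f x + Dm j g x)"
proof -
  have 0: "Dm (0, b) (\<lambda>x. f x + g x) = (\<lambda>x. Dm (0, b) f x + Dm (0, b) g x)" for b
    by (induction b) (simp_all add: Dm_Suc pd_add smooth_Dm f g)
  have "Dm (a, b) (\<lambda>x. f x + g x) = (\<lambda>x. Dm (a, b) f x + Dm (a, b) g x)" for a b
    by (induction a) (simp_all add: Dm_Suc 0 pd_add smooth_Dm f g)
  then show ?thesis by (cases j) simp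
qed

lemma loc_int_measurable: "loc_int f \<Longrightarrow> f \<in> borel_measurable lebesgue"
proof -
  assume f: "loc_int f"
  have s: "(\<lambda>x. indicator (cball 0 (real n)) x *\<^sub>R f x) \<in> borel_measurable lebesgue" for n
    using f unfolding loc_int_def set_integrable_def by (meson borel_measurable_integrable compact_cball)
  show ?thesis
  proof (rule borel_measurable_LIMSEQ_real[OF _ s])
    fix x :: "real \<times> real"
    obtain N where N: "norm x \<le> real N" using real_arch_simple by blast
    have "\<forall>\<^sub>F n in sequentially. indicator (cball 0 (real n)) x *\<^sub>R f x = f x"
      using eventually_ge_at_top[of N] by eventually_elim (use N in \<open>auto simp: indicator_def\<close>)
    then show "(\<lambda>n. indicator (cball 0 (real n)) x *\<^sub>R f x) \<longlonglongrightarrow> f x" by (rule tendsto_eventually)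
  qed
qed

text \<open>The given functions are only Lebesgue measurable; a Borel representative makes the
  results on \<open>lborel\<close> applicable.\<close>

lemma loc_int_representative:
  assumes f: "loc_int f"
  obtains f' where "locint f'" "AE x in lborel. f x = f' x"
proof -
  obtain f' where f': "f' \<in> borel_measurable lborel" "AE x in lborel. f x = f' x"
    using completion_ex_borel_measurable_real[OF loc_int_measurable[OF f]] by blast
  have [measurable]: "f' \<in> borel_measurable borel" using f'(1) by simp
  have "integrable lborel (\<lambda>x. f' x * indicator (sq c r) x)" for c r
  proof -
    have i: "integrable lebesgue (\<lambda>x. indicator (sq c r) x *\<^sub>R f x)"
      using f unfolding loc_int_def set_integrable_def sq_def by (meson compact_cbox)
    have "integrable lebesgue (\<lambda>x. f' x * indicator (sq c r) x)"
    proof (rule integrable_cong_AE_imp[OF i])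
      show "(\<lambda>x. f' x * indicator (sq c r) x) \<in> borel_measurable lebesgue"
        by (rule measurable_completion) measurable
      show "AE x in lebesgue. indicator (sq c r) x *\<^sub>R f x = f' x * indicator (sq c r) x"
        using AE_completion[OF f'(2)] by eventually_elim simp
    qed
    moreover have "(\<lambda>x. f' x * indicator (sq c r) x) \<in> borel_measurable lborel" by measurable
    ultimately show ?thesis by (simp add: integrable_completion)
  qed
  then have "locint f'" unfolding locint_def by auto
  then show thesis using f'(2) that by blast
qed

lemma lebesgue_integral_representative:
  fixes f f' :: "real \<times> real \<Rightarrow> real"
  assumes f: "f \<in> borel_measurable lebesgue" and f': "f' \<in> borel_measurable borel" and ae: "AE x in lborel. f x = f' x"
  shows "(\<integral>x. f x \<partial>lebesgue) = (\<integral>x. f' x \<partial>lborel)"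
proof -
  have m: "f' \<in> borel_measurable lborel" using f' by simp
  have "(\<integral>x. f x \<partial>lebesgue) = (\<integral>x. f' x \<partial>lebesgue)"
    by (rule integral_cong_AE[OF f measurable_completion[OF m] AE_completion[OF ae]])
  also have "\<dots> = (\<integral>x. f' x \<partial>lborel)" by (rule integral_completion[OF m])
  finally show ?thesis .
qed

lemma continuous_lebesgue_measurable:
  fixes \<phi> :: "real \<times> real \<Rightarrow> real"
  assumes "continuous_on UNIV \<phi>" shows "\<phi> \<in> borel_measurable borel" "\<phi> \<in> borel_measurable lebesgue"
proof -
  show b: "\<phi> \<in> borel_measurable borel" using assms by (rule borel_measurable_continuous_onI)
  then have "\<phi> \<in> borel_measurable lborel" by simp
  then show "\<phi> \<in> borel_measurable lebesgue" by (rule measurable_completion)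
qed

lemma integral_mult_representative:
  assumes f: "loc_int f" and f': "f' \<in> borel_measurable borel" and ae: "AE x in lborel. f x = f' x"
    and \<phi>: "continuous_on UNIV \<phi>"
  shows "(\<integral>x. f x * \<phi> x \<partial>lebesgue) = (\<integral>x. f' x * \<phi> x \<partial>lborel)"
proof (rule lebesgue_integral_representative)
  show "(\<lambda>x. f x * \<phi> x) \<in> borel_measurable lebesgue"
    by (intro borel_measurable_times loc_int_measurable[OF f] continuous_lebesgue_measurable[OF \<phi>])
  show "(\<lambda>x. f' x * \<phi> x) \<in> borel_measurable borel"
    by (intro borel_measurable_times f' continuous_lebesgue_measurable[OF \<phi>])
  show "AE x in lborel. f x * \<phi> x = f' x * \<phi> x" using ae by eventually_elim simp
qed

text \<open>The kernels are test functions, so the difference of two weak derivatives has vanishing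
  mollifications and \<open>moll_zero_AE\<close> concludes.\<close>

lemma weak_deriv_unique:
  assumes w: "weak_deriv j f w1" "weak_deriv j f w2"
  shows "AE x in lborel. w1 x = w2 x"
proof -
  have l: "loc_int w1" "loc_int w2" using w by (auto simp: weak_deriv_def)
  obtain v1 where v1: "locint v1" "AE x in lborel. w1 x = v1 x" using loc_int_representative[OF l(1)] by blast
  obtain v2 where v2: "locint v2" "AE x in lborel. w2 x = v2 x" using loc_int_representative[OF l(2)] by blast
  have b: "v1 \<in> borel_measurable borel" "v2 \<in> borel_measurable borel" using v1(1) v2(1) by (auto simp: locint_def)
  have "moll \<delta> (\<lambda>x. v1 x - v2 x) x = 0" if d: "\<delta> > 0" for \<delta> x
  proof -
    have k: "test_fun (ker \<delta> x)" unfolding test_fun_def using ker_smooth(1,2)[OF d, of x] smooth_imp_smooth2 by blast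
    have c: "continuous_on UNIV (ker \<delta> x)" by (rule smooth_cont[OF ker_smooth(1)[OF d]])
    have "(-1) ^ order j * (\<integral>y. w1 y * ker \<delta> x y \<partial>lebesgue) = (-1) ^ order j * (\<integral>y. w2 y * ker \<delta> x y \<partial>lebesgue)"
      using w k unfolding weak_deriv_def by metis
    then have "(\<integral>y. w1 y * ker \<delta> x y \<partial>lebesgue) = (\<integral>y. w2 y * ker \<delta> x y \<partial>lebesgue)" by simp
    then have "moll \<delta> v1 x = moll \<delta> v2 x"
      unfolding moll_def integral_mult_representative[OF l(1) b(1) v1(2) c] integral_mult_representative[OF l(2) b(2) v2(2) c] .
    then show ?thesis using moll_diff[OF v1(1) v2(1) d] by simp
  qed
  then have "AE x in lborel. v1 x - v2 x = 0" by (rule moll_zero_AE[OF locint_diff[OF v1(1) v2(1)]])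
  then show ?thesis using v1(2) v2(2) by eventually_elim simp
qed

text \<open>One family has to serve all purposes. Continuity and the zeros off \<Omega> come from
  \<open>cz\<close>, integrability from \<open>sob\<close>, and uniqueness of weak derivatives joins
  the two. The identification with every weak derivative of \<open>f\<close> is needed because
  \<open>sobolev_conv\<close> quantifies over all of them.\<close>

lemma sobolev_representatives:
  assumes m: "m \<ge> 1" and sob: "sobolev m p f"
    and cz: "\<And>j. order j \<le> m - 1 \<Longrightarrow> \<exists>g. weak_deriv j f g \<and> continuous_on UNIV g \<and> (\<forall>x. x \<notin> \<Omega> \<longrightarrow> g x = 0)"
  obtains G where "\<And>j. order j < m \<Longrightarrow> continuous_on UNIV (G j)"
    "\<And>j x. order j < m \<Longrightarrow> x \<notin> \<Omega> \<Longrightarrow> G j x = (0::real)"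
    "\<And>j. order j \<le> m \<Longrightarrow> G j \<in> borel_measurable borel"
    "\<And>j. order j \<le> m \<Longrightarrow> (\<integral>\<^sup>+x. ennreal (\<bar>G j x\<bar> powr p) \<partial>lborel) < \<infinity>"
    "\<And>j. order j \<le> m \<Longrightarrow> wderiv j (G (0, 0)) (G j)"
    "\<And>j w. order j \<le> m \<Longrightarrow> weak_deriv j f w \<Longrightarrow> AE x in lborel. w x = G j x"
    "f \<in> borel_measurable lebesgue" "AE x in lborel. f x = G (0, 0) x"
proof -
  have ex: "\<exists>v. (order j < m \<longrightarrow> continuous_on UNIV v \<and> (\<forall>x. x \<notin> \<Omega> \<longrightarrow> v x = 0)) \<and> v \<in> borel_measurable borel
      \<and> (\<exists>w. weak_deriv j f w \<and> Lp p w \<and> (AE x in lborel. w x = v x))" if j: "order j \<le> m" for j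
  proof -
    obtain w where w: "weak_deriv j f w" "Lp p w" using sob j unfolding sobolev_def by blast
    show ?thesis
    proof (cases "order j < m")
      case True
      then have "order j \<le> m - 1" by linarith
      then obtain g where g: "weak_deriv j f g" "continuous_on UNIV g" "\<forall>x. x \<notin> \<Omega> \<longrightarrow> g x = 0" using cz by blast
      show ?thesis
        using g(2,3) w weak_deriv_unique[OF w(1) g(1)] continuous_lebesgue_measurable(1)[OF g(2)] by blast
    next
      case False
      have "loc_int w" using w(1) by (simp add: weak_deriv_def)
      then obtain v where "locint v" "AE x in lborel. w x = v x" using loc_int_representative by blast
      then show ?thesis using False w unfolding locint_def by blast
    qed
  qed
  define P where "P j v \<longleftrightarrow> (order j < m \<longrightarrow> continuous_on UNIV v \<and> (\<forall>x. x \<notin> \<Omega> \<longrightarrow> v x = 0)) \<and> v \<in> borel_measurable borel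
      \<and> (\<exists>w. weak_deriv j f w \<and> Lp p w \<and> (AE x in lborel. w x = v x))" for j and v :: "real \<times> real \<Rightarrow> real"
  define G where "G j = (SOME v. P j v)" for j
  have G: "P j (G j)" if "order j \<le> m" for j
  proof -
    have "\<exists>v. P j v" using ex[OF that] unfolding P_def .
    then show ?thesis unfolding G_def by (rule someI_ex)
  qed
  have o0: "order (0, 0) \<le> m" by (simp add: order_def)
  have uniq: "AE x in lborel. w x = G j x" if j: "order j \<le> m" and w: "weak_deriv j f w" for j w
  proof -
    obtain w' where w': "weak_deriv j f w'" "AE x in lborel. w' x = G j x" using G[OF j] unfolding P_def by blast
    show ?thesis using weak_deriv_unique[OF w w'(1)] w'(2) by eventually_elim simp
  qed
  have lf: "loc_int f" using G[OF o0] unfolding P_def weak_deriv_def by blast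
  \<comment> \<open>\<open>f\<close> is its own weak derivative of order 0.\<close>
  have f0: "AE x in lborel. f x = G (0, 0) x"
    by (rule uniq[OF o0]) (simp add: weak_deriv_def lf order_def Dm_Suc)
  show thesis
  proof (rule that[of G])
    show "continuous_on UNIV (G j)" if "order j < m" for j using G[of j] that by (simp add: P_def)
    show "G j x = 0" if "order j < m" "x \<notin> \<Omega>" for j x using G[of j] that(1) spec[of "\<lambda>x. x \<notin> \<Omega> \<longrightarrow> G j x = 0" x] that(2) unfolding P_def by auto
    show Gb: "G j \<in> borel_measurable borel" if "order j \<le> m" for j using G[OF that] by (simp add: P_def)
    show "(\<integral>\<^sup>+x. ennreal (\<bar>G j x\<bar> powr p) \<partial>lborel) < \<infinity>" if j: "order j \<le> m" for j
    proof -
      obtain w where w: "Lp p w" "AE x in lborel. w x = G j x" using G[OF j] unfolding P_def by blast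
      have "(\<integral>\<^sup>+x. ennreal (\<bar>G j x\<bar> powr p) \<partial>lborel) = (\<integral>\<^sup>+x. ennreal (\<bar>w x\<bar> powr p) \<partial>lborel)"
        by (rule nn_integral_cong_AE) (use w(2) in \<open>eventually_elim, simp\<close>)
      then show ?thesis using w(1) unfolding Lp_def nn_integral_completion by simp
    qed
    show "wderiv j (G (0, 0)) (G j)" if j: "order j \<le> m" for j
      unfolding wderiv_def
    proof (intro allI impI)
      fix \<phi> assume \<phi>: "smooth \<phi>" "compact (csupp \<phi>)"
      obtain w where w: "weak_deriv j f w" using G[OF j] unfolding P_def by blast
      have lw: "loc_int w" using w by (simp add: weak_deriv_def)
      have "(\<integral>x. G (0, 0) x * Dm j \<phi> x \<partial>lborel) = (\<integral>x. f x * Dm j \<phi> x \<partial>lebesgue)"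
        by (rule integral_mult_representative[OF lf Gb[OF o0] f0 smooth_cont[OF smooth_Dm[OF \<phi>(1)]], symmetric])
      also have "\<dots> = (-1) ^ order j * (\<integral>x. w x * \<phi> x \<partial>lebesgue)"
        using w \<phi> smooth_imp_smooth2[OF \<phi>(1)] unfolding weak_deriv_def test_fun_def by blast
      also have "(\<integral>x. w x * \<phi> x \<partial>lebesgue) = (\<integral>x. G j x * \<phi> x \<partial>lborel)"
        by (rule integral_mult_representative[OF lw Gb[OF j] uniq[OF j w] smooth_cont[OF \<phi>(1)]])
      finally show "(\<integral>x. G (0, 0) x * Dm j \<phi> x \<partial>lborel) = (-1) ^ order j * (\<integral>x. G j x * \<phi> x \<partial>lborel)" .
    qed
  qed (use uniq f0 loc_int_measurable[OF lf] in auto)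
qed

section \<open>Convergence of the curls\<close>

text \<open>The components of the rotated gradient; the index \<open>True\<close> stands for the
  first component, as in \<open>g\<close>.\<close>

definition curlc :: "bool \<Rightarrow> (real \<times> real \<Rightarrow> real) \<Rightarrow> real \<times> real \<Rightarrow> real" where
  "curlc i E = (if i then pd2 E else (\<lambda>x. - pd1 E x))"

lemma smooth_curlc: "smooth E \<Longrightarrow> smooth (curlc i E)"
  by (simp add: curlc_def smooth_pd1 smooth_pd2 smooth_uminus)

lemma curlc_add: "smooth E \<Longrightarrow> smooth F \<Longrightarrow> curlc i (\<lambda>x. E x + F x) = (\<lambda>x. curlc i E x + curlc i F x)"
  by (simp add: curlc_def pd_add)

lemma Dm_curlc_le:
  assumes "smooth E" shows "\<bar>Dm j (curlc i E) x\<bar> \<le> dnorm (Suc (order j)) E x"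
proof -
  have "\<bar>Dm j (curlc i E) x\<bar> \<le> dnorm (order j) (curlc i E) x" by (rule Dm_le_dnorm)
  also have "\<dots> \<le> dnorm (Suc (order j)) E x"
    using dnorm_nonneg[of "order j" "pd1 E" x] dnorm_nonneg[of "order j" "pd2 E" x]
    by (simp add: curlc_def dnorm_uminus smooth_pd1 assms)
  finally show ?thesis .
qed

context divfree
begin

text \<open>The mollified field is the rotated gradient of \<open>psi\<close>. The error therefore
  splits into derivatives, of one order more, of the difference of stream functions, whose p-th
  powers have integral at most 1/(k+1), and the mollification error of \<open>g i j\<close>.\<close>

lemma curlc_convergence:
  assumes d: "\<And>k. 0 < \<delta> k" "\<And>k. \<delta> k \<le> 1" "\<And>k. \<delta> k \<le> inverse (real (Suc k))" and F: "\<And>k. smooth (F k)"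
    and I: "\<And>k l. 1 \<le> l \<Longrightarrow> l \<le> Suc m \<Longrightarrow>
      (\<integral>\<^sup>+x. ennreal (dnorm l (\<lambda>x. psi (\<delta> k) x - F k x) x powr p) \<partial>lborel) \<le> ennreal (inverse (real (Suc k)))"
    and j: "order j \<le> m"
  shows "(\<lambda>k. \<integral>\<^sup>+x. ennreal (\<bar>Dm j (curlc i (F k)) x - g i j x\<bar> powr p) \<partial>lborel) \<longlonglongrightarrow> 0"
proof -
  have d0: "\<delta> \<longlonglongrightarrow> 0"
    by (rule tendsto_sandwich[OF always_eventually always_eventually tendsto_const LIMSEQ_inverse_real_of_nat])
      (use d(3) less_imp_le[OF d(1)] in blast)+
  note [measurable] = meas[OF j]
  define c where "c k = (\<integral>\<^sup>+x. ennreal (\<bar>moll (\<delta> k) (g i j) x - g i j x\<bar> powr p) \<partial>lborel)" for k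
  have c: "c \<longlonglongrightarrow> 0" unfolding c_def
    by (rule moll_Lp_tendsto[OF meas[OF j] _ Lpg[OF j] d(1) d0]) (use p in simp)
  have lim: "(\<lambda>k. ennreal (3 powr p) * (ennreal (inverse (real (Suc k))) + c k)) \<longlonglongrightarrow> ennreal (3 powr p) * (ennreal 0 + 0)"
    by (intro ennreal_tendsto_cmult tendsto_add c tendsto_ennrealI LIMSEQ_inverse_real_of_nat) simp
  show ?thesis
  proof (rule ennreal_tendsto_0_mono)
    show "(\<lambda>k. ennreal (3 powr p) * (ennreal (inverse (real (Suc k))) + c k)) \<longlonglongrightarrow> 0" using lim by simp
    fix k
    define E where "E = (\<lambda>x. psi (\<delta> k) x - F k x)"
    have E: "smooth E" unfolding E_def by (rule smooth_diff[OF smooth_psi[OF d(1,2)] F])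
    have m0: "dnorm (Suc (order j)) E \<in> borel_measurable borel"
      by (rule continuous_lebesgue_measurable(1)[OF dnorm_continuous[OF E]])
    have mE: "(\<lambda>x. ennreal (dnorm (Suc (order j)) E x powr p)) \<in> borel_measurable lborel" using m0 by measurable
    have mM: "(\<lambda>x. ennreal (\<bar>moll (\<delta> k) (g i j) x - g i j x\<bar> powr p)) \<in> borel_measurable lborel" by measurable
    have "U i (\<delta> k) = curlc i (psi (\<delta> k))" by (cases i) (simp_all add: curlc_def pd_psi[OF d(1,2)])
    also have "psi (\<delta> k) = (\<lambda>x. E x + F k x)" by (simp add: E_def)
    finally have "Dm j (U i (\<delta> k)) = (\<lambda>x. Dm j (curlc i E) x + Dm j (curlc i (F k)) x)"
      by (simp add: curlc_add E F Dm_add smooth_curlc)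
    then have mo: "moll (\<delta> k) (g i j) x = Dm j (curlc i E) x + Dm j (curlc i (F k)) x" for x
      using fun_cong[OF Dm_U[OF d(1) j, of i k], of x] by (simp only:)
    have "(\<integral>\<^sup>+x. ennreal (\<bar>Dm j (curlc i (F k)) x - g i j x\<bar> powr p) \<partial>lborel)
      \<le> (\<integral>\<^sup>+x. ennreal (3 powr p) * (ennreal (dnorm (Suc (order j)) E x powr p) + ennreal (\<bar>moll (\<delta> k) (g i j) x - g i j x\<bar> powr p)) \<partial>lborel)"
    proof (rule nn_integral_mono)
      fix x
      have "\<bar>Dm j (curlc i (F k)) x - g i j x\<bar> = \<bar>- Dm j (curlc i E) x + (moll (\<delta> k) (g i j) x - g i j x) + 0\<bar>"
        by (simp add: mo)
      then have "\<bar>Dm j (curlc i (F k)) x - g i j x\<bar> powr p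
        \<le> 3 powr p * (\<bar>- Dm j (curlc i E) x\<bar> powr p + \<bar>moll (\<delta> k) (g i j) x - g i j x\<bar> powr p + \<bar>0\<bar> powr p)"
        using powr_add3_le[of p "- Dm j (curlc i E) x" "moll (\<delta> k) (g i j) x - g i j x" 0] p by simp
      also have "\<dots> = 3 powr p * (\<bar>Dm j (curlc i E) x\<bar> powr p + \<bar>moll (\<delta> k) (g i j) x - g i j x\<bar> powr p)" by simp
      also have "\<dots> \<le> 3 powr p * (dnorm (Suc (order j)) E x powr p + \<bar>moll (\<delta> k) (g i j) x - g i j x\<bar> powr p)"
        using p by (intro mult_left_mono add_mono powr_mono2 Dm_curlc_le[OF E]) auto
      finally have "ennreal (\<bar>Dm j (curlc i (F k)) x - g i j x\<bar> powr p)
        \<le> ennreal (3 powr p * (dnorm (Suc (order j)) E x powr p + \<bar>moll (\<delta> k) (g i j) x - g i j x\<bar> powr p))" by (rule ennreal_leI)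
      then show "ennreal (\<bar>Dm j (curlc i (F k)) x - g i j x\<bar> powr p)
        \<le> ennreal (3 powr p) * (ennreal (dnorm (Suc (order j)) E x powr p) + ennreal (\<bar>moll (\<delta> k) (g i j) x - g i j x\<bar> powr p))"
        by (simp add: ennreal_mult ennreal_plus[symmetric] del: ennreal_plus dnorm.simps)
    qed
    also have "\<dots> = ennreal (3 powr p) * ((\<integral>\<^sup>+x. ennreal (dnorm (Suc (order j)) E x powr p) \<partial>lborel) + c k)"
      unfolding c_def by (simp only: nn_integral_cmult[OF borel_measurable_add[OF mE mM]] nn_integral_add[OF mE mM])
    also have "\<dots> \<le> ennreal (3 powr p) * (ennreal (inverse (real (Suc k))) + c k)"
      unfolding E_def using j by (intro mult_left_mono add_mono order_refl I) auto
    finally show "(\<integral>\<^sup>+x. ennreal (\<bar>Dm j (curlc i (F k)) x - g i j x\<bar> powr p) \<partial>lborel) \<le> ennreal (3 powr p) * (ennreal (inverse (real (Suc k))) + c k)" .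
  qed
qed

end

lemma pd_zero_off_sq:
  assumes "\<And>x. x \<notin> sq c r \<Longrightarrow> F x = 0" and x: "x \<notin> sq c r"
  shows "pd1 F x = 0" "pd2 F x = 0"
proof -
  have o: "open (- sq c r)" unfolding sq_def by (simp add: open_Compl closed_cbox)
  have "dnorm 1 F x = dnorm 1 (\<lambda>x. 0) x" by (rule dnorm_cong_open[OF o]) (use assms in auto)
  then have "\<bar>pd1 F x\<bar> + \<bar>pd2 F x\<bar> = 0" by (simp add: pd_const)
  then show "pd1 F x = 0" "pd2 F x = 0" by auto
qed

theorem theorem1p1:
  fixes m :: nat and p :: real and \<Omega> :: "(real \<times> real) set"
    and u :: "real \<times> real \<Rightarrow> real \<times> real"
  assumes "m \<ge> 1" and "p > 2"
    and "open \<Omega>" and "bounded \<Omega>"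
    and "S_set \<Omega> \<in> null_sets lebesgue"
    and "sobolev m p (\<lambda>x. fst (u x))" and "sobolev m p (\<lambda>x. snd (u x))"
    and "weak_div_free u"
    and "\<forall>j. order j \<le> m - 1 \<longrightarrow>
           (\<exists>g. weak_deriv j (\<lambda>x. fst (u x)) g \<and> continuous_on UNIV g \<and> (\<forall>x. x \<notin> \<Omega> \<longrightarrow> g x = 0)) \<and>
           (\<exists>g. weak_deriv j (\<lambda>x. snd (u x)) g \<and> continuous_on UNIV g \<and> (\<forall>x. x \<notin> \<Omega> \<longrightarrow> g x = 0))"
  shows "\<exists>uk :: nat \<Rightarrow> real \<times> real \<Rightarrow> real \<times> real.
           (\<forall>k. test_fun (\<lambda>x. fst (uk k x)) \<and> test_fun (\<lambda>x. snd (uk k x)) \<and>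
                (\<forall>x. pd1 (\<lambda>y. fst (uk k y)) x + pd2 (\<lambda>y. snd (uk k y)) x = 0) \<and>
                csupp (uk k) \<subseteq> \<Omega>) \<and>
           sobolev_conv m p (\<lambda>k x. fst (uk k x)) (\<lambda>x. fst (u x)) \<and>
           sobolev_conv m p (\<lambda>k x. snd (uk k x)) (\<lambda>x. snd (u x))"
proof -
  define f where "f i = (if i then (\<lambda>x. fst (u x)) else (\<lambda>x. snd (u x)))" for i
  have sob: "sobolev m p (f i)" for i using assms(6,7) by (cases i) (simp_all only: f_def if_True if_False)
  have cz: "\<exists>g. weak_deriv j (f i) g \<and> continuous_on UNIV g \<and> (\<forall>x. x \<notin> \<Omega> \<longrightarrow> g x = 0)" if "order j \<le> m - 1" for i j
    using assms(9)[rule_format, OF that] by (cases i) (simp_all only: f_def if_True if_False simp_thms)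
  \<comment> \<open>The properties are bundled into one predicate so that a family can be chosen for
    both components at once.\<close>
  define P where "P i G \<longleftrightarrow> (\<forall>j. order j < m \<longrightarrow> continuous_on UNIV (G j)) \<and> (\<forall>j x. order j < m \<longrightarrow> x \<notin> \<Omega> \<longrightarrow> G j x = 0)
      \<and> (\<forall>j. order j \<le> m \<longrightarrow> G j \<in> borel_measurable borel)
      \<and> (\<forall>j. order j \<le> m \<longrightarrow> (\<integral>\<^sup>+x. ennreal (\<bar>G j x\<bar> powr p) \<partial>lborel) < \<infinity>)
      \<and> (\<forall>j. order j \<le> m \<longrightarrow> wderiv j (G (0, 0)) (G j))
      \<and> (\<forall>j w. order j \<le> m \<longrightarrow> weak_deriv j (f i) w \<longrightarrow> (AE x in lborel. w x = G j x))
      \<and> f i \<in> borel_measurable lebesgue \<and> (AE x in lborel. f i x = G (0, 0) x)"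
    for i and G :: "nat \<times> nat \<Rightarrow> real \<times> real \<Rightarrow> real"
  have "\<exists>G. P i G" for i
    by (rule sobolev_representatives[OF assms(1) sob[of i] cz[of _ i]], assumption) (unfold P_def, blast)
  then obtain g where gP: "\<And>i. P i (g i)" by metis
  have g1: "continuous_on UNIV (g i j)" "x \<notin> \<Omega> \<Longrightarrow> g i j x = 0" if "order j < m" for i j x
    using gP[of i] that unfolding P_def by blast+
  have g2: "g i j \<in> borel_measurable borel" "(\<integral>\<^sup>+x. ennreal (\<bar>g i j x\<bar> powr p) \<partial>lborel) < \<infinity>"
      "wderiv j (g i (0, 0)) (g i j)" "weak_deriv j (f i) w \<Longrightarrow> AE x in lborel. w x = g i j x" if "order j \<le> m" for i j w
    using gP[of i] that unfolding P_def by blast+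
  have g3: "f i \<in> borel_measurable lebesgue" "AE x in lborel. f i x = g i (0, 0) x" for i
    using gP[of i] unfolding P_def by blast+
  obtain R where R: "R > 0" "\<And>x. x \<in> \<Omega> \<Longrightarrow> norm x \<le> R" using assms(4) unfolding bounded_pos by blast
  have RS: "x \<in> - \<Omega>" if "x \<notin> sq 0 R" for x
  proof
    assume "x \<in> \<Omega>"
    then have "norm x \<le> R" by (rule R(2))
    then have "\<bar>fst x\<bar> \<le> R" "\<bar>snd x\<bar> \<le> R"
      using norm_fst_le[of "fst x" "snd x"] norm_snd_le[of "snd x" "fst x"] by auto
    then show False using that by (simp add: mem_sq)
  qed
  have div: "(\<integral>x. g True (0, 0) x * pd1 \<phi> x + g False (0, 0) x * pd2 \<phi> x \<partial>lborel) = 0"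
    if \<phi>: "smooth \<phi>" "compact (csupp \<phi>)" for \<phi>
  proof -
    have o0: "order (0, 0) \<le> m" by (simp add: order_def)
    note c = smooth_cont[OF smooth_pd1[OF \<phi>(1)]] smooth_cont[OF smooth_pd2[OF \<phi>(1)]]
    have "(\<integral>x. f True x * pd1 \<phi> x + f False x * pd2 \<phi> x \<partial>lebesgue)
      = (\<integral>x. g True (0, 0) x * pd1 \<phi> x + g False (0, 0) x * pd2 \<phi> x \<partial>lborel)"
    proof (rule lebesgue_integral_representative)
      show "(\<lambda>x. f True x * pd1 \<phi> x + f False x * pd2 \<phi> x) \<in> borel_measurable lebesgue"
        by (intro borel_measurable_add borel_measurable_times g3 continuous_lebesgue_measurable c)
      show "(\<lambda>x. g True (0, 0) x * pd1 \<phi> x + g False (0, 0) x * pd2 \<phi> x) \<in> borel_measurable borel"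
        by (intro borel_measurable_add borel_measurable_times g2(1)[OF o0] continuous_lebesgue_measurable c)
      show "AE x in lborel. f True x * pd1 \<phi> x + f False x * pd2 \<phi> x = g True (0, 0) x * pd1 \<phi> x + g False (0, 0) x * pd2 \<phi> x"
        using g3(2)[of True] g3(2)[of False] by eventually_elim simp
    qed
    moreover have "(\<integral>x. f True x * pd1 \<phi> x + f False x * pd2 \<phi> x \<partial>lebesgue) = 0"
      using assms(8) \<phi> smooth_imp_smooth2[OF \<phi>(1)] unfolding weak_div_free_def test_fun_def f_def if_True if_False by blast
    ultimately show ?thesis by simp
  qed
  \<comment> \<open>The complement of \<Omega> takes the role of \<open>K\<close>; it contains
    everything off a square because \<Omega> is bounded.\<close>
  interpret divfree m p R "- \<Omega>" g
  proof
    show "g i j x = 0" if "order j < m" "x \<in> - \<Omega>" for i j x using g1(2)[OF that(1)] that(2) by simp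
    show "closed (- \<Omega>)" using assms(3) by (rule closed_Compl)
  qed (fact assms(1) assms(2) R(1) RS g1(1) g2(1) g2(2) g2(3) div)+
  define Q where "Q k F \<delta> r \<longleftrightarrow> 0 < \<delta> \<and> \<delta> \<le> 1 \<and> \<delta> \<le> inverse (real (Suc k)) \<and> r > 0 \<and> smooth F \<and> (\<forall>x. x \<notin> sq 0 B0 \<longrightarrow> F x = 0)
      \<and> (\<forall>x. infdist x (- \<Omega>) < r \<longrightarrow> pd1 F x = 0) \<and> (\<forall>x. infdist x (- \<Omega>) < r \<longrightarrow> pd2 F x = 0)
      \<and> (\<forall>l. 1 \<le> l \<longrightarrow> l \<le> Suc m \<longrightarrow> (\<integral>\<^sup>+x. ennreal (dnorm l (\<lambda>x. psi \<delta> x - F x) x powr p) \<partial>lborel) \<le> ennreal (inverse (real (Suc k))))"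
    for k :: nat and F \<delta> and r :: real
  have "\<exists>F \<delta> r. Q k F \<delta> r" for k
  proof -
    have t: "inverse (real (Suc k)) > 0" by simp
    show ?thesis by (rule stream_approximation[OF t]) (unfold Q_def, blast)
  qed
  then obtain F \<delta> r where Q: "\<And>k. Q k (F k) (\<delta> k) (r k)" by metis
  have F: "smooth (F k)" "x \<notin> sq 0 B0 \<Longrightarrow> F k x = 0" "infdist x (- \<Omega>) < r k \<Longrightarrow> pd1 (F k) x = 0"
      "infdist x (- \<Omega>) < r k \<Longrightarrow> pd2 (F k) x = 0" "r k > 0" for k x
    using Q[of k] unfolding Q_def by blast+
  have conv: "(\<lambda>k. \<integral>\<^sup>+x. ennreal (\<bar>Dm j (curlc i (F k)) x - g i j x\<bar> powr p) \<partial>lborel) \<longlonglongrightarrow> 0" if "order j \<le> m" for i j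
    by (rule curlc_convergence[where \<delta> = \<delta>, OF _ _ _ F(1) _ that]) (use Q in \<open>unfold Q_def, blast\<close>)+
  have sc: "sobolev_conv m p (\<lambda>k. curlc i (F k)) (f i)" for i
    unfolding sobolev_conv_def
  proof (intro allI impI)
    fix j w assume j: "order j \<le> m" and w: "weak_deriv j (f i) w"
    have "(\<integral>\<^sup>+x. ennreal (\<bar>Dm j (curlc i (F k)) x - w x\<bar> powr p) \<partial>lebesgue) = (\<integral>\<^sup>+x. ennreal (\<bar>Dm j (curlc i (F k)) x - g i j x\<bar> powr p) \<partial>lborel)" for k
      unfolding nn_integral_completion by (rule nn_integral_cong_AE) (use g2(4)[OF j w] in \<open>eventually_elim, simp\<close>)
    then show "(\<lambda>k. \<integral>\<^sup>+x. ennreal (\<bar>Dm j (curlc i (F k)) x - w x\<bar> powr p) \<partial>lebesgue) \<longlonglongrightarrow> 0" using conv[OF j] by simp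
  qed
  have tf: "test_fun (curlc i (F k))" for i k
    unfolding test_fun_def
  proof
    show "smooth2 (curlc i (F k))" by (rule smooth_imp_smooth2[OF smooth_curlc[OF F(1)]])
    show "compact (csupp (curlc i (F k)))"
    proof (rule compact_csupp_sq, rule ccontr)
      fix y assume y: "curlc i (F k) y \<noteq> 0" "y \<notin> sq 0 B0"
      show False using y(1) pd_zero_off_sq[of 0 B0 "F k", OF F(2) y(2)] by (simp add: curlc_def split: if_splits)
    qed
  qed
  define uk where "uk k x = (curlc True (F k) x, curlc False (F k) x)" for k x
  have fs: "(\<lambda>x. fst (uk k x)) = curlc True (F k)" "(\<lambda>x. snd (uk k x)) = curlc False (F k)" for k
    by (simp_all add: uk_def)
  \<comment> \<open>The divergence of a rotated gradient vanishes by the symmetry of mixed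
    derivatives.\<close>
  have dv: "pd1 (curlc True (F k)) x + pd2 (curlc False (F k)) x = 0" for k x
    using pd_commute[OF F(1)[of k]] pd_uminus(2)[OF smooth_pd1[OF F(1)[of k]]] by (simp add: curlc_def)
  \<comment> \<open>The gradient vanishes within distance \<open>r k\<close> of the complement, so
    the field is supported in a closed set at positive distance from it, and taking the closure does
    not leave \<Omega>.\<close>
  have cs: "csupp (uk k) \<subseteq> \<Omega>" for k
  proof -
    have "{x. uk k x \<noteq> 0} \<subseteq> {x. r k \<le> infdist x (- \<Omega>)}"
    proof (rule subsetI, rule CollectI, rule ccontr)
      fix x assume x: "x \<in> {x. uk k x \<noteq> 0}" "\<not> r k \<le> infdist x (- \<Omega>)"
      then show False using F(3,4)[of x k] by (simp add: uk_def curlc_def zero_prod_def)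
    qed
    moreover have "closed {x. r k \<le> infdist x (- \<Omega>)}"
      by (intro closed_Collect_le continuous_on_const continuous_on_infdist continuous_on_id)
    ultimately have "csupp (uk k) \<subseteq> {x. r k \<le> infdist x (- \<Omega>)}" unfolding csupp_def by (rule closure_minimal)
    also have "\<dots> \<subseteq> \<Omega>"
    proof (rule subsetI, rule ccontr)
      fix x assume "x \<in> {x. r k \<le> infdist x (- \<Omega>)}" "x \<notin> \<Omega>"
      then show False using F(5)[of k] infdist_zero[of x "- \<Omega>"] by simp
    qed
    finally show ?thesis .
  qed
  have e: "f True = (\<lambda>x. fst (u x))" "f False = (\<lambda>x. snd (u x))" by (simp_all add: f_def)
  show ?thesis
    using tf dv cs sc[of True] sc[of False] unfolding e by (intro exI[of _ uk]) (simp add: fs)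
qed

end
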